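(* Suppose $\psi'(0+)>-\infty$ and $q>0$. For any $a>0$ and $x\le a$, $$\mathbb{E}_x\left(\int_{[0,T_a^+]}e^{-qt}\,dR_t\right)=\tilde r^{(q)}(a)\frac{r^{(q)}(x)}{r^{(q)}(a)}-\tilde r^{(q)}(x),$$ where, for $x\in\mathbb{R}$, $$\tilde r^{(q)}(x):=\overline{Z}^{(q)}(x)+\frac{\psi'(0+)}{q}+\delta\int_b^x\mathbb{W}^{(q)}(x-y)Z^{(q)}(y)\,dy,$$ $$r^{(q)}(x):=Z^{(q)}(x)+q\delta\int_b^x\mathbb{W}^{(q)}(x-y)W^{(q)}(y)\,dy.$$
   Context: Let $X=(X_t)_{t\ge0}$ be a spectrally negative Lévy process (no positive jumps, not the negative of a subordinator); $\mathbb{P}_x$ is its law when $X_0=x$, with expectation $\mathbb{E}_x$. Its Laplace exponent is $\psi(\theta)=\log\mathbb{E}_0[e^{\theta X_1}]=\gamma\theta+\frac{\sigma^2}{2}\theta^2+\int_{(-\infty,0)}(e^{\theta x}-1-\theta x1_{\{x>-1\}})\Pi(dx)$, $\theta\ge0$, with $\gamma\in\mathbb{R}$, $\sigma\ge0$ and Lévy measure $\Pi$ on $(-\infty,0)$, $\int(1\wedge x^2)\Pi(dx)<\infty$. If $X$ has paths of bounded variation, then $X_t=X_0+ct-S_t$ with $c:=\gamma-\int_{(-1,0)}x\,\Pi(dx)>0$ and $S$ a driftless subordinator. Fix $b>0$ and $\delta\ge0$, and assume $\delta<c$ whenever $X$ has paths of bounded variation. Put $Y_t:=X_t-\delta t$,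 a spectrally negative Lévy process with Laplace exponent $\psi_Y(\theta)=\psi(\theta)-\delta\theta$. Refracted-reflected process $V$ under $\mathbb{P}_x$ (reflected at $0$, refracted above $b$): Step 0: set $V_{0-}=x$; if $x\ge0$ set $\underline\tau:=0$ and go to Step 1, otherwise set $\overline\tau:=0$ and go to Step 2. Step 1: let $(\widetilde A_t)_{t\ge\underline\tau}$ be the refracted Lévy process started at time $\underline\tau$ at level $x$, i.e. the unique strong solution of $d\widetilde A_t=dX_t-\delta1_{\{\widetilde A_t>b\}}dt$ with $\widetilde A_{\underline\tau}=x$; let $\overline\tau:=\inf\{t>\underline\tau:\widetilde A_t<0\}$, set $V_t=\widetilde A_t$ for $\underline\tau\le t<\overline\tau$, and go to Step 2. Step 2: let $\widetilde U_t=(X_t-X_{\overline\tau})+\sup_{\overline\tau\le s\le t}(-(X_s-X_{\overline\tau}))\vee0$, $t\ge\overline\tau$, be the process reflected at $0$ started at time $\overline\tau$ at $0$; let $\underline\tau:=\inf\{t>\overline\tau:\widetilde U_t>b\}$, set $V_t=\widetilde U_t$ for $\overline\tau\le t<\underline\tau$, set $x=b$, and go to Step 1. For $a>0$, $T_a^+:=\inf\{t>0:V_t>a\}$ ($\inf\varnothing=\infty$). $V$ decomposes as $V_t=X_t+R_t-L_t$, where $L_t=\delta\int_0^t1_{\{V_s>b\}}ds$ and $R$ is the nondecreasing right-continuous process with $R_{0-}=0$ giving the cumulative upward modification at $0$, i.e. $R_t=V_t-X_t+L_t$ (so $R_0=(-x)\vee0$ under $\mathbb{P}_x$, and this atom at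 time $0$ is included in integrals over $[0,T_a^+]$). Scale functions: for $q\ge0$, $\Phi(q):=\sup\{\lambda\ge0:\psi(\lambda)=q\}$ and $\varphi(q):=\sup\{\lambda\ge0:\psi_Y(\lambda)=q\}$. $W^{(q)}$ (resp. $\mathbb{W}^{(q)}$) is the scale function of $X$ (resp. $Y$): zero on $(-\infty,0)$, continuous and increasing on $[0,\infty)$, with $\int_0^\infty e^{-\theta x}W^{(q)}(x)dx=1/(\psi(\theta)-q)$ for $\theta>\Phi(q)$ (resp. $\int_0^\infty e^{-\theta x}\mathbb{W}^{(q)}(x)dx=1/(\psi_Y(\theta)-q)$ for $\theta>\varphi(q)$). Also, for $x\in\mathbb{R}$, $\overline{W}^{(q)}(x):=\int_0^xW^{(q)}(y)dy$, $Z^{(q)}(x):=1+q\overline{W}^{(q)}(x)$, $\overline{Z}^{(q)}(x):=\int_0^xZ^{(q)}(z)dz$ (so $Z^{(q)}(x)=1$, $\overline{Z}^{(q)}(x)=x$ for $x\le0$). Integrals $\int_b^x\mathbb{W}^{(q)}(x-y)\cdots dy$ vanish for $x\le b$. *)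

theory Defs
  imports "HOL-Probability.Probability"
begin

section \<open>Spectrally negative Levy processes\<close>

text \<open>Time is modelled by the nonnegative reals; the values of a process at negative times are
  irrelevant throughout.\<close>

definition cadlag :: "(real \<Rightarrow> real) \<Rightarrow> bool" where
  "cadlag f \<longleftrightarrow>
     (\<forall>t\<ge>0. continuous (at_right t) f) \<and> (\<forall>t>0. \<exists>l. (f \<longlongrightarrow> l) (at_left t))"

locale levy_process = prob_space M for M :: "'a measure" +
  fixes X :: "real \<Rightarrow> 'a \<Rightarrow> real"
  assumes random_variable_X: "\<And>t. 0 \<le> t \<Longrightarrow> X t \<in> borel_measurable M"
    and start_zero: "AE \<omega> in M. X 0 \<omega> = 0"
    and independent_increments:
      "\<And>(n::nat) t. 0 \<le> t 0 \<Longrightarrow> mono t \<Longrightarrow>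
         indep_vars (\<lambda>_. borel) (\<lambda>i \<omega>. X (t (Suc i)) \<omega> - X (t i) \<omega>) {..<n}"
    and stationary_increments:
      "\<And>s t. 0 \<le> s \<Longrightarrow> 0 \<le> t \<Longrightarrow>
         distr M borel (\<lambda>\<omega>. X (s + t) \<omega> - X s \<omega>) = distr M borel (X t)"
    and cadlag_paths: "AE \<omega> in M. cadlag (\<lambda>t. X t \<omega>)"

text \<open>The negative of a subordinator is a Levy process with nonincreasing paths (including the
  zero process and negative drifts).\<close>

locale spectrally_negative_levy_process = levy_process M X
  for M :: "'a measure" and X :: "real \<Rightarrow> 'a \<Rightarrow> real" +
  assumes no_positive_jumps:
      "AE \<omega> in M. \<forall>t>0. \<forall>l. ((\<lambda>s. X s \<omega>) \<longlongrightarrow> l) (at_left t) \<longrightarrow> X t \<omega> \<le> l"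
    and not_negative_subordinator: "\<not> (AE \<omega> in M. antimono_on {0..} (\<lambda>t. X t \<omega>))"

definition laplace_exponent :: "'a measure \<Rightarrow> (real \<Rightarrow> 'a \<Rightarrow> real) \<Rightarrow> real \<Rightarrow> real" where
  "laplace_exponent M X \<theta> = ln (LINT \<omega>|M. exp (\<theta> * X 1 \<omega>))"

text \<open>The Levy measure on the negative half-line is represented by a measure on the whole line
  that does not charge \<open>[0,\<infinity>)\<close>.\<close>

definition levy_khintchine_triplet ::
  "real \<Rightarrow> real \<Rightarrow> real measure \<Rightarrow> (real \<Rightarrow> real) \<Rightarrow> bool" where
  "levy_khintchine_triplet \<gamma> \<sigma> \<nu> \<psi> \<longleftrightarrow>
     0 \<le> \<sigma> \<and> sets \<nu> = sets borel \<and> emeasure \<nu> {0..} = 0 \<and>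
     (\<integral>\<^sup>+x. ennreal (min 1 (x\<^sup>2)) \<partial>\<nu>) < \<infinity> \<and>
     (\<forall>\<theta>\<ge>0. \<psi> \<theta> = \<gamma> * \<theta> + \<sigma>\<^sup>2 / 2 * \<theta>\<^sup>2
        + (LINT x:{..<0}|\<nu>. exp (\<theta> * x) - 1 - \<theta> * x * indicator {-1<..} x))"

definition bounded_variation_on :: "real \<Rightarrow> (real \<Rightarrow> real) \<Rightarrow> bool" where
  "bounded_variation_on T f \<longleftrightarrow>
     (\<exists>C. \<forall>(n::nat) u. 0 \<le> u 0 \<and> mono u \<and> u n \<le> T \<longrightarrow> (\<Sum>i<n. \<bar>f (u (Suc i)) - f (u i)\<bar>) \<le> C)"

definition bounded_variation_paths :: "'a measure \<Rightarrow> (real \<Rightarrow> 'a \<Rightarrow> real) \<Rightarrow> bool" where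
  "bounded_variation_paths M X \<longleftrightarrow> (AE \<omega> in M. \<forall>T\<ge>0. bounded_variation_on T (\<lambda>t. X t \<omega>))"

definition drift :: "real \<Rightarrow> real measure \<Rightarrow> real" where
  "drift \<gamma> \<nu> = \<gamma> - (LINT x:{-1<..<0}|\<nu>. x)"

text \<open>The value \<open>\<psi>'(0+)\<close>. It is a priori an extended real: for a Laplace exponent it may
  be \<open>-\<infinity>\<close>.\<close>

definition deriv_zero_plus :: "(real \<Rightarrow> real) \<Rightarrow> ereal" where
  "deriv_zero_plus \<psi> = Lim (at_right 0) (\<lambda>\<theta>. ereal (deriv \<psi> \<theta>))"


section \<open>The refracted-reflected process\<close>

text \<open>First passage strictly after time \<open>s\<close>, with the convention that the infimum of the empty
  set is \<open>\<infinity>\<close>.\<close>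

definition first_time_after :: "real \<Rightarrow> (real \<Rightarrow> bool) \<Rightarrow> ereal" where
  "first_time_after s P = Inf (ereal ` {t. s < t \<and> P t})"

text \<open>The integrated form of \<open>dA = df - \<delta> 1{A > b} dt\<close> for a path \<open>f\<close>, started at time \<open>s\<close> at
  level \<open>y\<close>. Solutions are unique path by path, because the difference of two of them is
  absolutely continuous and its square is nonincreasing.\<close>

definition refracted_path ::
  "real \<Rightarrow> real \<Rightarrow> (real \<Rightarrow> real) \<Rightarrow> real \<Rightarrow> real \<Rightarrow> (real \<Rightarrow> real) \<Rightarrow> bool" where
  "refracted_path b \<delta> f s y A \<longleftrightarrow>
     (\<forall>t\<ge>s. A t = y + (f t - f s) - \<delta> * (LINT u:{s..t}|lborel. indicator {b<..} (A u)))"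

definition reflected_path :: "(real \<Rightarrow> real) \<Rightarrow> real \<Rightarrow> real \<Rightarrow> real" where
  "reflected_path f s t = (f t - f s) + (SUP u\<in>{s..t}. max (- (f u - f s)) 0)"

text \<open>The alternation of the two regimes along a path \<open>f\<close>: \<open>enters_refracted b \<delta> x f s y\<close> says that
  a refracted piece is entered at time \<open>s\<close> with level \<open>y\<close>, and \<open>enters_reflected b \<delta> x f s\<close> says that
  a piece reflected at \<open>0\<close> is entered at time \<open>s\<close>. The next regime is entered only if the switching time is finite.\<close>

inductive enters_refracted :: "real \<Rightarrow> real \<Rightarrow> real \<Rightarrow> (real \<Rightarrow> real) \<Rightarrow> real \<Rightarrow> real \<Rightarrow> bool"
  and enters_reflected :: "real \<Rightarrow> real \<Rightarrow> real \<Rightarrow> (real \<Rightarrow> real) \<Rightarrow> real \<Rightarrow> bool"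
  for b \<delta> x f where
  start_refracted: "0 \<le> x \<Longrightarrow> enters_refracted b \<delta> x f 0 x"
| start_reflected: "x < 0 \<Longrightarrow> enters_reflected b \<delta> x f 0"
| to_reflected: "enters_refracted b \<delta> x f s y \<Longrightarrow> refracted_path b \<delta> f s y A \<Longrightarrow>
    ereal s' = first_time_after s (\<lambda>t. A t < 0) \<Longrightarrow> enters_reflected b \<delta> x f s'"
| to_refracted: "enters_reflected b \<delta> x f s \<Longrightarrow>
    ereal s' = first_time_after s (\<lambda>t. reflected_path f s t > b) \<Longrightarrow>
    enters_refracted b \<delta> x f s' b"

text \<open>For a cadlag path \<open>f\<close> the switching times do not accumulate, since each passage from
  reflection to refraction needs an increase of \<open>f\<close> of size \<open>b > 0\<close>; hence the following
  determines \<open>v\<close> on \<open>[0,\<infinity>)\<close>.\<close>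

definition refracted_reflected_path ::
  "real \<Rightarrow> real \<Rightarrow> real \<Rightarrow> (real \<Rightarrow> real) \<Rightarrow> (real \<Rightarrow> real) \<Rightarrow> bool" where
  "refracted_reflected_path b \<delta> x f v \<longleftrightarrow>
     (\<forall>s y. enters_refracted b \<delta> x f s y \<longrightarrow>
        (\<exists>A. refracted_path b \<delta> f s y A \<and>
             (\<forall>t\<ge>s. ereal t < first_time_after s (\<lambda>t. A t < 0) \<longrightarrow> v t = A t))) \<and>
     (\<forall>s. enters_reflected b \<delta> x f s \<longrightarrow>
        (\<forall>t\<ge>s. ereal t < first_time_after s (\<lambda>t. reflected_path f s t > b) \<longrightarrow>
             v t = reflected_path f s t))"

definition augmented_filtration ::
  "'a measure \<Rightarrow> (real \<Rightarrow> 'a \<Rightarrow> real) \<Rightarrow> real \<Rightarrow> 'a measure" where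
  "augmented_filtration M X t =
     sigma (space M)
       ({X s -` B \<inter> space M | s B. 0 \<le> s \<and> s \<le> t \<and> B \<in> sets borel} \<union> null_sets M)"

text \<open>\<open>X\<close> starts at \<open>0\<close>, and the law of the process started at \<open>x\<close> is that of \<open>x + X\<close>. Adaptedness
  expresses that the refracted pieces are strong solutions.\<close>

definition refracted_reflected_process ::
  "'a measure \<Rightarrow> (real \<Rightarrow> 'a \<Rightarrow> real) \<Rightarrow> real \<Rightarrow> real \<Rightarrow> real \<Rightarrow> (real \<Rightarrow> 'a \<Rightarrow> real) \<Rightarrow> bool" where
  "refracted_reflected_process M X b \<delta> x V \<longleftrightarrow>
     (\<forall>t\<ge>0. V t \<in> borel_measurable (augmented_filtration M X t)) \<and>
     (AE \<omega> in M. refracted_reflected_path b \<delta> x (\<lambda>t. x + X t \<omega>) (\<lambda>t. V t \<omega>))"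

text \<open>\<open>R = V - (x + X) + L\<close>, extended by \<open>0\<close> to negative times, so that the atom \<open>R 0\<close> at time \<open>0\<close>
  is seen by the associated Stieltjes measure.\<close>

definition refraction_part :: "real \<Rightarrow> real \<Rightarrow> (real \<Rightarrow> real) \<Rightarrow> real \<Rightarrow> real" where
  "refraction_part b \<delta> v t = \<delta> * (LINT u:{0..t}|lborel. indicator {b<..} (v u))"

definition reflection_part ::
  "real \<Rightarrow> real \<Rightarrow> (real \<Rightarrow> real) \<Rightarrow> (real \<Rightarrow> real) \<Rightarrow> real \<Rightarrow> real" where
  "reflection_part b \<delta> f v t = (if t < 0 then 0 else v t - f t + refraction_part b \<delta> v t)"

definition discounted_injection ::
  "real \<Rightarrow> real \<Rightarrow> real \<Rightarrow> real \<Rightarrow> (real \<Rightarrow> real) \<Rightarrow> (real \<Rightarrow> real) \<Rightarrow> ennreal" where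
  "discounted_injection b \<delta> q a f v =
     (\<integral>\<^sup>+t \<in> {t. 0 \<le> t \<and> ereal t \<le> first_time_after 0 (\<lambda>t. v t > a)}. ennreal (exp (- q * t))
        \<partial>interval_measure (reflection_part b \<delta> f v))"


section \<open>Scale functions\<close>

definition right_inverse :: "(real \<Rightarrow> real) \<Rightarrow> real \<Rightarrow> real" where
  "right_inverse \<psi> q = Sup {p. 0 \<le> p \<and> \<psi> p = q}"

definition scale_function :: "(real \<Rightarrow> real) \<Rightarrow> real \<Rightarrow> (real \<Rightarrow> real) \<Rightarrow> bool" where
  "scale_function \<psi> q W \<longleftrightarrow>
     (\<forall>x<0. W x = 0) \<and> continuous_on {0..} W \<and> mono_on {0..} W \<and>
     (\<forall>\<theta>>right_inverse \<psi> q. ((\<lambda>x. exp (- \<theta> * x) * W x) has_integral 1 / (\<psi> \<theta> - q)) {0..})"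

text \<open>The interval integrals below are oriented. Thus \<open>scale_Zbar q W x = x\<close> for
  \<open>x \<le> 0\<close>, and the integrals from \<open>b\<close> to \<open>x\<close> vanish for \<open>x \<le> b\<close> because \<open>WY\<close> is zero on
  the negative half-line.\<close>

definition scale_Wbar :: "(real \<Rightarrow> real) \<Rightarrow> real \<Rightarrow> real" where
  "scale_Wbar W x = (LBINT y=0..ereal x. W y)"

definition scale_Z :: "real \<Rightarrow> (real \<Rightarrow> real) \<Rightarrow> real \<Rightarrow> real" where
  "scale_Z q W x = 1 + q * scale_Wbar W x"

definition scale_Zbar :: "real \<Rightarrow> (real \<Rightarrow> real) \<Rightarrow> real \<Rightarrow> real" where
  "scale_Zbar q W x = (LBINT z=0..ereal x. scale_Z q W z)"

definition r_fun ::
  "real \<Rightarrow> real \<Rightarrow> real \<Rightarrow> (real \<Rightarrow> real) \<Rightarrow> (real \<Rightarrow> real) \<Rightarrow> real \<Rightarrow> real" where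
  "r_fun b \<delta> q W WY x =
     scale_Z q W x + q * \<delta> * (LBINT y=ereal b..ereal x. WY (x - y) * W y)"

text \<open>The parameter \<open>d\<close> stands for \<open>\<psi>'(0+)\<close>.\<close>

definition r_tilde ::
  "real \<Rightarrow> real \<Rightarrow> real \<Rightarrow> real \<Rightarrow> (real \<Rightarrow> real) \<Rightarrow> (real \<Rightarrow> real) \<Rightarrow> real \<Rightarrow> real" where
  "r_tilde d b \<delta> q W WY x =
     scale_Zbar q W x + d / q + \<delta> * (LBINT y=ereal b..ereal x. WY (x - y) * scale_Z q W y)"

end

theory Submission
  imports Defs
begin

text \<open>Along a path, a change of variables for \<open>exp (\<theta> * V)\<close> up to the exit time balances boundary, occupation
  and injection terms, and each of them is weighted by the same exponential martingale. Optional stopping turns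
  this, for every \<open>\<theta> \<ge> 0\<close>, into an identity between exponential moments of three unknowns: the discounted exit
  probability \<open>p\<close>, the discounted occupation measure \<open>U\<close> and a measure \<open>\<kappa>\<close> on the negative half-line whose
  total mass is the expected discounted injection. Dividing by \<open>\<psi> - q\<close> and by \<open>\<psi> - \<delta> * \<theta> - q\<close> and inverting
  the Laplace transforms gives two convolution equations. The one with \<open>WY\<close> determines \<open>U\<close> above \<open>b\<close>; the one
  with \<open>W\<close> then yields \<open>p * r a = r x\<close> at \<open>0\<close> and the mean of \<open>U\<close> by integration; the derivative of the identity
  at \<open>\<theta> = 0\<close>, where \<open>\<psi>'(0+)\<close> enters, gives the mass of \<open>\<kappa>\<close>.\<close>

section \<open>Uniqueness of Laplace transforms\<close>

text \<open>The jump measure of \<open>X\<close> plays no part in the change of variables. Instead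
  exp(\<theta> R) is expanded over the levels r below \<open>R\<close>, and each level is charged to
  the time at which the injection first exceeds it. At that time \<open>V\<close> is 0 even if the
  injection jumps across r, so the only trace of the jump is r - R \<le> 0, whose discounted law is
  \<kappa>. The rate \<open>\<psi> \<theta> - q\<close> of the weight has no fixed sign, and nothing
  is known to be finite at first. It is therefore written as \<open>c1 - c2\<close> with nonnegative
  rates, and negative terms are moved to the other side, so that the balance lives in the extended
  nonnegative numbers; subtraction starts only after the identity at \<theta> = 0 has bounded the
  occupation measure. Two facts are hidden in the hypotheses and serve both inversions: exponential
  moments are finite because the scale function exists, and
  \<open>\<psi> \<theta> - \<delta> * \<theta>\<close> tends to infinity because \<delta> is below
  the drift when the variation is bounded.\<close>

lemma integral_eq_if_moments_eq:
  fixes \<mu>1 \<mu>2 :: "real measure" and \<phi> :: "real \<Rightarrow> real"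
  assumes f: "finite_measure \<mu>1" "finite_measure \<mu>2" "sets \<mu>1 = sets borel" "sets \<mu>2 = sets borel"
    and supp: "AE z in \<mu>1. z \<in> {0..1}" "AE z in \<mu>2. z \<in> {0..1}"
    and mom: "\<And>n::nat. (LINT z|\<mu>1. z ^ n) = (LINT z|\<mu>2. z ^ n)"
    and \<phi>: "continuous_on UNIV \<phi>"
  shows "(LINT z|\<mu>1. \<phi> z) = (LINT z|\<mu>2. \<phi> z)"
proof -
  define m where "m = measure \<mu>1 (space \<mu>1) + measure \<mu>2 (space \<mu>2)"
  have \<phi>m: "\<phi> \<in> borel_measurable borel" using \<phi> by (rule borel_measurable_continuous_onI)
  obtain B where B: "\<And>z. z \<in> {0..1} \<Longrightarrow> \<bar>\<phi> z\<bar> \<le> B"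
  proof -
    have "bounded (\<phi> ` {0..1})"
      by (intro compact_imp_bounded compact_continuous_image continuous_on_subset[OF \<phi>]) auto
    then show ?thesis unfolding bounded_iff using that by fastforce
  qed
  have int: "integrable \<mu> \<phi>" "\<And>n. integrable \<mu> (\<lambda>z. z ^ n)"
    if "finite_measure \<mu>" "sets \<mu> = sets borel" "AE z in \<mu>. z \<in> {0..1}" for \<mu>
  proof -
    have m: "f \<in> borel_measurable \<mu>" if "f \<in> borel_measurable borel" for f :: "real \<Rightarrow> real"
      using that \<open>sets \<mu> = sets borel\<close> by (simp cong: measurable_cong_sets)
    have "AE z in \<mu>. norm (\<phi> z) \<le> B" using that(3) by eventually_elim (use B in auto)
    then show "integrable \<mu> \<phi>"
      by (rule finite_measure.integrable_const_bound[OF that(1)]) (rule m[OF \<phi>m])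
    have "AE z in \<mu>. norm (z ^ n) \<le> 1" for n
      using that(3) by eventually_elim (auto simp: power_le_one abs_le_iff intro: order.trans[of _ 0])
    then show "integrable \<mu> (\<lambda>z. z ^ n)" for n
      by (rule finite_measure.integrable_const_bound[OF that(1)]) (rule m, measurable)
  qed
  note i1 = int[OF f(1,3) supp(1)] and i2 = int[OF f(2,4) supp(2)]
  \<comment> \<open>Weierstrass approximation: a polynomial within \<open>e\<close> of \<phi> on
    [0,1] has equal integrals under both measures, and each replacement costs at most
    \<open>e\<close> times a total mass. The summand 1 keeps the factor positive, so that
    \<open>e\<close> can be rescaled afterwards.\<close>
  have "\<bar>(LINT z|\<mu>1. \<phi> z) - (LINT z|\<mu>2. \<phi> z)\<bar> \<le> e * (m + 1)" if "e > 0" for e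
  proof -
    obtain g where g: "real_polynomial_function g" "\<And>z. z \<in> {0..1} \<Longrightarrow> \<bar>\<phi> z - g z\<bar> < e"
      using Stone_Weierstrass_real_polynomial_function[OF compact_Icc
          continuous_on_subset[OF \<phi> subset_UNIV] \<open>e > 0\<close>] by metis
    obtain c n where gs: "g = (\<lambda>z. \<Sum>i\<le>n. c i * z ^ i)"
      using g(1) unfolding real_polynomial_function_iff_sum by blast
    have gi: "integrable \<mu>1 g" "integrable \<mu>2 g" unfolding gs using i1(2) i2(2) by auto
    have geq: "(LINT z|\<mu>1. g z) = (LINT z|\<mu>2. g z)"
      unfolding gs using i1(2) i2(2) by (simp add: mom)
    have bd: "\<bar>(LINT z|\<mu>. \<phi> z) - (LINT z|\<mu>. g z)\<bar> \<le> e * measure \<mu> (space \<mu>)"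
      if "finite_measure \<mu>" "AE z in \<mu>. z \<in> {0..1}" "integrable \<mu> \<phi>" "integrable \<mu> g" for \<mu>
    proof -
      interpret finite_measure \<mu> by fact
      have "\<bar>(LINT z|\<mu>. \<phi> z) - (LINT z|\<mu>. g z)\<bar> = \<bar>LINT z|\<mu>. \<phi> z - g z\<bar>"
        using that by (simp add: Bochner_Integration.integral_diff)
      also have "\<dots> \<le> (LINT z|\<mu>. \<bar>\<phi> z - g z\<bar>)"
        by (rule integral_abs_bound)
      also have "\<dots> \<le> (LINT z|\<mu>. e)"
      proof (rule integral_mono_AE)
        show "AE z in \<mu>. \<bar>\<phi> z - g z\<bar> \<le> e"
          using that(2) by eventually_elim (use g(2) in \<open>auto intro: less_imp_le\<close>)
      qed (use that in auto)
      finally show ?thesis by (simp add: mult.commute)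
    qed
    have "e * measure \<mu>1 (space \<mu>1) + e * measure \<mu>2 (space \<mu>2) \<le> e * (m+1)"
      unfolding m_def using \<open>e > 0\<close> by (simp add: algebra_simps)
    then show ?thesis using bd[OF f(1) supp(1) i1(1) gi(1)] bd[OF f(2) supp(2) i2(1) gi(2)] geq
      by linarith
  qed
  moreover have "m \<ge> 0" unfolding m_def by simp
  ultimately have "\<bar>(LINT z|\<mu>1. \<phi> z) - (LINT z|\<mu>2. \<phi> z)\<bar> \<le> e" if "e > 0" for e
    using that by (metis add_nonneg_pos nonzero_eq_divide_eq zero_less_one less_irrefl divide_pos_pos)
  then show ?thesis using field_le_epsilon[of "\<bar>(LINT z|\<mu>1. \<phi> z) - (LINT z|\<mu>2. \<phi> z)\<bar>" 0] by auto
qed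

text \<open>Compact support makes sine and cosine uniform limits of polynomials on the support, so
  equal moments force equal characteristic functions, and Levy's uniqueness theorem applies.\<close>

lemma prob_eqI_moments:
  fixes \<mu>1 \<mu>2 :: "real measure"
  assumes p: "prob_space \<mu>1" "prob_space \<mu>2" "sets \<mu>1 = sets borel" "sets \<mu>2 = sets borel"
    and supp: "AE z in \<mu>1. z \<in> {0..1}" "AE z in \<mu>2. z \<in> {0..1}"
    and mom: "\<And>n::nat. (LINT z|\<mu>1. z ^ n) = (LINT z|\<mu>2. z ^ n)"
  shows "\<mu>1 = \<mu>2"
proof (rule Levy_uniqueness)
  have fin: "finite_measure \<mu>1" "finite_measure \<mu>2"
    using p by (auto simp: prob_space_def)
  show r: "real_distribution \<mu>1" "real_distribution \<mu>2"
    using p by (auto simp: real_distribution_def real_distribution_axioms_def dest: sets_eq_imp_space_eq)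
  have c: "char \<mu> t = Complex (LINT z|\<mu>. cos (t*z)) (LINT z|\<mu>. sin (t*z))" if "real_distribution \<mu>" for \<mu> t
  proof -
    interpret real_distribution \<mu> by fact
    have i: "integrable \<mu> (\<lambda>x. iexp (t * x))" by (intro integrable_iexp) auto
    show ?thesis unfolding char_def
      by (rule complex_eqI)
         (use i in \<open>simp_all add: integral_Re[symmetric] integral_Im[symmetric] Re_exp Im_exp del: of_real_mult\<close>)
  qed
  have "(LINT z|\<mu>1. cos (t*z)) = (LINT z|\<mu>2. cos (t*z))" "(LINT z|\<mu>1. sin (t*z)) = (LINT z|\<mu>2. sin (t*z))" for t
    by (rule integral_eq_if_moments_eq[OF fin p(3,4) supp mom]; intro continuous_intros)+
  then show "char \<mu>1 = char \<mu>2" by (intro ext) (simp add: c r)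
qed

text \<open>The substitution Z = exp(-(c - K)) turns the tilted and normalised densities into
  probability laws on [0,1]. Their n-th moment is, up to the common factor exp(n K) / I, the
  transform at \<theta> + n; agreement along this arithmetic progression is thus agreement of all
  moments. Undoing the substitution recovers the densities almost everywhere.\<close>

lemma laplace_unique_AE:
  fixes g1 g2 :: "real \<Rightarrow> ennreal" and K \<theta> :: real
  assumes m[measurable]: "g1 \<in> borel_measurable borel" "g2 \<in> borel_measurable borel"
    and z: "\<And>c. c < K \<Longrightarrow> g1 c = 0" "\<And>c. c < K \<Longrightarrow> g2 c = 0"
    and eq: "\<And>n::nat. (\<integral>\<^sup>+c. exp (- (\<theta> + n) * c) * g1 c \<partial>lborel) = (\<integral>\<^sup>+c. exp (- (\<theta> + n) * c) * g2 c \<partial>lborel)"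
    and fin: "(\<integral>\<^sup>+c. exp (- \<theta> * c) * g1 c \<partial>lborel) < \<infinity>"
  shows "AE c in lborel. g1 c = g2 c"
proof -
  define I where "I = (\<integral>\<^sup>+c. exp (- \<theta> * c) * g1 c \<partial>lborel)"
  have I2: "I = (\<integral>\<^sup>+c. exp (- \<theta> * c) * g2 c \<partial>lborel)" using eq[of 0] by (simp add: I_def)
  show ?thesis
  proof (cases "I = 0")
    case True
    have "AE c in lborel. exp (- \<theta> * c) * g1 c = 0" "AE c in lborel. exp (- \<theta> * c) * g2 c = 0"
      using True True[unfolded I2] unfolding I_def
      by (simp_all add: nn_integral_0_iff_AE del: mult_eq_0_iff)
    then show ?thesis by eventually_elim auto
  next
    case False
    have Ifin: "I < \<infinity>" using fin by (simp add: I_def)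
    define D where "D g = density lborel (\<lambda>c. exp (- \<theta> * c) * g c / I)" for g :: "real \<Rightarrow> ennreal"
    \<comment> \<open>The cut-off at \<open>K\<close> keeps \<open>Z\<close> in [0,1] on the whole
      line. Nothing is lost, because neither density charges the points below \<open>K\<close>, and
      on the rest \<open>Z\<close> is inverted by K - ln z.\<close>
    define Z where "Z c = exp (- (max (c - K) 0))" for c :: real
    have Zm[measurable]: "Z \<in> borel_measurable borel" unfolding Z_def by measurable
    have pD: "prob_space (D g)" if [measurable]: "g \<in> borel_measurable borel" and "I = (\<integral>\<^sup>+c. exp (- \<theta> * c) * g c \<partial>lborel)" for g :: "real \<Rightarrow> ennreal"
      by standard (use that(2)[symmetric] False Ifin in \<open>auto simp: D_def emeasure_density nn_integral_divide ennreal_divide_self top.not_eq_extremum\<close>)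
    have mm: "(LINT z|distr (D g) borel Z. z ^ n) = enn2real ((\<integral>\<^sup>+c. exp (- (\<theta>+n) * c) * g c \<partial>lborel) * exp (n*K) / I)"
      if [measurable]: "g \<in> borel_measurable borel" and gz: "\<And>c. c < K \<Longrightarrow> g c = 0" for g :: "real \<Rightarrow> ennreal" and n :: nat
    proof -
      have "(LINT z|distr (D g) borel Z. z ^ n) = (LINT c|D g. Z c ^ n)"
        by (subst integral_distr) (auto simp: D_def)
      also have "\<dots> = enn2real (\<integral>\<^sup>+c. ennreal (Z c ^ n) \<partial>D g)"
        by (rule integral_eq_nn_integral) (auto simp: D_def Z_def)
      also have "(\<integral>\<^sup>+c. ennreal (Z c ^ n) \<partial>D g) = (\<integral>\<^sup>+c. exp (- \<theta> * c) * g c / I * ennreal (Z c ^ n) \<partial>lborel)"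
        unfolding D_def by (subst nn_integral_density) auto
      also have "\<dots> = (\<integral>\<^sup>+c. (exp (- (\<theta>+n) * c) * g c) * (ennreal (exp (n*K)) / I) \<partial>lborel)"
      proof (rule nn_integral_cong)
        fix c
        show "exp (- \<theta> * c) * g c / I * ennreal (Z c ^ n) = exp (- (\<theta>+n) * c) * g c * (ennreal (exp (n*K)) / I)"
        proof (cases "c < K")
          case False
          then have "Z c ^ n = exp (- (real n * c)) * exp (n*K)"
            by (simp add: Z_def exp_of_nat_mult[symmetric] exp_add[symmetric] algebra_simps)
          moreover have "exp (- (\<theta>+n) * c) = exp (- \<theta> * c) * exp (- (real n * c))"
            by (simp add: exp_add[symmetric] algebra_simps)
          ultimately show ?thesis
            by (simp add: ennreal_mult divide_ennreal_def mult_ac)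
        qed (use gz in simp)
      qed
      also have "\<dots> = (\<integral>\<^sup>+c. exp (- (\<theta>+n) * c) * g c \<partial>lborel) * (exp (n*K) / I)"
        by (subst nn_integral_multc) auto
      finally show ?thesis by (simp add: ennreal_times_divide)
    qed
    have "distr (D g1) borel Z = distr (D g2) borel Z"
    proof (rule prob_eqI_moments)
      show "prob_space (distr (D g1) borel Z)" "prob_space (distr (D g2) borel Z)"
        by (rule prob_space.prob_space_distr[OF pD[OF m(1) I_def]] prob_space.prob_space_distr[OF pD[OF m(2) I2]],
            simp add: D_def)+
      show "AE z in distr (D g1) borel Z. z \<in> {0..1}" "AE z in distr (D g2) borel Z. z \<in> {0..1}"
        by (subst AE_distr_iff; auto simp: D_def Z_def)+
      show "(LINT z|distr (D g1) borel Z. z ^ n) = (LINT z|distr (D g2) borel Z. z ^ n)" for n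
        by (simp only: mm m z eq)
    qed auto
    then have dd: "distr (distr (D g1) borel Z) borel (\<lambda>z. - ln z + K) = distr (distr (D g2) borel Z) borel (\<lambda>z. - ln z + K)"
      by simp
    have inv: "distr (distr (D g) borel Z) borel (\<lambda>z. - ln z + K) = D g"
      if [measurable]: "g \<in> borel_measurable borel" and gz: "\<And>c. c < K \<Longrightarrow> g c = 0" for g :: "real \<Rightarrow> ennreal"
    proof -
      have ae: "AE c in D g. (- ln (Z c) + K) = c"
        unfolding D_def
      proof (subst AE_density)
        have "0 < ennreal (exp (- \<theta> * c)) * g c / I \<longrightarrow> - ln (Z c) + K = c" for c
        proof (cases "c < K")
          case True then show ?thesis using gz by (simp add: divide_ennreal_def)
        qed (simp add: Z_def)
        then show "AE c in lborel. 0 < ennreal (exp (- \<theta> * c)) * g c / I \<longrightarrow> - ln (Z c) + K = c" by auto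
      qed measurable
      have "distr (distr (D g) borel Z) borel (\<lambda>z. - ln z + K) = distr (D g) borel (\<lambda>c. - ln (Z c) + K)"
        by (subst distr_distr) (auto simp: D_def comp_def)
      also have "\<dots> = distr (D g) borel (\<lambda>c. c)"
        by (rule distr_cong_AE) (use ae in \<open>auto simp: D_def\<close>)
      also have "\<dots> = D g" by (rule distr_id2) (simp add: D_def)
      finally show ?thesis .
    qed
    have "D g1 = D g2" using dd inv m z by metis
    then have "AE c in lborel. exp (- \<theta> * c) * g1 c / I = exp (- \<theta> * c) * g2 c / I"
      unfolding D_def by (intro sigma_finite_measure.density_unique[OF lborel.sigma_finite_measure_axioms]) auto
    then show ?thesis
    proof eventually_elim
      case (elim c)
      have canc: "g / I * I = g" for g :: ennreal
        using False Ifin by (metis ennreal_divide_times ennreal_divide_self mult.commute mult_1 ennreal_times_divide top.not_eq_extremum infinity_ennreal_def mult.right_neutral)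
      have "exp (- \<theta> * c) * g1 c = exp (- \<theta> * c) * g2 c" by (metis elim canc)
      then show ?case by (simp add: ennreal_mult_cancel_left)
    qed
  qed
qed

section \<open>Optional stopping of exponential martingales\<close>

text \<open>The grid point lies strictly to the right of \<open>s\<close> even if \<open>s\<close>
  is itself dyadic. Hence the information required at the rounded time is of the form \<sigma> < t,
  and the approach takes place within \<open>at_right\<close>.\<close>

definition dyadic_above :: "nat \<Rightarrow> real \<Rightarrow> real" where
  "dyadic_above n s = (real_of_int \<lfloor>2 ^ n * s\<rfloor> + 1) / 2 ^ n"

lemma dyadic_above_gt: "s < dyadic_above n s"
  unfolding dyadic_above_def by (simp add: field_simps) linarith

lemma dyadic_above_le: "dyadic_above n s \<le> s + 1 / 2 ^ n"
  unfolding dyadic_above_def by (simp add: field_simps)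

lemma dyadic_above_tendsto: "filterlim (\<lambda>n. dyadic_above n s) (at_right s) sequentially"
  unfolding filterlim_at
proof (intro conjI)
  have *: "(\<lambda>n. s + 1 / 2 ^ n) \<longlonglongrightarrow> s + 0"
    by (intro tendsto_add tendsto_const) real_asymp
  show "(\<lambda>n. dyadic_above n s) \<longlonglongrightarrow> s"
    by (rule tendsto_sandwich[OF _ _ tendsto_const *[simplified]])
       (auto simp: dyadic_above_le less_imp_le[OF dyadic_above_gt])
qed (auto simp: dyadic_above_gt less_imp_neq[OF dyadic_above_gt, symmetric])

lemma tendsto_dyadic_above:
  "continuous (at_right s) f \<Longrightarrow> (\<lambda>n. f (dyadic_above n s)) \<longlonglongrightarrow> f s"
  unfolding continuous_within by (rule filterlim_compose[OF _ dyadic_above_tendsto])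

text \<open>Each dyadic rounding of time involves countably many sections and is therefore
  measurable in both variables; right-continuity identifies the pointwise limit.\<close>

lemma right_continuous_jointly_measurable:
  fixes Y :: "real \<Rightarrow> 'a \<Rightarrow> real"
  assumes m[measurable]: "\<And>s. Y s \<in> borel_measurable N"
    and rc: "\<And>w s. w \<in> space N \<Longrightarrow> continuous (at_right s) (\<lambda>s. Y s w)"
  shows "(\<lambda>z. Y (snd z) (fst z)) \<in> borel_measurable (N \<Otimes>\<^sub>M borel)"
proof (rule borel_measurable_LIMSEQ_metric)
  show "(\<lambda>z. Y (dyadic_above n (snd z)) (fst z)) \<in> borel_measurable (N \<Otimes>\<^sub>M borel)" for n
    unfolding dyadic_above_def
    by (rule measurable_compose_countable[where f = "\<lambda>i z. Y ((real_of_int i + 1) / 2 ^ n) (fst z)"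
          and g = "\<lambda>z. \<lfloor>2 ^ n * snd z\<rfloor>"]) measurable
  show "(\<lambda>n. Y (dyadic_above n (snd z)) (fst z)) \<longlonglongrightarrow> Y (snd z) (fst z)"
    if "z \<in> space (N \<Otimes>\<^sub>M borel)" for z
    by (rule tendsto_dyadic_above[where f = "\<lambda>s. Y s (fst z)"])
       (use that in \<open>auto intro: rc simp: space_pair_measure\<close>)
qed

text \<open>An L2 bound gives uniform integrability: g \<le> min g K + g^2 / K, so truncation at
  \<open>K\<close> costs at most C / K uniformly in n, and the truncated integrals converge by
  domination. Fatou's lemma gives the other inequality.\<close>

lemma (in finite_measure) nn_integral_eq_of_L2_bounded_limit:
  fixes g :: "nat \<Rightarrow> 'a \<Rightarrow> real"
  assumes [measurable]: "\<And>n. g n \<in> borel_measurable M" "h \<in> borel_measurable M"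
    and nn: "\<And>n \<omega>. \<omega> \<in> space M \<Longrightarrow> 0 \<le> g n \<omega>"
    and lim: "\<And>\<omega>. \<omega> \<in> space M \<Longrightarrow> (\<lambda>n. g n \<omega>) \<longlonglongrightarrow> h \<omega>"
    and L2: "\<And>n. (\<integral>\<^sup>+\<omega>. ennreal ((g n \<omega>)\<^sup>2) \<partial>M) \<le> ennreal C"
    and I: "\<And>n. (\<integral>\<^sup>+\<omega>. ennreal (g n \<omega>) \<partial>M) = I"
  shows "(\<integral>\<^sup>+\<omega>. ennreal (h \<omega>) \<partial>M) = I"
proof (rule antisym)
  have "(\<integral>\<^sup>+\<omega>. ennreal (h \<omega>) \<partial>M) = (\<integral>\<^sup>+\<omega>. liminf (\<lambda>n. ennreal (g n \<omega>)) \<partial>M)"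
    by (intro nn_integral_cong lim_imp_Liminf[symmetric]) (auto intro!: tendsto_ennrealI lim)
  also have "\<dots> \<le> liminf (\<lambda>n. \<integral>\<^sup>+\<omega>. ennreal (g n \<omega>) \<partial>M)"
    by (intro nn_integral_liminf) auto
  finally show "(\<integral>\<^sup>+\<omega>. ennreal (h \<omega>) \<partial>M) \<le> I" by (simp add: I Liminf_const)
  have K: "I \<le> (\<integral>\<^sup>+\<omega>. ennreal (h \<omega>) \<partial>M) + ennreal (\<bar>C\<bar> / K)" if "K > 0" for K :: real
  proof -
    have "I \<le> (\<integral>\<^sup>+\<omega>. ennreal (min (g n \<omega>) K) \<partial>M) + ennreal (\<bar>C\<bar> / K)" for n
    proof -
      have "I = (\<integral>\<^sup>+\<omega>. ennreal (g n \<omega>) \<partial>M)" by (simp add: I)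
      also have "\<dots> \<le> (\<integral>\<^sup>+\<omega>. ennreal (min (g n \<omega>) K) + ennreal (1 / K) * ennreal ((g n \<omega>)\<^sup>2) \<partial>M)"
      proof (rule nn_integral_mono)
        fix \<omega> assume w: "\<omega> \<in> space M"
        have "g n \<omega> \<le> min (g n \<omega>) K + 1 / K * (g n \<omega>)\<^sup>2"
        proof (cases "g n \<omega> \<le> K")
          case False
          then have "K * g n \<omega> \<le> g n \<omega> * g n \<omega>" using that nn[OF w] by (intro mult_right_mono) auto
          then show ?thesis using that False by (simp add: field_simps power2_eq_square min_def add_pos_pos
                add_increasing order_less_imp_le)
        qed (use that in \<open>auto simp: min_def\<close>)
        then show "ennreal (g n \<omega>) \<le> ennreal (min (g n \<omega>) K) + ennreal (1 / K) * ennreal ((g n \<omega>)\<^sup>2)"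
          using that nn[OF w]
          by (subst ennreal_mult[symmetric], simp, simp, subst ennreal_plus[symmetric])
             (auto simp del: ennreal_plus intro!: ennreal_leI)
      qed
      also have "\<dots> = (\<integral>\<^sup>+\<omega>. ennreal (min (g n \<omega>) K) \<partial>M) + ennreal (1 / K) * (\<integral>\<^sup>+\<omega>. ennreal ((g n \<omega>)\<^sup>2) \<partial>M)"
        by (subst nn_integral_add) (auto simp: nn_integral_cmult)
      also have "ennreal (1 / K) * (\<integral>\<^sup>+\<omega>. ennreal ((g n \<omega>)\<^sup>2) \<partial>M) \<le> ennreal (1 / K) * ennreal \<bar>C\<bar>"
        by (intro mult_left_mono order.trans[OF L2]) (auto intro: ennreal_leI)
      also have "\<dots> = ennreal (\<bar>C\<bar> / K)" using that by (subst ennreal_mult[symmetric]) auto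
      finally show ?thesis by (simp add: add_left_mono)
    qed
    moreover have "(\<lambda>n. (\<integral>\<^sup>+\<omega>. ennreal (min (g n \<omega>) K) \<partial>M) + ennreal (\<bar>C\<bar> / K)) \<longlonglongrightarrow>
      (\<integral>\<^sup>+\<omega>. ennreal (min (h \<omega>) K) \<partial>M) + ennreal (\<bar>C\<bar> / K)"
    proof (intro tendsto_add tendsto_const nn_integral_dominated_convergence[where w = "\<lambda>_. ennreal K"])
      show "AE \<omega> in M. (\<lambda>n. ennreal (min (g n \<omega>) K)) \<longlonglongrightarrow> ennreal (min (h \<omega>) K)"
        by (intro AE_I2 tendsto_ennrealI tendsto_min lim tendsto_const)
      show "(\<integral>\<^sup>+\<omega>. ennreal K \<partial>M) < \<infinity>"
        using emeasure_finite by (simp add: ennreal_mult_less_top less_top[symmetric] ennreal_mult_eq_top_iff)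
    qed (auto intro!: ennreal_leI)
    ultimately have "I \<le> (\<integral>\<^sup>+\<omega>. ennreal (min (h \<omega>) K) \<partial>M) + ennreal (\<bar>C\<bar> / K)"
      by (intro LIMSEQ_le_const) auto
    also have "\<dots> \<le> (\<integral>\<^sup>+\<omega>. ennreal (h \<omega>) \<partial>M) + ennreal (\<bar>C\<bar> / K)"
      by (intro add_right_mono nn_integral_mono ennreal_leI) auto
    finally show ?thesis .
  qed
  have "(\<lambda>n. (\<integral>\<^sup>+\<omega>. ennreal (h \<omega>) \<partial>M) + ennreal (\<bar>C\<bar> / real (Suc n))) \<longlonglongrightarrow> (\<integral>\<^sup>+\<omega>. ennreal (h \<omega>) \<partial>M) + ennreal 0"
    by (intro tendsto_add tendsto_const tendsto_ennrealI LIMSEQ_Suc[OF lim_const_over_n])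
  moreover have "I \<le> (\<integral>\<^sup>+\<omega>. ennreal (h \<omega>) \<partial>M) + ennreal (\<bar>C\<bar> / real (Suc n))" for n
    using K[of "real (Suc n)"] by simp
  ultimately show "I \<le> (\<integral>\<^sup>+\<omega>. ennreal (h \<omega>) \<partial>M)"
    by (intro LIMSEQ_le_const) auto
qed

section \<open>Calculus for exponentials of time integrals\<close>

lemma borel_measurable_set_integral_upto:
  fixes g :: "real \<Rightarrow> real"
  assumes [measurable]: "g \<in> borel_measurable borel"
  shows "(\<lambda>t. LINT s:{c..t}|lborel. g s) \<in> borel_measurable borel"
proof -
  have "(\<lambda>t. LINT s|lborel. (if c \<le> s \<and> s \<le> t then g s else 0)) \<in> borel_measurable borel"
    by (rule lborel.borel_measurable_lebesgue_integral) (simp add: split_beta', measurable)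
  also have "(\<lambda>t. LINT s|lborel. (if c \<le> s \<and> s \<le> t then g s else 0)) = (\<lambda>t. LINT s:{c..t}|lborel. g s)"
    unfolding set_lebesgue_integral_def by (intro ext Bochner_Integration.integral_cong) (auto simp: indicator_def)
  finally show ?thesis .
qed

lemma abs_exp_minus_one_le: "\<bar>exp u - 1\<bar> \<le> \<bar>u\<bar> * exp \<bar>u\<bar>" for u :: real
proof (cases "0 \<le> u")
  case True
  have "1 - exp (- u) \<le> u" using exp_ge_add_one_self[of "- u"] by simp
  then have "exp u * (1 - exp (- u)) \<le> exp u * u" by (intro mult_left_mono) auto
  moreover have "exp u * (1 - exp (- u)) = exp u - 1" by (simp add: right_diff_distrib exp_add[symmetric])
  ultimately show ?thesis using True by (simp add: mult.commute)
next
  case False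
  then have "exp u < 1" by simp
  then have "\<bar>exp u - 1\<bar> \<le> \<bar>u\<bar> * 1" using False exp_ge_add_one_self[of u] by linarith
  also have "\<dots> \<le> \<bar>u\<bar> * exp \<bar>u\<bar>" by (intro mult_left_mono) auto
  finally show ?thesis .
qed

text \<open>For a merely measurable \<open>g\<close> the function \<open>h\<close> is Lipschitz but
  may fail to be differentiable at a given point. The difference of the two sides is smoother: its
  increments are quadratically small, so its derivative is 0 everywhere and it is constant.\<close>

lemma exp_integral_FTC:
  fixes g :: "real \<Rightarrow> real" and B :: real
  assumes [measurable]: "g \<in> borel_measurable borel" and B: "\<And>s. \<bar>g s\<bar> \<le> B"
  defines "h \<equiv> \<lambda>t. LINT s:{0..t}|lborel. g s"
  assumes ut: "0 \<le> u" "u \<le> t"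
  shows "exp (h t) = exp (h u) + (LINT s:{u..t}|lborel. exp (h s) * g s)"
proof -
  have B0: "B \<ge> 0" using B[of 0] by auto
  have bint: "set_integrable lborel {c..d} f"
    if [measurable]: "f \<in> borel_measurable borel" and "\<And>s. s \<in> {c..d} \<Longrightarrow> \<bar>f s\<bar> \<le> C" for f :: "real \<Rightarrow> real" and c d C
    unfolding set_integrable_def
    by (rule integrableI_bounded_set_indicator[where B = C]) (use that in \<open>auto simp: emeasure_lborel_Icc_eq\<close>)
  have gi: "set_integrable lborel {c..d} g" for c d by (rule bint) (use B in auto)
  have bd: "\<bar>LINT s:{c..d}|lborel. f s\<bar> \<le> C * (d - c)"
    if [measurable]: "f \<in> borel_measurable borel" and fb: "\<And>s. s \<in> {c..d} \<Longrightarrow> \<bar>f s\<bar> \<le> C" and "c \<le> d" "0 \<le> C" for f :: "real \<Rightarrow> real" and c d C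
  proof -
    have fi: "set_integrable lborel {c..d} f" by (rule bint) (use fb in auto)
    have "\<bar>LINT s:{c..d}|lborel. f s\<bar> \<le> (LINT s:{c..d}|lborel. \<bar>f s\<bar>)"
      using set_integral_norm_bound[OF fi] by simp
    also have "\<dots> \<le> (LINT s:{c..d}|lborel. C)"
    proof (rule set_integral_mono)
      show "set_integrable lborel {c..d} (\<lambda>s. C)" by (rule bint[where C = C]) (use \<open>0 \<le> C\<close> in auto)
    qed (use fi fb in \<open>auto intro: set_integrable_abs\<close>)
    also have "\<dots> = C * (d - c)" using \<open>c \<le> d\<close> by (simp add: set_lebesgue_integral_def)
    finally show ?thesis .
  qed
  have split: "(LINT s:{c..e}|lborel. f s) = (LINT s:{c..d}|lborel. f s) + (LINT s:{d..e}|lborel. f s)"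
    if [measurable]: "f \<in> borel_measurable borel" and "set_integrable lborel {c..e} f" and cde: "c \<le> d" "d \<le> e" for f :: "real \<Rightarrow> real" and c d e
  proof -
    have "(LINT s:{c..e}|lborel. f s) = (LINT s:{c..d} \<union> {d<..e}|lborel. f s)"
      using cde by (simp add: ivl_disj_un)
    also have "\<dots> = (LINT s:{c..d}|lborel. f s) + (LINT s:{d<..e}|lborel. f s)"
      by (rule set_integral_Un) (use cde that(2) in \<open>auto intro: set_integrable_subset\<close>)
    also have "(LINT s:{d<..e}|lborel. f s) = (LINT s:{d..e}|lborel. f s)"
    proof (rule set_integral_cong_set)
      show "AE s in lborel. (s \<in> {d..e}) = (s \<in> {d<..e})"
        using AE_lborel_singleton[of d] by eventually_elim (use cde in auto)
    qed (auto simp: set_borel_measurable_def)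
    finally show ?thesis .
  qed
  have hm[measurable]: "h \<in> borel_measurable borel"
    unfolding h_def by (rule borel_measurable_set_integral_upto) fact
  have hd: "h d - h c = (LINT s:{c..d}|lborel. g s)" if "0 \<le> c" "c \<le> d" for c d
    using split[of g 0 d c] gi that by (simp add: h_def)
  have hL: "\<bar>h d - h c\<bar> \<le> B * (d - c)" if "0 \<le> c" "c \<le> d" for c d
    unfolding hd[OF that] by (rule bd) (use B B0 that in auto)
  have hb: "\<bar>h s\<bar> \<le> B * t" if "0 \<le> s" "s \<le> t" for s
  proof -
    have "\<bar>h s\<bar> \<le> B * (s - 0)" using that bd[of g 0 s B] B B0 by (simp add: h_def)
    also have "\<dots> \<le> B * t" using that B0 by (auto intro: mult_left_mono)
    finally show ?thesis .
  qed
  define E where "E = exp (B * t)"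
  have E1: "E \<ge> 1" unfolding E_def using B0 ut by simp
  have eb: "exp (h s) \<le> E" if "0 \<le> s" "s \<le> t" for s
    using hb[OF that] by (simp add: E_def)
  have ei: "set_integrable lborel {c..d} (\<lambda>s. exp (h s) * g s)" if "0 \<le> c" "d \<le> t" for c d
    by (rule bint[where C = "E * B"]) (use that eb B B0 E1 in \<open>auto simp: abs_mult intro!: mult_mono\<close>)
  have exp2: "\<bar>exp y - 1 - y\<bar> \<le> y\<^sup>2 * exp (\<bar>y\<bar>)" for y :: real
  proof -
    obtain w where w: "\<bar>w\<bar> \<le> \<bar>y\<bar>" "exp y = (\<Sum>m<2. y ^ m / fact m) + exp w / fact 2 * y ^ 2"
      using Maclaurin_exp_le[of y 2] by blast
    have "exp y - 1 - y = exp w / 2 * y\<^sup>2" using w(2) by (simp add: numeral_2_eq_2)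
    then have "\<bar>exp y - 1 - y\<bar> = exp w / 2 * y\<^sup>2" by (simp only: abs_mult abs_divide) simp
    also have "\<dots> \<le> exp \<bar>y\<bar> * y\<^sup>2"
    proof (rule mult_right_mono)
      have "exp w \<le> exp \<bar>y\<bar>" using w(1) by simp
      then show "exp w / 2 \<le> exp \<bar>y\<bar>" using exp_gt_zero[of w] by linarith
    qed simp
    finally show ?thesis by (simp add: mult.commute)
  qed
  define D where "D s = exp (h s) - (LINT r:{0..s}|lborel. exp (h r) * g r)" for s
  \<comment> \<open>Two second-order errors are collected: the Taylor remainder of the exponential
    at \<open>h c\<close>, and the error of freezing exp (h s) at s = c inside the integral.\<close>
  define C where "C = E * B\<^sup>2 * E + E * E * B * B"
  have C0: "C \<ge> 0" unfolding C_def using E1 B0 by simp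
  have Db: "\<bar>D d - D c\<bar> \<le> C * (d - c)\<^sup>2" if cd: "0 \<le> c" "c \<le> d" "d \<le> t" for c d
  proof -
    have ed: "exp (h s) - exp (h c) = exp (h c) * (exp (h s - h c) - 1)" for s
      by (simp add: exp_diff field_simps)
    have cdb: "\<bar>h d - h c\<bar> \<le> B * t"
      using hL[OF cd(1,2)] by (rule order.trans) (use cd B0 in \<open>auto intro: mult_left_mono\<close>)
    have 1: "\<bar>exp (h d) - exp (h c) - exp (h c) * (h d - h c)\<bar> \<le> E * B\<^sup>2 * E * (d - c)\<^sup>2"
    proof -
      have "\<bar>exp (h d) - exp (h c) - exp (h c) * (h d - h c)\<bar> = exp (h c) * \<bar>exp (h d - h c) - 1 - (h d - h c)\<bar>"
        unfolding ed right_diff_distrib[symmetric] abs_mult by simp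
      also have "\<dots> \<le> E * ((h d - h c)\<^sup>2 * exp \<bar>h d - h c\<bar>)"
        by (intro mult_mono eb exp2) (use cd E1 in auto)
      also have "\<dots> \<le> E * ((B * (d - c))\<^sup>2 * E)"
        using hL[OF cd(1,2)] cdb E1 unfolding E_def
        by (intro mult_left_mono mult_mono) (auto simp: abs_le_square_iff[symmetric] intro: order.trans)
      finally show ?thesis by (simp add: power_mult_distrib mult_ac)
    qed
    have 2: "\<bar>(LINT s:{c..d}|lborel. exp (h s) * g s) - exp (h c) * (h d - h c)\<bar> \<le> E * E * B * B * (d - c)\<^sup>2"
    proof -
      have "exp (h c) * (h d - h c) = (LINT s:{c..d}|lborel. exp (h c) * g s)"
        unfolding hd[OF cd(1,2)] by simp
      then have "(LINT s:{c..d}|lborel. exp (h s) * g s) - exp (h c) * (h d - h c)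
         = (LINT s:{c..d}|lborel. exp (h s) * g s - exp (h c) * g s)"
        using ei[OF cd(1,3)] gi by (simp add: set_integral_diff)
      also have "\<bar>\<dots>\<bar> \<le> E * E * B * B * (d - c) * (d - c)"
      proof (rule bd)
        fix s assume s: "s \<in> {c..d}"
        have "\<bar>exp (h s) - exp (h c)\<bar> \<le> E * (E * (B * (d - c)))"
        proof -
          have hsc: "\<bar>h s - h c\<bar> \<le> B * (s - c)" using hL s cd by auto
          also have hsc2: "\<dots> \<le> B * (d - c)" using s B0 by (auto intro: mult_left_mono)
          finally have l: "\<bar>h s - h c\<bar> \<le> B * (d - c)" .
          have "\<bar>h s - h c\<bar> \<le> B * t" using l by (rule order.trans) (use cd B0 in \<open>auto intro: mult_left_mono\<close>)
          then have l2: "exp \<bar>h s - h c\<bar> \<le> E" by (simp add: E_def)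
          have "\<bar>exp (h s - h c) - 1\<bar> \<le> exp \<bar>h s - h c\<bar> * \<bar>h s - h c\<bar>"
            using abs_exp_minus_one_le[of "h s - h c"] by (simp add: mult.commute)
          also have "\<dots> \<le> E * (B * (d - c))"
            by (intro mult_mono l l2) (use E1 in auto)
          finally have "exp (h c) * \<bar>exp (h s - h c) - 1\<bar> \<le> E * (E * (B * (d - c)))"
            by (intro mult_mono eb) (use cd E1 in auto)
          then show ?thesis by (simp add: ed abs_mult)
        qed
        then have "\<bar>exp (h s) - exp (h c)\<bar> * \<bar>g s\<bar> \<le> E * (E * (B * (d - c))) * B"
          by (intro mult_mono B) (use E1 B0 cd in auto)
        then show "\<bar>exp (h s) * g s - exp (h c) * g s\<bar> \<le> E * E * B * B * (d - c)"
          unfolding left_diff_distrib[symmetric] abs_mult by (simp only: mult_ac)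
      qed (use cd E1 B0 in auto)
      finally show ?thesis by (simp add: power2_eq_square mult_ac)
    qed
    have "D d - D c = (exp (h d) - exp (h c) - exp (h c) * (h d - h c))
       - ((LINT s:{c..d}|lborel. exp (h s) * g s) - exp (h c) * (h d - h c))"
      using split[OF _ ei[of 0 d], of c] cd by (simp add: D_def)
    then show ?thesis using 1 2 unfolding C_def by (auto simp: algebra_simps)
  qed
  have "D t = D u"
  proof (cases "u = t")
    case False
    have Db': "\<bar>D d - D c\<bar> \<le> C * (d - c)\<^sup>2" if "c \<in> {0..t}" "d \<in> {0..t}" for c d
      using Db[of c d] Db[of d c] that by (cases "c \<le> d") (auto simp: power2_commute abs_minus_commute)
    have dz: "(D has_real_derivative 0) (at s within {u..t})" if s: "s \<in> {u..t}" for s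
      unfolding has_field_derivative_iff
    proof (rule Lim_null_comparison)
      show "\<forall>\<^sub>F y in at s within {u..t}. norm ((D y - D s) / (y - s)) \<le> C * \<bar>y - s\<bar>"
        unfolding eventually_at_filter
      proof (intro always_eventually allI impI)
        fix y assume y: "y \<noteq> s" "y \<in> {u..t}"
        have "\<bar>D y - D s\<bar> \<le> C * \<bar>y - s\<bar> * \<bar>y - s\<bar>"
          using Db'[of s y] s y ut by (simp add: power2_eq_square abs_mult_self_eq mult.assoc)
        then show "norm ((D y - D s) / (y - s)) \<le> C * \<bar>y - s\<bar>"
          using y by (simp add: divide_le_eq)
      qed
      have "((\<lambda>y. C * \<bar>y - s\<bar>) \<longlongrightarrow> C * \<bar>s - s\<bar>) (at s within {u..t})"
        by (intro tendsto_intros)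
      then show "((\<lambda>y. C * \<bar>y - s\<bar>) \<longlongrightarrow> 0) (at s within {u..t})" by simp
    qed
    have "\<exists>c. \<forall>s\<in>{u..t}. D s = c"
      by (rule has_field_derivative_zero_constant) (use dz in auto)
    then show ?thesis using ut by auto
  qed simp
  then show ?thesis
    using split[OF _ ei[of 0 t], of u] ut by (simp add: D_def)
qed

text \<open>\<open>exp_increment\<close> is the martingale property in product form, tested against
  any nonnegative functional \<open>H\<close> of the past, and only between dyadic times. This is
  what stationary independent increments yield directly, and stopping times are approximated on the
  same grid. The filtration is not assumed right-continuous, which is why the stopping conditions
  below involve the events \<sigma> < t.\<close>

locale exponential_martingales = prob_space M for M :: "'a measure" +
  fixes F :: "real \<Rightarrow> 'a measure" and X :: "real \<Rightarrow> 'a \<Rightarrow> real" and \<psi> :: "real \<Rightarrow> real"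
  assumes space_F: "\<And>t. space (F t) = space M"
    and sets_F: "\<And>t. sets (F t) \<subseteq> sets M"
    and F_mono: "\<And>s t. 0 \<le> s \<Longrightarrow> s \<le> t \<Longrightarrow> sets (F s) \<subseteq> sets (F t)"
    and X_adapted: "\<And>t. 0 \<le> t \<Longrightarrow> X t \<in> borel_measurable (F t)"
    and X_zero: "\<And>w. w \<in> space M \<Longrightarrow> X 0 w = 0"
    and X_right_continuous: "\<And>w t. w \<in> space M \<Longrightarrow> 0 \<le> t \<Longrightarrow> continuous (at_right t) (\<lambda>s. X s w)"
    and exp_increment: "\<And>\<theta> n k l H. 0 \<le> \<theta> \<Longrightarrow> k \<le> l \<Longrightarrow> H \<in> borel_measurable (F (real k / 2 ^ n)) \<Longrightarrow>
      (\<integral>\<^sup>+w. ennreal (exp (\<theta> * (X (real l / 2 ^ n) w - X (real k / 2 ^ n) w))) * H w \<partial>M)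
        = ennreal (exp (\<psi> \<theta> * (real (l - k) / 2 ^ n))) * (\<integral>\<^sup>+w. H w \<partial>M)"
begin

lemma measurable_F:
  assumes "f \<in> measurable (F t) N" shows "f \<in> measurable M N"
  using assms sets_F[of t] space_F[of t] by (auto simp: measurable_def)

lemma measurable_F_mono:
  assumes "f \<in> measurable (F s) N" "0 \<le> s" "s \<le> t" shows "f \<in> measurable (F t) N"
  using assms F_mono[of s t] space_F by (auto simp: measurable_def)

lemma X_measurable: "0 \<le> t \<Longrightarrow> X t \<in> borel_measurable M"
  by (rule measurable_F[OF X_adapted])

definition mart :: "real \<Rightarrow> real \<Rightarrow> 'a \<Rightarrow> real" where
  "mart \<theta> t w = exp (\<theta> * X t w - \<psi> \<theta> * t)"

lemma mart_measurable: "0 \<le> t \<Longrightarrow> mart \<theta> t \<in> borel_measurable M"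
  unfolding mart_def using X_measurable[measurable] by measurable

lemma mart_right_continuous:
  "w \<in> space M \<Longrightarrow> 0 \<le> t \<Longrightarrow> continuous (at_right t) (\<lambda>s. mart \<theta> s w)"
  unfolding mart_def by (intro continuous_intros X_right_continuous)

lemma mart_nn_integral:
  assumes "0 \<le> \<theta>" "k \<le> l" and H: "H \<in> borel_measurable (F (real k / 2 ^ n))"
  shows "(\<integral>\<^sup>+w. ennreal (mart \<theta> (real l / 2 ^ n) w) * H w \<partial>M) = (\<integral>\<^sup>+w. ennreal (mart \<theta> (real k / 2 ^ n) w) * H w \<partial>M)"
proof -
  let ?k = "real k / 2 ^ n" let ?l = "real l / 2 ^ n"
  let ?c = "exp (- (\<psi> \<theta> * (real (l - k) / 2 ^ n)))"
  have [measurable]: "X ?k \<in> borel_measurable M" "H \<in> borel_measurable M" "X ?l \<in> borel_measurable M"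
    using H by (auto intro: measurable_F X_measurable)
  have m: "(\<lambda>w. ennreal (mart \<theta> ?k w) * H w) \<in> borel_measurable (F ?k)"
    unfolding mart_def using X_adapted[of ?k, measurable] H[measurable] by measurable
  have [measurable]: "mart \<theta> ?k \<in> borel_measurable M" by (rule mart_measurable) simp
  have split: "mart \<theta> ?l w = ?c * (exp (\<theta> * (X ?l w - X ?k w)) * mart \<theta> ?k w)" for w
    using \<open>k \<le> l\<close> by (simp add: mart_def exp_add[symmetric] algebra_simps of_nat_diff diff_divide_distrib)
  have "(\<integral>\<^sup>+w. ennreal (mart \<theta> ?l w) * H w \<partial>M)
     = (\<integral>\<^sup>+w. ennreal ?c * (ennreal (exp (\<theta> * (X ?l w - X ?k w))) * (ennreal (mart \<theta> ?k w) * H w)) \<partial>M)"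
    unfolding split by (intro nn_integral_cong) (simp add: ennreal_mult mart_def mult_ac)
  also have "\<dots> = ennreal ?c * (\<integral>\<^sup>+w. ennreal (exp (\<theta> * (X ?l w - X ?k w))) * (ennreal (mart \<theta> ?k w) * H w) \<partial>M)"
    by (subst nn_integral_cmult) auto
  also have "\<dots> = ennreal ?c * (ennreal (exp (\<psi> \<theta> * (real (l - k) / 2 ^ n))) * (\<integral>\<^sup>+w. ennreal (mart \<theta> ?k w) * H w \<partial>M))"
    by (subst exp_increment[OF assms(1,2) m]) simp
  also have "\<dots> = (\<integral>\<^sup>+w. ennreal (mart \<theta> ?k w) * H w \<partial>M)"
    by (simp add: mult.assoc[symmetric] ennreal_mult[symmetric] exp_add[symmetric])
  finally show ?thesis .
qed

lemma nn_integral_mart: "0 \<le> \<theta> \<Longrightarrow> (\<integral>\<^sup>+w. ennreal (mart \<theta> (real k) w) \<partial>M) = 1"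
  using mart_nn_integral[of \<theta> 0 k "\<lambda>_. 1" 0]
  by (simp add: mart_def X_zero emeasure_space_1 cong: nn_integral_cong_simp)

text \<open>Cut the event \<sigma> < T into the events \<open>B k\<close> that \<sigma> falls into
  the k-th dyadic cell. On \<open>B k\<close> the rounded time is the right end of the cell, and
  \<open>H\<close> restricted to \<open>B k\<close> is known at that end, so the martingale property
  leads from there to \<open>T\<close>.\<close>

lemma mart_nn_integral_grid:
  fixes \<sigma> :: "'a \<Rightarrow> real" and H :: "'a \<Rightarrow> ennreal" and T :: nat
  assumes \<theta>: "0 \<le> \<theta>" and Hm[measurable]: "H \<in> borel_measurable M"
    and Hfin: "\<And>w. w \<in> space M \<Longrightarrow> H w < \<top>"
    and \<sigma>m[measurable]: "\<sigma> \<in> borel_measurable M" and \<sigma>0: "\<And>w. w \<in> space M \<Longrightarrow> 0 \<le> \<sigma> w"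
    and ad: "\<And>t. 0 \<le> t \<Longrightarrow> (\<lambda>w. H w * indicator {w. \<sigma> w < t} w) \<in> borel_measurable (F t)"
  shows "(\<integral>\<^sup>+w. ennreal (mart \<theta> (dyadic_above n (\<sigma> w)) w) * (H w * indicator {w. \<sigma> w < real T} w) \<partial>M)
      = (\<integral>\<^sup>+w. ennreal (mart \<theta> (real T) w) * (H w * indicator {w. \<sigma> w < real T} w) \<partial>M)"
proof -
  let ?t = "\<lambda>k. real k / 2 ^ n"
  let ?N = "T * 2 ^ n"
  define B where "B k = {w. ?t k \<le> \<sigma> w \<and> \<sigma> w < ?t (Suc k)}" for k
  have [measurable]: "mart \<theta> (?t k) \<in> borel_measurable M" for k by (rule mart_measurable) simp
  have [measurable]: "mart \<theta> (real T) \<in> borel_measurable M" by (rule mart_measurable) simp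
  have [measurable]: "Measurable.pred M (\<lambda>w. w \<in> B k)" for k unfolding B_def by simp
  have B: "w \<in> B k \<longleftrightarrow> k = nat \<lfloor>2 ^ n * \<sigma> w\<rfloor>" if "w \<in> space M" for w k
  proof -
    have "w \<in> B k \<longleftrightarrow> int k = \<lfloor>2 ^ n * \<sigma> w\<rfloor>"
      unfolding B_def by (auto simp: field_simps floor_eq_iff eq_commute[of "int k"])
    also have "\<dots> \<longleftrightarrow> k = nat \<lfloor>2 ^ n * \<sigma> w\<rfloor>" using \<sigma>0[OF that] by auto
    finally show ?thesis .
  qed
  have lt: "\<sigma> w < real T \<longleftrightarrow> nat \<lfloor>2 ^ n * \<sigma> w\<rfloor> < ?N" if "w \<in> space M" for w
  proof -
    have "\<sigma> w < real T \<longleftrightarrow> 2 ^ n * \<sigma> w < real_of_int (int ?N)" by (simp add: field_simps)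
    also have "\<dots> \<longleftrightarrow> \<lfloor>2 ^ n * \<sigma> w\<rfloor> < int ?N" by (simp only: floor_less_iff)
    also have "\<dots> \<longleftrightarrow> nat \<lfloor>2 ^ n * \<sigma> w\<rfloor> < ?N" using \<sigma>0[OF that] by (simp add: nat_less_iff)
    finally show ?thesis .
  qed
  have sum: "h (nat \<lfloor>2 ^ n * \<sigma> w\<rfloor>) * (H w * indicator {w. \<sigma> w < real T} w) = (\<Sum>k<?N. h k * (H w * indicator (B k) w))"
    if "w \<in> space M" for h :: "nat \<Rightarrow> ennreal" and w
  proof -
    have "(\<Sum>k<?N. h k * (H w * indicator (B k) w))
        = (\<Sum>k<?N. if k = nat \<lfloor>2 ^ n * \<sigma> w\<rfloor> then h k * H w else 0)"
      by (rule sum.cong) (auto simp: indicator_def B[OF that])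
    then show ?thesis using lt[OF that] by (simp add: indicator_def)
  qed
  have ad2: "(\<lambda>w. H w * indicator (B k) w) \<in> borel_measurable (F (?t (Suc k)))" for k
  proof -
    have [measurable]: "(\<lambda>w. H w * indicator {w. \<sigma> w < ?t (Suc k)} w) \<in> borel_measurable (F (?t (Suc k)))"
      by (rule ad) simp
    have [measurable]: "(\<lambda>w. H w * indicator {w. \<sigma> w < ?t k} w) \<in> borel_measurable (F (?t (Suc k)))"
      by (rule measurable_F_mono[OF ad[of "?t k"]]) (auto simp: divide_right_mono)
    \<comment> \<open>\<open>B k\<close> is the difference of two events of the form \<sigma> < t.
      Subtraction in \<open>ennreal\<close> is faithful here because \<open>H\<close> is
      finite.\<close>
    have "H w * indicator (B k) w = H w * indicator {w. \<sigma> w < ?t (Suc k)} w - H w * indicator {w. \<sigma> w < ?t k} w"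
      if "w \<in> space (F (?t (Suc k)))" for w
    proof -
      have "?t k \<le> ?t (Suc k)" by (simp add: divide_right_mono)
      moreover have "H w < \<top>" using that Hfin space_F by auto
      ultimately show ?thesis unfolding B_def by (auto simp: indicator_def)
    qed
    then show ?thesis by (subst measurable_cong) (assumption, measurable)
  qed
  have dy: "dyadic_above n (\<sigma> w) = ?t (Suc (nat \<lfloor>2 ^ n * \<sigma> w\<rfloor>))" if "w \<in> space M" for w
    using \<sigma>0[OF that] by (simp add: dyadic_above_def add.commute)
  have "(\<integral>\<^sup>+w. ennreal (mart \<theta> (real T) w) * (H w * indicator {w. \<sigma> w < real T} w) \<partial>M)
     = (\<integral>\<^sup>+w. (\<Sum>k<?N. ennreal (mart \<theta> (real T) w) * (H w * indicator (B k) w)) \<partial>M)"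
    by (intro nn_integral_cong sum)
  also have "\<dots> = (\<Sum>k<?N. \<integral>\<^sup>+w. ennreal (mart \<theta> (real T) w) * (H w * indicator (B k) w) \<partial>M)"
    by (rule nn_integral_sum) auto
  also have "\<dots> = (\<Sum>k<?N. \<integral>\<^sup>+w. ennreal (mart \<theta> (?t (Suc k)) w) * (H w * indicator (B k) w) \<partial>M)"
  proof (rule sum.cong[OF refl])
    fix k assume "k \<in> {..<?N}"
    then have "Suc k \<le> ?N" by simp
    from mart_nn_integral[OF \<theta> this ad2[of k]]
    show "(\<integral>\<^sup>+w. ennreal (mart \<theta> (real T) w) * (H w * indicator (B k) w) \<partial>M) = (\<integral>\<^sup>+w. ennreal (mart \<theta> (?t (Suc k)) w) * (H w * indicator (B k) w) \<partial>M)"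
      by simp
  qed
  also have "\<dots> = (\<integral>\<^sup>+w. (\<Sum>k<?N. ennreal (mart \<theta> (?t (Suc k)) w) * (H w * indicator (B k) w)) \<partial>M)"
    by (rule nn_integral_sum[symmetric]) (auto simp del: of_nat_Suc)
  also have "\<dots> = (\<integral>\<^sup>+w. ennreal (mart \<theta> (dyadic_above n (\<sigma> w)) w) * (H w * indicator {w. \<sigma> w < real T} w) \<partial>M)"
    by (intro nn_integral_cong) (simp only: sum[symmetric, where h = "\<lambda>k. ennreal (mart \<theta> (?t (Suc k)) _)"] dy)
  finally show ?thesis by simp
qed

lemma mart_dyadic_measurable:
  assumes [measurable]: "\<sigma> \<in> borel_measurable M" and \<sigma>0: "\<And>w. w \<in> space M \<Longrightarrow> 0 \<le> \<sigma> w"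
  shows "(\<lambda>w. mart \<theta> (dyadic_above n (\<sigma> w)) w) \<in> borel_measurable M"
proof -
  have "(\<lambda>w. mart \<theta> ((real_of_int \<lfloor>2 ^ n * \<sigma> w\<rfloor> + 1) / 2 ^ n) w) \<in> borel_measurable M \<longleftrightarrow>
    (\<lambda>w. mart \<theta> (max 0 ((real_of_int \<lfloor>2 ^ n * \<sigma> w\<rfloor> + 1) / 2 ^ n)) w) \<in> borel_measurable M"
    by (rule measurable_cong) (use \<sigma>0 in \<open>simp add: max_def\<close>)
  moreover have "(\<lambda>w. mart \<theta> (max 0 ((real_of_int \<lfloor>2 ^ n * \<sigma> w\<rfloor> + 1) / 2 ^ n)) w) \<in> borel_measurable M"
    by (rule measurable_compose_countable[where f = "\<lambda>i w. mart \<theta> (max 0 ((real_of_int i + 1) / 2 ^ n)) w"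
          and g = "\<lambda>w. \<lfloor>2 ^ n * \<sigma> w\<rfloor>"]) (auto intro!: mart_measurable)
  ultimately show ?thesis by (simp add: dyadic_above_def)
qed

lemma mart_dyadic_tendsto:
  assumes "w \<in> space M" "0 \<le> \<sigma> w"
  shows "(\<lambda>n. mart \<theta> (dyadic_above n (\<sigma> w)) w) \<longlonglongrightarrow> mart \<theta> (\<sigma> w) w"
  by (rule tendsto_dyadic_above) (intro mart_right_continuous assms)

lemma mart_stopped_measurable:
  assumes "\<sigma> \<in> borel_measurable M" and \<sigma>0: "\<And>w. w \<in> space M \<Longrightarrow> 0 \<le> \<sigma> w"
  shows "(\<lambda>w. mart \<theta> (\<sigma> w) w) \<in> borel_measurable M"
  by (rule borel_measurable_LIMSEQ_metric[OF mart_dyadic_measurable mart_dyadic_tendsto]) (use assms in auto)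

text \<open>The identity holds for the dyadic roundings of \<sigma>; the passage to the limit rests
  on uniform integrability. This comes from the martingale with parameter 2 \<theta>: the square of
  \<open>mart \<theta>\<close> is \<open>mart (2 * \<theta>)\<close> times a factor that is bounded
  on bounded time intervals.\<close>

lemma optional_stopping_bounded:
  fixes \<sigma> :: "'a \<Rightarrow> real" and H :: "'a \<Rightarrow> real" and T :: nat and K :: real
  assumes \<theta>: "0 \<le> \<theta>" and Hm[measurable]: "H \<in> borel_measurable M"
    and Hb: "\<And>w. w \<in> space M \<Longrightarrow> 0 \<le> H w \<and> H w \<le> K"
    and \<sigma>m[measurable]: "\<sigma> \<in> borel_measurable M" and \<sigma>0: "\<And>w. w \<in> space M \<Longrightarrow> 0 \<le> \<sigma> w"
    and ad: "\<And>t. 0 \<le> t \<Longrightarrow> (\<lambda>w. ennreal (H w) * indicator {w. \<sigma> w < t} w) \<in> borel_measurable (F t)"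
  shows "(\<integral>\<^sup>+w. ennreal (mart \<theta> (\<sigma> w) w) * (ennreal (H w) * indicator {w. \<sigma> w < real T} w) \<partial>M)
      = (\<integral>\<^sup>+w. ennreal (mart \<theta> (real T) w) * (ennreal (H w) * indicator {w. \<sigma> w < real T} w) \<partial>M)"
proof -
  define J where "J w = H w * indicat_real {w. \<sigma> w < real T} w" for w
  have [measurable]: "J \<in> borel_measurable M" unfolding J_def by measurable
  note mart_dyadic_measurable[OF \<sigma>m \<sigma>0, measurable]
  note lim = mart_dyadic_tendsto[of _ \<sigma>, OF _ \<sigma>0]
  note mart_stopped_measurable[OF \<sigma>m \<sigma>0, measurable]
  have J0: "0 \<le> J w" "J w \<le> K" if "w \<in> space M" for w
    using Hb[OF that] by (auto simp: J_def indicator_def)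
  have K0: "0 \<le> K" using not_empty J0 by fastforce
  have eJ: "ennreal m * (ennreal (H w) * indicator {w. \<sigma> w < real T} w) = ennreal (m * J w)"
    if "w \<in> space M" "0 \<le> m" for m w
    using that Hb by (simp add: J_def ennreal_mult indicator_def)
  have m0: "0 \<le> mart \<theta> t w" for t w unfolding mart_def by simp
  \<comment> \<open>Rounding moves a time below \<open>T\<close> by at most 1, hence
    \<open>real T + 1\<close>; the absolute value covers both signs of the exponent.\<close>
  define C where "C = exp (\<bar>\<psi> (2 * \<theta>) - 2 * \<psi> \<theta>\<bar> * (real T + 1))"
  have I: "(\<integral>\<^sup>+w. ennreal (mart \<theta> (\<sigma> w) w * J w) \<partial>M) = (\<integral>\<^sup>+w. ennreal (mart \<theta> (real T) w * J w) \<partial>M)"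
  proof (rule nn_integral_eq_of_L2_bounded_limit[where g = "\<lambda>n w. mart \<theta> (dyadic_above n (\<sigma> w)) w * J w"])
    show "(\<integral>\<^sup>+w. ennreal (mart \<theta> (dyadic_above n (\<sigma> w)) w * J w) \<partial>M) = (\<integral>\<^sup>+w. ennreal (mart \<theta> (real T) w * J w) \<partial>M)" for n
      using mart_nn_integral_grid[OF \<theta> _ _ \<sigma>m \<sigma>0 ad, of n T]
      by (simp add: eJ m0 cong: nn_integral_cong_simp)
    show "(\<integral>\<^sup>+w. ennreal ((mart \<theta> (dyadic_above n (\<sigma> w)) w * J w)\<^sup>2) \<partial>M) \<le> ennreal (C * K * K)" for n
    proof -
      have pt: "(mart \<theta> (dyadic_above n (\<sigma> w)) w * J w)\<^sup>2 \<le> C * K * (mart (2 * \<theta>) (dyadic_above n (\<sigma> w)) w * J w)"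
        if w: "w \<in> space M" for w
      proof (cases "\<sigma> w < real T")
        case True
        let ?d = "dyadic_above n (\<sigma> w)"
        have "0 \<le> ?d" using \<sigma>0[OF w] dyadic_above_gt[of "\<sigma> w" n] by linarith
        have "(1::real) / 2 ^ n \<le> 1" by simp
        then have d1: "?d \<le> real T + 1" using dyadic_above_le[of n "\<sigma> w"] True by linarith
        have "(\<psi> (2 * \<theta>) - 2 * \<psi> \<theta>) * ?d \<le> \<bar>\<psi> (2 * \<theta>) - 2 * \<psi> \<theta>\<bar> * (real T + 1)"
          using \<open>0 \<le> ?d\<close> d1 by (intro mult_mono) auto
        then have e: "exp ((\<psi> (2 * \<theta>) - 2 * \<psi> \<theta>) * ?d) \<le> C" unfolding C_def by simp
        have "(mart \<theta> ?d w)\<^sup>2 = mart (2 * \<theta>) ?d w * exp ((\<psi> (2 * \<theta>) - 2 * \<psi> \<theta>) * ?d)"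
          by (simp add: mart_def exp_double[symmetric] exp_add[symmetric] power2_eq_square algebra_simps)
        also have "\<dots> \<le> mart (2 * \<theta>) ?d w * C"
          by (intro mult_left_mono e) (simp add: mart_def)
        finally have "(mart \<theta> ?d w)\<^sup>2 * (J w * J w) \<le> (mart (2 * \<theta>) ?d w * C) * (K * J w)"
          using J0[OF w] by (intro mult_mono) (auto simp: mart_def C_def)
        then show ?thesis by (simp add: power2_eq_square mult_ac)
      qed (simp add: J_def)
      have "(\<integral>\<^sup>+w. ennreal ((mart \<theta> (dyadic_above n (\<sigma> w)) w * J w)\<^sup>2) \<partial>M)
        \<le> (\<integral>\<^sup>+w. ennreal (C * K) * ennreal (mart (2 * \<theta>) (dyadic_above n (\<sigma> w)) w * J w) \<partial>M)"
        by (rule nn_integral_mono, subst ennreal_mult[symmetric])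
           (use K0 J0 pt in \<open>auto simp: C_def mart_def intro!: ennreal_leI\<close>)
      also have "\<dots> = ennreal (C * K) * (\<integral>\<^sup>+w. ennreal (mart (2 * \<theta>) (dyadic_above n (\<sigma> w)) w * J w) \<partial>M)"
        by (rule nn_integral_cmult) measurable
      also have "(\<integral>\<^sup>+w. ennreal (mart (2 * \<theta>) (dyadic_above n (\<sigma> w)) w * J w) \<partial>M)
          = (\<integral>\<^sup>+w. ennreal (mart (2 * \<theta>) (dyadic_above n (\<sigma> w)) w) * (ennreal (H w) * indicator {w. \<sigma> w < real T} w) \<partial>M)"
        by (intro nn_integral_cong eJ[symmetric]) (auto simp: mart_def)
      also have "\<dots> = (\<integral>\<^sup>+w. ennreal (mart (2 * \<theta>) (real T) w) * (ennreal (H w) * indicator {w. \<sigma> w < real T} w) \<partial>M)"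
        by (rule mart_nn_integral_grid) (use \<theta> \<sigma>0 ad in auto)
      also have "\<dots> \<le> (\<integral>\<^sup>+w. ennreal (mart (2 * \<theta>) (real T) w) * ennreal K \<partial>M)"
        using Hb by (intro nn_integral_mono mult_left_mono) (auto simp: indicator_def intro: ennreal_leI)
      also have "\<dots> = ennreal K"
        using \<theta> mart_measurable[of "real T" "2 * \<theta>", measurable] by (subst nn_integral_multc) (auto simp: nn_integral_mart)
      also have "ennreal (C * K) * ennreal K = ennreal (C * K * K)"
        using K0 by (simp add: ennreal_mult C_def)
      finally show ?thesis by (simp add: mult_left_mono)
    qed
  qed (auto simp: m0 J0 intro!: tendsto_mult lim)
  then show ?thesis by (simp add: eJ m0 cong: nn_integral_cong_simp)
qed

text \<open>\<open>H\<close> carries the information about the past; it vanishes wherever the stopping time is meant to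
  be infinite.\<close>

lemma optional_stopping:
  fixes \<sigma> :: "'a \<Rightarrow> real" and H :: "'a \<Rightarrow> ennreal" and T :: nat
  assumes \<theta>: "0 \<le> \<theta>" and Hm[measurable]: "H \<in> borel_measurable M"
    and \<sigma>m[measurable]: "\<sigma> \<in> borel_measurable M" and \<sigma>0: "\<And>w. w \<in> space M \<Longrightarrow> 0 \<le> \<sigma> w"
    and ad: "\<And>t. 0 \<le> t \<Longrightarrow> (\<lambda>w. H w * indicator {w. \<sigma> w < t} w) \<in> borel_measurable (F t)"
  shows "(\<integral>\<^sup>+w. ennreal (mart \<theta> (\<sigma> w) w) * (H w * indicator {w. \<sigma> w < real T} w) \<partial>M)
      = (\<integral>\<^sup>+w. ennreal (mart \<theta> (real T) w) * (H w * indicator {w. \<sigma> w < real T} w) \<partial>M)"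
proof -
  \<comment> \<open>Truncation of \<open>H\<close> at height \<open>n\<close> reduces the claim to
    the bounded case; monotone convergence removes it on both sides.\<close>
  define K where "K n w = enn2real (min (H w) (of_nat n))" for n :: nat and w
  have K: "ennreal (K n w) = min (H w) (of_nat n)" for n w
    unfolding K_def by (rule ennreal_enn2real) (auto simp: min_less_iff_disj of_nat_less_top)
  have Km[measurable]: "K n \<in> borel_measurable M" for n unfolding K_def by measurable
  have Kb: "0 \<le> K n w \<and> K n w \<le> real n" for n w
  proof -
    have "ennreal (K n w) \<le> ennreal (real n)" unfolding K by (simp add: ennreal_of_nat_eq_real_of_nat)
    then show ?thesis by (simp add: K_def)
  qed
  have Kad: "(\<lambda>w. ennreal (K n w) * indicator {w. \<sigma> w < t} w) \<in> borel_measurable (F t)" if "0 \<le> t" for n t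
  proof -
    have [measurable]: "(\<lambda>w. H w * indicator {w. \<sigma> w < t} w) \<in> borel_measurable (F t)" by (rule ad) fact
    have "(\<lambda>w. ennreal (K n w) * indicator {w. \<sigma> w < t} w) = (\<lambda>w. min (H w * indicator {w. \<sigma> w < t} w) (of_nat n))"
      unfolding K by (auto simp: indicator_def)
    then show ?thesis by simp
  qed
  have sup: "(SUP n. m * (ennreal (K n w) * i)) = m * (H w * i)" for m i :: ennreal and w
  proof -
    have "(SUP n. min (H w) (of_nat n)) = H w"
      using inf_SUP[of "H w" "of_nat :: nat \<Rightarrow> ennreal" UNIV] by (simp add: ennreal_SUP_of_nat_eq_top inf_min)
    then show ?thesis
      unfolding K by (simp add: SUP_mult_left_ennreal[symmetric] SUP_mult_right_ennreal[symmetric])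
  qed
  have mono: "incseq (\<lambda>n w. m w * (ennreal (K n w) * i w))" for m i :: "'a \<Rightarrow> ennreal"
    unfolding K by (auto simp: incseq_def le_fun_def intro!: mult_left_mono mult_right_mono min.mono)
  have [measurable]: "mart \<theta> (real T) \<in> borel_measurable M" by (rule mart_measurable) simp
  have dm: "(\<lambda>w. mart \<theta> (\<sigma> w) w) \<in> borel_measurable M"
    by (rule mart_stopped_measurable) (use \<sigma>0 in auto)
  note dm[measurable]
  have eq: "(\<integral>\<^sup>+w. ennreal (m w) * (H w * indicator {w. \<sigma> w < real T} w) \<partial>M)
     = (SUP n. \<integral>\<^sup>+w. ennreal (m w) * (ennreal (K n w) * indicator {w. \<sigma> w < real T} w) \<partial>M)"
    if [measurable]: "m \<in> borel_measurable M" for m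
    by (subst nn_integral_monotone_convergence_SUP[OF mono, symmetric]) (auto simp: sup)
  show ?thesis
    unfolding eq[OF dm] eq[OF \<open>mart \<theta> (real T) \<in> borel_measurable M\<close>]
    by (intro SUP_cong refl optional_stopping_bounded[OF \<theta> Km Kb \<sigma>m \<sigma>0 Kad])
qed

end

section \<open>Exponential balance along a path\<close>

lemma right_continuous_borel_measurable:
  fixes f :: "real \<Rightarrow> real"
  assumes "\<And>t. continuous (at_right t) f"
  shows "f \<in> borel_measurable borel"
proof (rule borel_measurable_LIMSEQ_metric[where f = "\<lambda>n s. f (dyadic_above n s)"])
  show "(\<lambda>s. f (dyadic_above n s)) \<in> borel_measurable borel" for n
    unfolding dyadic_above_def
    by (rule measurable_compose_countable[where f = "\<lambda>i s. f ((real_of_int i + 1) / 2 ^ n)" and g = "\<lambda>s. \<lfloor>2 ^ n * s\<rfloor>"]) measurable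
qed (intro tendsto_dyadic_above assms)

lemma bex_Rats_iff: "(\<exists>q\<in>\<rat>. P q) \<longleftrightarrow> (\<exists>q. P (of_rat q))"
  by (auto simp: Rats_def)

lemma set_integrable_bounded:
  fixes f :: "real \<Rightarrow> real"
  assumes [measurable]: "f \<in> borel_measurable borel" and "\<And>s. s \<in> {c..d} \<Longrightarrow> \<bar>f s\<bar> \<le> C"
  shows "set_integrable lborel {c..d} f"
  unfolding set_integrable_def
  by (rule integrableI_bounded_set_indicator[where B = C]) (use assms(2) in \<open>auto simp: emeasure_lborel_Icc_eq\<close>)

text \<open>With \<rho> = \<open>R s\<close> the indicator records which levels the injection has
  passed by time \<open>s\<close>, so that a time integral of exp(\<theta> R) can be regrouped by
  levels.\<close>

lemma ennreal_exp_eq_nn_integral: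
  assumes "0 \<le> \<rho>" "0 \<le> \<theta>"
  shows "ennreal (exp (\<theta> * \<rho>)) = 1 + (\<integral>\<^sup>+r. ennreal (\<theta> * exp (\<theta> * r)) * indicator {0..<\<rho>} r \<partial>lborel)"
proof -
  have "(\<integral>\<^sup>+r. ennreal (\<theta> * exp (\<theta> * r)) * indicator {0..<\<rho>} r \<partial>lborel)
      = (\<integral>\<^sup>+r. ennreal (\<theta> * exp (\<theta> * r)) * indicator {0..\<rho>} r \<partial>lborel)"
    by (intro nn_integral_cong_AE, use AE_lborel_singleton[of \<rho>] in eventually_elim) (auto simp: indicator_def)
  also have "\<dots> = ennreal (exp (\<theta> * \<rho>) - exp (\<theta> * 0))"
    using assms by (intro nn_integral_FTC_Icc) (auto intro!: derivative_eq_intros)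
  also have "1 + \<dots> = ennreal (exp (\<theta> * \<rho>))"
    using assms by (subst ennreal_1[symmetric], subst ennreal_plus[symmetric]) auto
  finally show ?thesis ..
qed

text \<open>A path \<open>f\<close> without upward jumps and a nonnegative path \<open>v = f + R - L\<close>, where \<open>L\<close> is the
  refraction and the nondecreasing \<open>R\<close> only moves while \<open>v\<close> is at \<open>0\<close>. Paths are extended to the
  negative half-line by their value at \<open>0\<close>.\<close>

locale injected_path =
  fixes f v :: "real \<Rightarrow> real" and b \<delta> a :: real
  assumes \<delta>: "0 \<le> \<delta>" and a: "0 < a"
    and f_right_continuous: "\<And>t. continuous (at_right t) f"
    and v_right_continuous: "\<And>t. continuous (at_right t) v"
    and f_neg: "\<And>t. t \<le> 0 \<Longrightarrow> f t = f 0" and v_neg: "\<And>t. t \<le> 0 \<Longrightarrow> v t = v 0"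
    and f_no_up_jump: "\<And>t e. 0 < t \<Longrightarrow> 0 < e \<Longrightarrow> \<exists>\<eta>>0. \<forall>u. t - \<eta> < u \<and> u < t \<longrightarrow> f t \<le> f u + e"
    and v_nonneg: "\<And>t. 0 \<le> v t"
    and v_zero: "v 0 = max (f 0) 0" and f_zero: "f 0 \<le> a"
    and injection_mono: "\<And>s t. 0 \<le> s \<Longrightarrow> s \<le> t \<Longrightarrow>
       v s - f s + refraction_part b \<delta> v s \<le> v t - f t + refraction_part b \<delta> v t"
    and injection_flat: "\<And>t. 0 \<le> t \<Longrightarrow> 0 < v t \<Longrightarrow> \<exists>\<eta>>0. \<forall>u. 0 \<le> u \<and> \<bar>u - t\<bar> < \<eta> \<longrightarrow>
       v u - f u + refraction_part b \<delta> v u = v t - f t + refraction_part b \<delta> v t"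
begin

definition L where "L t = refraction_part b \<delta> v t"
definition R where "R t = v t - f t + L t"

lemma v_measurable[measurable]: "v \<in> borel_measurable borel"
  by (rule right_continuous_borel_measurable) (rule v_right_continuous)

lemma L_diff: "0 \<le> s \<Longrightarrow> s \<le> t \<Longrightarrow> L t - L s = \<delta> * (LINT u:{s..t}|lborel. indicator {b<..} (v u))"
proof -
  assume st: "0 \<le> s" "s \<le> t"
  have i: "set_integrable lborel {c..d} (\<lambda>u. indicator {b<..} (v u) :: real)" for c d
    by (rule set_integrable_bounded[where C = 1]) (auto simp: indicator_def)
  have "(LINT u:{0..t}|lborel. indicator {b<..} (v u)) = (LINT u:{0..s} \<union> {s<..t}|lborel. indicator {b<..} (v u) :: real)"
    using st by (simp add: ivl_disj_un)
  also have "\<dots> = (LINT u:{0..s}|lborel. indicator {b<..} (v u)) + (LINT u:{s<..t}|lborel. indicator {b<..} (v u))"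
    by (rule set_integral_Un) (auto intro: set_integrable_subset[OF i[of s t]] i)
  also have "(LINT u:{s<..t}|lborel. indicator {b<..} (v u)) = (LINT u:{s..t}|lborel. indicator {b<..} (v u) :: real)"
  proof (rule set_integral_cong_set)
    show "AE u in lborel. (u \<in> {s..t}) = (u \<in> {s<..t})"
      using AE_lborel_singleton[of s] by eventually_elim (use st in auto)
  qed (auto simp: set_borel_measurable_def)
  finally show ?thesis by (simp add: L_def refraction_part_def right_diff_distrib distrib_left)
qed

lemma L_lipschitz: "0 \<le> s \<Longrightarrow> s \<le> t \<Longrightarrow> 0 \<le> L t - L s \<and> L t - L s \<le> \<delta> * (t - s)"
proof -
  assume st: "0 \<le> s" "s \<le> t"
  have "(LINT u:{s..t}|lborel. indicator {b<..} (v u)) \<le> (LINT u:{s..t}|lborel. 1::real)"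
    by (rule set_integral_mono) (auto intro!: set_integrable_bounded[where C = 1] simp: indicator_def)
  moreover have "0 \<le> (LINT u:{s..t}|lborel. indicator {b<..} (v u) :: real)"
    unfolding set_lebesgue_integral_def by (intro integral_nonneg_AE) auto
  ultimately show ?thesis
    unfolding L_diff[OF st] using st \<delta> by (auto simp: set_lebesgue_integral_def intro!: mult_left_mono)
qed

lemma L_zero: "t \<le> 0 \<Longrightarrow> L t = 0"
proof -
  assume "t \<le> 0"
  have "AE u in lborel. u \<notin> {0..t}"
    using AE_lborel_singleton[of 0] by eventually_elim (use \<open>t \<le> 0\<close> in auto)
  then have "AE u in lborel. indicator {0..t} u *\<^sub>R (indicator {b<..} (v u) :: real) = 0"
    by eventually_elim simp
  then have "(LINT u:{0..t}|lborel. indicator {b<..} (v u) :: real) = 0"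
    unfolding set_lebesgue_integral_def by (rule integral_eq_zero_AE)
  then show ?thesis by (simp add: L_def refraction_part_def)
qed

lemma L_abs_diff: "\<bar>L t - L s\<bar> \<le> \<delta> * \<bar>t - s\<bar>"
proof -
  have "\<bar>L t - L s\<bar> = \<bar>L (max 0 t) - L (max 0 s)\<bar>" by (auto simp: max_def L_zero)
  also have "\<dots> \<le> \<delta> * \<bar>max 0 t - max 0 s\<bar>"
    using L_lipschitz[of "max 0 s" "max 0 t", OF max.cobounded1] L_lipschitz[of "max 0 t" "max 0 s", OF max.cobounded1]
    by (cases "max 0 s \<le> max 0 t") (auto simp only: abs_of_nonneg abs_of_nonpos diff_ge_0_iff_ge diff_le_0_iff_le minus_diff_eq linear)
  also have "\<dots> \<le> \<delta> * \<bar>t - s\<bar>" using \<delta> by (intro mult_left_mono) auto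
  finally show ?thesis .
qed

lemma L_continuous: "isCont L t"
proof -
  have "((\<lambda>s. L s - L t) \<longlongrightarrow> 0) (at t)"
  proof (rule Lim_null_comparison)
    show "\<forall>\<^sub>F s in at t. norm (L s - L t) \<le> \<delta> * \<bar>s - t\<bar>" by (simp add: L_abs_diff)
    have "((\<lambda>s. \<delta> * \<bar>s - t\<bar>) \<longlongrightarrow> \<delta> * \<bar>t - t\<bar>) (at t)" by (intro tendsto_intros)
    then show "((\<lambda>s. \<delta> * \<bar>s - t\<bar>) \<longlongrightarrow> 0) (at t)" by simp
  qed
  then show ?thesis by (simp add: isCont_def LIM_zero_iff)
qed

lemma L_nonneg: "0 \<le> L t" using L_lipschitz[of 0 t] L_zero[of 0] L_zero[of t] by (cases "0 \<le> t") auto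

lemma R_right_continuous: "continuous (at_right t) R"
  unfolding R_def[abs_def]
  by (intro continuous_add continuous_diff v_right_continuous f_right_continuous
      continuous_at_imp_continuous_at_within[OF L_continuous])

lemma R_measurable[measurable]: "R \<in> borel_measurable borel"
  by (rule right_continuous_borel_measurable) (rule R_right_continuous)

lemma L_measurable[measurable]: "L \<in> borel_measurable borel"
  by (rule right_continuous_borel_measurable) (rule continuous_at_imp_continuous_at_within[OF L_continuous])

lemma R_neg: "t \<le> 0 \<Longrightarrow> R t = R 0" by (simp add: R_def f_neg[of t] v_neg[of t] L_zero)

lemma R_mono: "s \<le> t \<Longrightarrow> R s \<le> R t"
  using injection_mono[of s t] injection_mono[of 0 t] R_neg[of s] R_neg[of t]
  by (cases "0 \<le> s"; cases "0 \<le> t") (auto simp: R_def L_def)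

lemma R_zero: "R 0 = max (- f 0) 0" by (simp add: R_def v_zero L_zero)

lemma R_nonneg: "0 \<le> R t"
  using R_mono[of 0 t] R_neg[of t] R_zero by (cases "0 \<le> t") auto

lemma R_flat: "0 \<le> t \<Longrightarrow> 0 < v t \<Longrightarrow> \<exists>\<eta>>0. \<forall>u. 0 \<le> u \<and> \<bar>u - t\<bar> < \<eta> \<longrightarrow> R u = R t"
  using injection_flat unfolding R_def L_def .

section \<open>Passage of the injection through levels\<close>

definition reached :: "real \<Rightarrow> bool" where "reached r \<longleftrightarrow> (\<exists>t\<ge>0. r < R t)"
text \<open>The right-continuous inverse of \<open>R\<close>. It is meaningful only for reached
  levels, since otherwise the infimum is over the empty set.\<close>

definition inj_time :: "real \<Rightarrow> real" where "inj_time r = Inf {t. 0 \<le> t \<and> r < R t}"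

lemma inj_time_le: "0 \<le> t \<Longrightarrow> r < R t \<Longrightarrow> inj_time r \<le> t"
  unfolding inj_time_def by (intro cInf_lower) (auto intro: bdd_belowI[of _ 0])

lemma inj_time_nonneg: "reached r \<Longrightarrow> 0 \<le> inj_time r"
  unfolding inj_time_def reached_def by (intro cInf_greatest) auto

lemma R_before_inj_time: "0 \<le> t \<Longrightarrow> t < inj_time r \<Longrightarrow> R t \<le> r"
  using inj_time_le[of t r] by force

lemma R_after_inj_time: "reached r \<Longrightarrow> inj_time r < t \<Longrightarrow> r < R t"
proof -
  assume r: "reached r" and "inj_time r < t"
  then obtain s where "0 \<le> s" "r < R s" "s < t"
    using cInf_lessD[of "{t. 0 \<le> t \<and> r < R t}" t] unfolding inj_time_def reached_def by auto
  then show ?thesis using R_mono[of s t] by linarith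
qed

lemma R_at_inj_time: "reached r \<Longrightarrow> r \<le> R (inj_time r)"
proof -
  assume r: "reached r"
  have "\<forall>\<^sub>F t in at_right (inj_time r). r \<le> R t"
    using R_after_inj_time[OF r] by (auto simp: eventually_at_right_field intro!: exI[of _ "inj_time r + 1"] less_imp_le)
  then show ?thesis
    using tendsto_lowerbound[OF R_right_continuous[of "inj_time r", unfolded continuous_within]] by simp
qed

text \<open>A positive value would make \<open>R\<close> constant near that time, but
  \<open>R\<close> exceeds \<open>r\<close> immediately afterwards and is at most \<open>r\<close>
  before. At time 0, where there is no before, a positive value of \<open>v\<close> means that
  \<open>f\<close> starts above 0 and nothing is injected.\<close>

lemma v_at_inj_time:
  assumes r: "reached r" "0 \<le> r"
  shows "v (inj_time r) = 0"
proof (rule ccontr)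
  let ?s = "inj_time r"
  assume "v ?s \<noteq> 0"
  then have "0 < v ?s" using v_nonneg[of ?s] by simp
  then obtain \<eta> where \<eta>: "\<eta> > 0" "\<And>u. 0 \<le> u \<Longrightarrow> \<bar>u - ?s\<bar> < \<eta> \<Longrightarrow> R u = R ?s"
    using R_flat[OF inj_time_nonneg[OF r(1)]] by metis
  have "r < R (?s + \<eta> / 2)" using R_after_inj_time[OF r(1)] \<eta>(1) by simp
  then have rs: "r < R ?s" using \<eta>(1) \<eta>(2)[of "?s + \<eta> / 2"] inj_time_nonneg[OF r(1)] by simp
  show False
  proof (cases "?s = 0")
    case True
    then have "0 < max (f 0) 0" using \<open>0 < v ?s\<close> v_zero by simp
    then have "R 0 = 0" using R_zero by (simp add: max_def split: if_splits)
    then show False using rs True r by simp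
  next
    case False
    then have "?s > 0" using inj_time_nonneg[OF r(1)] by simp
    define u where "u = max 0 (?s - \<eta> / 2)"
    have u: "0 \<le> u" "u < ?s" "\<bar>u - ?s\<bar> < \<eta>" using \<open>?s > 0\<close> \<eta>(1) by (auto simp: u_def)
    show False using R_before_inj_time[OF u(1,2)] \<eta>(2)[OF u(1,3)] rs by simp
  qed
qed

lemma reached_iff_rational: "reached r \<longleftrightarrow> (\<exists>q\<in>\<rat>. 0 \<le> q \<and> r < R q)"
proof
  assume "reached r"
  then obtain t where "0 \<le> t" "r < R t" unfolding reached_def by auto
  moreover obtain q where "q \<in> \<rat>" "t < q" using Rats_dense_in_real[of t "t+1"] by auto
  ultimately show "\<exists>q\<in>\<rat>. 0 \<le> q \<and> r < R q" using R_mono[of t q] by (auto intro!: bexI[of _ q])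
qed (auto simp: reached_def)

text \<open>Rational times suffice because \<open>R\<close> is monotone. The countable form is what
  gives measurability of the injection times, in the level as well as in the sample point.\<close>

lemma inj_time_less_iff_rational: "reached r \<and> inj_time r < t \<longleftrightarrow> (\<exists>q\<in>\<rat>. 0 \<le> q \<and> q < t \<and> r < R q)"
proof
  assume r: "reached r \<and> inj_time r < t"
  then obtain q where "q \<in> \<rat>" "inj_time r < q" "q < t" using Rats_dense_in_real by blast
  then show "\<exists>q\<in>\<rat>. 0 \<le> q \<and> q < t \<and> r < R q"
    using r R_after_inj_time[of r q] inj_time_nonneg[of r] by (auto intro!: bexI[of _ q])
next
  assume "\<exists>q\<in>\<rat>. 0 \<le> q \<and> q < t \<and> r < R q"
  then show "reached r \<and> inj_time r < t" using inj_time_le by (auto simp: reached_def intro: le_less_trans)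
qed

section \<open>Exit above the level \<open>a\<close>\<close>

definition exits :: bool where "exits \<longleftrightarrow> (\<exists>t>0. a < v t)"
definition exit_time :: real where "exit_time = Inf {t. 0 < t \<and> a < v t}"

lemma exit_time_le: "0 < t \<Longrightarrow> a < v t \<Longrightarrow> exit_time \<le> t"
  unfolding exit_time_def by (intro cInf_lower) (auto intro: bdd_belowI[of _ 0])

lemma exit_time_nonneg: "exits \<Longrightarrow> 0 \<le> exit_time"
  unfolding exit_time_def exits_def by (intro cInf_greatest) auto

lemma v_zero_le: "v 0 \<le> a" using v_zero f_zero a by simp

lemma v_le_before_exit: "0 \<le> t \<Longrightarrow> \<not> exits \<or> t < exit_time \<Longrightarrow> v t \<le> a"
proof -
  assume t: "0 \<le> t" "\<not> exits \<or> t < exit_time"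
  show "v t \<le> a"
  proof (rule ccontr)
    assume "\<not> v t \<le> a"
    then have "a < v t" "0 < t" using v_zero_le t(1) by (auto intro: le_neq_trans)
    then show False using t(2) exit_time_le[of t] by (auto simp: exits_def)
  qed
qed

text \<open>The path creeps over \<open>a\<close>: right-continuity gives at least \<open>a\<close>,
  and an overshoot is impossible because \<open>R\<close> is locally constant where \<open>v\<close>
  is positive, the refraction only pulls downwards, and \<open>f\<close> has no upward
  jumps.\<close>

lemma v_at_exit:
  assumes e: exits
  shows "v exit_time = a"
proof (rule antisym)
  show "a \<le> v exit_time"
  proof (rule ccontr)
    assume "\<not> a \<le> v exit_time"
    then have lt: "v exit_time < a" by simp
    then have "\<forall>\<^sub>F t in at_right exit_time. v t < a"
      using v_right_continuous[unfolded continuous_within] by (rule order_tendstoD(2)[rotated])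
    then obtain d where d: "d > exit_time" "\<And>t. exit_time < t \<Longrightarrow> t < d \<Longrightarrow> v t < a"
      by (auto simp: eventually_at_right_field)
    obtain t where "0 < t" "a < v t" "t < d"
      using cInf_lessD[of "{t. 0 < t \<and> a < v t}" d] d(1) e unfolding exit_time_def exits_def by auto
    then show False using d(2)[of t] exit_time_le[of t] lt by (cases "t = exit_time") auto
  qed
  show "v exit_time \<le> a"
  proof (rule ccontr)
    let ?t = exit_time
    assume "\<not> v ?t \<le> a"
    then have va: "a < v ?t" by simp
    have t0: "0 < ?t" using va v_zero_le exit_time_nonneg[OF e] by (cases "?t = 0") auto
    obtain \<eta>1 where \<eta>1: "\<eta>1 > 0" "\<And>u. 0 \<le> u \<Longrightarrow> \<bar>u - ?t\<bar> < \<eta>1 \<Longrightarrow> R u = R ?t"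
      using R_flat[of ?t] t0 va a by auto
    obtain \<eta>2 where \<eta>2: "\<eta>2 > 0" "\<And>u. ?t - \<eta>2 < u \<Longrightarrow> u < ?t \<Longrightarrow> f ?t \<le> f u + (v ?t - a) / 2"
      using f_no_up_jump[of ?t "(v ?t - a) / 2"] t0 va by auto
    \<comment> \<open>A nonnegative time just before the exit and inside both neighbourhoods. From
      \<open>u\<close> to the exit \<open>v\<close> rises by at most half of the assumed overshoot,
      so it is already above \<open>a\<close> at \<open>u\<close>.\<close>
    define u where "u = max (?t / 2) (?t - min \<eta>1 \<eta>2 / 2)"
    have u: "0 \<le> u" "\<bar>u - ?t\<bar> < \<eta>1" "?t - \<eta>2 < u" "u < ?t"
      using \<eta>1(1) \<eta>2(1) t0 by (auto simp: u_def max_def min_def abs_if)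
    have "v ?t - v u = f ?t - f u - (L ?t - L u)" using \<eta>1(2)[OF u(1,2)] by (simp add: R_def)
    moreover have "0 \<le> L ?t - L u" using L_lipschitz[of u ?t] u by simp
    moreover have "f ?t \<le> f u + (v ?t - a) / 2" by (rule \<eta>2(2)) (use u in auto)
    ultimately have "a < v u" using va by (auto simp: field_simps)
    then show False using v_le_before_exit[of u] u by auto
  qed
qed

text \<open>The path is at 0 at the one time and at \<open>a\<close> > 0 at the other. The strict
  separation leaves room for a rational time in between, on which the adaptedness of injections
  before the exit rests.\<close>

lemma inj_time_ne_exit_time: "reached r \<Longrightarrow> 0 \<le> r \<Longrightarrow> exits \<Longrightarrow> inj_time r \<noteq> exit_time"
  using v_at_inj_time[of r] v_at_exit a by (metis less_irrefl)

lemma exits_iff_rational: "exits \<and> exit_time < t \<longleftrightarrow> (\<exists>q\<in>\<rat>. 0 < q \<and> q < t \<and> a < v q)"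
proof
  assume "exits \<and> exit_time < t"
  then obtain s where s: "0 < s" "a < v s" "s < t"
    using cInf_lessD[of "{t. 0 < t \<and> a < v t}" t] unfolding exit_time_def exits_def by auto
  have "\<forall>\<^sub>F u in at_right s. a < v u"
    by (rule order_tendstoD(1)[OF v_right_continuous[unfolded continuous_within] s(2)])
  then obtain d where d: "d > s" "\<And>u. s < u \<Longrightarrow> u < d \<Longrightarrow> a < v u"
    by (auto simp: eventually_at_right_field)
  obtain q where "q \<in> \<rat>" "s < q" "q < min d t" using Rats_dense_in_real[of s "min d t"] d s by auto
  then show "\<exists>q\<in>\<rat>. 0 < q \<and> q < t \<and> a < v q" using d s by (auto intro!: bexI[of _ q])
next
  assume "\<exists>q\<in>\<rat>. 0 < q \<and> q < t \<and> a < v q"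
  then show "exits \<and> exit_time < t" using exit_time_le by (auto simp: exits_def intro: le_less_trans)
qed

lemma inj_time_measurable[measurable]:
  "Measurable.pred borel reached" "(\<lambda>r. if reached r then inj_time r else 0) \<in> borel_measurable borel"
proof -
  show 1[measurable]: "Measurable.pred borel reached"
    unfolding reached_iff_rational bex_Rats_iff by measurable
  have [measurable]: "Measurable.pred borel (\<lambda>r. reached r \<and> inj_time r < t)" for t
    unfolding inj_time_less_iff_rational bex_Rats_iff by measurable
  have "(if reached r then inj_time r else 0) < t \<longleftrightarrow> (reached r \<and> inj_time r < t) \<or> (\<not> reached r \<and> 0 < t)" for r t
    by auto
  then show "(\<lambda>r. if reached r then inj_time r else 0) \<in> borel_measurable borel"
    by (intro borel_measurableI_less) simp
qed

section \<open>Balance of exponential weights along one path\<close>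

context
  fixes \<theta> c1 c2 :: real
  assumes \<theta>: "0 \<le> \<theta>" and c: "0 \<le> c1" "0 \<le> c2"
begin

text \<open>The exponential weight without the injection. The driving path enters only through its
  initial value, so the weight is absolutely continuous in time; the fluctuations of
  \<open>X\<close> come back later through the exponential martingale.\<close>

definition G where "G s = exp (\<theta> * f 0 - \<theta> * L s + (c1 - c2) * s)"

lemma G_measurable[measurable]: "G \<in> borel_measurable borel" unfolding G_def by measurable

lemma G_pos: "0 < G s" by (simp add: G_def)

text \<open>Integration of G' = G * (c1 - c2 - \<theta> * \<delta> * 1{v > b}), with each term on
  the side on which it is nonnegative.\<close>

lemma G_balance:
  assumes ut: "0 \<le> u" "u \<le> T"
  shows "ennreal (G T) + (\<integral>\<^sup>+s\<in>{u..T}. ennreal (G s * (c2 + \<theta> * \<delta> * indicator {b<..} (v s))) \<partial>lborel)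
      = ennreal (G u) + (\<integral>\<^sup>+s\<in>{u..T}. ennreal (G s * c1) \<partial>lborel)"
proof -
  define g where "g s = (c1 - c2) - \<theta> * \<delta> * indicator {b<..} (v s)" for s
  have [measurable]: "g \<in> borel_measurable borel" unfolding g_def by measurable
  have i: "set_integrable lborel {c..d} (\<lambda>u. indicator {b<..} (v u) :: real)" for c d
    by (rule set_integrable_bounded[where C = 1]) (auto simp: indicator_def)
  define H where "H t = (LINT s:{0..t}|lborel. g s)" for t
  have h: "H t = (c1 - c2) * t - \<theta> * L t" if "0 \<le> t" for t
  proof -
    have "(LINT s:{0..t}|lborel. g s) = (LINT s:{0..t}|lborel. c1 - c2) - (LINT s:{0..t}|lborel. \<theta> * \<delta> * indicator {b<..} (v s))"
      unfolding g_def by (rule set_integral_diff) (auto intro!: set_integrable_bounded[where C = "\<bar>c1 - c2\<bar>"] set_integrable_mult_right i)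
    then show ?thesis using that by (simp add: H_def L_def refraction_part_def mult.commute[of t] set_lebesgue_integral_def)
  qed
  have GE: "G s = exp (\<theta> * f 0) * exp (H s)" if "0 \<le> s" for s
    unfolding h[OF that] G_def exp_add[symmetric] by (simp add: algebra_simps)
  have gb: "\<bar>g s\<bar> \<le> \<bar>c1 - c2\<bar> + \<theta> * \<delta>" for s
    using mult_nonneg_nonneg[OF \<theta> \<delta>] by (auto simp: g_def indicator_def abs_if)
  have "exp (H T) = exp (H u) + (LINT s:{u..T}|lborel. exp (H s) * g s)"
    unfolding H_def by (rule exp_integral_FTC[of g, OF _ gb ut]) measurable
  then have "G T = G u + exp (\<theta> * f 0) * (LINT s:{u..T}|lborel. exp (H s) * g s)"
    using ut by (simp add: GE distrib_left)
  also have "exp (\<theta> * f 0) * (LINT s:{u..T}|lborel. exp (H s) * g s) = (LINT s:{u..T}|lborel. G s * g s)"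
    unfolding set_lebesgue_integral_def integral_mult_right_zero[symmetric]
    by (intro Bochner_Integration.integral_cong) (use ut in \<open>auto simp: GE indicator_def\<close>)
  finally have main: "G T = G u + (LINT s:{u..T}|lborel. G s * g s)" .
  have Gb: "G s \<le> exp (\<theta> * f 0 + \<bar>c1 - c2\<bar> * T)" if "s \<in> {u..T}" for s
  proof -
    have "0 \<le> \<theta> * L s" using \<theta> L_nonneg by simp
    moreover have "(c1 - c2) * s \<le> \<bar>c1 - c2\<bar> * T" using that ut by (intro mult_mono) auto
    ultimately show ?thesis unfolding G_def by simp
  qed
  have iA: "set_integrable lborel {u..T} (\<lambda>s. G s * (c2 + \<theta> * \<delta> * indicator {b<..} (v s)))"
    by (rule set_integrable_bounded[where C = "exp (\<theta> * f 0 + \<bar>c1 - c2\<bar> * T) * (c2 + \<theta> * \<delta>)"])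
       (use Gb G_pos c \<theta> \<delta> in \<open>auto simp: abs_mult indicator_def less_imp_le intro!: mult_mono\<close>)
  have iB: "set_integrable lborel {u..T} (\<lambda>s. G s * c1)"
    by (rule set_integrable_bounded[where C = "exp (\<theta> * f 0 + \<bar>c1 - c2\<bar> * T) * c1"])
       (use Gb G_pos c in \<open>auto simp: abs_mult less_imp_le intro!: mult_mono\<close>)
  have "(LINT s:{u..T}|lborel. G s * g s) = (LINT s:{u..T}|lborel. G s * c1 - G s * (c2 + \<theta> * \<delta> * indicator {b<..} (v s)))"
    unfolding g_def by (simp add: algebra_simps)
  also have "\<dots> = (LINT s:{u..T}|lborel. G s * c1) - (LINT s:{u..T}|lborel. G s * (c2 + \<theta> * \<delta> * indicator {b<..} (v s)))"
    by (rule set_integral_diff[OF iB iA])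
  finally have real: "G T + (LINT s:{u..T}|lborel. G s * (c2 + \<theta> * \<delta> * indicator {b<..} (v s))) = G u + (LINT s:{u..T}|lborel. G s * c1)"
    using main by simp
  have conv: "(\<integral>\<^sup>+s\<in>{u..T}. ennreal (h s) \<partial>lborel) = ennreal (LINT s:{u..T}|lborel. h s)"
    if "set_integrable lborel {u..T} h" "\<And>s. 0 \<le> h s" for h :: "real \<Rightarrow> real"
  proof -
    have "ennreal (h s) * indicator {u..T} s = ennreal (indicator {u..T} s *\<^sub>R h s)" for s
      by (simp add: indicator_def)
    then show ?thesis
      using nn_integral_eq_integral[OF that(1)[unfolded set_integrable_def]] that(2)
      by (simp add: set_lebesgue_integral_def)
  qed
  have "0 \<le> (LINT s:{u..T}|lborel. G s * c1)" "0 \<le> (LINT s:{u..T}|lborel. G s * (c2 + \<theta> * \<delta> * indicator {b<..} (v s)))"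
    unfolding set_lebesgue_integral_def using G_pos c \<theta> \<delta> by (auto intro!: integral_nonneg_AE AE_I2 mult_nonneg_nonneg simp: less_imp_le)
  then show ?thesis
    using real G_pos[of T] G_pos[of u] c \<theta> \<delta> iA iB
    by (subst (1 2) conv) (auto intro!: mult_nonneg_nonneg simp: less_imp_le[OF G_pos] ennreal_plus[symmetric] simp del: ennreal_plus)
qed

text \<open>Write E = exp(\<theta> R) G and expand exp(\<theta> R) over the levels below
  \<open>R\<close>. For a fixed level the weight is switched on at its injection time, so
  \<open>G_balance\<close> from that time up to \<open>T\<close> contributes
  \<open>G (inj_time r)\<close> as the only new term. Integration over the levels gives the claim,
  whether \<open>R\<close> moves continuously or by jumps.\<close>

lemma exponential_balance:
  assumes T: "0 \<le> T"
  defines "E \<equiv> \<lambda>s. exp (\<theta> * (f 0 + R s - L s) + (c1 - c2) * s)"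
  shows "ennreal (E T) + (\<integral>\<^sup>+s\<in>{0..T}. ennreal (E s * (c2 + \<theta> * \<delta> * indicator {b<..} (v s))) \<partial>lborel)
      = ennreal (exp (\<theta> * f 0)) + (\<integral>\<^sup>+s\<in>{0..T}. ennreal (E s * c1) \<partial>lborel)
        + (\<integral>\<^sup>+r\<in>{r. 0 \<le> r \<and> reached r \<and> inj_time r \<le> T}. ennreal (\<theta> * exp (\<theta> * r) * G (inj_time r)) \<partial>lborel)"
proof -
  define A where "A s = c2 + \<theta> * \<delta> * indicator {b<..} (v s)" for s
  have A0: "0 \<le> A s" for s unfolding A_def using c \<theta> \<delta> by simp
  have [measurable]: "A \<in> borel_measurable borel" unfolding A_def by measurable
  define e where "e r = ennreal (\<theta> * exp (\<theta> * r)) * indicator {0..} r" for r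
  have [measurable]: "e \<in> borel_measurable borel" unfolding e_def by measurable
  define J where "J = (\<lambda>s. \<integral>\<^sup>+r. e r * indicator {..<R s} r \<partial>lborel)"
  have EG: "ennreal (E s * h) = ennreal (G s * h) + ennreal (G s * h) * J s" if "0 \<le> h" for s h
  proof -
    have "E s = exp (\<theta> * R s) * G s" unfolding E_def G_def exp_add[symmetric] by (simp add: algebra_simps)
    then have "ennreal (E s * h) = ennreal (G s * h) * ennreal (exp (\<theta> * R s))"
      using that G_pos[of s] by (simp add: ennreal_mult[symmetric] mult_ac)
    also have "ennreal (exp (\<theta> * R s)) = 1 + J s"
      unfolding ennreal_exp_eq_nn_integral[OF R_nonneg \<theta>] J_def
      by (intro arg_cong[where f = "\<lambda>x. 1 + x"] nn_integral_cong) (auto simp: e_def indicator_def)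
    finally show ?thesis by (simp add: distrib_left)
  qed
  have [measurable]: "(\<lambda>z. indicator {..<R (fst z)} (snd z) :: ennreal) \<in> borel_measurable (borel \<Otimes>\<^sub>M borel)"
    by (simp add: indicator_def[abs_def], measurable)
  have [measurable]: "(\<lambda>z. indicator {..<R (snd z)} (fst z) :: ennreal) \<in> borel_measurable (borel \<Otimes>\<^sub>M borel)"
    by (simp add: indicator_def[abs_def], measurable)
  have [measurable]: "(\<lambda>s. indicator {..<R s} r :: ennreal) \<in> borel_measurable borel" for r
    by (simp add: indicator_def[abs_def], measurable)
  have Jm[measurable]: "J \<in> borel_measurable borel"
    unfolding J_def by (rule lborel.borel_measurable_nn_integral) (simp add: split_beta')
  have sw: "(\<integral>\<^sup>+s\<in>{0..T}. ennreal (E s * h s) \<partial>lborel) = (\<integral>\<^sup>+s\<in>{0..T}. ennreal (G s * h s) \<partial>lborel)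
      + (\<integral>\<^sup>+r. e r * (\<integral>\<^sup>+s\<in>{0..T}. ennreal (G s * h s) * indicator {..<R s} r \<partial>lborel) \<partial>lborel)"
    if [measurable]: "h \<in> borel_measurable borel" and h0: "\<And>s. 0 \<le> h s" for h
  proof -
    have "(\<integral>\<^sup>+s\<in>{0..T}. ennreal (E s * h s) \<partial>lborel)
       = (\<integral>\<^sup>+s. ennreal (G s * h s) * indicator {0..T} s + ennreal (G s * h s) * J s * indicator {0..T} s \<partial>lborel)"
      by (intro nn_integral_cong) (simp add: EG[OF h0] distrib_right)
    also have "\<dots> = (\<integral>\<^sup>+s\<in>{0..T}. ennreal (G s * h s) \<partial>lborel) + (\<integral>\<^sup>+s\<in>{0..T}. ennreal (G s * h s) * J s \<partial>lborel)"
      by (rule nn_integral_add) auto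
    also have "(\<integral>\<^sup>+s\<in>{0..T}. ennreal (G s * h s) * J s \<partial>lborel)
        = (\<integral>\<^sup>+s. \<integral>\<^sup>+r. ennreal (G s * h s) * indicator {0..T} s * (e r * indicator {..<R s} r) \<partial>lborel \<partial>lborel)"
      unfolding J_def by (intro nn_integral_cong, subst nn_integral_cmult) (auto simp: mult_ac)
    also have "\<dots> = (\<integral>\<^sup>+r. \<integral>\<^sup>+s. ennreal (G s * h s) * indicator {0..T} s * (e r * indicator {..<R s} r) \<partial>lborel \<partial>lborel)"
      by (rule lborel_pair.Fubini') (simp add: split_beta')
    also have "\<dots> = (\<integral>\<^sup>+r. e r * (\<integral>\<^sup>+s\<in>{0..T}. ennreal (G s * h s) * indicator {..<R s} r \<partial>lborel) \<partial>lborel)"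
      by (intro nn_integral_cong, subst nn_integral_cmult[symmetric]) (auto simp: mult_ac)
    finally show ?thesis .
  qed
  have Sm: "(\<lambda>r. \<integral>\<^sup>+s\<in>{0..T}. ennreal (G s * h s) * indicator {..<R s} r \<partial>lborel) \<in> borel_measurable borel"
    if [measurable]: "h \<in> borel_measurable borel" for h
    by (rule lborel.borel_measurable_nn_integral) (simp add: split_beta')
  note [measurable] = Sm[of A, simplified] Sm[of "\<lambda>_. c1", simplified]
  define K where "K r = (if reached r \<and> inj_time r \<le> T then ennreal (G (inj_time r)) else 0)" for r
  have "K = (\<lambda>r. if reached r \<and> (if reached r then inj_time r else 0) \<le> T then ennreal (G (if reached r then inj_time r else 0)) else 0)"
    by (auto simp: K_def)
  then have [measurable]: "K \<in> borel_measurable borel" by simp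
  \<comment> \<open>Level by level: a level below \<open>R T\<close> has been passed, and its time
    integrals start at the injection time; a level above \<open>R T\<close> has not, and all terms
    are 0. The level \<open>R T\<close> itself is undecided but forms a null set.\<close>
  have br: "AE r in lborel. e r * (ennreal (G T) * indicator {..<R T} r) + e r * (\<integral>\<^sup>+s\<in>{0..T}. ennreal (G s * A s) * indicator {..<R s} r \<partial>lborel)
     = e r * (\<integral>\<^sup>+s\<in>{0..T}. ennreal (G s * c1) * indicator {..<R s} r \<partial>lborel) + e r * K r"
    using AE_lborel_singleton[of "R T"]
  proof eventually_elim
    case (elim r)
    show ?case
    proof (cases "0 \<le> r \<and> r < R T")
      case True
      then have r: "reached r" "inj_time r \<le> T" using T inj_time_le by (auto simp: reached_def)
      have "(\<integral>\<^sup>+s\<in>{0..T}. ennreal (h s) * indicator {..<R s} r \<partial>lborel) = (\<integral>\<^sup>+s\<in>{inj_time r..T}. ennreal (h s) \<partial>lborel)" for h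
      proof (intro nn_integral_cong_AE, use AE_lborel_singleton[of "inj_time r"] in eventually_elim)
        case (elim s)
        then show ?case
          using R_after_inj_time[OF r(1), of s] R_before_inj_time[of s r] inj_time_nonneg[OF r(1)]
          by (cases "s < inj_time r") (auto simp: indicator_def)
      qed
      then show ?thesis
        using G_balance[OF inj_time_nonneg[OF r(1)] r(2)] True r
        by (simp add: K_def A_def distrib_left[symmetric] add.commute)
    next
      case False
      then consider "r < 0" | "R T < r" using elim by force
      then show ?thesis
      proof cases
        case 2
        have "\<not> (reached r \<and> inj_time r \<le> T)"
          using R_at_inj_time[of r] R_mono[of "inj_time r" T] 2 by force
        moreover have "(\<integral>\<^sup>+s\<in>{0..T}. ennreal (h s) * indicator {..<R s} r \<partial>lborel) = 0" for h :: "real \<Rightarrow> real"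
        proof (intro nn_integral_zero' AE_I2)
          fix s show "ennreal (h s) * indicator {..<R s} r * indicator {0..T} s = 0"
            using R_mono[of s T] 2 by (auto simp: indicator_def)
        qed
        ultimately show ?thesis using 2 by (auto simp: K_def)
      qed (simp add: e_def)
    qed
  qed
  have J_T: "ennreal (G T) * J T = (\<integral>\<^sup>+r. e r * (ennreal (G T) * indicator {..<R T} r) \<partial>lborel)"
    unfolding J_def by (subst nn_integral_cmult[symmetric]) (auto simp: mult_ac)
  have "ennreal (E T) + (\<integral>\<^sup>+s\<in>{0..T}. ennreal (E s * A s) \<partial>lborel)
     = (ennreal (G T) + (\<integral>\<^sup>+s\<in>{0..T}. ennreal (G s * A s) \<partial>lborel)) +
       ((\<integral>\<^sup>+r. e r * (ennreal (G T) * indicator {..<R T} r) \<partial>lborel) +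
        (\<integral>\<^sup>+r. e r * (\<integral>\<^sup>+s\<in>{0..T}. ennreal (G s * A s) * indicator {..<R s} r \<partial>lborel) \<partial>lborel))"
    using EG[of 1 T] by (simp add: sw A0 J_T add_ac)
  also have "(\<integral>\<^sup>+r. e r * (ennreal (G T) * indicator {..<R T} r) \<partial>lborel) +
        (\<integral>\<^sup>+r. e r * (\<integral>\<^sup>+s\<in>{0..T}. ennreal (G s * A s) * indicator {..<R s} r \<partial>lborel) \<partial>lborel)
      = (\<integral>\<^sup>+r. e r * (ennreal (G T) * indicator {..<R T} r) + e r * (\<integral>\<^sup>+s\<in>{0..T}. ennreal (G s * A s) * indicator {..<R s} r \<partial>lborel) \<partial>lborel)"
    by (rule nn_integral_add[symmetric]) auto
  also have "\<dots> = (\<integral>\<^sup>+r. e r * (\<integral>\<^sup>+s\<in>{0..T}. ennreal (G s * c1) * indicator {..<R s} r \<partial>lborel) + e r * K r \<partial>lborel)"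
    by (rule nn_integral_cong_AE[OF br])
  also have "\<dots> = (\<integral>\<^sup>+r. e r * (\<integral>\<^sup>+s\<in>{0..T}. ennreal (G s * c1) * indicator {..<R s} r \<partial>lborel) \<partial>lborel) + (\<integral>\<^sup>+r. e r * K r \<partial>lborel)"
    by (rule nn_integral_add) auto
  also have "ennreal (G T) + (\<integral>\<^sup>+s\<in>{0..T}. ennreal (G s * A s) \<partial>lborel) = ennreal (exp (\<theta> * f 0)) + (\<integral>\<^sup>+s\<in>{0..T}. ennreal (G s * c1) \<partial>lborel)"
    using G_balance[of 0 T] T by (simp add: A_def G_def[of 0] L_zero)
  also have "(\<integral>\<^sup>+r. e r * K r \<partial>lborel) = (\<integral>\<^sup>+r\<in>{r. 0 \<le> r \<and> reached r \<and> inj_time r \<le> T}. ennreal (\<theta> * exp (\<theta> * r) * G (inj_time r)) \<partial>lborel)"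
    by (intro nn_integral_cong) (auto simp: e_def K_def indicator_def ennreal_mult \<theta> less_imp_le[OF G_pos])
  finally show ?thesis
    using sw[of "\<lambda>_. c1"] c by (simp add: A_def add_ac)
qed

end

end

section \<open>The exponential identity\<close>

locale injected_process = exponential_martingales M F X \<psi>
  for M :: "'a measure" and F X \<psi> +
  fixes V :: "real \<Rightarrow> 'a \<Rightarrow> real" and x b \<delta> a q :: real
  assumes V_adapted: "\<And>t. 0 \<le> t \<Longrightarrow> V t \<in> borel_measurable (F t)"
    and paths: "\<And>w. w \<in> space M \<Longrightarrow> injected_path (\<lambda>t. x + X t w) (\<lambda>t. V t w) b \<delta> a"
    and q: "0 < q"
begin

definition Lp where "Lp t w = injected_path.L (\<lambda>t. V t w) b \<delta> t"
definition Rp where "Rp t w = injected_path.R (\<lambda>t. x + X t w) (\<lambda>t. V t w) b \<delta> t"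
definition reach where "reach r w = injected_path.reached (\<lambda>t. x + X t w) (\<lambda>t. V t w) b \<delta> r"
definition itime where "itime r w = injected_path.inj_time (\<lambda>t. x + X t w) (\<lambda>t. V t w) b \<delta> r"
definition exit where "exit w = injected_path.exits (\<lambda>t. V t w) a"
definition etime where "etime w = injected_path.exit_time (\<lambda>t. V t w) a"
text \<open>The exit time itself still counts, in accordance with the closed range of integration up
  to the exit.\<close>

definition alive where "alive s w \<longleftrightarrow> \<not> (exit w \<and> etime w < s)"

lemmas proc_defs = Lp_def Rp_def reach_def itime_def exit_def etime_def

section \<open>Measurability and adaptedness of the path functionals\<close>

context
  fixes Y :: "real \<Rightarrow> 'a \<Rightarrow> real"
  assumes Y_adapted: "\<And>t. 0 \<le> t \<Longrightarrow> Y t \<in> borel_measurable (F t)"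
    and Y_neg: "\<And>t w. w \<in> space M \<Longrightarrow> t \<le> 0 \<Longrightarrow> Y t w = Y 0 w"
    and Y_rc: "\<And>t w. w \<in> space M \<Longrightarrow> continuous (at_right t) (\<lambda>t. Y t w)"
begin

lemma adapted_measurable: "Y t \<in> borel_measurable M"
proof (cases "0 \<le> t")
  case False
  then have "Y t \<in> borel_measurable M \<longleftrightarrow> Y 0 \<in> borel_measurable M"
    by (intro measurable_cong Y_neg) auto
  then show ?thesis using measurable_F[OF Y_adapted[of 0]] by simp
qed (rule measurable_F[OF Y_adapted])

lemma adapted_jointly_measurable: "(\<lambda>z. Y (snd z) (fst z)) \<in> borel_measurable (M \<Otimes>\<^sub>M borel)"
  by (rule right_continuous_jointly_measurable) (auto intro: adapted_measurable Y_rc)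

lemma progressive:
  assumes t: "0 \<le> t"
  shows "(\<lambda>z. Y (min (snd z) t) (fst z)) \<in> borel_measurable (F t \<Otimes>\<^sub>M borel)"
proof (rule right_continuous_jointly_measurable[where Y = "\<lambda>s. Y (min s t)"])
  fix s
  show "Y (min s t) \<in> borel_measurable (F t)"
  proof (cases "0 \<le> s")
    case True
    then show ?thesis using t by (intro measurable_F_mono[OF Y_adapted]) auto
  next
    case False
    then have "Y (min s t) \<in> borel_measurable (F t) \<longleftrightarrow> Y 0 \<in> borel_measurable (F t)"
      by (intro measurable_cong Y_neg) (auto simp: space_F)
    then show ?thesis using t measurable_F_mono[OF Y_adapted[of 0], of t] by simp
  qed
next
  fix w s assume "w \<in> space (F t)"
  then have w: "w \<in> space M" by (simp add: space_F)
  have "((\<lambda>s. Y (min s t) w) \<longlongrightarrow> Y (min s t) w) (at_right s)"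
  proof (cases "s < t")
    case True
    have "\<forall>\<^sub>F u in at_right s. Y u w = Y (min u t) w"
      using True by (auto simp: eventually_at_right_field intro!: exI[of _ t])
    then show ?thesis
      using tendsto_cong[of "\<lambda>u. Y u w" "\<lambda>u. Y (min u t) w" "at_right s"] Y_rc[OF w, of s] True
      by (simp add: continuous_within)
  next
    case False
    have "\<forall>\<^sub>F u in at_right s. Y (min u t) w = Y (min s t) w"
      using False by (auto simp: eventually_at_right_field intro!: exI[of _ "s + 1"])
    then show ?thesis by (rule tendsto_eventually)
  qed
  then show "continuous (at_right s) (\<lambda>s. Y (min s t) w)" by (simp add: continuous_within)
qed

text \<open>\<open>S\<close> marks where \<sigma> is a genuine time. Setting \<sigma> to
  \<open>t\<close> wherever \<open>S\<close> fails or \<sigma> is not below \<open>t\<close> gives a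
  function measurable at time \<open>t\<close>, and composing it with the progressively measurable
  process gives the stopped value.\<close>

lemma stopped_measurable:
  assumes t: "0 \<le> t"
    and S: "\<And>u. 0 \<le> u \<Longrightarrow> Measurable.pred (F u) (\<lambda>w. S w \<and> \<sigma> w < u)"
    and \<sigma>0: "\<And>w. w \<in> space M \<Longrightarrow> S w \<Longrightarrow> 0 \<le> \<sigma> w"
  shows "(\<lambda>w. if S w \<and> \<sigma> w < t then Y (\<sigma> w) w else 0) \<in> borel_measurable (F t)"
proof -
  have [measurable]: "Measurable.pred (F t) (\<lambda>w. S w \<and> \<sigma> w < t)" by (rule S) fact
  define \<sigma>' where "\<sigma>' w = (if S w \<and> \<sigma> w < t then \<sigma> w else t)" for w
  have [measurable]: "\<sigma>' \<in> borel_measurable (F t)"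
  proof (rule borel_measurableI_less)
    fix u
    have "Measurable.pred (F t) (\<lambda>w. \<sigma>' w < u)"
    proof (cases "t < u")
      case True
      then have "\<sigma>' w < u" for w by (auto simp: \<sigma>'_def)
      then show ?thesis by simp
    next
      case False
      then have eq: "\<sigma>' w < u \<longleftrightarrow> S w \<and> \<sigma> w < u" for w by (auto simp: \<sigma>'_def)
      show ?thesis
      proof (cases "0 \<le> u")
        case True
        then show ?thesis unfolding eq using False by (intro measurable_F_mono[OF S]) auto
      next
        case neg: False
        have "Measurable.pred (F t) (\<lambda>w. S w \<and> \<sigma> w < u) \<longleftrightarrow> Measurable.pred (F t) (\<lambda>w. False)"
          using neg \<sigma>0 by (intro measurable_cong) (force simp: space_F)
        then show ?thesis unfolding eq by simp
      qed
    qed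
    then show "{w \<in> space (F t). \<sigma>' w < u} \<in> sets (F t)" by (simp add: pred_def)
  qed
  have "(\<lambda>w. (\<lambda>z. Y (min (snd z) t) (fst z)) (w, \<sigma>' w)) \<in> borel_measurable (F t)"
    by (rule measurable_compose[OF _ progressive[OF t]]) measurable
  then have [measurable]: "(\<lambda>w. Y (min (\<sigma>' w) t) w) \<in> borel_measurable (F t)" by simp
  have "(\<lambda>w. if S w \<and> \<sigma> w < t then Y (\<sigma> w) w else 0) = (\<lambda>w. if S w \<and> \<sigma> w < t then Y (min (\<sigma>' w) t) w else 0)"
    by (auto simp: \<sigma>'_def fun_eq_iff)
  then show ?thesis by simp
qed

end

text \<open>The path locale depends on the sample point and can be entered only inside a proof; its
  consequences are gathered here in a form that is uniform in \<open>w\<close>.\<close>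

lemma path_facts:
  assumes "w \<in> space M"
  shows "t \<le> 0 \<Longrightarrow> V t w = V 0 w" "t \<le> 0 \<Longrightarrow> X t w = X 0 w" "t \<le> 0 \<Longrightarrow> Lp t w = Lp 0 w" "t \<le> 0 \<Longrightarrow> Rp t w = Rp 0 w"
    "continuous (at_right t) (\<lambda>t. V t w)" "continuous (at_right t) (\<lambda>t. X t w)"
    "continuous (at_right t) (\<lambda>t. Lp t w)" "continuous (at_right t) (\<lambda>t. Rp t w)"
    "Rp t w = V t w - (x + X t w) + Lp t w" "0 \<le> V t w"
    "reach r w \<Longrightarrow> 0 \<le> itime r w" "reach r w \<Longrightarrow> r \<le> Rp (itime r w) w"
    "reach r w \<Longrightarrow> 0 \<le> r \<Longrightarrow> V (itime r w) w = 0"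
    "exit w \<Longrightarrow> 0 \<le> etime w" "exit w \<Longrightarrow> V (etime w) w = a"
    "0 \<le> t \<Longrightarrow> alive t w \<Longrightarrow> V t w \<le> a"
    "reach r w \<Longrightarrow> 0 \<le> r \<Longrightarrow> exit w \<Longrightarrow> itime r w \<noteq> etime w"
    "reach r w \<and> itime r w < t \<longleftrightarrow> (\<exists>q. 0 \<le> real_of_rat q \<and> real_of_rat q < t \<and> r < Rp (real_of_rat q) w)"
    "reach r w \<longleftrightarrow> (\<exists>q. 0 \<le> real_of_rat q \<and> r < Rp (real_of_rat q) w)"
    "exit w \<and> etime w < t \<longleftrightarrow> (\<exists>q. 0 < real_of_rat q \<and> real_of_rat q < t \<and> a < V (real_of_rat q) w)"
proof -
  interpret injected_path "\<lambda>t. x + X t w" "\<lambda>t. V t w" b \<delta> a by (rule paths) fact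
  show "t \<le> 0 \<Longrightarrow> V t w = V 0 w" "t \<le> 0 \<Longrightarrow> X t w = X 0 w" "t \<le> 0 \<Longrightarrow> Lp t w = Lp 0 w" "t \<le> 0 \<Longrightarrow> Rp t w = Rp 0 w"
    using v_neg[of t] f_neg[of t] L_zero[of t] L_zero[of 0] R_neg[of t] by (simp_all add: proc_defs)
  show "continuous (at_right t) (\<lambda>t. V t w)" by (rule v_right_continuous)
  show "continuous (at_right t) (\<lambda>t. X t w)"
    using continuous_diff[OF f_right_continuous[of t] continuous_const[of _ x]] by simp
  show "continuous (at_right t) (\<lambda>t. Lp t w)" "continuous (at_right t) (\<lambda>t. Rp t w)"
    unfolding proc_defs by (rule continuous_at_imp_continuous_at_within[OF L_continuous], rule R_right_continuous)
  show "Rp t w = V t w - (x + X t w) + Lp t w" "0 \<le> V t w"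
    by (simp_all add: proc_defs R_def v_nonneg)
  show "reach r w \<Longrightarrow> 0 \<le> itime r w" "reach r w \<Longrightarrow> r \<le> Rp (itime r w) w"
    "reach r w \<Longrightarrow> 0 \<le> r \<Longrightarrow> V (itime r w) w = 0"
    "exit w \<Longrightarrow> 0 \<le> etime w" "exit w \<Longrightarrow> V (etime w) w = a"
    unfolding proc_defs by (fact inj_time_nonneg R_at_inj_time v_at_inj_time exit_time_nonneg v_at_exit)+
  show "0 \<le> t \<Longrightarrow> alive t w \<Longrightarrow> V t w \<le> a"
    unfolding alive_def proc_defs using v_le_before_exit[of t] v_at_exit by (cases exits; cases "t = exit_time") auto
  show "reach r w \<Longrightarrow> 0 \<le> r \<Longrightarrow> exit w \<Longrightarrow> itime r w \<noteq> etime w"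
    unfolding proc_defs by (rule inj_time_ne_exit_time)
  show "reach r w \<and> itime r w < t \<longleftrightarrow> (\<exists>q. 0 \<le> real_of_rat q \<and> real_of_rat q < t \<and> r < Rp (real_of_rat q) w)"
    "reach r w \<longleftrightarrow> (\<exists>q. 0 \<le> real_of_rat q \<and> r < Rp (real_of_rat q) w)"
    "exit w \<and> etime w < t \<longleftrightarrow> (\<exists>q. 0 < real_of_rat q \<and> real_of_rat q < t \<and> a < V (real_of_rat q) w)"
    unfolding proc_defs
    by (fact inj_time_less_iff_rational[unfolded bex_Rats_iff] reached_iff_rational[unfolded bex_Rats_iff]
        exits_iff_rational[unfolded bex_Rats_iff])+
qed

lemma Lp_adapted: "0 \<le> t \<Longrightarrow> Lp t \<in> borel_measurable (F t)"
proof -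
  assume t: "0 \<le> t"
  note [measurable] = progressive[of V, OF V_adapted path_facts(1,5) t]
  \<comment> \<open>On the range of integration \<open>min u t\<close> is just \<open>u\<close>, but
    it makes the integrand jointly measurable with respect to the information at time
    \<open>t\<close>.\<close>
  have "(\<lambda>w. \<delta> * (LINT u|lborel. (if 0 \<le> u \<and> u \<le> t then if b < V (min u t) w then 1 else 0 else 0 :: real))) \<in> borel_measurable (F t)"
    by (rule borel_measurable_times[OF borel_measurable_const], rule lborel.borel_measurable_lebesgue_integral)
       (simp add: split_beta', measurable)
  moreover have "Lp t w = \<delta> * (LINT u|lborel. (if 0 \<le> u \<and> u \<le> t then if b < V (min u t) w then 1 else 0 else 0 :: real))"
    if "w \<in> space (F t)" for w
  proof -
    interpret injected_path "\<lambda>t. x + X t w" "\<lambda>t. V t w" b \<delta> a by (rule paths) (use that space_F in simp)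
    have "(LINT u:{0..t}|lborel. indicator {b<..} (V u w) :: real) = (LINT u|lborel. (if 0 \<le> u \<and> u \<le> t then if b < V (min u t) w then 1 else 0 else 0 :: real))"
      unfolding set_lebesgue_integral_def by (intro Bochner_Integration.integral_cong) (auto simp: indicator_def min_def)
    then show ?thesis by (simp add: Lp_def L_def refraction_part_def)
  qed
  ultimately show ?thesis by (subst measurable_cong)
qed

end

lemma pred_ex_rat:
  assumes "\<And>q::rat. C q \<Longrightarrow> Measurable.pred N (P q)"
  shows "Measurable.pred N (\<lambda>w. \<exists>q. C q \<and> P q w)"
proof (rule pred_intros_countable)
  fix q show "Measurable.pred N (\<lambda>w. C q \<and> P q w)"
    using assms[of q] by (cases "C q") auto
qed

lemma jointly_measurable_compose:
  assumes "(\<lambda>z. Y (snd z) (fst z)) \<in> measurable (M \<Otimes>\<^sub>M borel) K"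
    and "f \<in> borel_measurable N" "g \<in> measurable N M"
  shows "(\<lambda>z. Y (f z) (g z)) \<in> measurable N K"
  using measurable_compose[OF measurable_Pair[OF assms(3,2)] assms(1)] by simp

context exponential_martingales begin

text \<open>On \<sigma> = T the two integrands coincide, so the closed inequality reduces to the
  strict one.\<close>

lemma optional_stopping_le:
  fixes \<sigma> :: "'a \<Rightarrow> real" and H :: "'a \<Rightarrow> ennreal" and T :: nat
  assumes \<theta>: "0 \<le> \<theta>" and Hm[measurable]: "H \<in> borel_measurable M"
    and \<sigma>m[measurable]: "\<sigma> \<in> borel_measurable M" and \<sigma>0: "\<And>w. w \<in> space M \<Longrightarrow> 0 \<le> \<sigma> w"
    and ad: "\<And>t. 0 \<le> t \<Longrightarrow> (\<lambda>w. H w * indicator {w. \<sigma> w < t} w) \<in> borel_measurable (F t)"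
  shows "(\<integral>\<^sup>+w. ennreal (mart \<theta> (real T) w) * (H w * indicator {w. \<sigma> w \<le> real T} w) \<partial>M)
      = (\<integral>\<^sup>+w. ennreal (mart \<theta> (\<sigma> w) w) * (H w * indicator {w. \<sigma> w \<le> real T} w) \<partial>M)"
proof -
  note [measurable] = mart_stopped_measurable[OF \<sigma>m \<sigma>0] mart_measurable[of "real T"]
  have split: "indicator {w. \<sigma> w \<le> real T} w = (indicator {w. \<sigma> w < real T} w + indicator {w. \<sigma> w = real T} w :: ennreal)" for w
    by (auto simp: indicator_def)
  have "(\<integral>\<^sup>+w. ennreal (mart \<theta> (real T) w) * (H w * indicator {w. \<sigma> w = real T} w) \<partial>M)
      = (\<integral>\<^sup>+w. ennreal (mart \<theta> (\<sigma> w) w) * (H w * indicator {w. \<sigma> w = real T} w) \<partial>M)"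
    by (intro nn_integral_cong) (auto simp: indicator_def)
  then show ?thesis
    unfolding split distrib_left
    using optional_stopping[OF \<theta> Hm \<sigma>m \<sigma>0 ad, of T] by (simp add: nn_integral_add)
qed

end

context injected_process begin

lemma Rp_adapted: "0 \<le> t \<Longrightarrow> Rp t \<in> borel_measurable (F t)"
proof -
  assume "0 \<le> t"
  note [measurable] = V_adapted[OF this] X_adapted[OF this] Lp_adapted[OF this]
  have "Rp t \<in> borel_measurable (F t) \<longleftrightarrow> (\<lambda>w. V t w - (x + X t w) + Lp t w) \<in> borel_measurable (F t)"
    by (intro measurable_cong path_facts(9)) (simp add: space_F)
  then show ?thesis by simp
qed

lemmas V_measurable[measurable] = adapted_measurable[of V, OF V_adapted path_facts(1,5)]
lemmas R_measurable[measurable] = adapted_measurable[of Rp, OF Rp_adapted path_facts(4,8)]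
lemmas V_joint = adapted_jointly_measurable[of V, OF V_adapted path_facts(1,5)]
lemmas L_joint = adapted_jointly_measurable[of Lp, OF Lp_adapted path_facts(3,7)]
lemmas R_joint = adapted_jointly_measurable[of Rp, OF Rp_adapted path_facts(4,8)]

lemma pred_itime_less: "Measurable.pred (F t) (\<lambda>w. reach r w \<and> itime r w < t)"
proof -
  have "Measurable.pred (F t) (\<lambda>w. \<exists>p. (0 \<le> real_of_rat p \<and> real_of_rat p < t) \<and> r < Rp (real_of_rat p) w)"
  proof (rule pred_ex_rat)
    fix p assume "0 \<le> real_of_rat p \<and> real_of_rat p < t"
    then have [measurable]: "Rp (real_of_rat p) \<in> borel_measurable (F t)" by (intro measurable_F_mono[OF Rp_adapted]) auto
    show "Measurable.pred (F t) (\<lambda>w. r < Rp (real_of_rat p) w)" by measurable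
  qed
  then show ?thesis
    by (rule measurable_cong[THEN iffD2, rotated]) (simp add: space_F path_facts(18) conj_assoc)
qed

lemma pred_etime_less: "Measurable.pred (F t) (\<lambda>w. exit w \<and> etime w < t)"
proof -
  have "Measurable.pred (F t) (\<lambda>w. \<exists>p. (0 < real_of_rat p \<and> real_of_rat p < t) \<and> a < V (real_of_rat p) w)"
  proof (rule pred_ex_rat)
    fix p assume "0 < real_of_rat p \<and> real_of_rat p < t"
    then have [measurable]: "V (real_of_rat p) \<in> borel_measurable (F t)" by (intro measurable_F_mono[OF V_adapted]) auto
    show "Measurable.pred (F t) (\<lambda>w. a < V (real_of_rat p) w)" by measurable
  qed
  then show ?thesis
    by (rule measurable_cong[THEN iffD2, rotated]) (simp add: space_F path_facts(20) conj_assoc)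
qed

text \<open>Being alive at an injection time means that the exit, if any, comes strictly later, as
  the two times never coincide. A rational time that separates them turns this into a countable
  union of events decided before \<open>t\<close>.\<close>

lemma pred_alive_itime_less:
  assumes r: "0 \<le> r"
  shows "Measurable.pred (F t) (\<lambda>w. (reach r w \<and> alive (itime r w) w) \<and> itime r w < t)"
proof -
  have eq: "((reach r w \<and> alive (itime r w) w) \<and> itime r w < t) \<longleftrightarrow>
     (\<exists>p. (0 \<le> real_of_rat p \<and> real_of_rat p < t) \<and> ((reach r w \<and> itime r w < real_of_rat p) \<and> \<not> (exit w \<and> etime w < real_of_rat p)))" (is "?l \<longleftrightarrow> ?r")
    if w: "w \<in> space M" for w
  proof
    assume l: ?l
    define m where "m = (if exit w then min t (etime w) else t)"
    have "itime r w < m"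
      using l path_facts(17)[OF w, of r] r by (auto simp: m_def alive_def)
    then obtain p where p: "itime r w < real_of_rat p" "real_of_rat p < m"
      using of_rat_dense by blast
    have "0 \<le> itime r w" using l path_facts(11)[OF w] by auto
    then have "0 \<le> real_of_rat p" using p by linarith
    then show ?r using l p by (intro exI[of _ p]) (auto simp: m_def split: if_splits)
  next
    assume ?r then show ?l by (auto simp: alive_def)
  qed
  have "Measurable.pred (F t) (\<lambda>w. (\<exists>p. (0 \<le> real_of_rat p \<and> real_of_rat p < t) \<and> ((reach r w \<and> itime r w < real_of_rat p) \<and> \<not> (exit w \<and> etime w < real_of_rat p))))"
  proof (rule pred_ex_rat)
    fix p assume p: "0 \<le> real_of_rat p \<and> real_of_rat p < t"
    have [measurable]: "Measurable.pred (F t) (\<lambda>w. reach r w \<and> itime r w < real_of_rat p)"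
      "Measurable.pred (F t) (\<lambda>w. exit w \<and> etime w < real_of_rat p)"
      using p by (auto intro: measurable_F_mono[OF pred_itime_less] measurable_F_mono[OF pred_etime_less])
    show "Measurable.pred (F t) (\<lambda>w. (reach r w \<and> itime r w < real_of_rat p) \<and> \<not> (exit w \<and> etime w < real_of_rat p))"
      by measurable
  qed
  then show ?thesis by (rule measurable_cong[THEN iffD2, rotated]) (rule eq, simp add: space_F)
qed

lemma pred_alive:
  assumes "s < t"
  shows "Measurable.pred (F t) (alive s)"
proof -
  have "Measurable.pred (F t) (\<lambda>w. exit w \<and> etime w < s)"
  proof (cases "0 \<le> s")
    case True
    then show ?thesis using assms by (intro measurable_F_mono[OF pred_etime_less]) auto
  next
    case False
    have "Measurable.pred (F t) (\<lambda>w. exit w \<and> etime w < s) \<longleftrightarrow> Measurable.pred (F t) (\<lambda>w. False)"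
      using False path_facts(14) by (intro measurable_cong) (force simp: space_F)
    then show ?thesis by simp
  qed
  then have "Measurable.pred (F t) (\<lambda>w. \<not> (exit w \<and> etime w < s))" by measurable
  then show ?thesis by (simp add: alive_def[abs_def])
qed

lemma joint_predicates[measurable]:
  "Measurable.pred (M \<Otimes>\<^sub>M borel) (\<lambda>z. alive (snd z) (fst z))"
  "Measurable.pred (M \<Otimes>\<^sub>M borel) (\<lambda>z. reach (snd z) (fst z))"
  "(\<lambda>z. if reach (snd z) (fst z) then itime (snd z) (fst z) else 0) \<in> borel_measurable (M \<Otimes>\<^sub>M borel)"
  "Measurable.pred M exit" "(\<lambda>w. if exit w then etime w else 0) \<in> borel_measurable M"
proof -
  have "Measurable.pred (M \<Otimes>\<^sub>M borel) (\<lambda>z. \<exists>q. 0 < real_of_rat q \<and> real_of_rat q < snd z \<and> a < V (real_of_rat q) (fst z))"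
    by measurable
  then have "Measurable.pred (M \<Otimes>\<^sub>M borel) (\<lambda>z. exit (fst z) \<and> etime (fst z) < snd z)"
    by (rule measurable_cong[THEN iffD2, rotated]) (rule path_facts(20), auto simp: space_pair_measure)
  then have "Measurable.pred (M \<Otimes>\<^sub>M borel) (\<lambda>z. \<not> (exit (fst z) \<and> etime (fst z) < snd z))" by measurable
  then show "Measurable.pred (M \<Otimes>\<^sub>M borel) (\<lambda>z. alive (snd z) (fst z))" by (simp add: alive_def)
  show [measurable]: "Measurable.pred (M \<Otimes>\<^sub>M borel) (\<lambda>z. reach (snd z) (fst z))"
  proof (rule measurable_cong[THEN iffD2])
    show "reach (snd z) (fst z) \<longleftrightarrow> (\<exists>q. 0 \<le> real_of_rat q \<and> snd z < Rp (real_of_rat q) (fst z))"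
      if "z \<in> space (M \<Otimes>\<^sub>M borel)" for z by (rule path_facts(19)) (use that in \<open>auto simp: space_pair_measure\<close>)
  qed measurable
  have m: "Measurable.pred (M \<Otimes>\<^sub>M borel) (\<lambda>z. reach (snd z) (fst z) \<and> itime (snd z) (fst z) < u)" for u
  proof (rule measurable_cong[THEN iffD2])
    show "reach (snd z) (fst z) \<and> itime (snd z) (fst z) < u \<longleftrightarrow> (\<exists>q. 0 \<le> real_of_rat q \<and> real_of_rat q < u \<and> snd z < Rp (real_of_rat q) (fst z))"
      if "z \<in> space (M \<Otimes>\<^sub>M borel)" for z by (rule path_facts(18)) (use that in \<open>auto simp: space_pair_measure\<close>)
  qed measurable
  have "Measurable.pred (M \<Otimes>\<^sub>M borel) (\<lambda>z. (reach (snd z) (fst z) \<and> itime (snd z) (fst z) < u) \<or> (\<not> reach (snd z) (fst z) \<and> 0 < u))" for u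
    using m[of u, measurable] by measurable
  moreover have "((reach r w \<and> itime r w < u) \<or> (\<not> reach r w \<and> 0 < u)) = ((if reach r w then itime r w else 0) < u)" for r w u
    by auto
  ultimately show "(\<lambda>z. if reach (snd z) (fst z) then itime (snd z) (fst z) else 0) \<in> borel_measurable (M \<Otimes>\<^sub>M borel)"
    by (intro borel_measurableI_less) (simp add: pred_def)
  have [measurable]: "Measurable.pred M (\<lambda>w. exit w \<and> etime w < t)" for t
    by (rule measurable_F[OF pred_etime_less])
  have "exit w \<longleftrightarrow> (\<exists>n::nat. exit w \<and> etime w < real n)" for w by (auto intro: reals_Archimedean2)
  then have "exit = (\<lambda>w. \<exists>n::nat. exit w \<and> etime w < real n)" by (rule ext)
  moreover have "Measurable.pred M (\<lambda>w. \<exists>n::nat. exit w \<and> etime w < real n)" by measurable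
  ultimately show [measurable]: "Measurable.pred M exit" by simp
  have "Measurable.pred M (\<lambda>w. (exit w \<and> etime w < u) \<or> (\<not> exit w \<and> 0 < u))" for u by measurable
  moreover have "((exit w \<and> etime w < u) \<or> (\<not> exit w \<and> 0 < u)) = ((if exit w then etime w else 0) < u)" for w u by auto
  ultimately show "(\<lambda>w. if exit w then etime w else 0) \<in> borel_measurable M"
    by (intro borel_measurableI_less) (simp add: pred_def)
qed

lemma alive_measurable[measurable]: "Measurable.pred M (alive s)"
  using measurable_compose[OF measurable_Pair[OF measurable_ident measurable_const[of s borel]] joint_predicates(1)]
  by simp

text \<open>Total version of the injection time, as a function of the sample point and the level.
  The value 0 at levels that are never reached is harmless, because the integrands carry the
  condition \<open>reach\<close>.\<close>

definition it where "it z = (if reach (snd z) (fst z) then itime (snd z) (fst z) else 0)"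

lemma it_measurable[measurable]: "it \<in> borel_measurable (M \<Otimes>\<^sub>M borel)"
  unfolding it_def[abs_def] by (rule joint_predicates(3))

lemma it_composites[measurable]:
  "Measurable.pred (M \<Otimes>\<^sub>M borel) (\<lambda>z. alive (it z) (fst z))"
  "(\<lambda>z. Rp (it z) (fst z)) \<in> borel_measurable (M \<Otimes>\<^sub>M borel)"
  "(\<lambda>z. Lp (it z) (fst z)) \<in> borel_measurable (M \<Otimes>\<^sub>M borel)"
proof -
  show "Measurable.pred (M \<Otimes>\<^sub>M borel) (\<lambda>z. alive (it z) (fst z))"
    by (rule jointly_measurable_compose[where Y = alive, OF joint_predicates(1) it_measurable measurable_fst])
  show "(\<lambda>z. Rp (it z) (fst z)) \<in> borel_measurable (M \<Otimes>\<^sub>M borel)"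
    by (rule jointly_measurable_compose[where Y = Rp, OF R_joint it_measurable measurable_fst])
  show "(\<lambda>z. Lp (it z) (fst z)) \<in> borel_measurable (M \<Otimes>\<^sub>M borel)"
    by (rule jointly_measurable_compose[where Y = Lp, OF L_joint it_measurable measurable_fst])
qed

abbreviation "MT \<equiv> M \<Otimes>\<^sub>M (lborel :: real measure)"
abbreviation disc :: "real \<Rightarrow> ennreal" where "disc t \<equiv> ennreal (exp (- q * t))"
abbreviation mart' :: "real \<Rightarrow> nat \<Rightarrow> 'a \<Rightarrow> ennreal" where "mart' \<theta> n w \<equiv> ennreal (mart \<theta> (real n) w)"

definition lived where "lived T s w \<longleftrightarrow> 0 \<le> s \<and> s \<le> T \<and> alive s w"
definition injecting where "injecting T r w \<longleftrightarrow> 0 \<le> r \<and> reach r w \<and> itime r w \<le> T \<and> alive (itime r w) w"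

abbreviation living :: "nat \<Rightarrow> real \<Rightarrow> 'a \<Rightarrow> ennreal" where "living n s w \<equiv> of_bool (lived (real n) s w)"
abbreviation injects :: "nat \<Rightarrow> real \<Rightarrow> 'a \<Rightarrow> ennreal" where "injects n r w \<equiv> of_bool (injecting (real n) r w)"
abbreviation exited :: "nat \<Rightarrow> 'a \<Rightarrow> ennreal" where "exited n w \<equiv> of_bool (exit w \<and> etime w < real n)"

section \<open>Expectations of the weighted terms\<close>

context
  fixes \<theta> c1 c2 :: real
  assumes \<theta>: "0 \<le> \<theta>" and c: "0 \<le> c1" "0 \<le> c2" and cd: "c1 - c2 = \<psi> \<theta> - q"
begin

definition EE where "EE t w = exp (\<theta> * (x + Rp t w - Lp t w) + (c1 - c2) * t)"
definition GG where "GG t w = exp (\<theta> * x - \<theta> * Lp t w + (c1 - c2) * t)"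

lemma EE_adapted: "0 \<le> t \<Longrightarrow> EE t \<in> borel_measurable (F t)"
  unfolding EE_def using Lp_adapted[measurable] Rp_adapted[measurable] by measurable

lemma GG_adapted: "0 \<le> t \<Longrightarrow> GG t \<in> borel_measurable (F t)"
  unfolding GG_def using Lp_adapted[measurable] by measurable

text \<open>Only the values at nonnegative times matter; constancy on the negative half-line makes the processes
  progressive.\<close>

definition EE' where "EE' t = EE (max 0 t)"
definition GG' where "GG' t = GG (max 0 t)"

lemma continuous_max_zero:
  assumes "\<And>t. continuous (at_right t) (g :: real \<Rightarrow> real)"
  shows "continuous (at_right t) (\<lambda>t. g (max 0 t))"
proof (cases "0 \<le> t")
  case True
  have "\<forall>\<^sub>F u in at_right t. g u = g (max 0 u)"
    using True by (auto simp: eventually_at_right_field intro!: exI[of _ "t + 1"])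
  then have "(g \<longlongrightarrow> g t) (at_right t) \<longleftrightarrow> ((\<lambda>u. g (max 0 u)) \<longlongrightarrow> g t) (at_right t)" by (rule tendsto_cong)
  then show ?thesis using assms[of t] True by (simp add: continuous_within)
next
  case False
  have "\<forall>\<^sub>F u in at_right t. g (max 0 u) = g (max 0 t)"
    using False by (auto simp: eventually_at_right_field intro!: exI[of _ 0])
  then show ?thesis by (simp add: continuous_within tendsto_eventually)
qed

lemma EE'_props:
  shows "0 \<le> t \<Longrightarrow> EE' t \<in> borel_measurable (F t)" "w \<in> space M \<Longrightarrow> t \<le> 0 \<Longrightarrow> EE' t w = EE' 0 w"
    "w \<in> space M \<Longrightarrow> continuous (at_right t) (\<lambda>t. EE' t w)"
proof -
  show "0 \<le> t \<Longrightarrow> EE' t \<in> borel_measurable (F t)" "w \<in> space M \<Longrightarrow> t \<le> 0 \<Longrightarrow> EE' t w = EE' 0 w"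
    using EE_adapted by (auto simp: EE'_def max_def)
  show "continuous (at_right t) (\<lambda>t. EE' t w)" if "w \<in> space M"
    unfolding EE'_def by (rule continuous_max_zero) (unfold EE_def, intro continuous_intros path_facts(7,8) that)
qed

lemma GG'_props:
  shows "0 \<le> t \<Longrightarrow> GG' t \<in> borel_measurable (F t)" "w \<in> space M \<Longrightarrow> t \<le> 0 \<Longrightarrow> GG' t w = GG' 0 w"
    "w \<in> space M \<Longrightarrow> continuous (at_right t) (\<lambda>t. GG' t w)"
proof -
  show "0 \<le> t \<Longrightarrow> GG' t \<in> borel_measurable (F t)" "w \<in> space M \<Longrightarrow> t \<le> 0 \<Longrightarrow> GG' t w = GG' 0 w"
    using GG_adapted by (auto simp: GG'_def max_def)
  show "continuous (at_right t) (\<lambda>t. GG' t w)" if "w \<in> space M"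
    unfolding GG'_def by (rule continuous_max_zero) (unfold GG_def, intro continuous_intros path_facts(7) that)
qed

lemmas EE'_joint = adapted_jointly_measurable[of EE', OF EE'_props]
lemmas GG'_joint = adapted_jointly_measurable[of GG', OF GG'_props]

lemma GG'_it[measurable]: "(\<lambda>z. GG' (it z) (fst z)) \<in> borel_measurable (M \<Otimes>\<^sub>M borel)"
  by (rule jointly_measurable_compose[where Y = GG', OF GG'_joint it_measurable measurable_fst])

lemma EE_eq: "0 \<le> t \<Longrightarrow> EE t w = EE' t w" and GG_eq: "0 \<le> t \<Longrightarrow> GG t w = GG' t w"
  by (simp_all add: EE'_def GG'_def)

text \<open>The compensator of the martingale cancels against the rate \<open>c1 - c2\<close>, which
  leaves only the discount; this dictates the difference of the two rates.\<close>

lemma mart_EE: "w \<in> space M \<Longrightarrow> mart \<theta> t w * EE t w = exp (\<theta> * V t w - q * t)"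
  unfolding mart_def EE_def cd path_facts(9) exp_add[symmetric] by (simp add: algebra_simps)

text \<open>At an injection time \<open>V\<close> is 0, so the refraction equals x + X + R there and
  the position drops out. What remains besides the discount is r - R \<le> 0, minus the amount by
  which the injection overshoots the level: this is the coordinate on which \<kappa> lives.\<close>

lemma mart_GG:
  assumes "w \<in> space M" "reach r w" "0 \<le> r"
  shows "mart \<theta> (itime r w) w * (exp (\<theta> * r) * GG (itime r w) w)
     = exp (- q * itime r w) * exp (\<theta> * (r - Rp (itime r w) w))"
proof -
  have L: "Lp (itime r w) w = x + X (itime r w) w + Rp (itime r w) w"
    using path_facts(9)[OF assms(1), of "itime r w"] path_facts(13)[OF assms] by simp
  show ?thesis
    unfolding mart_def GG_def cd exp_add[symmetric] L by (simp add: algebra_simps)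
qed

lemma pathwise_balance:
  assumes w: "w \<in> space M" and T: "0 \<le> T"
  shows "ennreal (EE T w) * of_bool (alive T w) + ennreal (EE (etime w) w) * of_bool (exit w \<and> etime w < T)
     + (\<integral>\<^sup>+s. ennreal (EE s w * (c2 + \<theta> * \<delta> * indicator {b<..} (V s w))) * of_bool (lived T s w) \<partial>lborel)
    = ennreal (exp (\<theta> * x)) + (\<integral>\<^sup>+s. ennreal (EE s w * c1) * of_bool (lived T s w) \<partial>lborel)
     + (\<integral>\<^sup>+r. ennreal (\<theta> * exp (\<theta> * r) * GG (itime r w) w) * of_bool (injecting T r w) \<partial>lborel)"
proof -
  interpret injected_path "\<lambda>t. x + X t w" "\<lambda>t. V t w" b \<delta> a by (rule paths) fact
  \<comment> \<open>Evaluation at the smaller of \<open>T\<close> and the exit time splits the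
    boundary term into the part still alive and the part that has exited.\<close>
  define T' where "T' = (if exit w \<and> etime w < T then etime w else T)"
  have T'0: "0 \<le> T'" using T path_facts(14)[OF w] by (simp add: T'_def)
  have 1: "s \<in> {0..T'} \<longleftrightarrow> lived T s w" for s
    by (auto simp: T'_def lived_def alive_def)
  have 2: "r \<in> {r. 0 \<le> r \<and> reached r \<and> inj_time r \<le> T'} \<longleftrightarrow> injecting T r w" for r
    by (auto simp: T'_def injecting_def alive_def reach_def[symmetric] itime_def[symmetric])
  have E: "exp (\<theta> * (x + X 0 w + R s - L s) + (c1 - c2) * s) = EE s w" for s
    using X_zero[OF w] by (simp add: EE_def Rp_def Lp_def)
  have GE: "G \<theta> c1 c2 s = GG s w" for s
    using X_zero[OF w] by (simp add: G_def[OF \<theta> c] GG_def Lp_def)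
  have ind: "indicator A s = (of_bool (s \<in> A) :: ennreal)" for A and s :: real by (simp add: indicator_def)
  have t1: "ennreal (EE T' w) = ennreal (EE T w) * of_bool (alive T w) + ennreal (EE (etime w) w) * of_bool (exit w \<and> etime w < T)"
    by (auto simp: T'_def alive_def)
  show ?thesis
    using exponential_balance[OF \<theta> c T'0] X_zero[OF w]
    unfolding E GE ind 1 2 t1 by (simp add: itime_def)
qed

lemma expected_terminal:
  "(\<integral>\<^sup>+w. mart' \<theta> T w * (ennreal (EE (real T) w) * of_bool (alive (real T) w)) \<partial>M)
    = (\<integral>\<^sup>+w. ennreal (exp (\<theta> * V (real T) w - q * real T)) * of_bool (alive (real T) w) \<partial>M)"
  by (intro nn_integral_cong)
     (simp add: mart_EE[symmetric] ennreal_mult mult.assoc mart_def EE_def)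

text \<open>All terms carry the martingale at the fixed time \<open>T\<close>. Optional stopping
  moves it back to the exit time, where \<open>V\<close> equals \<open>a\<close>.\<close>

lemma expected_exit:
  "(\<integral>\<^sup>+w. mart' \<theta> T w * (ennreal (EE (etime w) w) * exited T w) \<partial>M)
    = ennreal (exp (\<theta> * a)) * (\<integral>\<^sup>+w. disc (etime w) * exited T w \<partial>M)"
proof -
  define \<sigma> where "\<sigma> w = (if exit w then etime w else 0)" for w
  define H where "H w = ennreal (if exit w then EE' (\<sigma> w) w else 0)" for w
  have \<sigma>m[measurable]: "\<sigma> \<in> borel_measurable M" unfolding \<sigma>_def[abs_def] by (rule joint_predicates(5))
  have \<sigma>0: "0 \<le> \<sigma> w" if "w \<in> space M" for w using path_facts(14)[OF that] by (simp add: \<sigma>_def)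
  have [measurable]: "(\<lambda>w. EE' (\<sigma> w) w) \<in> borel_measurable M"
    by (rule jointly_measurable_compose[where Y = EE', OF EE'_joint \<sigma>m]) measurable
  have Hm: "H \<in> borel_measurable M" unfolding H_def[abs_def] by measurable
  have ad: "(\<lambda>w. H w * indicator {w. \<sigma> w < t} w) \<in> borel_measurable (F t)" if t: "0 \<le> t" for t
  proof -
    have "(\<lambda>w. ennreal (if exit w \<and> etime w < t then EE' (etime w) w else 0)) \<in> borel_measurable (F t)"
      using stopped_measurable[of EE', OF EE'_props t pred_etime_less path_facts(14)] by measurable
    also have "(\<lambda>w. ennreal (if exit w \<and> etime w < t then EE' (etime w) w else 0)) = (\<lambda>w. H w * indicator {w. \<sigma> w < t} w)"
      by (auto simp: H_def \<sigma>_def indicator_def)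
    finally show ?thesis .
  qed
  have [measurable]: "Measurable.pred M (\<lambda>w. exit w \<and> etime w < real T)"
    by (rule measurable_F[OF pred_etime_less])
  have [measurable]: "(\<lambda>w. disc (etime w) * exited T w) \<in> borel_measurable M"
  proof -
    have "(\<lambda>w. disc (\<sigma> w) * (if exit w \<and> etime w < real T then 1 else 0)) \<in> borel_measurable M" by measurable
    also have "(\<lambda>w. disc (\<sigma> w) * (if exit w \<and> etime w < real T then 1 else 0)) = (\<lambda>w. disc (etime w) * exited T w)"
      by (auto simp: \<sigma>_def)
    finally show ?thesis .
  qed
  have "(\<integral>\<^sup>+w. mart' \<theta> T w * (ennreal (EE (etime w) w) * exited T w) \<partial>M)
      = (\<integral>\<^sup>+w. mart' \<theta> T w * (H w * indicator {w. \<sigma> w < real T} w) \<partial>M)"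
    by (intro nn_integral_cong) (auto simp: H_def \<sigma>_def indicator_def EE_eq path_facts(14))
  also have "\<dots> = (\<integral>\<^sup>+w. ennreal (mart \<theta> (\<sigma> w) w) * (H w * indicator {w. \<sigma> w < real T} w) \<partial>M)"
    by (rule optional_stopping[OF \<theta> Hm \<sigma>m \<sigma>0 ad, symmetric])
  also have "\<dots> = (\<integral>\<^sup>+w. ennreal (exp (\<theta> * a)) * (disc (etime w) * exited T w) \<partial>M)"
  proof (rule nn_integral_cong)
    fix w assume w: "w \<in> space M"
    show "ennreal (mart \<theta> (\<sigma> w) w) * (H w * indicator {w. \<sigma> w < real T} w) = ennreal (exp (\<theta> * a)) * (disc (etime w) * exited T w)"
    proof (cases "exit w")
      case True
      have "ennreal (mart \<theta> (etime w) w) * ennreal (EE (etime w) w) = ennreal (exp (\<theta> * a)) * disc (etime w)"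
        using mart_EE[OF w, of "etime w"] path_facts(15)[OF w True]
        by (simp add: ennreal_mult[symmetric] mart_def EE_def exp_add[symmetric])
      then show ?thesis using True path_facts(14)[OF w]
        by (simp add: H_def \<sigma>_def indicator_def EE_eq mult.assoc[symmetric])
    qed (simp add: H_def)
  qed
  also have "\<dots> = ennreal (exp (\<theta> * a)) * (\<integral>\<^sup>+w. disc (etime w) * exited T w \<partial>M)"
    by (rule nn_integral_cmult) measurable
  finally show ?thesis .
qed

text \<open>After the order of integration is exchanged, each fixed \<open>s\<close> serves as a
  deterministic stopping time, and the martingale moves from \<open>T\<close> back to
  \<open>s\<close>.\<close>

lemma expected_occupation:
  fixes h :: "real \<Rightarrow> real"
  assumes [measurable]: "h \<in> borel_measurable borel" and h: "\<And>y. 0 \<le> h y"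
  shows "(\<integral>\<^sup>+w. mart' \<theta> T w * (\<integral>\<^sup>+s. ennreal (EE s w * h (V s w)) * living T s w \<partial>lborel) \<partial>M)
    = (\<integral>\<^sup>+z. ennreal (exp (\<theta> * V (snd z) (fst z)) * h (V (snd z) (fst z))) * (disc (snd z) * living T (snd z) (fst z)) \<partial>MT)"
proof -
  note V_joint[measurable] EE'_joint[measurable]
  note [measurable] = mart_measurable[of "real T" \<theta>]
  have [measurable]: "(\<lambda>z. mart \<theta> (real T) (fst z)) \<in> borel_measurable (M \<Otimes>\<^sub>M borel)"
    by (rule measurable_compose[OF measurable_fst]) simp
  have lm[measurable]: "(\<lambda>z. living T (snd z) (fst z) :: ennreal) \<in> borel_measurable (M \<Otimes>\<^sub>M borel)"
    unfolding lived_def of_bool_def by measurable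
  define k where "k w s = ennreal (EE' s w * h (V s w)) * living T s w" for w s
  have km[measurable]: "(\<lambda>z. k (fst z) (snd z)) \<in> borel_measurable (M \<Otimes>\<^sub>M borel)" unfolding k_def by measurable
  have km1[measurable]: "k w \<in> borel_measurable borel" if "w \<in> space M" for w
    using measurable_compose[OF measurable_Pair1'[OF that] km] by simp
  have "(\<integral>\<^sup>+w. mart' \<theta> T w * (\<integral>\<^sup>+s. ennreal (EE s w * h (V s w)) * living T s w \<partial>lborel) \<partial>M)
     = (\<integral>\<^sup>+w. \<integral>\<^sup>+s. mart' \<theta> T w * k w s \<partial>lborel \<partial>M)"
  proof (rule nn_integral_cong)
    fix w assume w: "w \<in> space M"
    have "(\<integral>\<^sup>+s. ennreal (EE s w * h (V s w)) * living T s w \<partial>lborel) = (\<integral>\<^sup>+s. k w s \<partial>lborel)"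
      by (intro nn_integral_cong) (auto simp: k_def lived_def EE_eq)
    then show "mart' \<theta> T w * (\<integral>\<^sup>+s. ennreal (EE s w * h (V s w)) * living T s w \<partial>lborel) = (\<integral>\<^sup>+s. mart' \<theta> T w * k w s \<partial>lborel)"
      using km1[OF w] by (simp add: nn_integral_cmult)
  qed
  also have "\<dots> = (\<integral>\<^sup>+z. ennreal (mart \<theta> (real T) (fst z)) * k (fst z) (snd z) \<partial>MT)"
    by (subst lborel.nn_integral_fst[symmetric]) auto
  also have "\<dots> = (\<integral>\<^sup>+s. \<integral>\<^sup>+w. mart' \<theta> T w * k w s \<partial>M \<partial>lborel)"
  proof -
    interpret P: pair_sigma_finite M lborel ..
    show ?thesis by (subst P.nn_integral_snd[symmetric]) auto
  qed
  also have "\<dots> = (\<integral>\<^sup>+s. \<integral>\<^sup>+w. ennreal (exp (\<theta> * V s w) * h (V s w)) * (disc s * living T s w) \<partial>M \<partial>lborel)"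
  proof (rule nn_integral_cong)
    fix s :: real
    show "(\<integral>\<^sup>+w. mart' \<theta> T w * k w s \<partial>M) = (\<integral>\<^sup>+w. ennreal (exp (\<theta> * V s w) * h (V s w)) * (disc s * living T s w) \<partial>M)"
    proof (cases "0 \<le> s \<and> s \<le> real T")
      case False
      then show ?thesis by (auto simp: k_def lived_def)
    next
      case True
      then have s: "0 \<le> s" "s \<le> real T" by auto
      define H where "H w = ennreal (EE s w * h (V s w)) * of_bool (alive s w)" for w
      have Hm: "H \<in> borel_measurable (F t)" if t: "s < t" for t
      proof -
        have [measurable]: "EE s \<in> borel_measurable (F t)" "V s \<in> borel_measurable (F t)" "Measurable.pred (F t) (alive s)"
          using s t by (auto intro: measurable_F_mono[OF EE_adapted] measurable_F_mono[OF V_adapted] pred_alive)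
        show ?thesis unfolding H_def[abs_def] of_bool_def by measurable
      qed
      have "(\<integral>\<^sup>+w. mart' \<theta> T w * (H w * indicator {w. s \<le> real T} w) \<partial>M)
          = (\<integral>\<^sup>+w. ennreal (mart \<theta> s w) * (H w * indicator {w. s \<le> real T} w) \<partial>M)"
      proof (rule optional_stopping_le[OF \<theta>])
        show "H \<in> borel_measurable M" using measurable_F[OF Hm[of "s + 1"]] by simp
        show "(\<lambda>w. H w * indicator {w. s < t} w) \<in> borel_measurable (F t)" for t
          using Hm[of t] by (cases "s < t") auto
      qed (use s in auto)
      moreover have "k w s = H w" for w using s by (simp add: k_def H_def lived_def EE_eq)
      moreover have "ennreal (mart \<theta> s w) * H w = ennreal (exp (\<theta> * V s w) * h (V s w)) * (disc s * living T s w)"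
        if w: "w \<in> space M" for w
      proof -
        have "ennreal (mart \<theta> s w) * ennreal (EE s w * h (V s w)) = ennreal (exp (\<theta> * V s w - q * s) * h (V s w))"
          unfolding mart_EE[OF w, symmetric] using h by (simp add: ennreal_mult[symmetric] mart_def EE_def mult.assoc)
        also have "\<dots> = ennreal (exp (\<theta> * V s w) * h (V s w)) * disc s"
          using h by (simp add: ennreal_mult[symmetric] exp_add[symmetric] mult_ac exp_diff exp_minus field_simps)
        finally show ?thesis using s by (simp add: H_def lived_def mult.assoc[symmetric])
      qed
      ultimately show ?thesis using s by (simp cong: nn_integral_cong_simp)
    qed
  qed
  also have "\<dots> = (\<integral>\<^sup>+z. ennreal (exp (\<theta> * V (snd z) (fst z)) * h (V (snd z) (fst z))) * (disc (snd z) * living T (snd z) (fst z)) \<partial>MT)"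
  proof -
    interpret P: pair_sigma_finite M lborel ..
    show ?thesis by (subst P.nn_integral_snd[symmetric]) auto
  qed
  finally show ?thesis .
qed

text \<open>For a fixed level the injection time acts as a stopping time on the event that it
  precedes the exit; optional stopping is applied level by level, under the integral over the
  levels.\<close>

lemma expected_injection:
  "(\<integral>\<^sup>+w. mart' \<theta> T w * (\<integral>\<^sup>+r. ennreal (\<theta> * exp (\<theta> * r) * GG (itime r w) w) * injects T r w \<partial>lborel) \<partial>M)
    = ennreal \<theta> * (\<integral>\<^sup>+z. ennreal (exp (\<theta> * (snd z - Rp (it z) (fst z)))) * (disc (it z) * injects T (snd z) (fst z)) \<partial>MT)"
proof -
  note [measurable] = mart_measurable[of "real T" \<theta>]
  have [measurable]: "(\<lambda>z. mart \<theta> (real T) (fst z)) \<in> borel_measurable (M \<Otimes>\<^sub>M borel)"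
    by (rule measurable_compose[OF measurable_fst]) simp
  have inj: "injecting T r w \<longleftrightarrow> 0 \<le> r \<and> reach r w \<and> it (w, r) \<le> T \<and> alive (it (w, r)) w" for T r w
    by (auto simp: injecting_def it_def)
  have [measurable]: "(\<lambda>z. injects T (snd z) (fst z) :: ennreal) \<in> borel_measurable (M \<Otimes>\<^sub>M borel)"
    unfolding inj of_bool_def by simp
  define k where "k w r = ennreal (\<theta> * exp (\<theta> * r) * GG' (it (w, r)) w) * injects T r w" for w r
  have km[measurable]: "(\<lambda>z. k (fst z) (snd z)) \<in> borel_measurable (M \<Otimes>\<^sub>M borel)"
    unfolding k_def using GG'_it[measurable] by simp
  have km1[measurable]: "k w \<in> borel_measurable borel" if "w \<in> space M" for w
    using measurable_compose[OF measurable_Pair1'[OF that] km] by simp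
  have "(\<integral>\<^sup>+w. mart' \<theta> T w * (\<integral>\<^sup>+r. ennreal (\<theta> * exp (\<theta> * r) * GG (itime r w) w) * injects T r w \<partial>lborel) \<partial>M)
     = (\<integral>\<^sup>+w. \<integral>\<^sup>+r. mart' \<theta> T w * k w r \<partial>lborel \<partial>M)"
  proof (rule nn_integral_cong)
    fix w assume w: "w \<in> space M"
    have "(\<integral>\<^sup>+r. ennreal (\<theta> * exp (\<theta> * r) * GG (itime r w) w) * injects T r w \<partial>lborel) = (\<integral>\<^sup>+r. k w r \<partial>lborel)"
      by (intro nn_integral_cong) (auto simp: k_def injecting_def it_def GG_eq path_facts(11)[OF w])
    then show "mart' \<theta> T w * (\<integral>\<^sup>+r. ennreal (\<theta> * exp (\<theta> * r) * GG (itime r w) w) * injects T r w \<partial>lborel) = (\<integral>\<^sup>+r. mart' \<theta> T w * k w r \<partial>lborel)"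
      using km1[OF w] by (simp add: nn_integral_cmult)
  qed
  also have "\<dots> = (\<integral>\<^sup>+z. ennreal (mart \<theta> (real T) (fst z)) * k (fst z) (snd z) \<partial>MT)"
    by (subst lborel.nn_integral_fst[symmetric]) auto
  also have "\<dots> = (\<integral>\<^sup>+r. \<integral>\<^sup>+w. mart' \<theta> T w * k w r \<partial>M \<partial>lborel)"
  proof -
    interpret P: pair_sigma_finite M lborel ..
    show ?thesis by (subst P.nn_integral_snd[symmetric]) auto
  qed
  also have "\<dots> = (\<integral>\<^sup>+r. \<integral>\<^sup>+w. ennreal \<theta> * (ennreal (exp (\<theta> * (r - Rp (it (w, r)) w))) * (disc (it (w, r)) * injects T r w)) \<partial>M \<partial>lborel)"
  proof (rule nn_integral_cong)
    fix r :: real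
    show "(\<integral>\<^sup>+w. mart' \<theta> T w * k w r \<partial>M) = (\<integral>\<^sup>+w. ennreal \<theta> * (ennreal (exp (\<theta> * (r - Rp (it (w, r)) w))) * (disc (it (w, r)) * injects T r w)) \<partial>M)"
    proof (cases "0 \<le> r")
      case False
      then show ?thesis by (auto simp: k_def injecting_def)
    next
      case r: True
      define S where "S w \<longleftrightarrow> reach r w \<and> alive (itime r w) w" for w
      define \<sigma> where "\<sigma> w = it (w, r)" for w
      define H where "H w = ennreal (if S w then \<theta> * exp (\<theta> * r) * GG' (\<sigma> w) w else 0)" for w
      have pr: "(\<lambda>w. (w, r)) \<in> measurable M (M \<Otimes>\<^sub>M borel)" by measurable
      have \<sigma>m[measurable]: "\<sigma> \<in> borel_measurable M"
        unfolding \<sigma>_def[abs_def] by (rule measurable_compose[OF pr it_measurable])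
      have \<sigma>0: "0 \<le> \<sigma> w" if "w \<in> space M" for w
        using path_facts(11)[OF that] by (simp add: \<sigma>_def it_def)
      have [measurable]: "(\<lambda>w. GG' (\<sigma> w) w) \<in> borel_measurable M"
        using measurable_compose[OF pr GG'_it] by (simp add: \<sigma>_def)
      have "Measurable.pred M (\<lambda>w. reach r w \<and> alive (it (w, r)) w)"
        using measurable_compose[OF pr joint_predicates(2)] measurable_compose[OF pr it_composites(1)] by simp
      then have [measurable]: "Measurable.pred M S"
        unfolding S_def[abs_def] by (simp add: it_def cong: conj_cong)
      have Hm: "H \<in> borel_measurable M" unfolding H_def[abs_def] by measurable
      have ad: "(\<lambda>w. H w * indicator {w. \<sigma> w < t} w) \<in> borel_measurable (F t)" if t: "0 \<le> t" for t
      proof -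
        have S: "Measurable.pred (F u) (\<lambda>w. S w \<and> itime r w < u)" for u
          unfolding S_def by (rule pred_alive_itime_less[OF r])
        have "(\<lambda>w. if S w \<and> itime r w < t then GG' (itime r w) w else 0) \<in> borel_measurable (F t)"
          by (rule stopped_measurable[of GG', OF GG'_props t S]) (auto simp: S_def path_facts(11))
        then have "(\<lambda>w. ennreal (\<theta> * exp (\<theta> * r) * (if S w \<and> itime r w < t then GG' (itime r w) w else 0))) \<in> borel_measurable (F t)"
          by measurable
        also have "(\<lambda>w. ennreal (\<theta> * exp (\<theta> * r) * (if S w \<and> itime r w < t then GG' (itime r w) w else 0))) = (\<lambda>w. H w * indicator {w. \<sigma> w < t} w)"
          by (auto simp: H_def \<sigma>_def S_def it_def indicator_def)
        finally show ?thesis .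
      qed
      have "(\<integral>\<^sup>+w. mart' \<theta> T w * k w r \<partial>M) = (\<integral>\<^sup>+w. mart' \<theta> T w * (H w * indicator {w. \<sigma> w \<le> real T} w) \<partial>M)"
        by (intro nn_integral_cong) (auto simp: k_def H_def S_def \<sigma>_def inj it_def r)
      also have "\<dots> = (\<integral>\<^sup>+w. ennreal (mart \<theta> (\<sigma> w) w) * (H w * indicator {w. \<sigma> w \<le> real T} w) \<partial>M)"
        by (rule optional_stopping_le[OF \<theta> Hm \<sigma>m \<sigma>0 ad])
      also have "\<dots> = (\<integral>\<^sup>+w. ennreal \<theta> * (ennreal (exp (\<theta> * (r - Rp (it (w, r)) w))) * (disc (it (w, r)) * injects T r w)) \<partial>M)"
      proof (rule nn_integral_cong)
        fix w assume w: "w \<in> space M"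
        show "ennreal (mart \<theta> (\<sigma> w) w) * (H w * indicator {w. \<sigma> w \<le> real T} w)
          = ennreal \<theta> * (ennreal (exp (\<theta> * (r - Rp (it (w, r)) w))) * (disc (it (w, r)) * injects T r w))"
        proof (cases "S w")
          case True
          then have re: "reach r w" "it (w, r) = itime r w" by (auto simp: S_def it_def)
          have "ennreal (mart \<theta> (\<sigma> w) w) * H w = ennreal (\<theta> * (mart \<theta> (itime r w) w * (exp (\<theta> * r) * GG (itime r w) w)))"
            using True \<theta> re path_facts(11)[OF w]
            by (simp add: H_def \<sigma>_def ennreal_mult[symmetric] mart_def GG_eq GG'_def GG_def mult_ac)
          also have "\<dots> = ennreal \<theta> * (ennreal (exp (\<theta> * (r - Rp (it (w, r)) w))) * disc (it (w, r)))"
            unfolding mart_GG[OF w re(1) r] re(2) using \<theta> by (simp add: ennreal_mult[symmetric] mult_ac)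
          finally show ?thesis
            using True re r by (simp add: S_def injecting_def \<sigma>_def indicator_def mult.assoc[symmetric])
        qed (auto simp: H_def S_def injecting_def)
      qed
      finally show ?thesis .
    qed
  qed
  also have "\<dots> = (\<integral>\<^sup>+z. ennreal \<theta> * (ennreal (exp (\<theta> * (snd z - Rp (it z) (fst z)))) * (disc (it z) * injects T (snd z) (fst z))) \<partial>MT)"
  proof -
    interpret P: pair_sigma_finite M lborel ..
    show ?thesis by (subst P.nn_integral_snd[symmetric]) auto
  qed
  also have "\<dots> = ennreal \<theta> * (\<integral>\<^sup>+z. ennreal (exp (\<theta> * (snd z - Rp (it z) (fst z)))) * (disc (it z) * injects T (snd z) (fst z)) \<partial>MT)"
    by (rule nn_integral_cmult) auto
  finally show ?thesis .
qed

end

text \<open>The discounted occupation measure of \<open>V\<close> up to the exit time, and the law of the part of the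
  injection that overshoots a level; the latter is carried by the negative half-line and its total
  mass is the expected discounted injection.\<close>

definition occupation :: "real measure" where
  "occupation = distr (density MT
     (\<lambda>z. disc (snd z) * of_bool (0 \<le> snd z \<and> alive (snd z) (fst z)))) borel (\<lambda>z. V (snd z) (fst z))"

definition undershoot :: "real measure" where
  "undershoot = distr (density MT
     (\<lambda>z. disc (it z) * of_bool (0 \<le> snd z \<and> reach (snd z) (fst z) \<and> alive (it z) (fst z)))) borel
     (\<lambda>z. snd z - Rp (it z) (fst z))"

definition exit_transform :: ennreal where
  "exit_transform = (\<integral>\<^sup>+w. disc (etime w) * of_bool (exit w) \<partial>M)"

lemma nn_integral_occupation:
  assumes [measurable]: "g \<in> borel_measurable borel"
  shows "(\<integral>\<^sup>+y. g y \<partial>occupation) = (\<integral>\<^sup>+z. g (V (snd z) (fst z)) * (disc (snd z) * of_bool (0 \<le> snd z \<and> alive (snd z) (fst z))) \<partial>MT)"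
proof -
  note V_joint[measurable]
  show ?thesis
    unfolding occupation_def
    by (subst nn_integral_distr, simp, simp, subst nn_integral_density) (auto simp: of_bool_def mult_ac)
qed

lemma nn_integral_undershoot:
  assumes [measurable]: "g \<in> borel_measurable borel"
  shows "(\<integral>\<^sup>+y. g y \<partial>undershoot) = (\<integral>\<^sup>+z. g (snd z - Rp (it z) (fst z)) * (disc (it z) * of_bool (0 \<le> snd z \<and> reach (snd z) (fst z) \<and> alive (it z) (fst z))) \<partial>MT)"
  unfolding undershoot_def
  by (subst nn_integral_distr, simp, simp, subst nn_integral_density) (auto simp: of_bool_def mult_ac)

lemma nn_integral_restrict_LIMSEQ:
  fixes g :: "'b \<Rightarrow> ennreal"
  assumes [measurable]: "\<And>n::nat. (\<lambda>z. g z * of_bool (P n z)) \<in> borel_measurable N"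
    and mono: "\<And>m n z. m \<le> n \<Longrightarrow> P m z \<Longrightarrow> P n z"
    and lim: "\<And>z. Q z \<longleftrightarrow> (\<exists>n. P n z)"
  shows "(\<lambda>n. \<integral>\<^sup>+z. g z * of_bool (P n z) \<partial>N) \<longlonglongrightarrow> (\<integral>\<^sup>+z. g z * of_bool (Q z) \<partial>N)"
proof (rule nn_integral_LIMSEQ)
  show "incseq (\<lambda>n z. g z * of_bool (P n z))"
    using mono by (auto simp: incseq_def le_fun_def intro!: mult_left_mono)
  fix z
  show "(\<lambda>n. g z * of_bool (P n z)) \<longlonglongrightarrow> g z * of_bool (Q z)"
  proof (cases "Q z")
    case True
    then obtain n0 where "P n0 z" using lim by auto
    then have "\<forall>\<^sub>F n in sequentially. g z * of_bool (P n z) = g z * of_bool (Q z)"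
      using mono True by (auto simp: eventually_sequentially intro!: exI[of _ n0])
    then show ?thesis by (rule tendsto_eventually)
  qed (use lim in simp)
qed measurable

text \<open>The pathwise balance at time \<open>n\<close>, weighted by the martingale at time
  \<open>n\<close>, is integrated term by term. As n grows the boundary term vanishes, since V \<le>
  a while alive and the discount is exp(-q n), and the other terms increase to the exit transform
  and to integrals against \<open>occupation\<close> and \<open>undershoot\<close>. All terms are
  allowed to be infinite.\<close>

theorem exponential_identity:
  assumes \<theta>: "0 \<le> \<theta>" and c: "0 \<le> c1" "0 \<le> c2" and cd: "c1 - c2 = \<psi> \<theta> - q"
  shows "ennreal (exp (\<theta> * a)) * exit_transform + (\<integral>\<^sup>+y. ennreal (exp (\<theta> * y) * (c2 + \<theta> * \<delta> * indicator {b<..} y)) \<partial>occupation)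
    = ennreal (exp (\<theta> * x)) + (\<integral>\<^sup>+y. ennreal (exp (\<theta> * y) * c1) \<partial>occupation) + ennreal \<theta> * (\<integral>\<^sup>+y. ennreal (exp (\<theta> * y)) \<partial>undershoot)"
proof -
  have "0 \<le> \<delta>"
    using not_empty paths injected_path.\<delta> by blast
  note V_joint[measurable]
  define h where "h y = c2 + \<theta> * \<delta> * indicator {b<..} y" for y :: real
  have h: "h \<in> borel_measurable borel" "\<And>y. 0 \<le> h y" unfolding h_def using c \<theta> \<open>0 \<le> \<delta>\<close> by auto
  define A where "A n = (\<integral>\<^sup>+w. ennreal (exp (\<theta> * V (real n) w - q * real n)) * of_bool (alive (real n) w) \<partial>M)" for n :: nat
  define B where "B n = (\<integral>\<^sup>+w. disc (etime w) * exited n w \<partial>M)" for n :: nat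
  define C where "C g n = (\<integral>\<^sup>+z. ennreal (exp (\<theta> * V (snd z) (fst z)) * g (V (snd z) (fst z))) * (disc (snd z) * living n (snd z) (fst z)) \<partial>MT)" for g and n :: nat
  define D where "D n = (\<integral>\<^sup>+z. ennreal (exp (\<theta> * (snd z - Rp (it z) (fst z)))) * (disc (it z) * injects n (snd z) (fst z)) \<partial>MT)" for n :: nat
  note ld = lived_def
  note idf = injecting_def
  have inj: "injecting T r w \<longleftrightarrow> 0 \<le> r \<and> reach r w \<and> it (w, r) \<le> T \<and> alive (it (w, r)) w" for T r w
    by (auto simp: idf it_def)
  have fin: "ennreal (exp (\<theta> * a)) * B n + A n + C h n = ennreal (exp (\<theta> * x)) + C (\<lambda>_. c1) n + ennreal \<theta> * D n" for n
  proof -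
    define N where "N w = mart' \<theta> n w" for w
    have [measurable]: "N \<in> borel_measurable M" unfolding N_def[abs_def] using mart_measurable[of "real n" \<theta>] by measurable
    define t1 where "t1 w = ennreal (EE \<theta> c1 c2 (real n) w) * of_bool (alive (real n) w)" for w
    define t2 where "t2 w = ennreal (EE \<theta> c1 c2 (etime w) w) * exited n w" for w
    define t3 where "t3 g w = (\<integral>\<^sup>+s. ennreal (EE \<theta> c1 c2 s w * g (V s w)) * living n s w \<partial>lborel)" for g w
    define t4 where "t4 w = (\<integral>\<^sup>+r. ennreal (\<theta> * exp (\<theta> * r) * GG \<theta> c1 c2 (itime r w) w) * injects n r w \<partial>lborel)" for w
    note ctx = \<theta> c cd
    have E: "EE \<theta> c1 c2 s w = EE' \<theta> c1 c2 s w" "GG \<theta> c1 c2 s w = GG' \<theta> c1 c2 s w" if "0 \<le> s" for s w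
      using that by (simp_all add: EE_eq[OF ctx] GG_eq[OF ctx])
    note EE'_joint[OF ctx, measurable] GG'_it[OF ctx, measurable]
    have [measurable]: "(\<lambda>z. living n (snd z) (fst z) :: ennreal) \<in> borel_measurable (M \<Otimes>\<^sub>M borel)"
      unfolding ld of_bool_def by measurable
    have [measurable]: "(\<lambda>z. injects n (snd z) (fst z) :: ennreal) \<in> borel_measurable (M \<Otimes>\<^sub>M borel)"
      unfolding inj of_bool_def by simp
    have m1[measurable]: "t1 \<in> borel_measurable M"
      unfolding t1_def[abs_def] of_bool_def using measurable_F[OF EE_adapted[OF ctx, of "real n"]] by measurable
    have m2[measurable]: "t2 \<in> borel_measurable M"
    proof -
      define \<sigma> where "\<sigma> w = (if exit w then etime w else 0)" for w
      have \<sigma>m[measurable]: "\<sigma> \<in> borel_measurable M" unfolding \<sigma>_def[abs_def] by (rule joint_predicates(5))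
      have [measurable]: "(\<lambda>w. EE' \<theta> c1 c2 (\<sigma> w) w) \<in> borel_measurable M"
        by (rule jointly_measurable_compose[where Y = "EE' \<theta> c1 c2", OF EE'_joint[OF ctx] \<sigma>m]) measurable
      have "(\<lambda>w. if exit w \<and> \<sigma> w < real n then ennreal (EE' \<theta> c1 c2 (\<sigma> w) w) else 0) \<in> borel_measurable M" by measurable
      moreover have "t2 w = (if exit w \<and> \<sigma> w < real n then ennreal (EE' \<theta> c1 c2 (\<sigma> w) w) else 0)" if "w \<in> space M" for w
        using path_facts(14)[OF that] by (auto simp: t2_def \<sigma>_def E)
      ultimately show ?thesis by (subst measurable_cong)
    qed
    have m3[measurable]: "t3 g \<in> borel_measurable M" if [measurable]: "g \<in> borel_measurable borel" for g
    proof -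
      have "t3 g w = (\<integral>\<^sup>+s. ennreal (EE' \<theta> c1 c2 s w * g (V s w)) * living n s w \<partial>lborel)" for w
        unfolding t3_def by (intro nn_integral_cong) (auto simp: ld E)
      moreover have "(\<lambda>w. \<integral>\<^sup>+s. ennreal (EE' \<theta> c1 c2 s w * g (V s w)) * living n s w \<partial>lborel) \<in> borel_measurable M"
        by (rule lborel.borel_measurable_nn_integral) (simp add: split_beta')
      ultimately show ?thesis by (simp cong: measurable_cong)
    qed
    have m4[measurable]: "t4 \<in> borel_measurable M"
    proof -
      have "t4 w = (\<integral>\<^sup>+r. ennreal (\<theta> * exp (\<theta> * r) * GG' \<theta> c1 c2 (it (w, r)) w) * injects n r w \<partial>lborel)" if "w \<in> space M" for w
        unfolding t4_def by (intro nn_integral_cong) (use path_facts(11)[OF that] in \<open>auto simp: idf E it_def\<close>)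
      moreover have "(\<lambda>w. \<integral>\<^sup>+r. ennreal (\<theta> * exp (\<theta> * r) * GG' \<theta> c1 c2 (it (w, r)) w) * injects n r w \<partial>lborel) \<in> borel_measurable M"
        by (rule lborel.borel_measurable_nn_integral) (simp add: split_beta')
      ultimately show ?thesis by (subst measurable_cong)
    qed
    have [measurable]: "t3 h \<in> borel_measurable M" "t3 (\<lambda>_. c1) \<in> borel_measurable M" using h(1) by (auto intro!: m3)
    have "(\<integral>\<^sup>+w. N w * (t1 w + t2 w + t3 h w) \<partial>M) = (\<integral>\<^sup>+w. N w * (ennreal (exp (\<theta> * x)) + t3 (\<lambda>_. c1) w + t4 w) \<partial>M)"
      by (rule nn_integral_cong) (use pathwise_balance[OF ctx, of _ "real n"] in \<open>simp add: t1_def t2_def t3_def t4_def h_def\<close>)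
    moreover have "(\<integral>\<^sup>+w. N w * (t1 w + t2 w + t3 h w) \<partial>M)
       = (\<integral>\<^sup>+w. N w * t1 w \<partial>M) + (\<integral>\<^sup>+w. N w * t2 w \<partial>M) + (\<integral>\<^sup>+w. N w * t3 h w \<partial>M)"
      by (simp add: distrib_left nn_integral_add)
    moreover have "(\<integral>\<^sup>+w. N w * (ennreal (exp (\<theta> * x)) + t3 (\<lambda>_. c1) w + t4 w) \<partial>M)
       = (\<integral>\<^sup>+w. N w * ennreal (exp (\<theta> * x)) \<partial>M) + (\<integral>\<^sup>+w. N w * t3 (\<lambda>_. c1) w \<partial>M) + (\<integral>\<^sup>+w. N w * t4 w \<partial>M)"
      by (simp add: distrib_left nn_integral_add)
    moreover have "(\<integral>\<^sup>+w. N w * ennreal (exp (\<theta> * x)) \<partial>M) = ennreal (exp (\<theta> * x))"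
    proof -
      have "(\<integral>\<^sup>+w. N w * ennreal (exp (\<theta> * x)) \<partial>M) = (\<integral>\<^sup>+w. N w \<partial>M) * ennreal (exp (\<theta> * x))"
        by (rule nn_integral_multc) measurable
      then show ?thesis using nn_integral_mart[OF \<theta>, of n] by (simp add: N_def)
    qed
    ultimately show ?thesis
      using expected_terminal[OF ctx, of n] expected_exit[OF ctx, of n] expected_occupation[OF ctx h, of n]
        expected_occupation[OF ctx, of "\<lambda>_. c1" n] c expected_injection[OF ctx, of n]
      by (simp add: A_def B_def C_def D_def N_def t1_def t2_def t3_def t4_def add_ac)
  qed
  have limA: "A \<longlonglongrightarrow> 0"
  proof (rule tendsto_sandwich[OF _ _ tendsto_const])
    have "A n \<le> ennreal (exp (\<theta> * a) * exp (- q * real n))" for n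
    proof -
      have "A n \<le> (\<integral>\<^sup>+w. ennreal (exp (\<theta> * a) * exp (- q * real n)) \<partial>M)"
        unfolding A_def exp_add[symmetric]
        by (rule nn_integral_mono) (use path_facts(16) \<theta> in \<open>auto intro!: ennreal_leI mult_left_mono\<close>)
      then show ?thesis by (simp add: emeasure_space_1)
    qed
    then show "\<forall>\<^sub>F n in sequentially. A n \<le> ennreal (exp (\<theta> * a) * exp (- q * real n))" by simp
    have "(\<lambda>n. exp (\<theta> * a) * exp (- q * real n)) \<longlonglongrightarrow> exp (\<theta> * a) * 0"
      using q by (intro tendsto_mult tendsto_const) real_asymp
    then show "(\<lambda>n. ennreal (exp (\<theta> * a) * exp (- q * real n))) \<longlonglongrightarrow> 0"
      using tendsto_ennrealI by fastforce
  qed simp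
  have limB: "B \<longlonglongrightarrow> exit_transform"
    unfolding B_def exit_transform_def
  proof (rule nn_integral_restrict_LIMSEQ)
    show "(\<lambda>w. disc (etime w) * exited n w) \<in> borel_measurable M" for n
    proof -
      have "(\<lambda>w. if exit w \<and> (if exit w then etime w else 0) < real n then disc (if exit w then etime w else 0) else 0) \<in> borel_measurable M"
        using joint_predicates(4,5) by measurable
      also have "(\<lambda>w. if exit w \<and> (if exit w then etime w else 0) < real n then disc (if exit w then etime w else 0) else 0)
         = (\<lambda>w. disc (etime w) * exited n w)" by auto
      finally show ?thesis .
    qed
    show "exit w \<longleftrightarrow> (\<exists>n::nat. exit w \<and> etime w < real n)" for w by (auto intro: reals_Archimedean2)
  qed (auto intro: less_le_trans)
  have limC: "C g \<longlonglongrightarrow> (\<integral>\<^sup>+y. ennreal (exp (\<theta> * y) * g y) \<partial>occupation)" if [measurable]: "g \<in> borel_measurable borel" for g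
  proof -
    have "(\<lambda>n::nat. \<integral>\<^sup>+z. (ennreal (exp (\<theta> * V (snd z) (fst z)) * g (V (snd z) (fst z))) * disc (snd z)) * living n (snd z) (fst z) \<partial>MT)
      \<longlonglongrightarrow> (\<integral>\<^sup>+z. (ennreal (exp (\<theta> * V (snd z) (fst z)) * g (V (snd z) (fst z))) * disc (snd z)) * of_bool (0 \<le> snd z \<and> alive (snd z) (fst z)) \<partial>MT)"
    proof (rule nn_integral_restrict_LIMSEQ)
      show "(\<lambda>z. (ennreal (exp (\<theta> * V (snd z) (fst z)) * g (V (snd z) (fst z))) * disc (snd z)) * living n (snd z) (fst z)) \<in> borel_measurable MT" for n
        unfolding ld of_bool_def by simp
      show "0 \<le> snd z \<and> alive (snd z) (fst z) \<longleftrightarrow> (\<exists>n::nat. lived (real n) (snd z) (fst z))" for z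
        using real_arch_simple[of "snd z"] by (auto simp: ld)
    qed (auto simp: ld)
    then show ?thesis by (subst nn_integral_occupation) (simp_all add: C_def[abs_def] mult.assoc)
  qed
  have limD: "D \<longlonglongrightarrow> (\<integral>\<^sup>+y. ennreal (exp (\<theta> * y)) \<partial>undershoot)"
  proof -
    have "(\<lambda>n::nat. \<integral>\<^sup>+z. (ennreal (exp (\<theta> * (snd z - Rp (it z) (fst z)))) * disc (it z)) * injects n (snd z) (fst z) \<partial>MT)
      \<longlonglongrightarrow> (\<integral>\<^sup>+z. (ennreal (exp (\<theta> * (snd z - Rp (it z) (fst z)))) * disc (it z)) * of_bool (0 \<le> snd z \<and> reach (snd z) (fst z) \<and> alive (it z) (fst z)) \<partial>MT)"
    proof (rule nn_integral_restrict_LIMSEQ)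
      show "(\<lambda>z. (ennreal (exp (\<theta> * (snd z - Rp (it z) (fst z)))) * disc (it z)) * injects n (snd z) (fst z)) \<in> borel_measurable MT" for n
        unfolding inj of_bool_def by simp
      show "0 \<le> snd z \<and> reach (snd z) (fst z) \<and> alive (it z) (fst z) \<longleftrightarrow> (\<exists>n::nat. injecting (real n) (snd z) (fst z))" for z
        using real_arch_simple[of "it z"] by (auto simp: inj)
    qed (auto simp: inj)
    then show ?thesis by (subst nn_integral_undershoot) (simp_all add: D_def[abs_def] mult.assoc)
  qed
  have lim1: "(\<lambda>n. ennreal (exp (\<theta> * a)) * B n + A n + C h n) \<longlonglongrightarrow> ennreal (exp (\<theta> * a)) * exit_transform + 0 + (\<integral>\<^sup>+y. ennreal (exp (\<theta> * y) * h y) \<partial>occupation)"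
    by (intro tendsto_add limA limC h ennreal_tendsto_cmult limB) simp
  have lim2: "(\<lambda>n. ennreal (exp (\<theta> * x)) + C (\<lambda>_. c1) n + ennreal \<theta> * D n) \<longlonglongrightarrow>
     ennreal (exp (\<theta> * x)) + (\<integral>\<^sup>+y. ennreal (exp (\<theta> * y) * c1) \<partial>occupation) + ennreal \<theta> * (\<integral>\<^sup>+y. ennreal (exp (\<theta> * y)) \<partial>undershoot)"
    by (intro tendsto_add limC tendsto_const ennreal_tendsto_cmult limD) simp_all
  have "ennreal (exp (\<theta> * a)) * exit_transform + 0 + (\<integral>\<^sup>+y. ennreal (exp (\<theta> * y) * h y) \<partial>occupation) =
     ennreal (exp (\<theta> * x)) + (\<integral>\<^sup>+y. ennreal (exp (\<theta> * y) * c1) \<partial>occupation) + ennreal \<theta> * (\<integral>\<^sup>+y. ennreal (exp (\<theta> * y)) \<partial>undershoot)"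
    by (rule LIMSEQ_unique[OF lim1[unfolded fin] lim2])
  then show ?thesis by (simp add: h_def)
qed

end

section \<open>The injection as a time change\<close>

lemma refraction_part_cong:
  assumes "\<And>u. 0 \<le> u \<Longrightarrow> v u = v' u"
  shows "refraction_part b \<delta> v t = refraction_part b \<delta> v' t"
  unfolding refraction_part_def
  by (intro arg_cong[where f = "\<lambda>y. \<delta> * y"] set_lebesgue_integral_cong) (use assms in auto)

lemma discounted_injection_cong:
  assumes f: "\<And>u. 0 \<le> u \<Longrightarrow> f u = f' u" and v: "\<And>u. 0 \<le> u \<Longrightarrow> v u = v' u"
  shows "discounted_injection b \<delta> q a f v = discounted_injection b \<delta> q a f' v'"
proof -
  have "reflection_part b \<delta> f v = reflection_part b \<delta> f' v'"
    using f v refraction_part_cong[of v v' b \<delta>] by (auto simp: fun_eq_iff reflection_part_def)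
  moreover have "{t. 0 < t \<and> a < v t} = {t. 0 < t \<and> a < v' t}" using v by auto
  ultimately show ?thesis by (simp add: discounted_injection_def first_time_after_def)
qed

context injected_path begin

definition "clamped_inj_time r = (if reached r then inj_time r else 0)"

lemma clamped_inj_time_measurable[measurable]: "clamped_inj_time \<in> borel_measurable borel"
  using inj_time_measurable(2) by (simp add: clamped_inj_time_def[abs_def])

lemma emeasure_lborel_between:
  assumes "{l<..<u} \<subseteq> A" "A \<subseteq> {l..u}" "l \<le> u" "A \<in> sets borel"
  shows "emeasure lborel A = ennreal (u - l)"
proof (rule antisym)
  show "emeasure lborel A \<le> ennreal (u - l)" using emeasure_mono[OF assms(2), of lborel] assms(3) by simp
  show "ennreal (u - l) \<le> emeasure lborel A" using emeasure_mono[OF assms(1), of lborel] assms(3,4) by simp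
qed

text \<open>The Stieltjes measure of a nondecreasing function is the image of Lebesgue measure on
  the levels under the generalised inverse: the levels whose injection time falls in (s, t] fill the
  interval from the value at s to the value at t up to end points. The atom at time 0 arises from
  the levels below \<open>R 0\<close>, all of which have injection time 0.\<close>

lemma interval_measure_time_change:
  "interval_measure (reflection_part b \<delta> f v)
     = distr (density lborel (indicator {r. 0 \<le> r \<and> reached r})) borel clamped_inj_time" (is "_ = ?N")
proof -
  define \<rho> where "\<rho> = reflection_part b \<delta> f v"
  have \<rho>: "\<rho> t = (if t < 0 then 0 else R t)" for t by (simp add: \<rho>_def reflection_part_def R_def L_def)
  have \<rho>_mono: "\<rho> s \<le> \<rho> t" if "s \<le> t" for s t using that R_mono R_nonneg by (auto simp: \<rho>)
  have \<rho>_rc: "continuous (at_right t) \<rho>" for t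
  proof -
    have "\<forall>\<^sub>F s in at_right t. (if t < 0 then 0 else R s) = \<rho> s"
    proof (cases "t < 0")
      case True
      then show ?thesis by (auto simp: \<rho> eventually_at_right_field intro!: exI[of _ 0])
    next
      case False
      then show ?thesis by (auto simp: \<rho> eventually_at_right_field intro!: exI[of _ "t + 1"])
    qed
    moreover have "((\<lambda>s. if t < 0 then 0 else R s) \<longlongrightarrow> \<rho> t) (at_right t)"
      using R_right_continuous[of t] by (auto simp: \<rho> continuous_within)
    ultimately show ?thesis unfolding continuous_within by (rule Lim_transform_eventually[rotated])
  qed
  have [measurable]: "{r. 0 \<le> r \<and> reached r} \<in> sets borel" by measurable
  have N: "emeasure ?N {s<..t} = ennreal (\<rho> t - \<rho> s)" if st: "s \<le> t" for s t
  proof -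
    define A where "A = {r. 0 \<le> r \<and> reached r \<and> clamped_inj_time r \<in> {s<..t}}"
    have Am: "A \<in> sets borel" unfolding A_def by measurable
    have [measurable]: "clamped_inj_time -` {s<..t} \<in> sets borel"
      using measurable_sets[OF clamped_inj_time_measurable, of "{s<..t}"] by simp
    have "emeasure ?N {s<..t} = (\<integral>\<^sup>+r. indicator {r. 0 \<le> r \<and> reached r} r * indicator (clamped_inj_time -` {s<..t}) r \<partial>lborel)"
      by (subst emeasure_distr, simp, simp, subst emeasure_density) auto
    also have "\<dots> = (\<integral>\<^sup>+r. indicator A r \<partial>lborel)"
      by (intro nn_integral_cong) (auto simp: A_def indicator_def)
    also have "\<dots> = emeasure lborel A" using Am by simp
    also have "\<dots> = ennreal (\<rho> t - \<rho> s)"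
    proof (rule emeasure_lborel_between[OF _ _ \<rho>_mono[OF st] Am])
      show "A \<subseteq> {\<rho> s..\<rho> t}"
      proof
        fix r assume "r \<in> A"
        then have r: "0 \<le> r" "reached r" "s < inj_time r" "inj_time r \<le> t" by (auto simp: A_def clamped_inj_time_def)
        have "0 \<le> t" using inj_time_nonneg[OF r(2)] r(4) by simp
        moreover have "r \<le> R t" using R_at_inj_time[OF r(2)] R_mono[OF r(4)] by simp
        moreover have "\<rho> s \<le> r" using R_before_inj_time[OF _ r(3)] r(1) by (simp add: \<rho>)
        ultimately show "r \<in> {\<rho> s..\<rho> t}" by (simp add: \<rho>)
      qed
      show "{\<rho> s<..<\<rho> t} \<subseteq> A"
      proof
        fix r assume "r \<in> {\<rho> s<..<\<rho> t}"
        then have r: "\<rho> s < r" "r < \<rho> t" by auto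
        have "0 \<le> \<rho> s" using R_nonneg[of s] by (simp add: \<rho>)
        then have r0: "0 \<le> r" using r by simp
        have t0: "0 \<le> t" using r r0 by (simp add: \<rho> split: if_splits)
        then have rt: "r < R t" using r by (simp add: \<rho>)
        then have rr: "reached r" using t0 unfolding reached_def by blast
        have "s < inj_time r"
        proof (cases "s < 0")
          case True
          then show ?thesis using inj_time_nonneg[OF rr] by simp
        next
          case False
          then have "R s < r" using r by (simp add: \<rho>)
          then show ?thesis using R_at_inj_time[OF rr] R_mono[of "inj_time r" s] by (meson not_less order_trans less_le_trans)
        qed
        then show "r \<in> A" using r0 rr inj_time_le[OF t0 rt] by (simp add: A_def clamped_inj_time_def)
      qed
    qed
    finally show ?thesis .
  qed
  have I: "emeasure (interval_measure \<rho>) {s<..t} = ennreal (\<rho> t - \<rho> s)" if "s \<le> t" for s t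
    by (rule emeasure_interval_measure_Ioc[OF that]) (use \<rho>_mono \<rho>_rc in auto)
  have "interval_measure \<rho> = ?N"
  proof (rule measure_eqI_generator_eq[where E = "range (\<lambda>(s, t). {s<..t :: real})" and A = "\<lambda>n. {- real n<..real n}" and \<Omega> = UNIV])
    show "Int_stable (range (\<lambda>(s, t). {s<..t :: real}))"
      by (auto simp: Int_stable_def)
    show "sets (interval_measure \<rho>) = sigma_sets UNIV (range (\<lambda>(s, t). {s<..t :: real}))" "sets ?N = sigma_sets UNIV (range (\<lambda>(s, t). {s<..t :: real}))"
      by (simp_all add: borel_sigma_sets_Ioc)
    show "emeasure (interval_measure \<rho>) B = emeasure ?N B" if "B \<in> range (\<lambda>(s, t). {s<..t :: real})" for B
    proof -
      from that obtain s t where B: "B = {s<..t}" by auto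
      show ?thesis
      proof (cases "s \<le> t")
        case True
        show ?thesis unfolding B I[OF True] N[OF True] by (rule refl)
      qed (simp add: B)
    qed
    show "(\<Union>n. {- real n<..real n}) = UNIV"
    proof -
      have "\<exists>n. y \<in> {- real n<..real n}" for y
      proof -
        obtain n where "\<bar>y\<bar> < real n" using reals_Archimedean2 by blast
        then show ?thesis by (intro exI[of _ n]) auto
      qed
      then show ?thesis by blast
    qed
    show "emeasure (interval_measure \<rho>) {- real n<..real n} \<noteq> \<infinity>" for n by (subst I) auto
  qed auto
  then show ?thesis by (simp add: \<rho>_def)
qed

text \<open>Rewriting the path integral over time as one over levels makes it the integrand of the
  total mass of \<open>undershoot\<close>.\<close>

lemma discounted_injection_eq:
  "discounted_injection b \<delta> q a f v
     = (\<integral>\<^sup>+r. ennreal (exp (- q * clamped_inj_time r)) * of_bool (0 \<le> r \<and> reached r \<and> \<not> (exits \<and> exit_time < clamped_inj_time r)) \<partial>lborel)"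
proof -
  define S where "S = {t. 0 \<le> t \<and> ereal t \<le> first_time_after 0 (\<lambda>t. a < v t)}"
  have [measurable]: "S \<in> sets borel" "{r. 0 \<le> r \<and> reached r} \<in> sets borel" unfolding S_def by measurable
  have S_iff: "t \<in> S \<longleftrightarrow> \<not> (exits \<and> exit_time < t)" if "0 \<le> t" for t
  proof -
    have "t \<in> S \<longleftrightarrow> (\<forall>s. 0 < s \<and> a < v s \<longrightarrow> t \<le> s)" using that by (auto simp: S_def first_time_after_def le_Inf_iff)
    also have "\<dots> \<longleftrightarrow> \<not> (exits \<and> exit_time < t)"
    proof
      assume l: "\<forall>s. 0 < s \<and> a < v s \<longrightarrow> t \<le> s"
      have "t \<le> exit_time" if exits
        unfolding exit_time_def using that l by (intro cInf_greatest) (auto simp: exits_def)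
      then show "\<not> (exits \<and> exit_time < t)" by auto
    next
      assume "\<not> (exits \<and> exit_time < t)"
      then show "\<forall>s. 0 < s \<and> a < v s \<longrightarrow> t \<le> s" using exit_time_le by (force simp: exits_def)
    qed
    finally show ?thesis .
  qed
  have "discounted_injection b \<delta> q a f v = (\<integral>\<^sup>+t. ennreal (exp (- q * t)) * indicator S t \<partial>interval_measure (reflection_part b \<delta> f v))"
    by (simp add: discounted_injection_def S_def)
  also have "\<dots> = (\<integral>\<^sup>+r. indicator {r. 0 \<le> r \<and> reached r} r * (ennreal (exp (- q * clamped_inj_time r)) * indicator S (clamped_inj_time r)) \<partial>lborel)"
    unfolding interval_measure_time_change
    by (subst nn_integral_distr, simp, simp, subst nn_integral_density) auto
  also have "\<dots> = (\<integral>\<^sup>+r. ennreal (exp (- q * clamped_inj_time r)) * of_bool (0 \<le> r \<and> reached r \<and> \<not> (exits \<and> exit_time < clamped_inj_time r)) \<partial>lborel)"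
  proof (rule nn_integral_cong)
    fix r
    have "0 \<le> clamped_inj_time r" using inj_time_nonneg by (simp add: clamped_inj_time_def)
    then show "indicator {r. 0 \<le> r \<and> reached r} r * (ennreal (exp (- q * clamped_inj_time r)) * indicator S (clamped_inj_time r))
      = ennreal (exp (- q * clamped_inj_time r)) * of_bool (0 \<le> r \<and> reached r \<and> \<not> (exits \<and> exit_time < clamped_inj_time r))"
      using S_iff by (auto simp: indicator_def)
  qed
  finally show ?thesis .
qed

end

section \<open>Paths of the refracted-reflected process\<close>

locale spectrally_negative_path =
  fixes f :: "real \<Rightarrow> real"
  assumes right_cont: "\<And>t. 0 \<le> t \<Longrightarrow> continuous (at_right t) f"
    and left_lim: "\<And>t. 0 < t \<Longrightarrow> \<exists>l. (f \<longlongrightarrow> l) (at_left t)"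
    and no_up_jump: "\<And>t l. 0 < t \<Longrightarrow> (f \<longlongrightarrow> l) (at_left t) \<Longrightarrow> f t \<le> l"
begin

lemma near_right:
  assumes "0 \<le> t" "0 < e"
  shows "\<exists>\<eta>>0. \<forall>u. t \<le> u \<and> u < t + \<eta> \<longrightarrow> \<bar>f u - f t\<bar> < e"
proof -
  have "\<forall>\<^sub>F u in at_right t. dist (f u) (f t) < e"
    using right_cont[OF assms(1)] assms(2) by (auto simp: continuous_within intro: tendstoD)
  then obtain d where d: "d > t" "\<And>u. t < u \<Longrightarrow> u < d \<Longrightarrow> \<bar>f u - f t\<bar> < e"
    by (auto simp: eventually_at_right_field dist_real_def)
  show ?thesis
  proof (intro exI[of _ "d - t"] conjI allI impI)
    fix u assume "t \<le> u \<and> u < t + (d - t)"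
    then show "\<bar>f u - f t\<bar> < e" using d(2)[of u] assms(2) by (cases "u = t") auto
  qed (use d in simp)
qed

lemma near_left:
  assumes "0 < t" "0 < e"
  shows "\<exists>\<eta>>0. \<eta> \<le> t \<and> (\<forall>u w. t - \<eta> < u \<and> u < t \<and> t - \<eta> < w \<and> w < t \<longrightarrow> \<bar>f u - f w\<bar> < e) \<and> (\<forall>u. t - \<eta> < u \<and> u < t \<longrightarrow> f t \<le> f u + e)"
proof -
  obtain l where l: "(f \<longlongrightarrow> l) (at_left t)" using left_lim[OF assms(1)] by auto
  have "\<forall>\<^sub>F u in at_left t. dist (f u) l < e / 2"
    using tendstoD[OF l, of "e / 2"] assms(2) by simp
  then obtain d where d: "d < t" "\<And>u. d < u \<Longrightarrow> u < t \<Longrightarrow> \<bar>f u - l\<bar> < e / 2"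
    by (auto simp: eventually_at_left_field dist_real_def)
  have ftl: "f t \<le> l" by (rule no_up_jump[OF assms(1) l])
  show ?thesis
  proof (intro exI[of _ "min t (t - d)"] conjI allI impI)
    show "\<bar>f u - f w\<bar> < e" if "t - min t (t - d) < u \<and> u < t \<and> t - min t (t - d) < w \<and> w < t" for u w
    proof -
      have "\<bar>f u - l\<bar> < e / 2" "\<bar>f w - l\<bar> < e / 2" using d(2)[of u] d(2)[of w] that by (auto simp: min_def split: if_splits)
      then show ?thesis unfolding abs_less_iff by linarith
    qed
    show "f t \<le> f u + e" if "t - min t (t - d) < u \<and> u < t" for u
    proof -
      have "\<bar>f u - l\<bar> < e / 2" using d(2)[of u] that by (auto simp: min_def split: if_splits)
      then show ?thesis using ftl assms(2) unfolding abs_less_iff by linarith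
    qed
  qed (use d assms in auto)
qed

text \<open>One-sided limits bound the path near each time, and bisection glues the local bounds.
  This makes the supremum in the reflected path finite.\<close>

lemma bounded_on:
  assumes "0 \<le> s" "s \<le> t"
  shows "\<exists>C. \<forall>u. s \<le> u \<and> u \<le> t \<longrightarrow> \<bar>f u\<bar> \<le> C"
proof -
  have "0 \<le> s \<longrightarrow> (\<exists>C. \<forall>u. s \<le> u \<and> u \<le> t \<longrightarrow> \<bar>f u\<bar> \<le> C)"
    using assms(2)
  proof (induction rule: Bolzano)
    case (trans a c d)
    show ?case
    proof
      assume "0 \<le> a"
      then obtain C1 C2 where "\<forall>u. a \<le> u \<and> u \<le> c \<longrightarrow> \<bar>f u\<bar> \<le> C1" "\<forall>u. c \<le> u \<and> u \<le> d \<longrightarrow> \<bar>f u\<bar> \<le> C2"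
        using trans by auto
      then have "\<bar>f u\<bar> \<le> max C1 C2" if "a \<le> u \<and> u \<le> d" for u
        using that by (cases "u \<le> c") (auto simp: le_max_iff_disj)
      then show "\<exists>C. \<forall>u. a \<le> u \<and> u \<le> d \<longrightarrow> \<bar>f u\<bar> \<le> C" by blast
    qed
  next
    case (local z)
    then have z: "0 \<le> z" using assms by simp
    obtain \<eta>1 where \<eta>1: "\<eta>1 > 0" "\<And>u. z \<le> u \<Longrightarrow> u < z + \<eta>1 \<Longrightarrow> \<bar>f u - f z\<bar> < 1"
      using near_right[OF z, of 1] by auto
    have "\<exists>\<eta>2>0. \<exists>C. \<forall>u. 0 \<le> u \<and> z - \<eta>2 < u \<and> u < z \<longrightarrow> \<bar>f u\<bar> \<le> C"
    proof (cases "z = 0")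
      case False
      then have "0 < z" using z by simp
      then obtain \<eta>2 where \<eta>2: "\<eta>2 > 0" "\<And>u w. z - \<eta>2 < u \<Longrightarrow> u < z \<Longrightarrow> z - \<eta>2 < w \<Longrightarrow> w < z \<Longrightarrow> \<bar>f u - f w\<bar> < 1"
        using near_left[of z 1] by auto
      have "\<bar>f u\<bar> \<le> \<bar>f (z - \<eta>2 / 2)\<bar> + 1" if "z - \<eta>2 < u" "u < z" for u
        using \<eta>2(2)[of u "z - \<eta>2 / 2"] that \<eta>2(1) by simp
      then show ?thesis using \<eta>2(1) by blast
    qed (auto intro: exI[of _ 1])
    then obtain \<eta>2 C where \<eta>2: "\<eta>2 > 0" "\<And>u. 0 \<le> u \<Longrightarrow> z - \<eta>2 < u \<Longrightarrow> u < z \<Longrightarrow> \<bar>f u\<bar> \<le> C" by auto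
    show ?case
    proof (rule exI[of _ "min \<eta>1 \<eta>2"], intro conjI allI impI)
      fix a d assume ad: "a \<le> z \<and> z \<le> d \<and> d - a < min \<eta>1 \<eta>2" and "0 \<le> a"
      have "\<bar>f u\<bar> \<le> max C (\<bar>f z\<bar> + 1)" if u: "a \<le> u" "u \<le> d" for u
      proof (cases "u < z")
        case True then show ?thesis using \<eta>2(2)[of u] u ad \<open>0 \<le> a\<close> by auto
      next
        case False then show ?thesis using \<eta>1(2)[of u] u ad by auto
      qed
      then show "\<exists>C. \<forall>u. a \<le> u \<and> u \<le> d \<longrightarrow> \<bar>f u\<bar> \<le> C" by blast
    qed (use \<eta>1(1) \<eta>2(1) in simp)
  qed
  then show ?thesis using assms by simp
qed

text \<open>The Skorokhod regulator at 0 of the path restarted at time \<open>s\<close>: the least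
  nondecreasing push that keeps it nonnegative.\<close>

definition m where "m s t = (SUP u\<in>{s..t}. max (- (f u - f s)) 0)"

lemma reflected_path_eq: "reflected_path f s t = (f t - f s) + m s t"
  by (simp add: reflected_path_def m_def)

lemma m_bdd: "0 \<le> s \<Longrightarrow> bdd_above ((\<lambda>u. max (- (f u - f s)) 0) ` {s..t})"
proof -
  assume s: "0 \<le> s"
  show ?thesis
  proof (cases "s \<le> t")
    case True
    then obtain C where C: "\<And>u. s \<le> u \<Longrightarrow> u \<le> t \<Longrightarrow> \<bar>f u\<bar> \<le> C" using bounded_on s by blast
    have "max (- (f u - f s)) 0 \<le> 2 * C" if "u \<in> {s..t}" for u
      using C[of u] C[of s] that True by auto
    then show ?thesis by (intro bdd_aboveI2) auto
  qed simp
qed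

lemma m_ge: "0 \<le> s \<Longrightarrow> s \<le> u \<Longrightarrow> u \<le> t \<Longrightarrow> f s - f u \<le> m s t"
  unfolding m_def using cSUP_upper[OF _ m_bdd, of u s t] by auto

lemma m_nonneg: "0 \<le> s \<Longrightarrow> s \<le> t \<Longrightarrow> 0 \<le> m s t"
  using m_ge[of s s t] by simp

lemma m_le: "0 \<le> s \<Longrightarrow> s \<le> t \<Longrightarrow> 0 \<le> c \<Longrightarrow> (\<And>u. s \<le> u \<Longrightarrow> u \<le> t \<Longrightarrow> f s - f u \<le> c) \<Longrightarrow> m s t \<le> c"
  unfolding m_def by (rule cSUP_least) auto

lemma m_mono: "0 \<le> s \<Longrightarrow> s \<le> u \<Longrightarrow> u \<le> t \<Longrightarrow> m s u \<le> m s t"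
  using m_le[of s u "m s t"] m_ge[of s _ t] m_nonneg[of s t] by force

lemma m_refl: "0 \<le> s \<Longrightarrow> m s s = 0"
  using m_le[of s s 0] m_nonneg[of s s] by force

lemma m_extend: "0 \<le> s \<Longrightarrow> s \<le> u \<Longrightarrow> u \<le> t \<Longrightarrow> m s u \<le> c \<Longrightarrow> (\<And>w. u < w \<Longrightarrow> w \<le> t \<Longrightarrow> f s - f w \<le> c) \<Longrightarrow> m s t \<le> c"
  using m_nonneg[of s u] m_ge[of s _ u] by (intro m_le) (force, force, force, metis linorder_not_le order_trans)

lemma reflected_nonneg: "0 \<le> s \<Longrightarrow> s \<le> t \<Longrightarrow> 0 \<le> reflected_path f s t"
  using m_ge[of s t t] by (simp add: reflected_path_eq)

lemma reflected_start: "0 \<le> s \<Longrightarrow> reflected_path f s s = 0"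
  by (simp add: reflected_path_eq m_refl)

lemma reflected_near_right:
  assumes s: "0 \<le> s" "s \<le> t" and e: "0 < e"
  shows "\<exists>\<eta>>0. \<forall>u. t \<le> u \<and> u < t + \<eta> \<longrightarrow> \<bar>reflected_path f s u - reflected_path f s t\<bar> < e"
proof -
  obtain \<eta> where \<eta>: "\<eta> > 0" "\<And>u. t \<le> u \<Longrightarrow> u < t + \<eta> \<Longrightarrow> \<bar>f u - f t\<bar> < e / 2"
    using near_right[of t "e / 2"] s e by auto
  have "\<bar>reflected_path f s u - reflected_path f s t\<bar> < e" if u: "t \<le> u" "u < t + \<eta>" for u
  proof -
    have "m s u \<le> m s t + e / 2"
    proof (rule m_extend[OF s u(1)])
      fix w assume "t < w" "w \<le> u"
      then have "\<bar>f w - f t\<bar> < e / 2" using \<eta>(2)[of w] u by simp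
      then show "f s - f w \<le> m s t + e / 2" using m_ge[OF s order_refl] unfolding abs_less_iff by linarith
    qed (use e in simp)
    moreover have "m s t \<le> m s u" by (rule m_mono) (use s u in auto)
    ultimately show ?thesis using \<eta>(2)[OF u] unfolding reflected_path_eq abs_less_iff by linarith
  qed
  then show ?thesis using \<eta>(1) by blast
qed

lemma running_sup_flat_right:
  assumes s: "0 \<le> s" "s \<le> t" and pos: "0 < reflected_path f s t"
  shows "\<exists>\<eta>>0. \<forall>u. t \<le> u \<and> u < t + \<eta> \<longrightarrow> m s u = m s t"
proof -
  obtain \<eta> where \<eta>: "\<eta> > 0" "\<And>u. t \<le> u \<Longrightarrow> u < t + \<eta> \<Longrightarrow> \<bar>f u - f t\<bar> < reflected_path f s t"
    using near_right[of t "reflected_path f s t"] s pos by auto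
  have "m s u = m s t" if u: "t \<le> u" "u < t + \<eta>" for u
  proof (rule antisym)
    show "m s u \<le> m s t"
    proof (rule m_extend[OF s u(1)])
      fix w assume "t < w" "w \<le> u"
      then show "f s - f w \<le> m s t" using \<eta>(2)[of w] u by (auto simp: reflected_path_eq)
    qed simp
  qed (rule m_mono, use s u in auto)
  then show ?thesis using \<eta>(1) by blast
qed

text \<open>Without upward jumps, \<open>f\<close> just before \<open>t\<close> is below
  \<open>f t\<close> by at most half of the reflected value, so it stays away from the running
  minimum there and the regulator has no occasion to grow.\<close>

lemma running_sup_flat_left:
  assumes s: "0 \<le> s" "s < t" and pos: "0 < reflected_path f s t"
  shows "\<exists>\<eta>>0. \<forall>u. s \<le> u \<and> t - \<eta> < u \<and> u \<le> t \<longrightarrow> m s u = m s t"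
proof -
  let ?e = "reflected_path f s t / 2"
  obtain \<eta> where \<eta>: "\<eta> > 0" "\<And>u. t - \<eta> < u \<Longrightarrow> u < t \<Longrightarrow> f t \<le> f u + ?e"
    using near_left[of t ?e] s pos by auto
  have "m s u = m s t" if u: "s \<le> u" "t - \<eta> < u" "u \<le> t" for u
  proof (rule antisym)
    show "m s t \<le> m s u"
    proof -
      have "m s t \<le> max (m s u) (m s t - ?e)"
      proof (rule m_extend[OF s(1) u(1,3)])
        fix w assume w: "u < w" "w \<le> t"
        have "f t \<le> f w + ?e" using \<eta>(2)[of w] w u pos by (cases "w = t") auto
        then have "f s - f w \<le> m s t - ?e" by (simp add: reflected_path_eq field_simps)
        then show "f s - f w \<le> max (m s u) (m s t - ?e)" by simp
      qed simp
      then show ?thesis using pos by (auto simp: max_def split: if_splits)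
    qed
  qed (rule m_mono, use s u in auto)
  then show ?thesis using \<eta>(1) by blast
qed

text \<open>The reflected path has no upward jumps either: where it is positive the regulator is
  constant just before, and \<open>f\<close> does not jump up. Hence \<open>b\<close> is reached
  without overshoot.\<close>

lemma reflected_le_of_before:
  assumes s: "0 \<le> s" "s < t" and le: "\<And>u. s \<le> u \<Longrightarrow> u < t \<Longrightarrow> reflected_path f s u \<le> c" and c: "0 \<le> c"
  shows "reflected_path f s t \<le> c"
proof (rule ccontr)
  let ?U = "reflected_path f s"
  assume "\<not> ?U t \<le> c"
  then have gt: "c < ?U t" by simp
  then obtain \<eta>1 where \<eta>1: "\<eta>1 > 0" "\<And>u. s \<le> u \<Longrightarrow> t - \<eta>1 < u \<Longrightarrow> u \<le> t \<Longrightarrow> m s u = m s t"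
    using running_sup_flat_left[OF s] c by auto
  obtain \<eta>2 where \<eta>2: "\<eta>2 > 0" "\<And>u. t - \<eta>2 < u \<Longrightarrow> u < t \<Longrightarrow> f t \<le> f u + (?U t - c) / 2"
    using near_left[of t "(?U t - c) / 2"] s gt by auto
  define u where "u = max s (t - min \<eta>1 \<eta>2 / 2)"
  have u: "s \<le> u" "u < t" "t - \<eta>1 < u" "t - \<eta>2 < u" using \<eta>1(1) \<eta>2(1) s by (auto simp: u_def max_def min_def)
  have "m s u = m s t" "f t \<le> f u + (?U t - c) / 2" using \<eta>1(2)[of u] \<eta>2(2)[of u] u by auto
  then have "?U t - ?U u \<le> (?U t - c) / 2" unfolding reflected_path_eq by linarith
  then show False using le[OF u(1,2)] gt by (simp add: field_simps)
qed

lemma extended_measurable: "(\<lambda>t. f (max 0 t)) \<in> borel_measurable borel"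
proof (rule right_continuous_borel_measurable)
  fix t :: real
  show "continuous (at_right t) (\<lambda>t. f (max 0 t))"
  proof (cases "0 \<le> t")
    case True
    have "\<forall>\<^sub>F u in at_right t. f u = f (max 0 u)"
      using True by (auto simp: eventually_at_right_field intro!: exI[of _ "t + 1"])
    then have "(f \<longlongrightarrow> f t) (at_right t) \<longleftrightarrow> ((\<lambda>u. f (max 0 u)) \<longlongrightarrow> f t) (at_right t)" by (rule tendsto_cong)
    then show ?thesis using right_cont[of t] True by (simp add: continuous_within)
  next
    case False
    have "\<forall>\<^sub>F u in at_right t. f (max 0 u) = f (max 0 t)"
      using False by (auto simp: eventually_at_right_field intro!: exI[of _ 0])
    then show ?thesis by (simp add: continuous_within tendsto_eventually)
  qed
qed

text \<open>The defining equation alone does not say that the indicator is integrable, and a Bochner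
  integral of a non-integrable function is 0 by convention. The integral is nevertheless piecewise
  monotone in its upper end: nondecreasing on the initial interval \<open>S\<close> where the
  indicator is integrable, and 0 beyond. So the solution is measurable, and the bounded indicator is
  integrable after all.\<close>

lemma refracted_measurable:
  assumes s: "0 \<le> s" and A: "refracted_path b \<delta> f s y A"
  shows "(\<lambda>t. if s \<le> t then A t else 0) \<in> borel_measurable borel"
proof -
  define I where "I t = (LINT u:{s..t}|lborel. indicator {b<..} (A u) :: real)" for t
  define S where "S = {t. s \<le> t \<and> set_integrable lborel {s..t} (\<lambda>u. indicator {b<..} (A u) :: real)}"
  have down: "u \<in> S" if "t \<in> S" "s \<le> u" "u \<le> t" for t u
    using that unfolding S_def by (auto intro: set_integrable_subset)
  have "mono (\<lambda>t. if t \<in> S \<or> t < s then 0 else 1 :: real)"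
    using down by (intro monoI) (auto simp: S_def)
  then have [measurable]: "(\<lambda>t. if t \<in> S \<or> t < s then 0 else 1 :: real) \<in> borel_measurable borel"
    by (rule borel_measurable_mono)
  have "S = {t \<in> space borel. (if t \<in> S \<or> t < s then 0 else 1 :: real) < 1 \<and> s \<le> t}" by (auto simp: S_def)
  also have "\<dots> \<in> sets borel" by measurable
  finally have S[measurable]: "S \<in> sets borel" .
  define J where "J t = (if s \<le> t then I t else 0)" for t
  have [measurable]: "J \<in> borel_measurable borel"
  proof (rule borel_measurable_piecewise_mono)
    show "countable {S, {..<s}, {s..} - S}" by simp
    show "\<Union> {S, {..<s}, {s..} - S} = UNIV" by auto
    fix C assume "C \<in> {S, {..<s}, {s..} - S}"
    then consider "C = S" | "C = {..<s}" | "C = {s..} - S" by auto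
    then show "mono_on C J"
    proof cases
      case 1
      show ?thesis
      proof (rule mono_onI)
        fix u t assume ut: "u \<in> C" "t \<in> C" "u \<le> t"
        then have "I u \<le> I t"
          unfolding I_def set_lebesgue_integral_def
          using 1 unfolding S_def set_integrable_def
          by (intro integral_mono) (auto simp: indicator_def)
        then show "J u \<le> J t" using ut 1 by (auto simp: J_def S_def)
      qed
    next
      case 2 then show ?thesis by (auto intro!: mono_onI simp: J_def)
    next
      case 3
      have "I t = 0" if "t \<in> {s..} - S" for t
        using that unfolding I_def S_def set_lebesgue_integral_def set_integrable_def
        by (auto intro: not_integrable_integral_eq)
      then show ?thesis using 3 by (auto intro!: mono_onI simp: J_def)
    qed
  qed auto
  have "(\<lambda>t. if s \<le> t then A t else 0) = (\<lambda>t. if s \<le> t then y + (f (max 0 t) - f s) - \<delta> * J t else 0)"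
    using A s unfolding refracted_path_def by (auto simp: fun_eq_iff J_def I_def)
  also have "\<dots> \<in> borel_measurable borel" using extended_measurable[measurable] by measurable
  finally show ?thesis .
qed

lemma refracted_increment:
  assumes s: "0 \<le> s" "s \<le> u" "u \<le> t" and A: "refracted_path b \<delta> f s y A"
  shows "A t - A u = (f t - f u) - \<delta> * (LINT w:{u..t}|lborel. indicator {b<..} (A w))"
proof -
  note [measurable] = refracted_measurable[OF s(1) A]
  let ?A = "\<lambda>w. if s \<le> w then A w else 0"
  let ?i = "\<lambda>w. indicator {b<..} (?A w) :: real"
  have int: "set_integrable lborel {c..d} ?i" for c d
    by (rule set_integrable_bounded[where C = 1]) (auto simp: indicator_def)
  have eq: "(LINT w:{c..d}|lborel. indicator {b<..} (A w)) = (LINT w:{c..d}|lborel. ?i w)" if "s \<le> c" for c d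
    by (rule set_lebesgue_integral_cong) (use that in auto)
  have "(LINT w:{s..t}|lborel. ?i w) = (LINT w:{s..u} \<union> {u<..t}|lborel. ?i w)"
    using s by (simp add: ivl_disj_un)
  also have "\<dots> = (LINT w:{s..u}|lborel. ?i w) + (LINT w:{u<..t}|lborel. ?i w)"
    by (rule set_integral_Un) (auto intro: set_integrable_subset[OF int[of u t]] int)
  also have "(LINT w:{u<..t}|lborel. ?i w) = (LINT w:{u..t}|lborel. ?i w)"
  proof (rule set_integral_cong_set)
    show "AE w in lborel. (w \<in> {u..t}) = (w \<in> {u<..t})"
      using AE_lborel_singleton[of u] by eventually_elim (use s in auto)
  qed (auto simp: set_borel_measurable_def)
  finally have "(LINT w:{s..t}|lborel. ?i w) - (LINT w:{s..u}|lborel. ?i w) = (LINT w:{u..t}|lborel. ?i w)" by simp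
  moreover have "A t - A u = (f t - f u) - \<delta> * ((LINT w:{s..t}|lborel. ?i w) - (LINT w:{s..u}|lborel. ?i w))"
  proof -
    have "A t = y + (f t - f s) - \<delta> * (LINT w:{s..t}|lborel. ?i w)" "A u = y + (f u - f s) - \<delta> * (LINT w:{s..u}|lborel. ?i w)"
      using A s eq[of s t] eq[of s u] unfolding refracted_path_def by auto
    then show ?thesis unfolding right_diff_distrib by linarith
  qed
  ultimately show ?thesis using eq[of u t] s by simp
qed

lemma indicator_integral_bounds:
  fixes g :: "real \<Rightarrow> real"
  assumes "g \<in> borel_measurable borel" "u \<le> t"
  shows "0 \<le> (LINT w:{u..t}|lborel. indicator {b<..} (g w) :: real)" "(LINT w:{u..t}|lborel. indicator {b<..} (g w) :: real) \<le> t - u"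
proof -
  note [measurable] = assms(1)
  show "0 \<le> (LINT w:{u..t}|lborel. indicator {b<..} (g w) :: real)"
    unfolding set_lebesgue_integral_def by (intro integral_nonneg_AE) auto
  have "(LINT w:{u..t}|lborel. indicator {b<..} (g w)) \<le> (LINT w:{u..t}|lborel. 1::real)"
    by (rule set_integral_mono) (auto intro!: set_integrable_bounded[where C = 1] simp: indicator_def)
  then show "(LINT w:{u..t}|lborel. indicator {b<..} (g w) :: real) \<le> t - u"
    using assms(2) by (simp add: set_lebesgue_integral_def)
qed

lemma refracted_near_right:
  assumes s: "0 \<le> s" "s \<le> t" and A: "refracted_path b \<delta> f s y A" and d: "0 \<le> \<delta>" and e: "0 < e"
  shows "\<exists>\<eta>>0. \<forall>u. t \<le> u \<and> u < t + \<eta> \<longrightarrow> \<bar>A u - A t\<bar> < e"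
proof -
  obtain \<eta> where \<eta>: "\<eta> > 0" "\<And>u. t \<le> u \<Longrightarrow> u < t + \<eta> \<Longrightarrow> \<bar>f u - f t\<bar> < e / 2"
    using near_right[of t "e / 2"] s e by auto
  \<comment> \<open>Within time \<eta>' the refraction moves the path by at most \<delta> \<eta>' <
    e / 2; the summand 1 avoids a division by 0 when \<delta> = 0.\<close>
  define \<eta>' where "\<eta>' = min \<eta> (e / (2 * (\<delta> + 1)))"
  have \<eta>': "\<eta>' > 0" "\<delta> * \<eta>' < e / 2"
  proof -
    show "\<eta>' > 0" using \<eta> e d by (simp add: \<eta>'_def)
    have "(\<delta> + 1) * \<eta>' \<le> (\<delta> + 1) * (e / (2 * (\<delta> + 1)))" using d by (intro mult_left_mono) (auto simp: \<eta>'_def)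
    also have "\<dots> = e / 2" using d by (simp add: field_simps)
    finally show "\<delta> * \<eta>' < e / 2" using \<open>\<eta>' > 0\<close> by (simp add: algebra_simps)
  qed
  have "\<bar>A u - A t\<bar> < e" if u: "t \<le> u" "u < t + \<eta>'" for u
  proof -
    let ?I = "LINT w:{t..u}|lborel. indicator {b<..} (A w) :: real"
    have "?I = (LINT w:{t..u}|lborel. indicator {b<..} (if s \<le> w then A w else 0))"
      by (rule set_lebesgue_integral_cong) (use s in auto)
    then have "0 \<le> ?I" "?I \<le> u - t" using indicator_integral_bounds[OF refracted_measurable[OF s(1) A] u(1)] by auto
    then have "0 \<le> \<delta> * ?I" "\<delta> * ?I \<le> \<delta> * \<eta>'" using d u by (auto intro!: mult_left_mono)
    moreover have "\<bar>f u - f t\<bar> < e / 2" using \<eta>(2)[of u] u by (simp add: \<eta>'_def)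
    ultimately show ?thesis
      using refracted_increment[OF s u(1) A] \<eta>'(2) unfolding abs_less_iff by linarith
  qed
  then show ?thesis using \<eta>'(1) by blast
qed

end

lemma first_time_after_ge: "ereal s \<le> first_time_after s P"
  unfolding first_time_after_def by (rule Inf_greatest) auto

lemma not_before_first_time: "s < t \<Longrightarrow> ereal t < first_time_after s P \<Longrightarrow> \<not> P t"
  using Inf_lower[of "ereal t" "ereal ` {t. s < t \<and> P t}"] by (auto simp: first_time_after_def)

lemma hits_after_first_time:
  assumes "first_time_after s P < ereal d"
  shows "\<exists>t. s < t \<and> t < d \<and> P t"
  using assms unfolding first_time_after_def Inf_less_iff by auto

lemma indicator_integral_split:
  fixes g :: "real \<Rightarrow> real"
  assumes [measurable]: "g \<in> borel_measurable borel" and "s \<le> u" "u \<le> t"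
  shows "(LINT w:{s..t}|lborel. indicator {b<..} (g w) :: real) = (LINT w:{s..u}|lborel. indicator {b<..} (g w)) + (LINT w:{u..t}|lborel. indicator {b<..} (g w))"
proof -
  have int: "set_integrable lborel {c..d} (\<lambda>w. indicator {b<..} (g w) :: real)" for c d
    by (rule set_integrable_bounded[where C = 1]) (auto simp: indicator_def)
  have "(LINT w:{s..t}|lborel. indicator {b<..} (g w) :: real) = (LINT w:{s..u} \<union> {u<..t}|lborel. indicator {b<..} (g w))"
    using assms by (simp add: ivl_disj_un)
  also have "\<dots> = (LINT w:{s..u}|lborel. indicator {b<..} (g w)) + (LINT w:{u<..t}|lborel. indicator {b<..} (g w))"
    by (rule set_integral_Un) (auto intro: set_integrable_subset[OF int[of u t]] int)
  also have "(LINT w:{u<..t}|lborel. indicator {b<..} (g w) :: real) = (LINT w:{u..t}|lborel. indicator {b<..} (g w))"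
  proof (rule set_integral_cong_set)
    show "AE w in lborel. (w \<in> {u..t}) = (w \<in> {u<..t})"
      using AE_lborel_singleton[of u] by eventually_elim (use assms in auto)
  qed (auto simp: set_borel_measurable_def)
  finally show ?thesis .
qed

lemma right_continuousI:
  fixes g :: "real \<Rightarrow> real"
  assumes "\<And>e. 0 < e \<Longrightarrow> \<exists>\<eta>>0. \<forall>u. t \<le> u \<and> u < t + \<eta> \<longrightarrow> \<bar>g u - g t\<bar> < e"
  shows "continuous (at_right t) g"
  unfolding continuous_within
proof (rule tendstoI)
  fix e :: real assume "0 < e"
  then obtain \<eta> where "\<eta> > 0" "\<And>u. t \<le> u \<Longrightarrow> u < t + \<eta> \<Longrightarrow> \<bar>g u - g t\<bar> < e" using assms by blast
  then show "\<forall>\<^sub>F u in at_right t. dist (g u) (g t) < e"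
    by (auto simp: eventually_at_right_field dist_real_def intro!: exI[of _ "t + \<eta>"])
qed

lemma right_continuous_extend:
  assumes "\<And>t. 0 \<le> t \<Longrightarrow> continuous (at_right t) (g :: real \<Rightarrow> real)"
  shows "continuous (at_right t) (\<lambda>t. g (max 0 t))"
proof (cases "0 \<le> t")
  case True
  have "\<forall>\<^sub>F u in at_right t. g u = g (max 0 u)"
    using True by (auto simp: eventually_at_right_field intro!: exI[of _ "t + 1"])
  then have "(g \<longlongrightarrow> g t) (at_right t) \<longleftrightarrow> ((\<lambda>u. g (max 0 u)) \<longlongrightarrow> g t) (at_right t)" by (rule tendsto_cong)
  then show ?thesis using assms[of t] True by (simp add: continuous_within)
next
  case False
  have "\<forall>\<^sub>F u in at_right t. g (max 0 u) = g (max 0 t)"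
    using False by (auto simp: eventually_at_right_field intro!: exI[of _ 0])
  then show ?thesis by (simp add: continuous_within tendsto_eventually)
qed

section \<open>Decomposition of time into refracted and reflected pieces\<close>

locale refracted_reflected = spectrally_negative_path f for f :: "real \<Rightarrow> real" +
  fixes v :: "real \<Rightarrow> real" and b \<delta> x :: real
  assumes b: "0 < b" and \<delta>: "0 \<le> \<delta>" and f_zero: "f 0 = x"
    and rrp: "refracted_reflected_path b \<delta> x f v"
begin

lemma entry_times:
  "(enters_refracted b \<delta> x f s y \<longrightarrow> 0 \<le> s \<and> (y = b \<or> s = 0 \<and> y = x \<and> 0 \<le> x)) \<and> (enters_reflected b \<delta> x f s \<longrightarrow> 0 \<le> s)"
proof -
  have 1: "enters_refracted b \<delta> x f s y \<Longrightarrow> 0 \<le> s \<and> (y = b \<or> s = 0 \<and> y = x \<and> 0 \<le> x)"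
    and 2: "enters_reflected b \<delta> x f s \<Longrightarrow> 0 \<le> s" for s y
  proof (induction rule: enters_refracted_enters_reflected.inducts)
    case (to_reflected s y A s')
    then show ?case using first_time_after_ge[of s "\<lambda>t. A t < 0"] by (metis ereal_less_eq(3) order_trans)
  next
    case (to_refracted s s')
    then show ?case using first_time_after_ge[of s "\<lambda>t. reflected_path f s t > b"] by (metis ereal_less_eq(3) order_trans)
  qed auto
  show ?thesis using 1 2 by blast
qed

abbreviation U where "U \<equiv> reflected_path f"

text \<open>A piece determines \<open>v\<close> on the half-open interval from \<open>s\<close> to
  its end \<open>e\<close>, which may be infinite. A refracted piece can be degenerate, e = s, only
  when it starts at 0; later ones start at b > 0, and a reflected piece always has positive
  length.\<close>

definition refr_piece where
  "refr_piece s e A \<longleftrightarrow> enters_refracted b \<delta> x f s (A s) \<and> refracted_path b \<delta> f s (A s) A \<and>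
     e = first_time_after s (\<lambda>t. A t < 0) \<and> (\<forall>t\<ge>s. ereal t < e \<longrightarrow> v t = A t)"

definition refl_piece where
  "refl_piece s e \<longleftrightarrow> enters_reflected b \<delta> x f s \<and> e = first_time_after s (\<lambda>t. U s t > b) \<and>
     (\<forall>t\<ge>s. ereal t < e \<longrightarrow> v t = U s t)"

lemma refr_pieceD:
  assumes "refr_piece s e A"
  shows "0 \<le> s" "A s = b \<or> s = 0 \<and> A s = x" "0 \<le> A s" "ereal s \<le> e" "refracted_path b \<delta> f s (A s) A"
    "s \<le> t \<Longrightarrow> ereal t < e \<Longrightarrow> v t = A t" "s \<le> t \<Longrightarrow> ereal t < e \<Longrightarrow> 0 \<le> A t"
proof -
  have *: "enters_refracted b \<delta> x f s (A s)" "e = first_time_after s (\<lambda>t. A t < 0)" using assms by (auto simp: refr_piece_def)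
  show "0 \<le> s" "A s = b \<or> s = 0 \<and> A s = x" and As: "0 \<le> A s" using entry_times * b by force+
  show "ereal s \<le> e" using * first_time_after_ge by simp
  show "refracted_path b \<delta> f s (A s) A" "s \<le> t \<Longrightarrow> ereal t < e \<Longrightarrow> v t = A t" using assms by (auto simp: refr_piece_def)
  show "s \<le> t \<Longrightarrow> ereal t < e \<Longrightarrow> 0 \<le> A t"
    using not_before_first_time[of s t "\<lambda>t. A t < 0"] * As by (cases "t = s") auto
qed

lemma refl_pieceD:
  assumes "refl_piece s e"
  shows "0 \<le> s" "ereal s < e" "s \<le> t \<Longrightarrow> ereal t < e \<Longrightarrow> v t = U s t" "s \<le> t \<Longrightarrow> ereal t < e \<Longrightarrow> U s t \<le> b"
proof -
  have *: "enters_reflected b \<delta> x f s" and e: "e = first_time_after s (\<lambda>t. U s t > b)" using assms by (auto simp: refl_piece_def)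
  show s: "0 \<le> s" using entry_times * by blast
  obtain \<eta> where \<eta>: "\<eta> > 0" "\<And>u. s \<le> u \<Longrightarrow> u < s + \<eta> \<Longrightarrow> \<bar>U s u - U s s\<bar> < b"
    using reflected_near_right[OF s order_refl b] by blast
  show se: "ereal s < e"
  proof (rule ccontr)
    assume "\<not> ereal s < e"
    then have "e \<le> ereal s" by simp
    also have "ereal s < ereal (s + \<eta>)" using \<eta>(1) by simp
    finally have "e < ereal (s + \<eta>)" .
    then obtain t where "s < t" "t < s + \<eta>" "U s t > b" unfolding e using hits_after_first_time by blast
    then show False using \<eta>(2)[of t] reflected_start[OF s] by auto
  qed
  show "s \<le> t \<Longrightarrow> ereal t < e \<Longrightarrow> v t = U s t" using assms by (auto simp: refl_piece_def)
  show "s \<le> t \<Longrightarrow> ereal t < e \<Longrightarrow> U s t \<le> b"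
    using not_before_first_time[of s t "\<lambda>t. U s t > b"] e reflected_start[OF s] b by (cases "t = s") auto
qed

lemma refl_piece_start_v: "refl_piece s e \<Longrightarrow> v s = 0"
  using refl_pieceD(3)[of s e s] refl_pieceD(2)[of s e] refl_pieceD(1)[of s e] reflected_start[of s] by simp

lemma refr_piece_pos:
  assumes p: "refr_piece s e A" and "0 < A s"
  shows "ereal s < e"
proof (rule ccontr)
  assume "\<not> ereal s < e"
  obtain \<eta> where \<eta>: "\<eta> > 0" "\<And>u. s \<le> u \<Longrightarrow> u < s + \<eta> \<Longrightarrow> \<bar>A u - A s\<bar> < A s"
    using refracted_near_right[OF refr_pieceD(1)[OF p] order_refl refr_pieceD(5)[OF p] \<delta> assms(2)] by blast
  have "e \<le> ereal s" using \<open>\<not> ereal s < e\<close> by simp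
  also have "ereal s < ereal (s + \<eta>)" using \<eta>(1) by simp
  finally have "e < ereal (s + \<eta>)" .
  then obtain t where "s < t" "t < s + \<eta>" "A t < 0"
    using p hits_after_first_time[of s "\<lambda>t. A t < 0"] unfolding refr_piece_def by blast
  then show False using \<eta>(2)[of t] by auto
qed

lemma enters_refracted_piece:
  assumes "enters_refracted b \<delta> x f s y"
  shows "\<exists>e A. refr_piece s e A \<and> A s = y"
proof -
  obtain A where A: "refracted_path b \<delta> f s y A" "\<forall>t\<ge>s. ereal t < first_time_after s (\<lambda>t. A t < 0) \<longrightarrow> v t = A t"
    using rrp assms unfolding refracted_reflected_path_def by blast
  have "(LINT u:{s..s}|lborel. indicator {b<..} (A u) :: real) = 0"
    unfolding set_lebesgue_integral_def by (rule integral_eq_zero_AE) (use AE_lborel_singleton[of s] in eventually_elim, simp)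
  then have "A s = y" using A(1) by (auto simp: refracted_path_def)
  then show ?thesis using A assms by (auto simp: refr_piece_def)
qed

lemma enters_reflected_piece:
  assumes "enters_reflected b \<delta> x f s"
  shows "\<exists>e. refl_piece s e"
proof -
  have "\<forall>t\<ge>s. ereal t < first_time_after s (\<lambda>t. U s t > b) \<longrightarrow> v t = U s t"
    using rrp assms by (simp add: refracted_reflected_path_def)
  then show ?thesis using assms by (intro exI[of _ "first_time_after s (\<lambda>t. U s t > b)"]) (simp add: refl_piece_def)
qed

text \<open>The level at the end may be strictly negative after a jump; the reflected piece then
  restarts at 0, and the deficit is injected at once.\<close>

lemma refr_piece_end:
  assumes p: "refr_piece s (ereal r) A"
  shows "s \<le> r" "A r \<le> 0" "\<exists>e. refl_piece r e"
proof -
  show sr: "s \<le> r" using refr_pieceD(4)[OF p] by simp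
  show "A r \<le> 0"
  proof (rule ccontr)
    assume "\<not> A r \<le> 0"
    then obtain \<eta> where \<eta>: "\<eta> > 0" "\<And>u. r \<le> u \<Longrightarrow> u < r + \<eta> \<Longrightarrow> \<bar>A u - A r\<bar> < A r"
      using refracted_near_right[OF refr_pieceD(1)[OF p] sr refr_pieceD(5)[OF p] \<delta>, of "A r"] by auto
    have "first_time_after s (\<lambda>t. A t < 0) < ereal (r + \<eta>)" using p \<eta>(1) by (simp add: refr_piece_def eq_commute[of "ereal r"])
    then obtain t where t: "s < t" "t < r + \<eta>" "A t < 0" using hits_after_first_time by blast
    then show False using \<eta>(2)[of t] refr_pieceD(7)[OF p, of t] by (cases "t < r") auto
  qed
  have "enters_reflected b \<delta> x f r"
    using p unfolding refr_piece_def by (intro to_reflected[of b \<delta> x f s "A s" A r]) auto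
  then show "\<exists>e. refl_piece r e" by (rule enters_reflected_piece)
qed

text \<open>The reflected path cannot jump over \<open>b\<close>, so starting the next refracted
  piece at \<open>b\<close> creates no discontinuity.\<close>

lemma refl_piece_end:
  assumes p: "refl_piece s (ereal r)"
  shows "s < r" "U s r = b" "\<exists>e A. refr_piece r e A \<and> A r = b"
proof -
  show sr: "s < r" using refl_pieceD(2)[OF p] by simp
  note s = refl_pieceD(1)[OF p]
  show "U s r = b"
  proof (rule antisym)
    show "U s r \<le> b"
      by (rule reflected_le_of_before[OF s sr]) (use refl_pieceD(4)[OF p] b in auto)
    show "b \<le> U s r"
    proof (rule ccontr)
      assume "\<not> b \<le> U s r"
      then obtain \<eta> where \<eta>: "\<eta> > 0" "\<And>u. r \<le> u \<Longrightarrow> u < r + \<eta> \<Longrightarrow> \<bar>U s u - U s r\<bar> < b - U s r"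
        using reflected_near_right[OF s less_imp_le[OF sr], of "b - U s r"] by auto
      have "first_time_after s (\<lambda>t. U s t > b) < ereal (r + \<eta>)" using p \<eta>(1) by (simp add: refl_piece_def eq_commute[of "ereal r"])
      then obtain t where t: "s < t" "t < r + \<eta>" "U s t > b" using hits_after_first_time by blast
      then show False using \<eta>(2)[of t] refl_pieceD(4)[OF p, of t] by (cases "t < r") auto
    qed
  qed
  have "enters_refracted b \<delta> x f r b"
    using p unfolding refl_piece_def by (intro to_refracted[of b \<delta> x f s r]) auto
  then show "\<exists>e A. refr_piece r e A \<and> A r = b" by (rule enters_refracted_piece)
qed

definition piece where "piece s e \<longleftrightarrow> refl_piece s e \<or> (\<exists>A. refr_piece s e A)"

lemma piece_nonneg: "piece s e \<Longrightarrow> 0 \<le> s"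
  using refr_pieceD(1) refl_pieceD(1) by (auto simp: piece_def)

text \<open>The last clause says that of two consecutive pieces at least one is reflected, which is
  what excludes an accumulation of switching times.\<close>

lemma next_piece:
  assumes "piece s (ereal r)"
  shows "\<exists>e. piece r e \<and> ereal r < e \<and> (refl_piece s (ereal r) \<or> refl_piece r e)"
proof -
  consider (refl) "refl_piece s (ereal r)" | (refr) "\<exists>A. refr_piece s (ereal r) A"
    using assms by (auto simp: piece_def)
  then show ?thesis
  proof cases
    case p: refl
    then obtain e A where n: "refr_piece r e A" "A r = b" using refl_piece_end(3) by blast
    have "ereal r < e" by (rule refr_piece_pos[OF n(1)]) (use n(2) b in simp)
    then show ?thesis using n(1) p by (auto simp: piece_def)
  next
    case refr
    then obtain e where n: "refl_piece r e" using refr_piece_end(3) by blast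
    then show ?thesis using refl_pieceD(2)[OF n] by (auto simp: piece_def)
  qed
qed

lemma first_piece: "\<exists>e. piece 0 e \<and> 0 < e"
proof (cases "0 \<le> x")
  case True
  then obtain e A where p: "refr_piece 0 e A" using enters_refracted_piece[OF start_refracted] by blast
  show ?thesis
  proof (cases "0 < e")
    case False
    then have "e = ereal 0" using refr_pieceD(4)[OF p] by (simp add: zero_ereal_def)
    then obtain e' where "refl_piece 0 e'" using refr_piece_end(3) p by blast
    then show ?thesis using refl_pieceD(2)[of 0 e'] by (auto simp: piece_def zero_ereal_def)
  qed (use p in \<open>auto simp: piece_def\<close>)
next
  case False
  then obtain e where "refl_piece 0 e" using enters_reflected_piece[OF start_reflected] by force
  then show ?thesis using refl_pieceD(2)[of 0 e] by (auto simp: piece_def zero_ereal_def)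
qed

text \<open>A reflected piece ends after a rise of \<open>f\<close> of size at least \<open>b\<close>; just before \<open>T\<close> the path
  oscillates by less than that, so the pieces cannot accumulate at \<open>T\<close>.\<close>

lemma left_covered_if_right_covered_before:
  assumes T: "0 < T" and cov: "\<And>t. 0 \<le> t \<Longrightarrow> t < T \<Longrightarrow> \<exists>s e. piece s e \<and> s \<le> t \<and> ereal t < e"
  shows "\<exists>s e. piece s e \<and> s < T \<and> ereal T \<le> e"
proof -
  obtain \<eta> where \<eta>: "\<eta> > 0" "\<eta> \<le> T" "\<And>u w. T - \<eta> < u \<Longrightarrow> u < T \<Longrightarrow> T - \<eta> < w \<Longrightarrow> w < T \<Longrightarrow> \<bar>f u - f w\<bar> < b / 2"
    using near_left[OF T, of "b / 2"] b by auto
  have long: "ereal T \<le> e" if p: "refl_piece s e" and s: "T - \<eta> < s" "s < T" for s e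
  proof (rule ccontr)
    assume "\<not> ereal T \<le> e"
    then obtain r where r: "e = ereal r" "r < T" using refl_pieceD(2)[OF p] by (cases e) auto
    note p' = p[unfolded r(1)]
    have sr: "s < r" by (rule refl_piece_end[OF p'])
    have "m s r \<le> f s - f r + b / 2"
    proof (rule m_le)
      have osc: "\<bar>f r - f u\<bar> < b / 2" if "s \<le> u" "u \<le> r" for u
        by (rule \<eta>(3)) (use s sr r that in auto)
      show "0 \<le> f s - f r + b / 2" using osc[of s] sr unfolding abs_less_iff by linarith
      show "f s - f u \<le> f s - f r + b / 2" if "s \<le> u" "u \<le> r" for u
        using osc[OF that] unfolding abs_less_iff by linarith
    qed (use refl_pieceD(1)[OF p] sr in auto)
    then have "U s r \<le> b / 2" by (simp add: reflected_path_eq)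
    then show False using refl_piece_end(2)[OF p'] b by simp
  qed
  define u where "u = T - \<eta> / 2"
  have u: "0 \<le> u" "u < T" "T - \<eta> < u" using \<eta> T by (auto simp: u_def)
  obtain s e where p: "piece s e" "s \<le> u" "ereal u < e" using cov[OF u(1,2)] by blast
  show ?thesis
  proof (cases "ereal T \<le> e")
    case False
    then obtain r where r: "e = ereal r" "r < T" "u < r" using p(3) by (cases e) auto
    obtain e1 where e1: "piece r e1" "ereal r < e1" using next_piece p(1) r(1) by blast
    show ?thesis
    proof (cases "ereal T \<le> e1")
      case False
      then obtain r1 where r1: "e1 = ereal r1" "r1 < T" "r < r1" using e1(2) by (cases e1) auto
      \<comment> \<open>The pieces that start at \<open>r\<close> and \<open>r1\<close> both begin
        inside the window before \<open>T\<close>, and one of them is reflected, hence long; so the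
        second of them reaches \<open>T\<close> at the latest.\<close>
      obtain e2 where e2: "piece r1 e2" "refl_piece r (ereal r1) \<or> refl_piece r1 e2"
        using next_piece e1(1) r1(1) by blast
      then have "ereal T \<le> e2"
        using long[of r "ereal r1"] long[of r1 e2] r r1 u by auto
      then show ?thesis using e2(1) r1(2) by blast
    qed (use e1(1) r(2) in blast)
  qed (use p u in \<open>auto intro!: exI[of _ s] exI[of _ e]\<close>)
qed

text \<open>The infimum of the uncovered times is itself covered: by a first piece, or by the piece
  that covers it from the left, or by the successor of that piece. Coverage extends to a right
  neighbourhood, which contradicts the choice of the infimum.\<close>

lemma right_covered:
  assumes "0 \<le> t"
  shows "\<exists>s e. piece s e \<and> s \<le> t \<and> ereal t < e"
proof (rule ccontr)
  assume nc: "\<not> ?thesis"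
  let ?N = "{t. 0 \<le> t \<and> \<not> (\<exists>s e. piece s e \<and> s \<le> t \<and> ereal t < e)}"
  define T where "T = Inf ?N"
  have tN: "t \<in> ?N" using assms nc by auto
  have bdd: "bdd_below ?N" by (rule bdd_belowI[of _ 0]) auto
  have T0: "0 \<le> T" unfolding T_def by (rule cInf_greatest) (use tN in auto)
  have before: "\<exists>s e. piece s e \<and> s \<le> u \<and> ereal u < e" if "0 \<le> u" "u < T" for u
    using that cInf_lower[OF _ bdd, of u] unfolding T_def by force
  have "\<exists>s e. piece s e \<and> s \<le> T \<and> ereal T < e"
  proof (cases "T = 0")
    case True
    then show ?thesis using first_piece by (auto simp: zero_ereal_def)
  next
    case False
    then have "0 < T" using T0 by simp
    from left_covered_if_right_covered_before[OF this before]
    obtain s e where p: "piece s e" "s < T" "ereal T \<le> e" by blast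
    show ?thesis
    proof (cases "ereal T = e")
      case True
      then obtain e' where "piece T e'" "ereal T < e'" using next_piece[of s T] p(1) by blast
      then show ?thesis by blast
    qed (use p in \<open>auto intro!: exI[of _ s] exI[of _ e]\<close>)
  qed
  then obtain s e where p: "piece s e" "s \<le> T" "ereal T < e" by blast
  obtain d where d: "T < d" "ereal d \<le> e"
  proof (cases e)
    case (real r)
    then show ?thesis using that[of r] p(3) by simp
  next
    case PInf
    then show ?thesis using that[of "T + 1"] by simp
  qed (use p(3) in simp)
  obtain u where u: "u \<in> ?N" "u < d" using cInf_lessD[of ?N d] tN d(1) unfolding T_def by blast
  have "T \<le> u" unfolding T_def by (rule cInf_lower[OF u(1) bdd])
  moreover have "ereal u < e" using u(2) d(2) by (cases e) auto
  ultimately have "piece s e \<and> s \<le> u \<and> ereal u < e" using p(1,2) by simp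
  then show False using u(1) by blast
qed

lemma left_covered: "0 < t \<Longrightarrow> \<exists>s e. piece s e \<and> s < t \<and> ereal t \<le> e"
  by (rule left_covered_if_right_covered_before) (auto intro: right_covered)

lemma room_right:
  assumes "ereal t < e"
  shows "\<exists>\<eta>>0. \<forall>u. u < t + \<eta> \<longrightarrow> ereal u < e"
proof (cases e)
  case (real r)
  then show ?thesis using assms by (intro exI[of _ "r - t"]) auto
qed (use assms in \<open>auto intro: exI[of _ 1]\<close>)

lemma v_right_continuous: "0 \<le> t \<Longrightarrow> continuous (at_right t) v"
proof (rule right_continuousI)
  fix \<epsilon> :: real assume t: "0 \<le> t" and \<epsilon>: "0 < \<epsilon>"
  obtain s e where p: "piece s e" "s \<le> t" "ereal t < e" using right_covered[OF t] by blast
  obtain \<eta>0 where \<eta>0: "\<eta>0 > 0" "\<And>u. u < t + \<eta>0 \<Longrightarrow> ereal u < e" using room_right[OF p(3)] by blast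
  have "\<exists>g. (\<forall>u\<ge>s. ereal u < e \<longrightarrow> v u = g u) \<and> (\<exists>\<eta>>0. \<forall>u. t \<le> u \<and> u < t + \<eta> \<longrightarrow> \<bar>g u - g t\<bar> < \<epsilon>)"
    using p(1) unfolding piece_def
  proof
    assume r: "refl_piece s e"
    show ?thesis
      by (rule exI[of _ "U s"]) (use refl_pieceD(3)[OF r] reflected_near_right[OF refl_pieceD(1)[OF r] p(2) \<epsilon>] in blast)
  next
    assume "\<exists>A. refr_piece s e A"
    then obtain A where r: "refr_piece s e A" by blast
    show ?thesis
      by (rule exI[of _ A]) (use refr_pieceD(6)[OF r] refracted_near_right[OF refr_pieceD(1)[OF r] p(2) refr_pieceD(5)[OF r] \<delta> \<epsilon>] in blast)
  qed
  then obtain g \<eta> where g: "\<And>u. s \<le> u \<Longrightarrow> ereal u < e \<Longrightarrow> v u = g u" "\<eta> > 0" "\<And>u. t \<le> u \<Longrightarrow> u < t + \<eta> \<Longrightarrow> \<bar>g u - g t\<bar> < \<epsilon>"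
    by blast
  show "\<exists>\<eta>>0. \<forall>u. t \<le> u \<and> u < t + \<eta> \<longrightarrow> \<bar>v u - v t\<bar> < \<epsilon>"
  proof (rule exI[of _ "min \<eta> \<eta>0"], intro conjI allI impI)
    fix u assume u: "t \<le> u \<and> u < t + min \<eta> \<eta>0"
    have "v u = g u" "v t = g t" using g(1)[of u] g(1)[of t] u \<eta>0(2)[of u] p by auto
    moreover have "u < t + \<eta>" using u by (auto simp: min_def split: if_splits)
    ultimately show "\<bar>v u - v t\<bar> < \<epsilon>" using g(3)[of u] u by simp
  qed (use g(2) \<eta>0(1) in simp)
qed

lemma v_measurable: "(\<lambda>t. v (max 0 t)) \<in> borel_measurable borel"
  by (rule right_continuous_borel_measurable) (rule right_continuous_extend[OF v_right_continuous])

section \<open>Monotonicity of the injection along the pieces\<close>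

definition R where "R t = v t - f t + refraction_part b \<delta> v t"

lemma refraction_increment:
  assumes "0 \<le> u" "u \<le> t"
  shows "refraction_part b \<delta> v t - refraction_part b \<delta> v u = \<delta> * (LINT w:{u..t}|lborel. indicator {b<..} (v w))"
proof -
  have eq: "(LINT w:{c..d}|lborel. indicator {b<..} (v w) :: real) = (LINT w:{c..d}|lborel. indicator {b<..} (v (max 0 w)))" if "0 \<le> c" for c d
    by (rule set_lebesgue_integral_cong) (use that in auto)
  show ?thesis
    unfolding refraction_part_def right_diff_distrib[symmetric]
    using indicator_integral_split[OF v_measurable, of 0 u t b] assms by (simp add: eq)
qed

text \<open>Agreement is asked only before the upper end, because a piece determines
  \<open>v\<close> only on a half-open interval.\<close>

lemma indicator_integral_cong:
  fixes g :: "real \<Rightarrow> real"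
  assumes "0 \<le> u" and "g \<in> borel_measurable borel" and "\<And>w. u \<le> w \<Longrightarrow> w < t \<Longrightarrow> v w = g w"
  shows "(LINT w:{u..t}|lborel. indicator {b<..} (v w) :: real) = (LINT w:{u..t}|lborel. indicator {b<..} (g w))"
proof -
  note [measurable] = v_measurable assms(2)
  have "(LINT w:{u..t}|lborel. indicator {b<..} (v w) :: real) = (LINT w:{u..t}|lborel. indicator {b<..} (v (max 0 w)))"
    by (rule set_lebesgue_integral_cong) (use assms in auto)
  also have "\<dots> = (LINT w:{u..t}|lborel. indicator {b<..} (g w))"
    unfolding set_lebesgue_integral_def
  proof (rule Bochner_Integration.integral_cong_AE)
    show "AE w in lborel. indicator {u..t} w *\<^sub>R indicator {b<..} (v (max 0 w)) = indicator {u..t} w *\<^sub>R (indicator {b<..} (g w) :: real)"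
      using AE_lborel_singleton[of t] by eventually_elim (use assms in \<open>auto simp: indicator_def\<close>)
  qed measurable
  finally show ?thesis .
qed

text \<open>Inside the piece \<open>v\<close> solves the refracted equation and nothing is injected.
  At its end \<open>v\<close> restarts at 0 while \<open>A\<close> is at most 0, so the injection
  grows by the modulus of \<open>A\<close>.\<close>

lemma refr_piece_R:
  assumes p: "refr_piece s e A" and ut: "s \<le> u" "u \<le> t"
  shows "ereal t < e \<Longrightarrow> R t = R u" "ereal u < e \<Longrightarrow> ereal t = e \<Longrightarrow> R u \<le> R t"
proof -
  note s = refr_pieceD(1)[OF p] and A = refr_pieceD(5)[OF p]
  have key: "R t - R u = v t - A t - (v u - A u)" if "ereal t \<le> e"
  proof -
    have "(LINT w:{u..t}|lborel. indicator {b<..} (v w) :: real) = (LINT w:{u..t}|lborel. indicator {b<..} (if s \<le> w then A w else 0))"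
    proof (rule indicator_integral_cong[OF _ refracted_measurable[OF s A]])
      show "v w = (if s \<le> w then A w else 0)" if "u \<le> w" "w < t" for w
      proof -
        have "ereal w < e" using that \<open>ereal t \<le> e\<close> by (cases e) auto
        then show ?thesis using refr_pieceD(6)[OF p, of w] that ut by simp
      qed
    qed (use s ut in simp)
    also have "\<dots> = (LINT w:{u..t}|lborel. indicator {b<..} (A w))"
      by (rule set_lebesgue_integral_cong) (use ut in auto)
    finally have I: "(LINT w:{u..t}|lborel. indicator {b<..} (v w) :: real) = (LINT w:{u..t}|lborel. indicator {b<..} (A w))" .
    have "0 \<le> u" using s ut by simp
    show ?thesis using refraction_increment[OF \<open>0 \<le> u\<close> ut(2)] refracted_increment[OF s ut A] unfolding R_def I by simp
  qed
  have u: "v u = A u" if "ereal u < e" by (rule refr_pieceD(6)[OF p ut(1) that])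
  show "R t = R u" if "ereal t < e"
  proof -
    have "ereal u < e" using that ut by (cases e) auto
    then show ?thesis using key u refr_pieceD(6)[OF p, of t] that ut by simp
  qed
  show "R u \<le> R t" if eu: "ereal u < e" "ereal t = e"
  proof -
    obtain e' where "refl_piece t e'" and "A t \<le> 0" using refr_piece_end[of s t A] p eu(2) by auto
    then have "v t = 0" by (auto intro: refl_piece_start_v)
    then show ?thesis using key u eu \<open>A t \<le> 0\<close> by simp
  qed
qed

lemma refl_piece_end_v:
  assumes "refl_piece s (ereal r)"
  shows "v r = b"
proof -
  obtain e A where n: "refr_piece r e A" "A r = b" using refl_piece_end(3)[OF assms] by blast
  have "ereal r < e" by (rule refr_piece_pos[OF n(1)]) (use n(2) b in simp)
  then show ?thesis using refr_pieceD(6)[OF n(1) order_refl] n(2) by simp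
qed

lemma refr_piece_end_v: "refr_piece s (ereal r) A \<Longrightarrow> v r = 0"
  using refr_piece_end(3)[of s r A] refl_piece_start_v by blast

lemma refl_piece_v:
  assumes p: "refl_piece s e" and t: "s \<le> t" "ereal t \<le> e"
  shows "v t = U s t"
proof (cases "ereal t < e")
  case False
  then have "e = ereal t" using t by simp
  then have "refl_piece s (ereal t)" using p by simp
  then show ?thesis using refl_piece_end_v[of s t] refl_piece_end(2)[of s t] by simp
qed (use refl_pieceD(3)[OF p] t in auto)

lemma refl_piece_R:
  assumes p: "refl_piece s e" and t: "s \<le> t" "ereal t \<le> e"
  shows "R t = R s + m s t"
proof -
  note s = refl_pieceD(1)[OF p]
  \<comment> \<open>During a reflected piece v \<le> b, so capping at \<open>b\<close> changes
    nothing before the end; the capped function is measurable and its indicator vanishes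
    identically. Hence no refraction takes place.\<close>
  have "(LINT w:{s..t}|lborel. indicator {b<..} (v w) :: real) = (LINT w:{s..t}|lborel. indicator {b<..} (min b (v (max 0 w))))"
  proof (rule indicator_integral_cong[OF s])
    show "(\<lambda>w. min b (v (max 0 w))) \<in> borel_measurable borel" using v_measurable by measurable
    show "v w = min b (v (max 0 w))" if "s \<le> w" "w < t" for w
    proof -
      have "ereal w < e" using that t by (cases e) auto
      then show ?thesis using refl_pieceD(3,4)[OF p, of w] that t s by simp
    qed
  qed
  also have "\<dots> = 0" unfolding set_lebesgue_integral_def by simp
  finally have "refraction_part b \<delta> v t = refraction_part b \<delta> v s" using refraction_increment[OF s t(1)] by simp
  moreover have "v s = 0" by (rule refl_piece_start_v[OF p])
  ultimately show ?thesis using refl_piece_v[OF p t] by (simp add: R_def reflected_path_eq)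
qed

lemma v_nonneg: "0 \<le> t \<Longrightarrow> 0 \<le> v t"
proof -
  assume "0 \<le> t"
  then obtain s e where p: "piece s e" "s \<le> t" "ereal t < e" using right_covered by blast
  from p(1) show ?thesis unfolding piece_def
  proof
    assume r: "refl_piece s e"
    show ?thesis using refl_pieceD(1,3)[OF r] reflected_nonneg[of s t] p by auto
  next
    assume "\<exists>A. refr_piece s e A"
    then obtain A where "refr_piece s e A" by blast
    then show ?thesis using refr_pieceD(6,7)[of s e A t] p by simp
  qed
qed

lemma v_zero: "v 0 = max x 0"
proof -
  obtain s e where p: "piece s e" "s \<le> 0" "ereal 0 < e" using right_covered[of 0] by auto
  then have s: "s = 0" using piece_nonneg by force
  show ?thesis
  proof (cases "0 \<le> x")
    case True
    then obtain e A where r: "refr_piece 0 e A" "A 0 = x" using enters_refracted_piece[OF start_refracted] by blast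
    show ?thesis
    proof (cases "ereal 0 < e")
      case False
      then have e: "e = ereal 0" using refr_pieceD(4)[OF r(1)] by simp
      have "\<not> 0 < x" using refr_piece_pos[OF r(1)] r(2) False by auto
      moreover have "v 0 = 0" using refr_piece_end_v r(1) e by blast
      ultimately show ?thesis using True by simp
    qed (use refr_pieceD(6)[OF r(1), of 0] r(2) True in simp)
  next
    case False
    then obtain e where r: "refl_piece 0 e" using enters_reflected_piece[OF start_reflected] by force
    show ?thesis using refl_piece_start_v[OF r] False by simp
  qed
qed

lemma R_local_right:
  assumes t: "0 \<le> t"
  shows "\<exists>\<eta>>0. \<forall>u. t \<le> u \<and> u < t + \<eta> \<longrightarrow> R t \<le> R u \<and> (0 < v t \<longrightarrow> R u = R t)"
proof -
  obtain s e where p: "piece s e" "s \<le> t" "ereal t < e" using right_covered[OF t] by blast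
  obtain \<eta>0 where \<eta>0: "\<eta>0 > 0" "\<And>u. u < t + \<eta>0 \<Longrightarrow> ereal u < e" using room_right[OF p(3)] by blast
  from p(1) show ?thesis unfolding piece_def
  proof
    assume r: "refl_piece s e"
    note s = refl_pieceD(1)[OF r]
    have "\<exists>\<eta>>0. \<forall>u. t \<le> u \<and> u < t + \<eta> \<longrightarrow> (0 < v t \<longrightarrow> m s u = m s t)"
    proof (cases "0 < v t")
      case True
      then show ?thesis using running_sup_flat_right[OF s p(2)] refl_pieceD(3)[OF r p(2,3)] by auto
    qed (auto intro: exI[of _ 1])
    then obtain \<eta> where \<eta>: "\<eta> > 0" "\<And>u. t \<le> u \<Longrightarrow> u < t + \<eta> \<Longrightarrow> 0 < v t \<Longrightarrow> m s u = m s t" by blast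
    show ?thesis
    proof (rule exI[of _ "min \<eta> \<eta>0"], intro conjI allI impI)
      fix u assume "t \<le> u \<and> u < t + min \<eta> \<eta>0"
      then have u: "t \<le> u" "u < t + \<eta>" "u < t + \<eta>0" by (auto simp: min_def split: if_splits)
      have Ru: "R u = R s + m s u" "R t = R s + m s t"
        using refl_piece_R[OF r, of u] refl_piece_R[OF r, of t] \<eta>0(2)[of u] u p by (auto intro: less_imp_le)
      show "R t \<le> R u" using Ru m_mono[OF s p(2), of u] u by simp
      show "R u = R t" if "0 < v t" using Ru \<eta>(2)[OF u(1,2) that] by simp
    qed (use \<eta>(1) \<eta>0(1) in simp)
  next
    assume "\<exists>A. refr_piece s e A"
    then obtain A where r: "refr_piece s e A" by blast
    have "R u = R t" if "t \<le> u" "u < t + \<eta>0" for u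
      using refr_piece_R(1)[OF r p(2) that(1)] \<eta>0(2)[OF that(2)] by simp
    then have "\<forall>u. t \<le> u \<and> u < t + \<eta>0 \<longrightarrow> R t \<le> R u \<and> (0 < v t \<longrightarrow> R u = R t)" by (metis order_refl)
    then show ?thesis using \<eta>0(1) by blast
  qed
qed

text \<open>The piece that covers \<open>t\<close> from the left may end at \<open>t\<close>. If it
  is reflected, the regulator formula still holds there; if it is refracted, then v t = 0 and only
  monotonicity is claimed.\<close>

lemma R_local_left:
  assumes t: "0 < t"
  shows "\<exists>\<eta>>0. \<forall>u. 0 \<le> u \<and> t - \<eta> < u \<and> u \<le> t \<longrightarrow> R u \<le> R t \<and> (0 < v t \<longrightarrow> R u = R t)"
proof -
  obtain s e where p: "piece s e" "s < t" "ereal t \<le> e" using left_covered[OF t] by blast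
  from p(1) show ?thesis unfolding piece_def
  proof
    assume r: "refl_piece s e"
    note s = refl_pieceD(1)[OF r]
    have "\<exists>\<eta>>0. \<forall>u. s \<le> u \<and> t - \<eta> < u \<and> u \<le> t \<longrightarrow> (0 < v t \<longrightarrow> m s u = m s t)"
    proof (cases "0 < v t")
      case True
      then show ?thesis using running_sup_flat_left[OF s p(2)] refl_piece_v[OF r, of t] p by auto
    qed (auto intro: exI[of _ 1])
    then obtain \<eta> where \<eta>: "\<eta> > 0" "\<And>u. s \<le> u \<Longrightarrow> t - \<eta> < u \<Longrightarrow> u \<le> t \<Longrightarrow> 0 < v t \<Longrightarrow> m s u = m s t" by blast
    show ?thesis
    proof (rule exI[of _ "min \<eta> (t - s)"], intro conjI allI impI)
      fix u assume "0 \<le> u \<and> t - min \<eta> (t - s) < u \<and> u \<le> t"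
      then have u: "0 \<le> u" "t - \<eta> < u" "u \<le> t" and su: "s \<le> u" by (auto simp: min_def split: if_splits)
      have "ereal u \<le> e" using u p(3) by (cases e) auto
      then have Ru: "R u = R s + m s u" "R t = R s + m s t"
        using refl_piece_R[OF r, of u] refl_piece_R[OF r, of t] su p by auto
      show "R u \<le> R t" using Ru m_mono[OF s su, of t] u by simp
      show "R u = R t" if "0 < v t" using Ru \<eta>(2)[OF su u(2,3) that] by simp
    qed (use \<eta>(1) p(2) in simp)
  next
    assume "\<exists>A. refr_piece s e A"
    then obtain A where r: "refr_piece s e A" by blast
    have "R u \<le> R t \<and> (0 < v t \<longrightarrow> R u = R t)" if u: "s \<le> u" "u \<le> t" for u
    proof (cases "ereal t < e")
      case True
      then show ?thesis using refr_piece_R(1)[OF r u] by simp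
    next
      case False
      then have e: "e = ereal t" using p(3) by simp
      then have "v t = 0" using refr_piece_end_v r by blast
      moreover have "R u \<le> R t"
      proof (cases "u = t")
        case False
        then have "ereal u < e" using e u by simp
        then show ?thesis by (rule refr_piece_R(2)[OF r u _ e[symmetric]])
      qed simp
      ultimately show ?thesis by simp
    qed
    note main = this
    show ?thesis
    proof (rule exI[of _ "t - s"], rule conjI, use p(2) in simp, intro allI impI)
      fix u assume "0 \<le> u \<and> t - (t - s) < u \<and> u \<le> t"
      then show "R u \<le> R t \<and> (0 < v t \<longrightarrow> R u = R t)" by (intro main) simp_all
    qed
  qed
qed

text \<open>Local monotonicity on both sides of each time is glued by bisection, which spares an
  enumeration of the pieces.\<close>

lemma R_mono:
  assumes "0 \<le> s" "s \<le> t"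
  shows "R s \<le> R t"
proof -
  have "0 \<le> s \<longrightarrow> R s \<le> R t"
    using assms(2)
  proof (induction rule: Bolzano)
    case (local z)
    then have z: "0 \<le> z" using assms by simp
    obtain \<eta>1 where \<eta>1: "\<eta>1 > 0" "\<And>u. z \<le> u \<Longrightarrow> u < z + \<eta>1 \<Longrightarrow> R z \<le> R u" using R_local_right[OF z] by blast
    obtain \<eta>2 where \<eta>2: "\<eta>2 > 0" "\<And>u. 0 \<le> u \<Longrightarrow> z - \<eta>2 < u \<Longrightarrow> u \<le> z \<Longrightarrow> R u \<le> R z"
    proof (cases "z = 0")
      case True
      then show ?thesis using that[of 1] by force
    next
      case False
      then have "0 < z" using z by simp
      from R_local_left[OF this] show ?thesis using that by blast
    qed
    show ?case
    proof (rule exI[of _ "min \<eta>1 \<eta>2"], intro conjI allI impI)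
      fix c d assume "c \<le> z \<and> z \<le> d \<and> d - c < min \<eta>1 \<eta>2" "0 \<le> c"
      then have "R z \<le> R d" "R c \<le> R z" by (auto intro!: \<eta>1(2) \<eta>2(2))
      then show "R c \<le> R d" by simp
    qed (use \<eta>1(1) \<eta>2(1) in simp)
  qed auto
  then show ?thesis using assms by simp
qed

theorem injected_path:
  assumes "0 < a" "x \<le> a"
  shows "injected_path (\<lambda>t. f (max 0 t)) (\<lambda>t. v (max 0 t)) b \<delta> a"
proof
  have ref: "refraction_part b \<delta> (\<lambda>t. v (max 0 t)) t = refraction_part b \<delta> v t" if "0 \<le> t" for t
    unfolding refraction_part_def by (intro arg_cong[where f = "\<lambda>y. \<delta> * y"] set_lebesgue_integral_cong) auto
  show "continuous (at_right t) (\<lambda>t. f (max 0 t))" "continuous (at_right t) (\<lambda>t. v (max 0 t))" for t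
    by (rule right_continuous_extend[OF right_cont] right_continuous_extend[OF v_right_continuous]; assumption)+
  show "\<exists>\<eta>>0. \<forall>u. t - \<eta> < u \<and> u < t \<longrightarrow> f (max 0 t) \<le> f (max 0 u) + e" if te: "0 < t" "0 < e" for t e
  proof -
    obtain \<eta> where "\<eta> > 0" "\<eta> \<le> t" "\<And>u. t - \<eta> < u \<Longrightarrow> u < t \<Longrightarrow> f t \<le> f u + e" using near_left[OF te] by blast
    then show ?thesis using te by (intro exI[of _ \<eta>]) auto
  qed
  show "v (max 0 s) - f (max 0 s) + refraction_part b \<delta> (\<lambda>t. v (max 0 t)) s
      \<le> v (max 0 t) - f (max 0 t) + refraction_part b \<delta> (\<lambda>t. v (max 0 t)) t" if "0 \<le> s" "s \<le> t" for s t
    using R_mono[OF that] that by (simp add: R_def ref)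
  show "\<exists>\<eta>>0. \<forall>u. 0 \<le> u \<and> \<bar>u - t\<bar> < \<eta> \<longrightarrow>
       v (max 0 u) - f (max 0 u) + refraction_part b \<delta> (\<lambda>t. v (max 0 t)) u
       = v (max 0 t) - f (max 0 t) + refraction_part b \<delta> (\<lambda>t. v (max 0 t)) t" if t: "0 \<le> t" "0 < v (max 0 t)" for t
  proof -
    have vt: "0 < v t" using t by simp
    obtain \<eta>1 where \<eta>1: "\<eta>1 > 0" "\<And>u. t \<le> u \<Longrightarrow> u < t + \<eta>1 \<Longrightarrow> R u = R t" using R_local_right[OF t(1)] vt by blast
    obtain \<eta>2 where \<eta>2: "\<eta>2 > 0" "\<And>u. 0 \<le> u \<Longrightarrow> t - \<eta>2 < u \<Longrightarrow> u \<le> t \<Longrightarrow> R u = R t"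
    proof (cases "t = 0")
      case True
      then show ?thesis using that[of 1] by force
    next
      case False
      then have "0 < t" using t by simp
      from R_local_left[OF this] show ?thesis using that vt by blast
    qed
    have eq: "R u = R t" if "0 \<le> u" "\<bar>u - t\<bar> < min \<eta>1 \<eta>2" for u
      using that \<eta>1(2)[of u] \<eta>2(2)[of u] by (cases "t \<le> u") (auto simp: min_def split: if_splits)
    show ?thesis
    proof (rule exI[of _ "min \<eta>1 \<eta>2"], intro conjI allI impI)
      fix u assume u: "0 \<le> u \<and> \<bar>u - t\<bar> < min \<eta>1 \<eta>2"
      then show "v (max 0 u) - f (max 0 u) + refraction_part b \<delta> (\<lambda>t. v (max 0 t)) u
       = v (max 0 t) - f (max 0 t) + refraction_part b \<delta> (\<lambda>t. v (max 0 t)) t"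
        using eq[of u] t(1) by (simp add: R_def ref)
    qed (use \<eta>1(1) \<eta>2(1) in simp)
  qed
qed (use assms \<delta> v_nonneg v_zero f_zero in auto)

end

section \<open>Independent increments and exponential moments\<close>

context levy_process begin

abbreviation "Fil \<equiv> augmented_filtration M X"

lemma augmented_generator_subset:
  "{X s -` B \<inter> space M | s B. 0 \<le> s \<and> s \<le> t \<and> B \<in> sets borel} \<union> null_sets M \<subseteq> sets M"
  using random_variable_X by (auto intro: measurable_sets)

lemma sets_augmented_filtration:
  "sets (Fil t) = sigma_sets (space M) ({X s -` B \<inter> space M | s B. 0 \<le> s \<and> s \<le> t \<and> B \<in> sets borel} \<union> null_sets M)"
  unfolding augmented_filtration_def
  by (rule sets_measure_of) (use sets.sets_into_space in \<open>auto dest: null_setsD2\<close>)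

lemma space_augmented_filtration: "space (Fil t) = space M"
  unfolding augmented_filtration_def
  by (rule space_measure_of) (use sets.sets_into_space in \<open>auto dest: null_setsD2\<close>)

lemma sets_augmented_filtration_le: "sets (Fil t) \<subseteq> sets M"
  unfolding sets_augmented_filtration
  by (rule sets.sigma_sets_subset[OF augmented_generator_subset])

lemma augmented_filtration_mono: "s \<le> t \<Longrightarrow> sets (Fil s) \<subseteq> sets (Fil t)"
  unfolding sets_augmented_filtration by (rule sigma_sets_mono', rule Un_mono) (blast intro: order_trans, simp)

lemma null_sets_augmented: "N \<in> null_sets M \<Longrightarrow> N \<in> sets (Fil t)"
  unfolding sets_augmented_filtration by (rule sigma_sets.Basic) simp

lemma X_adapted: "0 \<le> t \<Longrightarrow> X t \<in> borel_measurable (Fil t)"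
  by (rule measurableI) (auto simp: space_augmented_filtration sets_augmented_filtration intro!: sigma_sets.Basic)

text \<open>On the grid 0, \<open>J\<close> in increasing order, \<open>t\<close>, \<open>T\<close>,
  the values X s - X 0 at the points of \<open>J\<close> are partial sums of the first
  \<open>n\<close> increments, whereas X T - X t is the increment with index \<open>Suc n\<close>;
  the one that leads up to \<open>t\<close> lies between and is skipped. Since X 0 = 0 holds only
  almost surely, the events are first shifted by \<open>X 0\<close>.\<close>

lemma indep_cylinder_increment:
  assumes t: "0 \<le> t" "t \<le> T" and J: "finite J" "J \<subseteq> {0..t}" and B[measurable]: "\<And>s. B s \<in> sets borel" and C[measurable]: "C \<in> sets borel"
  shows "prob {w \<in> space M. (\<forall>s\<in>J. X s w \<in> B s) \<and> X T w - X t w \<in> C}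
     = prob {w \<in> space M. \<forall>s\<in>J. X s w \<in> B s} * prob {w \<in> space M. X T w - X t w \<in> C}"
proof -
  define l where "l = sorted_list_of_set J"
  have l: "sorted l" "set l = J" using J by (auto simp: l_def)
  define ts where "ts = (0 # l) @ [t]"
  define n where "n = length l"
  have len: "length ts = n + 2" by (simp add: ts_def n_def)
  have sorted: "sorted ts" using l J t by (auto simp: ts_def sorted_append)
  define tm where "tm i = (if i < n + 2 then ts ! i else T)" for i
  have ts_le: "ts ! i \<le> T" "0 \<le> ts ! i" if "i < n + 2" for i
  proof -
    have "ts ! i \<in> set ts" using that len by (intro nth_mem) simp
    then show "ts ! i \<le> T" "0 \<le> ts ! i" using l J t by (auto simp: ts_def)
  qed
  have tm0: "tm 0 = 0" by (simp add: tm_def ts_def)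
  have mono: "mono tm"
  proof (rule monoI)
    fix i j :: nat assume "i \<le> j"
    then show "tm i \<le> tm j" using sorted_nth_mono[OF sorted, of i j] ts_le(1)[of i] len by (auto simp: tm_def)
  qed
  have tmn: "tm (Suc n) = t" "tm (Suc (Suc n)) = T" by (auto simp: tm_def ts_def n_def nth_append)
  have tmj: "tm (Suc j) = l ! j" if "j < n" for j using that by (simp add: tm_def ts_def n_def nth_append)
  define I where "I i w = X (tm (Suc i)) w - X (tm i) w" for i w
  have ind: "indep_vars (\<lambda>_. borel) I {..<n + 2}"
    unfolding I_def using independent_increments[of tm "n + 2"] mono tm0 by simp
  have iv: "indep_var (PiM {..<n} (\<lambda>_. borel)) (\<lambda>w. restrict (\<lambda>i. I i w) {..<n}) (PiM {Suc n} (\<lambda>_. borel)) (\<lambda>w. restrict (\<lambda>i. I i w) {Suc n})"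
    by (rule indep_var_restrict[OF ind]) auto
  define Xa where "Xa = {y \<in> space (PiM {..<n} (\<lambda>_. borel :: real measure)). \<forall>j\<in>{..<n}. (\<Sum>i<Suc j. y i) \<in> B (l ! j)}"
  define Xb where "Xb = {y \<in> space (PiM {Suc n} (\<lambda>_. borel :: real measure)). y (Suc n) \<in> C}"
  have "(\<lambda>y. \<Sum>i<Suc j. y i) \<in> borel_measurable (PiM {..<n} (\<lambda>_. borel :: real measure))" if "j \<in> {..<n}" for j
    using that by (intro borel_measurable_sum measurable_component_singleton) auto
  then have Xa: "Xa \<in> sets (PiM {..<n} (\<lambda>_. borel))"
    unfolding Xa_def by (intro sets.sets_Collect_finite_All) (auto intro: measurable_sets_borel[OF _ B] simp: measurable_sets_borel)
  have Xb: "Xb \<in> sets (PiM {Suc n} (\<lambda>_. borel))" unfolding Xb_def by measurable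
  have tel: "(\<Sum>i<Suc j. I i w) = X (tm (Suc j)) w - X 0 w" for j w
    unfolding I_def by (subst sum_lessThan_telescope) (simp add: tm0)
  have JE: "(\<forall>s\<in>J. X s w \<in> B s) \<longleftrightarrow> (\<forall>j<n. X (l ! j) w \<in> B (l ! j))" for w
    unfolding l(2)[symmetric] all_set_conv_all_nth n_def ..
  have aeq: "(\<lambda>w. restrict (\<lambda>i. I i w) {..<n}) -` Xa \<inter> space M = {w \<in> space M. \<forall>j<n. X (l ! j) w - X 0 w \<in> B (l ! j)}"
  proof -
    have "(\<Sum>i<Suc j. restrict (\<lambda>i. I i w) {..<n} i) = X (l ! j) w - X 0 w" if "j < n" for j w
    proof -
      have "(\<Sum>i<Suc j. restrict (\<lambda>i. I i w) {..<n} i) = (\<Sum>i<Suc j. I i w)"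
        by (rule sum.cong) (use that in auto)
      also have "\<dots> = X (l ! j) w - X 0 w" unfolding tel tmj[OF that] ..
      finally show ?thesis .
    qed
    then show ?thesis by (auto simp: Xa_def space_PiM PiE_def)
  qed
  have beq: "(\<lambda>w. restrict (\<lambda>i. I i w) {Suc n}) -` Xb \<inter> space M = {w \<in> space M. X T w - X t w \<in> C}"
    by (auto simp: Xb_def space_PiM I_def tmn)
  have abeq: "(\<lambda>w. (restrict (\<lambda>i. I i w) {..<n}, restrict (\<lambda>i. I i w) {Suc n})) -` (Xa \<times> Xb) \<inter> space M
      = {w \<in> space M. (\<forall>j<n. X (l ! j) w - X 0 w \<in> B (l ! j)) \<and> X T w - X t w \<in> C}"
    using aeq beq by auto
  have [measurable]: "X 0 \<in> borel_measurable M" "X T \<in> borel_measurable M" "X t \<in> borel_measurable M"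
    using t by (auto intro: random_variable_X)
  have [measurable]: "X (l ! j) \<in> borel_measurable M" if "j < n" for j
    using that l J by (intro random_variable_X) (auto simp: n_def dest: nth_mem)
  have main: "prob {w \<in> space M. (\<forall>j<n. X (l ! j) w - X 0 w \<in> B (l ! j)) \<and> X T w - X t w \<in> C}
     = prob {w \<in> space M. \<forall>j<n. X (l ! j) w - X 0 w \<in> B (l ! j)} * prob {w \<in> space M. X T w - X t w \<in> C}"
    using indep_varD[OF iv Xa Xb] unfolding abeq aeq beq .
  have sets: "{w \<in> space M. \<forall>j<n. X (l ! j) w - X 0 w \<in> B (l ! j)} \<in> events" "{w \<in> space M. \<forall>j<n. X (l ! j) w \<in> B (l ! j)} \<in> events"
    unfolding lessThan_iff[symmetric] Ball_def[symmetric]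
    by (intro sets.sets_Collect_finite_All; measurable)+
  have C': "{w \<in> space M. X T w - X t w \<in> C} \<in> events" by measurable
  have e1: "prob {w \<in> space M. \<forall>j<n. X (l ! j) w - X 0 w \<in> B (l ! j)} = prob {w \<in> space M. \<forall>j<n. X (l ! j) w \<in> B (l ! j)}"
    by (rule finite_measure_eq_AE[OF _ sets]) (use start_zero in eventually_elim, simp)
  have e2: "prob {w \<in> space M. (\<forall>j<n. X (l ! j) w - X 0 w \<in> B (l ! j)) \<and> X T w - X t w \<in> C} = prob {w \<in> space M. (\<forall>j<n. X (l ! j) w \<in> B (l ! j)) \<and> X T w - X t w \<in> C}"
  proof (rule finite_measure_eq_AE)
    show "AE w in M. (w \<in> {w \<in> space M. (\<forall>j<n. X (l ! j) w - X 0 w \<in> B (l ! j)) \<and> X T w - X t w \<in> C}) = (w \<in> {w \<in> space M. (\<forall>j<n. X (l ! j) w \<in> B (l ! j)) \<and> X T w - X t w \<in> C})"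
      using start_zero by eventually_elim simp
    have "{w \<in> space M. P w \<and> X T w - X t w \<in> C} = {w \<in> space M. P w} \<inter> {w \<in> space M. X T w - X t w \<in> C}" for P
      by auto
    then show "{w \<in> space M. (\<forall>j<n. X (l ! j) w - X 0 w \<in> B (l ! j)) \<and> X T w - X t w \<in> C} \<in> events"
      "{w \<in> space M. (\<forall>j<n. X (l ! j) w \<in> B (l ! j)) \<and> X T w - X t w \<in> C} \<in> events"
      using sets.Int[OF sets(1) C'] sets.Int[OF sets(2) C'] by metis+
  qed
  show ?thesis unfolding JE using main e1 e2 by simp
qed

text \<open>Independence is extended from a class of events that is stable under intersections. The
  class consists of the events almost surely equal to a cylinder, so that it also contains the null
  sets, which agree almost surely with an empty cylinder.\<close>

lemma indep_past_increment:
  assumes t: "0 \<le> t" "t \<le> T"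
  shows "indep_set (sets (Fil t)) (sigma_sets (space M) {(\<lambda>w. X T w - X t w) -` C \<inter> space M | C. C \<in> sets borel})"
proof -
  let ?C = "\<lambda>C. (\<lambda>w. X T w - X t w) -` C \<inter> space M"
  have [measurable]: "X T \<in> borel_measurable M" "X t \<in> borel_measurable M" using t by (auto intro: random_variable_X)
  have Cm: "?C C \<in> events" if [measurable]: "C \<in> sets borel" for C by measurable
  define cyl where "cyl J B = {w \<in> space M. \<forall>s\<in>J. X s w \<in> B s}" for J and B :: "real \<Rightarrow> real set"
  define P where "P J B A \<longleftrightarrow> finite J \<and> J \<subseteq> {0..t} \<and> (\<forall>s. B s \<in> sets borel) \<and> (AE w in M. w \<in> A \<longleftrightarrow> w \<in> cyl J B)" for J B A
  define \<G> where "\<G> = {A \<in> events. \<exists>J B. P J B A}"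
  have Int: "Int_stable \<G>"
  proof (rule Int_stableI)
    fix A1 A2 assume A12: "A1 \<in> \<G>" "A2 \<in> \<G>"
    then obtain J1 B1 J2 B2 where 12: "P J1 B1 A1" "P J2 B2 A2" by (auto simp: \<G>_def)
    define B where "B s = (if s \<in> J1 then B1 s else UNIV) \<inter> (if s \<in> J2 then B2 s else UNIV)" for s
    from 12 have "AE w in M. w \<in> A1 \<longleftrightarrow> w \<in> cyl J1 B1" "AE w in M. w \<in> A2 \<longleftrightarrow> w \<in> cyl J2 B2" by (auto simp: P_def)
    then have "AE w in M. w \<in> A1 \<inter> A2 \<longleftrightarrow> w \<in> cyl (J1 \<union> J2) B"
      by eventually_elim (auto simp: cyl_def B_def)
    then have "P (J1 \<union> J2) B (A1 \<inter> A2)" using 12 by (auto simp: P_def B_def)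
    then show "A1 \<inter> A2 \<in> \<G>" using A12 by (auto simp: \<G>_def)
  qed
  have gen: "{X s -` B \<inter> space M | s B. 0 \<le> s \<and> s \<le> t \<and> B \<in> sets borel} \<union> null_sets M \<subseteq> \<G>"
  proof
    fix A assume "A \<in> {X s -` B \<inter> space M | s B. 0 \<le> s \<and> s \<le> t \<and> B \<in> sets borel} \<union> null_sets M"
    then consider s B where "A = X s -` B \<inter> space M" "0 \<le> s" "s \<le> t" "B \<in> sets borel" | "A \<in> null_sets M" by blast
    then show "A \<in> \<G>"
    proof cases
      case 1
      then have "A \<in> events" "P {s} (\<lambda>_. B) A" using random_variable_X by (auto simp: P_def cyl_def intro: measurable_sets)
      then show ?thesis by (auto simp: \<G>_def)
    next
      case 2
      have "AE w in M. w \<in> A \<longleftrightarrow> w \<in> cyl {0} (\<lambda>_. {})"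
        using AE_not_in[OF 2] by eventually_elim (auto simp: cyl_def)
      then have "P {0} (\<lambda>_. {}) A" using t by (auto simp: P_def)
      then show ?thesis using 2 by (auto simp: \<G>_def)
    qed
  qed
  have "indep_set \<G> {?C C | C. C \<in> sets borel}"
  proof (rule indep_setI)
    fix A D assume "A \<in> \<G>" "D \<in> {?C C | C. C \<in> sets borel}"
    then obtain C J B where A: "A \<in> events" "P J B A" and C: "C \<in> sets borel" "D = ?C C" by (auto simp: \<G>_def)
    then have J: "finite J" "J \<subseteq> {0..t}" "\<And>s. B s \<in> sets borel" "AE w in M. w \<in> A \<longleftrightarrow> w \<in> cyl J B" by (auto simp: P_def)
    have ce: "cyl J B \<in> events"
      unfolding cyl_def
    proof (intro sets.sets_Collect_finite_All J(1))
      fix s assume "s \<in> J"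
      then have [measurable]: "X s \<in> borel_measurable M" "B s \<in> sets borel" using J random_variable_X by auto
      show "{w \<in> space M. X s w \<in> B s} \<in> events" by measurable
    qed
    have "prob A = prob (cyl J B)" by (rule finite_measure_eq_AE[OF J(4) A(1) ce])
    moreover have "prob (A \<inter> D) = prob (cyl J B \<inter> D)"
      by (rule finite_measure_eq_AE) (use J(4) in eventually_elim, auto intro!: sets.Int A(1) ce Cm simp: C)
    moreover have "cyl J B \<inter> D = {w \<in> space M. (\<forall>s\<in>J. X s w \<in> B s) \<and> X T w - X t w \<in> C}" "D = {w \<in> space M. X T w - X t w \<in> C}"
      by (auto simp: cyl_def C)
    ultimately show "prob (A \<inter> D) = prob A * prob D"
      using indep_cylinder_increment[OF t J(1-3) C(1)] by (simp add: cyl_def)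
  qed (use Cm in \<open>auto simp: \<G>_def\<close>)
  moreover have "Int_stable {?C C | C. C \<in> sets borel}"
  proof (rule Int_stableI, clarify)
    fix C C' :: "real set" assume "C \<in> sets borel" "C' \<in> sets borel"
    then show "\<exists>C''. ?C C \<inter> ?C C' = ?C C'' \<and> C'' \<in> sets borel" by (intro exI[of _ "C \<inter> C'"]) auto
  qed
  ultimately have "indep_set (sigma_sets (space M) \<G>) (sigma_sets (space M) {?C C | C. C \<in> sets borel})"
    using Int by (intro indep_set_sigma_sets)
  then show ?thesis
    unfolding indep_set_def sets_augmented_filtration
    by (rule indep_sets_mono_sets) (use sigma_sets_mono'[OF gen] in \<open>auto split: bool.split\<close>)
qed

lemma nn_integral_past_increment:
  assumes t: "0 \<le> t" "t \<le> T" and H[measurable]: "H \<in> borel_measurable (Fil t)" and [measurable]: "g \<in> borel_measurable borel"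
  shows "(\<integral>\<^sup>+w. g (X T w - X t w) * H w \<partial>M) = (\<integral>\<^sup>+w. g (X (T - t) w) \<partial>M) * (\<integral>\<^sup>+w. H w \<partial>M)"
proof -
  define D where "D w = X T w - X t w" for w
  have [measurable]: "X T \<in> borel_measurable M" "X t \<in> borel_measurable M" "X (T - t) \<in> borel_measurable M"
    using t by (auto intro: random_variable_X)
  have Dm[measurable]: "D \<in> borel_measurable M" unfolding D_def by measurable
  have Hm[measurable]: "H \<in> borel_measurable M"
    using H sets_augmented_filtration_le[of t] by (auto simp: measurable_def space_augmented_filtration)
  have iv: "indep_var borel H borel (\<lambda>w. g (D w))"
    unfolding indep_var_eq
  proof (intro conjI)
    show "indep_set (sigma_sets (space M) {H -` A \<inter> space M | A. A \<in> sets borel}) (sigma_sets (space M) {(\<lambda>w. g (D w)) -` A \<inter> space M | A. A \<in> sets borel})"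
      using indep_past_increment[OF t] unfolding indep_set_def
    proof (rule indep_sets_mono_sets)
      have 1: "sigma_sets (space M) {H -` A \<inter> space M | A. A \<in> sets borel} \<subseteq> sets (Fil t)"
      proof (rule sets.sigma_sets_subset[of _ "Fil t", unfolded space_augmented_filtration], clarify)
        fix A :: "ennreal set" assume "A \<in> sets borel"
        from measurable_sets[OF H this] show "H -` A \<inter> space M \<in> sets (Fil t)" by (simp add: space_augmented_filtration)
      qed
      have 2: "sigma_sets (space M) {(\<lambda>w. g (D w)) -` A \<inter> space M | A. A \<in> sets borel} \<subseteq> sigma_sets (space M) {(\<lambda>w. X T w - X t w) -` C \<inter> space M | C. C \<in> sets borel}"
      proof (intro sigma_sets_mono' subsetI, clarify)
        fix A :: "ennreal set" assume "A \<in> sets borel"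
        then have "g -` A \<in> sets borel" using measurable_sets_borel[of g borel A] by simp
        then show "\<exists>C. (\<lambda>w. g (D w)) -` A \<inter> space M = (\<lambda>w. X T w - X t w) -` C \<inter> space M \<and> C \<in> sets borel"
          by (intro exI[of _ "g -` A"]) (auto simp: D_def)
      qed
      show "case_bool (sigma_sets (space M) {H -` A \<inter> space M | A. A \<in> sets borel}) (sigma_sets (space M) {(\<lambda>w. g (D w)) -` A \<inter> space M | A. A \<in> sets borel}) i
        \<subseteq> case_bool (sets (Fil t)) (sigma_sets (space M) {(\<lambda>w. X T w - X t w) -` C \<inter> space M | C. C \<in> sets borel}) i" for i
        using 1 2 by (cases i) simp_all
    qed
  qed measurable
  interpret B: prob_space "distr M borel (\<lambda>w. g (D w))" by (rule prob_space_distr) measurable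
  have st: "distr M borel D = distr M borel (X (T - t))"
    using stationary_increments[of t "T - t"] t by (simp add: D_def[abs_def])
  have "(\<integral>\<^sup>+w. g (D w) * H w \<partial>M) = (\<integral>\<^sup>+z. snd z * fst z \<partial>distr M (borel \<Otimes>\<^sub>M borel) (\<lambda>w. (H w, g (D w))))"
    by (subst nn_integral_distr) auto
  also have "\<dots> = (\<integral>\<^sup>+z. snd z * fst z \<partial>(distr M borel H \<Otimes>\<^sub>M distr M borel (\<lambda>w. g (D w))))"
    using iv by (simp add: indep_var_distribution_eq)
  also have "\<dots> = (\<integral>\<^sup>+w. g (D w) \<partial>M) * (\<integral>\<^sup>+w. H w \<partial>M)"
    by (subst B.nn_integral_fst[symmetric]) (simp_all add: nn_integral_multc nn_integral_cmult nn_integral_distr)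
  also have "(\<integral>\<^sup>+w. g (D w) \<partial>M) = (\<integral>\<^sup>+w. g (X (T - t) w) \<partial>M)"
    using nn_integral_distr[of D M borel g] nn_integral_distr[of "X (T - t)" M borel g] st by simp
  finally show ?thesis by (simp add: D_def)
qed

end

section \<open>Finiteness of the exponential moments\<close>

context spectrally_negative_levy_process begin

lemma AE_spectrally_negative_path: "AE w in M. spectrally_negative_path (\<lambda>t. X t w) \<and> X 0 w = 0"
  using cadlag_paths no_positive_jumps start_zero
proof eventually_elim
  case (elim w)
  then show ?case unfolding cadlag_def by (auto intro!: spectrally_negative_path.intro)
qed

lemma exponential_moment_power:
  assumes h: "0 \<le> h"
  shows "(\<integral>\<^sup>+w. ennreal (exp (\<theta> * X (real k * h) w)) \<partial>M) = (\<integral>\<^sup>+w. ennreal (exp (\<theta> * X h w)) \<partial>M) ^ k"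
proof (induction k)
  case 0
  have "(\<integral>\<^sup>+w. ennreal (exp (\<theta> * X 0 w)) \<partial>M) = (\<integral>\<^sup>+w. 1 \<partial>M)"
    by (rule nn_integral_cong_AE) (use start_zero in eventually_elim, simp)
  then show ?case by (simp add: emeasure_space_1)
next
  case (Suc k)
  have "(\<integral>\<^sup>+w. ennreal (exp (\<theta> * X (real (Suc k) * h) w)) \<partial>M)
    = (\<integral>\<^sup>+w. ennreal (exp (\<theta> * (X (real (Suc k) * h) w - X (real k * h) w))) * ennreal (exp (\<theta> * X (real k * h) w)) \<partial>M)"
    by (intro nn_integral_cong) (simp add: ennreal_mult[symmetric] exp_add[symmetric] right_diff_distrib)
  also have "\<dots> = (\<integral>\<^sup>+w. ennreal (exp (\<theta> * X (real (Suc k) * h - real k * h) w)) \<partial>M) * (\<integral>\<^sup>+w. ennreal (exp (\<theta> * X (real k * h) w)) \<partial>M)"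
  proof (rule nn_integral_past_increment[where g = "\<lambda>y. ennreal (exp (\<theta> * y))"])
    show "(\<lambda>w. ennreal (exp (\<theta> * X (real k * h) w))) \<in> borel_measurable (Fil (real k * h))"
      using X_adapted[OF mult_nonneg_nonneg[OF of_nat_0_le_iff h], of k] by measurable
    show "0 \<le> real k * h" by (rule mult_nonneg_nonneg[OF of_nat_0_le_iff h])
    show "real k * h \<le> real (Suc k) * h" by (rule mult_right_mono[OF _ h]) simp
  qed measurable
  also have "real (Suc k) * h - real k * h = h" by (simp add: algebra_simps)
  finally show ?case using Suc by simp
qed

text \<open>If an exponential moment were infinite, then the junk value \<open>ln 0 = 0\<close> of the Laplace exponent would
  give the scale function a Laplace transform that is \<open>- 1 / q\<close> for all large arguments.\<close>

lemma exponential_moment_integrable: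
  assumes W: "scale_function (laplace_exponent M X) q W" and q: "0 < q" and \<theta>: "0 \<le> \<theta>"
  shows "integrable M (\<lambda>w. exp (\<theta> * X 1 w))"
proof (rule ccontr)
  assume not: "\<not> integrable M (\<lambda>w. exp (\<theta> * X 1 w))"
  have [measurable]: "X 1 \<in> borel_measurable M" by (rule random_variable_X) simp
  \<comment> \<open>\<open>s\<close> is at least \<theta>, so its exponential moment is infinite
    too; it lies beyond \<open>right_inverse\<close>, so the transform of \<open>W\<close> is
    prescribed there; and it exceeds q * |W 0|, which the last estimate contradicts.\<close>
  define s where "s = Max {1, \<theta>, right_inverse (laplace_exponent M X) q + 1, q * \<bar>W 0\<bar> + 1}"
  have s: "1 \<le> s" "\<theta> \<le> s" "right_inverse (laplace_exponent M X) q + 1 \<le> s" "q * \<bar>W 0\<bar> + 1 \<le> s"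
    unfolding s_def by (rule Max_ge; simp)+
  have "\<not> integrable M (\<lambda>w. exp (s * X 1 w))"
  proof
    assume "integrable M (\<lambda>w. exp (s * X 1 w))"
    then have "integrable M (\<lambda>w. 1 + exp (s * X 1 w))" by simp
    then have "integrable M (\<lambda>w. exp (\<theta> * X 1 w))"
    proof (rule Bochner_Integration.integrable_bound)
      have "exp (\<theta> * y) \<le> 1 + exp (s * y)" for y
      proof (cases "0 \<le> y")
        case True
        then have "exp (\<theta> * y) \<le> exp (s * y)" using s(2) by (simp add: mult_right_mono)
        also have "\<dots> \<le> 1 + exp (s * y)" by simp
        finally show ?thesis .
      next
        case False
        then have "exp (\<theta> * y) \<le> 1" using \<theta> by (simp add: mult_nonneg_nonpos)
        then show ?thesis by (simp add: add_increasing2)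
      qed
      then show "AE w in M. norm (exp (\<theta> * X 1 w)) \<le> norm (1 + exp (s * X 1 w))" by simp
    qed simp
    then show False using not by simp
  qed
  then have "laplace_exponent M X s = 0" by (simp add: laplace_exponent_def not_integrable_integral_eq)
  then have "((\<lambda>x. exp (- s * x) * W x) has_integral - 1 / q) {0..}"
    using W s(3) unfolding scale_function_def by (metis diff_0 divide_minus_right less_add_one order_less_le_trans minus_divide_left)
  moreover have "((\<lambda>x. exp (- s * x)) has_integral exp (- s * 0) / s) {0..}"
    using has_integral_exp_minus_to_infinity[of s 0] s(1) by simp
  ultimately have "((\<lambda>x. exp (- s * x) * W x - W 0 * exp (- s * x)) has_integral (- 1 / q - W 0 * (exp (- s * 0) / s))) {0..}"
    by (intro has_integral_diff has_integral_mult_right)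
  \<comment> \<open>\<open>W\<close> is bounded below by \<open>W 0\<close>, whose sign is still
    unknown at this stage; comparing the transforms gives s \<le> - q * W 0.\<close>
  then have "0 \<le> - 1 / q - W 0 * (exp (- s * 0) / s)"
  proof (rule has_integral_nonneg)
    fix x :: real assume "x \<in> {0..}"
    then have "W 0 \<le> W x" using W by (simp add: scale_function_def mono_on_def)
    then show "0 \<le> exp (- s * x) * W x - W 0 * exp (- s * x)" by (simp add: mult.commute)
  qed
  then have "s \<le> q * - W 0" using q s(1) by (simp add: field_simps)
  also have "\<dots> \<le> q * \<bar>W 0\<bar>" using q by (intro mult_left_mono) auto
  finally show False using s(4) by simp
qed

end

locale exponentially_integrable_process = spectrally_negative_levy_process +
  assumes exp_integrable: "0 \<le> \<theta> \<Longrightarrow> integrable M (\<lambda>w. exp (\<theta> * X 1 w))"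
begin

text \<open>The moment at k / 2^n is the k-th power of the one at 1 / 2^n, and the latter is the
  2^n-th root of the moment at time 1. This is the reason for working with dyadic times.\<close>

lemma exponential_moment:
  assumes \<theta>: "0 \<le> \<theta>"
  shows "integrable M (\<lambda>w. exp (\<theta> * X 1 w))" "0 < (LINT w|M. exp (\<theta> * X 1 w))"
    and "(\<integral>\<^sup>+w. ennreal (exp (\<theta> * X (real k / 2 ^ n) w)) \<partial>M) = ennreal (exp (laplace_exponent M X \<theta> * (real k / 2 ^ n)))"
proof -
  define m where "m t = (\<integral>\<^sup>+w. ennreal (exp (\<theta> * X t w)) \<partial>M)" for t
  have pow: "m (real k / 2 ^ n) = m (1 / 2 ^ n) ^ k" for k n
    using exponential_moment_power[of "1 / 2 ^ n" \<theta> k] by (simp add: m_def)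
  have X1[measurable]: "X 1 \<in> borel_measurable M" by (rule random_variable_X) simp
  show int: "integrable M (\<lambda>w. exp (\<theta> * X 1 w))" by (rule exp_integrable[OF \<theta>])
  show pos: "0 < (LINT w|M. exp (\<theta> * X 1 w))"
    using int integral_less_AE_space[of "\<lambda>_. 0" "\<lambda>w. exp (\<theta> * X 1 w)"] emeasure_space_1 by simp
  have m1: "m 1 = ennreal (exp (laplace_exponent M X \<theta>))"
    unfolding m_def laplace_exponent_def using pos by (simp add: nn_integral_eq_integral[OF int])
  have root: "m (1 / 2 ^ n) = ennreal (exp (laplace_exponent M X \<theta> / 2 ^ n))" for n
  proof -
    have p: "m (1 / 2 ^ n) ^ (2 ^ n) = ennreal (exp (laplace_exponent M X \<theta>))" using pow[of "2 ^ n" n] m1 by simp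
    then have "m (1 / 2 ^ n) ^ (2 ^ n) < \<top>" by simp
    then have "m (1 / 2 ^ n) < \<top>" by (simp add: power_less_top_ennreal)
    then obtain y where y: "m (1 / 2 ^ n) = ennreal y" "0 \<le> y" by (cases "m (1 / 2 ^ n)") auto
    have "y ^ (2 ^ n) = exp (laplace_exponent M X \<theta>)" using p y by (simp add: ennreal_power)
    also have "\<dots> = exp (laplace_exponent M X \<theta> / 2 ^ n) ^ (2 ^ n)" by (simp add: exp_of_nat_mult[symmetric])
    finally have "y = exp (laplace_exponent M X \<theta> / 2 ^ n)" using y(2) by (intro power_eq_imp_eq_base[of y "2 ^ n"]) auto
    then show ?thesis using y by simp
  qed
  show "(\<integral>\<^sup>+w. ennreal (exp (\<theta> * X (real k / 2 ^ n) w)) \<partial>M) = ennreal (exp (laplace_exponent M X \<theta> * (real k / 2 ^ n)))"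
    using pow[of k n] root[of n] by (simp add: m_def ennreal_power exp_of_nat_mult[symmetric] mult.commute)
qed

end

section \<open>The Laplace exponent\<close>

context exponentially_integrable_process begin

abbreviation "\<psi> \<equiv> laplace_exponent M X"

lemma exp_laplace_exponent: "0 \<le> \<theta> \<Longrightarrow> (LINT w|M. exp (\<theta> * X 1 w)) = exp (\<psi> \<theta>)"
  using exponential_moment(2)[of \<theta>] by (simp add: laplace_exponent_def)

lemma laplace_exponent_zero: "\<psi> 0 = 0"
  by (simp add: laplace_exponent_def prob_space)

lemma X1_measurable[measurable]: "X 1 \<in> borel_measurable M" by (rule random_variable_X) simp

text \<open>Convexity of exp is applied to s X - \<psi>(s) and u X - \<psi>(u), whose exponentials
  have mean 1; taking expectations is Hoelder's inequality in logarithmic form.\<close>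

lemma convex_on_laplace_exponent: "convex_on {0..} \<psi>"
proof (rule convex_onI)
  fix t s u :: real assume t: "0 < t" "t < 1" and "s \<in> {0..}" "u \<in> {0..}"
  then have su: "0 \<le> s" "0 \<le> u" by auto
  define c where "c = (1 - t) * \<psi> s + t * \<psi> u"
  define v where "v = (1 - t) * s + t * u"
  have v: "0 \<le> v" using t su by (simp add: v_def)
  have "exp (v * y - c) \<le> (1 - t) * exp (s * y - \<psi> s) + t * exp (u * y - \<psi> u)" for y
  proof -
    have "exp ((1 - t) *\<^sub>R (s * y - \<psi> s) + t *\<^sub>R (u * y - \<psi> u)) \<le> (1 - t) * exp (s * y - \<psi> s) + t * exp (u * y - \<psi> u)"
      using exp_convex t by (intro convex_onD[of UNIV]) auto
    moreover have "(1 - t) *\<^sub>R (s * y - \<psi> s) + t *\<^sub>R (u * y - \<psi> u) = v * y - c" by (simp add: v_def c_def algebra_simps)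
    ultimately show ?thesis by simp
  qed
  then have "exp (v * y) * exp (- c) \<le> (1 - t) * (exp (s * y) * exp (- \<psi> s)) + t * (exp (u * y) * exp (- \<psi> u))" for y
    by (simp add: exp_add[symmetric])
  then have "(LINT w|M. exp (v * X 1 w) * exp (- c)) \<le> (LINT w|M. (1 - t) * (exp (s * X 1 w) * exp (- \<psi> s)) + t * (exp (u * X 1 w) * exp (- \<psi> u)))"
    by (intro integral_mono integrable_mult_left integrable_mult_right Bochner_Integration.integrable_add exponential_moment(1) v su)
  also have "\<dots> = (1 - t) * (exp (\<psi> s) * exp (- \<psi> s)) + t * (exp (\<psi> u) * exp (- \<psi> u))"
    using exponential_moment(1)[OF su(1)] exponential_moment(1)[OF su(2)] by (simp add: exp_laplace_exponent su)
  also have "\<dots> = 1" by (simp add: exp_minus)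
  finally have "exp (\<psi> v) * exp (- c) \<le> 1" by (simp add: exp_laplace_exponent v)
  then have "\<psi> v \<le> c" by (simp add: exp_minus field_simps)
  then show "\<psi> ((1 - t) *\<^sub>R s + t *\<^sub>R u) \<le> (1 - t) * \<psi> s + t * \<psi> u" by (simp add: v_def c_def)
qed simp

text \<open>Differentiation under the expectation. For |h| < \<theta> / 2 the difference quotients
  are dominated by a multiple of exp(2 \<theta> X) + 1: one half of \<theta> absorbs the shift h,
  the other half the factor |X|.\<close>

lemma laplace_exponent_differentiable:
  assumes \<theta>: "0 < \<theta>"
  shows "\<psi> field_differentiable (at \<theta>)"
proof -
  define \<eta> where "\<eta> = \<theta> / 2"
  have \<eta>: "0 < \<eta>" "2 * \<eta> = \<theta>" using \<theta> by (auto simp: \<eta>_def)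
  define m where "m s = (LINT \<omega>|M. exp (s * X 1 \<omega>))" for s
  have bound: "\<bar>(exp ((\<theta> + h) * y) - exp (\<theta> * y)) / h\<bar> \<le> (1 / \<eta>) * (exp (2 * \<theta> * y) + exp (0 * y))" if h: "h \<noteq> 0" "\<bar>h\<bar> < \<eta>" for h y
  proof -
    have "\<bar>(exp ((\<theta> + h) * y) - exp (\<theta> * y)) / h\<bar> = exp (\<theta> * y) * (\<bar>exp (h * y) - 1\<bar> / \<bar>h\<bar>)"
    proof -
      have "exp ((\<theta> + h) * y) - exp (\<theta> * y) = exp (\<theta> * y) * (exp (h * y) - 1)"
        by (simp add: distrib_right exp_add right_diff_distrib)
      then show ?thesis by (simp add: abs_mult)
    qed
    also have "\<dots> \<le> exp (\<theta> * y) * (\<bar>y\<bar> * exp (\<eta> * \<bar>y\<bar>))"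
    proof (intro mult_left_mono)
      have "\<bar>exp (h * y) - 1\<bar> / \<bar>h\<bar> \<le> \<bar>h * y\<bar> * exp \<bar>h * y\<bar> / \<bar>h\<bar>" using abs_exp_minus_one_le[of "h * y"] h by (intro divide_right_mono) auto
      also have "\<dots> = \<bar>y\<bar> * exp (\<bar>h\<bar> * \<bar>y\<bar>)" using h by (simp add: abs_mult)
      also have "\<dots> \<le> \<bar>y\<bar> * exp (\<eta> * \<bar>y\<bar>)" using h by (intro mult_left_mono) (auto intro!: mult_right_mono)
      finally show "\<bar>exp (h * y) - 1\<bar> / \<bar>h\<bar> \<le> \<bar>y\<bar> * exp (\<eta> * \<bar>y\<bar>)" .
    qed simp
    also have "\<dots> \<le> exp (\<theta> * y) * ((1 / \<eta>) * exp (\<theta> * \<bar>y\<bar>))"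
    proof (intro mult_left_mono)
      have "\<eta> * \<bar>y\<bar> \<le> exp (\<eta> * \<bar>y\<bar>)" using exp_ge_add_one_self[of "\<eta> * \<bar>y\<bar>"] by linarith
      then have "(\<eta> * \<bar>y\<bar>) * exp (\<eta> * \<bar>y\<bar>) \<le> exp (\<eta> * \<bar>y\<bar>) * exp (\<eta> * \<bar>y\<bar>)" by (intro mult_right_mono) auto
      also have "\<dots> = exp (\<theta> * \<bar>y\<bar>)" unfolding exp_add[symmetric] using \<eta>(2) by (simp add: algebra_simps)
      finally show "\<bar>y\<bar> * exp (\<eta> * \<bar>y\<bar>) \<le> (1 / \<eta>) * exp (\<theta> * \<bar>y\<bar>)" using \<eta>(1) by (simp add: field_simps)
    qed simp
    also have "\<dots> = (1 / \<eta>) * exp (\<theta> * y + \<theta> * \<bar>y\<bar>)" by (simp add: exp_add)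
    also have "\<dots> \<le> (1 / \<eta>) * (exp (2 * \<theta> * y) + exp (0 * y))"
    proof (intro mult_left_mono)
      show "exp (\<theta> * y + \<theta> * \<bar>y\<bar>) \<le> exp (2 * \<theta> * y) + exp (0 * y)"
        by (cases "0 \<le> y") (auto simp: algebra_simps)
    qed (use \<eta> in simp)
    finally show ?thesis .
  qed
  have lim: "((\<lambda>h. (m (\<theta> + h) - m \<theta>) / h) \<longlongrightarrow> (LINT \<omega>|M. X 1 \<omega> * exp (\<theta> * X 1 \<omega>))) (at 0)"
  proof (rule Lim_transform_eventually)
    show "((\<lambda>h. LINT \<omega>|M. (exp ((\<theta> + h) * X 1 \<omega>) - exp (\<theta> * X 1 \<omega>)) / h) \<longlongrightarrow> (LINT \<omega>|M. X 1 \<omega> * exp (\<theta> * X 1 \<omega>))) (at 0)"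
      unfolding tendsto_at_iff_sequentially comp_def
    proof (intro allI impI)
      fix h :: "nat \<Rightarrow> real" assume h: "\<forall>i. h i \<in> UNIV - {0}" "h \<longlonglongrightarrow> 0"
      have "\<forall>\<^sub>F i in sequentially. \<bar>h i\<bar> < \<eta>" using h(2) \<eta>(1) by (auto dest!: tendstoD[where e = \<eta>])
      then obtain i0 where i0: "\<And>i. i0 \<le> i \<Longrightarrow> \<bar>h i\<bar> < \<eta>" by (auto simp: eventually_sequentially)
      have "(\<lambda>i. LINT \<omega>|M. (exp ((\<theta> + h (i + i0)) * X 1 \<omega>) - exp (\<theta> * X 1 \<omega>)) / h (i + i0)) \<longlonglongrightarrow> (LINT \<omega>|M. X 1 \<omega> * exp (\<theta> * X 1 \<omega>))"
      proof (rule integral_dominated_convergence[where w = "\<lambda>\<omega>. (1 / \<eta>) * (exp (2 * \<theta> * X 1 \<omega>) + exp (0 * X 1 \<omega>))"])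
        show "integrable M (\<lambda>\<omega>. (1 / \<eta>) * (exp (2 * \<theta> * X 1 \<omega>) + exp (0 * X 1 \<omega>)))"
          using \<theta> by (intro integrable_mult_right Bochner_Integration.integrable_add exponential_moment(1)) auto
        show "AE \<omega> in M. norm ((exp ((\<theta> + h (i + i0)) * X 1 \<omega>) - exp (\<theta> * X 1 \<omega>)) / h (i + i0)) \<le> (1 / \<eta>) * (exp (2 * \<theta> * X 1 \<omega>) + exp (0 * X 1 \<omega>))" for i
          unfolding real_norm_def using h(1) i0[of "i + i0"] by (intro AE_I2 bound) auto
        show "AE \<omega> in M. (\<lambda>i. (exp ((\<theta> + h (i + i0)) * X 1 \<omega>) - exp (\<theta> * X 1 \<omega>)) / h (i + i0)) \<longlonglongrightarrow> X 1 \<omega> * exp (\<theta> * X 1 \<omega>)"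
        proof (rule AE_I2)
          fix \<omega>
          have "((\<lambda>s. exp (s * X 1 \<omega>)) has_field_derivative X 1 \<omega> * exp (\<theta> * X 1 \<omega>)) (at \<theta>)"
            by (auto intro!: derivative_eq_intros)
          then have "((\<lambda>h. (exp ((\<theta> + h) * X 1 \<omega>) - exp (\<theta> * X 1 \<omega>)) / h) \<longlongrightarrow> X 1 \<omega> * exp (\<theta> * X 1 \<omega>)) (at 0)"
            by (simp add: DERIV_def)
          then have "(\<lambda>i. (exp ((\<theta> + h i) * X 1 \<omega>) - exp (\<theta> * X 1 \<omega>)) / h i) \<longlonglongrightarrow> X 1 \<omega> * exp (\<theta> * X 1 \<omega>)"
            using h unfolding tendsto_at_iff_sequentially comp_def by auto
          then show "(\<lambda>i. (exp ((\<theta> + h (i + i0)) * X 1 \<omega>) - exp (\<theta> * X 1 \<omega>)) / h (i + i0)) \<longlonglongrightarrow> X 1 \<omega> * exp (\<theta> * X 1 \<omega>)"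
            by (rule LIMSEQ_ignore_initial_segment)
        qed
      qed measurable
      then show "(\<lambda>i. LINT \<omega>|M. (exp ((\<theta> + h i) * X 1 \<omega>) - exp (\<theta> * X 1 \<omega>)) / h i) \<longlonglongrightarrow> (LINT \<omega>|M. X 1 \<omega> * exp (\<theta> * X 1 \<omega>))"
        by (rule LIMSEQ_offset)
    qed
    have "\<forall>\<^sub>F h in at 0. \<bar>h\<bar> < \<theta>" using \<theta> by (auto simp: eventually_at dist_real_def)
    then show "\<forall>\<^sub>F h in at 0. (LINT \<omega>|M. (exp ((\<theta> + h) * X 1 \<omega>) - exp (\<theta> * X 1 \<omega>)) / h) = (m (\<theta> + h) - m \<theta>) / h"
    proof eventually_elim
      case (elim h)
      then have "0 \<le> \<theta> + h" "0 \<le> \<theta>" using \<theta> by auto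
      then show ?case unfolding m_def by (simp add: exponential_moment(1) Bochner_Integration.integral_diff)
    qed
  qed
  have dm: "(m has_field_derivative (LINT \<omega>|M. X 1 \<omega> * exp (\<theta> * X 1 \<omega>))) (at \<theta>)"
    using lim by (simp add: DERIV_def)
  have "0 < m \<theta>" using exponential_moment(2)[of \<theta>] \<theta> by (simp add: m_def)
  then have "((\<lambda>s. ln (m s)) has_field_derivative inverse (m \<theta>) * (LINT \<omega>|M. X 1 \<omega> * exp (\<theta> * X 1 \<omega>))) (at \<theta>)"
    by (intro DERIV_chain2[OF DERIV_ln dm])
  then show ?thesis unfolding field_differentiable_def m_def laplace_exponent_def[abs_def] by blast
qed

lemma laplace_exponent_tangent:
  assumes "0 < \<theta>" "0 \<le> s"
  shows "deriv \<psi> \<theta> * (s - \<theta>) \<le> \<psi> s - \<psi> \<theta>"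
proof (rule convex_on_imp_above_tangent[OF convex_on_laplace_exponent])
  show "(\<psi> has_field_derivative deriv \<psi> \<theta>) (at \<theta> within {0..})"
    using laplace_exponent_differentiable[OF assms(1)] by (meson field_differentiable_derivI has_field_derivative_at_within)
qed (use assms in auto)

lemma deriv_laplace_exponent_mono:
  assumes "0 < s" "s \<le> \<theta>"
  shows "deriv \<psi> s \<le> deriv \<psi> \<theta>"
proof (cases "s = \<theta>")
  case False
  have "deriv \<psi> \<theta> * (s - \<theta>) \<le> \<psi> s - \<psi> \<theta>" "deriv \<psi> s * (\<theta> - s) \<le> \<psi> \<theta> - \<psi> s"
    using assms by (auto intro!: laplace_exponent_tangent)
  then have "deriv \<psi> s * (\<theta> - s) \<le> deriv \<psi> \<theta> * (\<theta> - s)" by (simp add: algebra_simps)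
  then show ?thesis using False assms by simp
qed simp

text \<open>By convexity the derivative is monotone, so its limit at 0+ exists as an infimum, finite
  by assumption and by comparison with the derivative at 1. The quotient \<psi>(\<theta>) / \<theta>
  lies above this limit, by tangents at points tending to 0 where \<psi> tends to 0, and below the
  derivative at \<theta>, by the tangent there evaluated at 0.\<close>

lemma laplace_exponent_slope_at_zero:
  assumes D: "deriv_zero_plus \<psi> > - \<infinity>"
  shows "((\<lambda>\<theta>. \<psi> \<theta> / \<theta>) \<longlongrightarrow> real_of_ereal (deriv_zero_plus \<psi>)) (at_right 0)"
proof -
  define I where "I = (INF \<theta>\<in>{0<..}. ereal (deriv \<psi> \<theta>))"
  have I_le: "I \<le> ereal (deriv \<psi> \<theta>)" if "0 < \<theta>" for \<theta> unfolding I_def by (rule INF_lower) (use that in simp)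
  have lim: "((\<lambda>\<theta>. ereal (deriv \<psi> \<theta>)) \<longlongrightarrow> I) (at_right 0)"
  proof (rule order_tendstoI)
    fix u assume "u < I"
    then have "\<And>\<theta>. 0 < \<theta> \<Longrightarrow> u < ereal (deriv \<psi> \<theta>)" using I_le by (rule less_le_trans)
    then show "\<forall>\<^sub>F \<theta> in at_right 0. u < ereal (deriv \<psi> \<theta>)" by (auto simp: eventually_at_right_field intro: exI[of _ 1])
  next
    fix u assume "I < u"
    then obtain s where s: "0 < s" "ereal (deriv \<psi> s) < u" unfolding I_def INF_less_iff by auto
    have "ereal (deriv \<psi> \<theta>) < u" if "0 < \<theta>" "\<theta> < s" for \<theta>
      by (rule le_less_trans[OF _ s(2)]) (use that deriv_laplace_exponent_mono[of \<theta> s] in simp)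
    then show "\<forall>\<^sub>F \<theta> in at_right 0. ereal (deriv \<psi> \<theta>) < u" using s(1) by (auto simp: eventually_at_right_field)
  qed
  then have "deriv_zero_plus \<psi> = I" unfolding deriv_zero_plus_def by (intro tendsto_Lim) auto
  moreover have "I \<noteq> \<infinity>" using I_le[of 1] by auto
  ultimately obtain d where d: "deriv_zero_plus \<psi> = ereal d" "I = ereal d" using D by (cases I) auto
  have limD: "((\<lambda>\<theta>. deriv \<psi> \<theta>) \<longlongrightarrow> d) (at_right 0)" using lim unfolding d by simp
  have d_le: "d \<le> deriv \<psi> \<theta>" if "0 < \<theta>" for \<theta> using I_le[OF that] d by simp
  define t where "t n = 1 / (real n + 1)" for n :: nat
  have t: "0 < t n" "t n \<le> 1" for n by (auto simp: t_def field_simps)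
  have t0: "t \<longlonglongrightarrow> 0" unfolding t_def by real_asymp
  have "(\<lambda>n. LINT \<omega>|M. exp (t n * X 1 \<omega>)) \<longlonglongrightarrow> (LINT \<omega>|M. 1)"
  proof (rule integral_dominated_convergence[where w = "\<lambda>\<omega>. exp (0 * X 1 \<omega>) + exp (1 * X 1 \<omega>)"])
    show "integrable M (\<lambda>\<omega>. exp (0 * X 1 \<omega>) + exp (1 * X 1 \<omega>))"
      by (intro Bochner_Integration.integrable_add exponential_moment(1)) auto
    show "AE \<omega> in M. norm (exp (t n * X 1 \<omega>)) \<le> exp (0 * X 1 \<omega>) + exp (1 * X 1 \<omega>)" for n
    proof (rule AE_I2)
      fix \<omega>
      show "norm (exp (t n * X 1 \<omega>)) \<le> exp (0 * X 1 \<omega>) + exp (1 * X 1 \<omega>)"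
      proof (cases "0 \<le> X 1 \<omega>")
        case True
        then have "t n * X 1 \<omega> \<le> 1 * X 1 \<omega>" using t[of n] by (intro mult_right_mono) auto
        then show ?thesis by (simp add: add_increasing)
      next
        case False
        then have "t n * X 1 \<omega> \<le> 0" using t[of n] by (simp add: mult_le_0_iff)
        then show ?thesis by (simp add: add_increasing2)
      qed
    qed
    show "AE \<omega> in M. (\<lambda>n. exp (t n * X 1 \<omega>)) \<longlonglongrightarrow> 1"
    proof (rule AE_I2)
      fix \<omega>
      have "(\<lambda>n. exp (t n * X 1 \<omega>)) \<longlonglongrightarrow> exp (0 * X 1 \<omega>)" by (intro tendsto_intros t0)
      then show "(\<lambda>n. exp (t n * X 1 \<omega>)) \<longlonglongrightarrow> 1" by simp
    qed
  qed measurable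
  then have "(\<lambda>n. ln (LINT \<omega>|M. exp (t n * X 1 \<omega>))) \<longlonglongrightarrow> ln 1"
    by (intro tendsto_ln) (auto simp: prob_space)
  then have \<psi>t: "(\<lambda>n. \<psi> (t n)) \<longlonglongrightarrow> 0" by (simp add: laplace_exponent_def)
  have lower: "d \<le> \<psi> \<theta> / \<theta>" if \<theta>: "0 < \<theta>" for \<theta>
  proof -
    have "(\<lambda>n. \<psi> (t n) + d * (\<theta> - t n)) \<longlonglongrightarrow> 0 + d * (\<theta> - 0)" by (intro tendsto_intros \<psi>t t0)
    moreover have "\<exists>N. \<forall>n\<ge>N. \<psi> (t n) + d * (\<theta> - t n) \<le> \<psi> \<theta>"
    proof -
      obtain N where N: "\<And>n. N \<le> n \<Longrightarrow> t n < \<theta>"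
        using order_tendstoD(2)[OF t0 \<theta>] by (auto simp: eventually_sequentially)
      have "\<psi> (t n) + d * (\<theta> - t n) \<le> \<psi> \<theta>" if "N \<le> n" for n
      proof -
        have "d * (\<theta> - t n) \<le> deriv \<psi> (t n) * (\<theta> - t n)" using N[OF that] d_le[OF t(1)] by (intro mult_right_mono) auto
        also have "\<dots> \<le> \<psi> \<theta> - \<psi> (t n)" using t \<theta> by (intro laplace_exponent_tangent) auto
        finally show ?thesis by simp
      qed
      then show ?thesis by blast
    qed
    ultimately have "0 + d * (\<theta> - 0) \<le> \<psi> \<theta>" by (rule LIMSEQ_le_const2)
    then show ?thesis using \<theta> by (simp add: field_simps)
  qed
  have upper: "\<psi> \<theta> / \<theta> \<le> deriv \<psi> \<theta>" if \<theta>: "0 < \<theta>" for \<theta>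
    using laplace_exponent_tangent[OF \<theta>, of 0] \<theta> by (simp add: laplace_exponent_zero field_simps)
  have "((\<lambda>\<theta>. \<psi> \<theta> / \<theta>) \<longlongrightarrow> d) (at_right 0)"
  proof (rule tendsto_sandwich[OF _ _ tendsto_const limD])
    show "\<forall>\<^sub>F \<theta> in at_right 0. d \<le> \<psi> \<theta> / \<theta>" "\<forall>\<^sub>F \<theta> in at_right 0. \<psi> \<theta> / \<theta> \<le> deriv \<psi> \<theta>"
      using lower upper by (auto simp: eventually_at_right_field intro: exI[of _ 1])
  qed
  then show ?thesis using d by simp
qed

end

text \<open>Divide the representation at \<theta> = n by n. The Gaussian part is nonnegative and is
  dropped, jumps of size at least 1 contribute at most K / n, and Fatou's lemma extracts from the
  compensated small jumps the integral of -x over (-1,0). Thus \<gamma> plus this integral is at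
  most \<delta>, and that sum is the drift.\<close>

lemma levy_khintchine_drift_le:
  assumes LK: "levy_khintchine_triplet \<gamma> \<sigma> \<nu> \<psi>" and slope: "\<And>\<theta>. 0 \<le> \<theta> \<Longrightarrow> \<psi> \<theta> \<le> \<delta> * \<theta>"
  shows "drift \<gamma> \<nu> \<le> \<delta>"
proof -
  have s[measurable_cong]: "sets \<nu> = sets borel" and null: "emeasure \<nu> {0..} = 0"
    and fin: "(\<integral>\<^sup>+x. ennreal (min 1 (x\<^sup>2)) \<partial>\<nu>) < \<infinity>"
    and \<psi>: "\<And>\<theta>. 0 \<le> \<theta> \<Longrightarrow> \<psi> \<theta> = \<gamma> * \<theta> + \<sigma>\<^sup>2 / 2 * \<theta>\<^sup>2 + (LINT x:{..<0}|\<nu>. exp (\<theta> * x) - 1 - \<theta> * x * indicator {-1<..} x)"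
    using LK by (auto simp: levy_khintchine_triplet_def)
  have mint: "integrable \<nu> (\<lambda>x. min 1 (x\<^sup>2))"
    using fin by (simp add: integrable_iff_bounded)
  define g where "g n x = indicator {..<0} x * (exp (real n * x) - 1 - real n * x * indicator {-1<..} x)" for n and x :: real
  \<comment> \<open>Splitting at -1, where the compensator stops: \<open>g1\<close> collects the
    compensated small jumps and is nonnegative, \<open>g2\<close> the uncompensated large ones with
    the sign changed, so that it lies between 0 and 1.\<close>
  define g1 where "g1 n x = indicator {-1<..<0} x * (exp (real n * x) - 1 - real n * x)" for n and x :: real
  define g2 where "g2 n x = indicator {..-1} x * (1 - exp (real n * x))" for n and x :: real
  have split: "g n x = g1 n x - g2 n x" for n x by (auto simp: g_def g1_def g2_def indicator_def)
  have [measurable]: "g1 n \<in> borel_measurable borel" "g2 n \<in> borel_measurable borel" for n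
    unfolding g1_def[abs_def] g2_def[abs_def] by measurable
  have g1_nonneg: "0 \<le> g1 n x" for n x
  proof -
    have "0 \<le> exp (real n * x) - 1 - real n * x" using exp_ge_add_one_self[of "real n * x"] by linarith
    then show ?thesis by (simp add: g1_def indicator_def)
  qed
  have g1_le: "g1 n x \<le> (real n)\<^sup>2 * min 1 (x\<^sup>2)" for n x
  proof (cases "-1 < x \<and> x < 0")
    case True
    define u where "u = - (real n * x)"
    have u: "0 \<le> u" using True by (simp add: u_def mult_le_0_iff)
    have "exp (- u) - 1 + u \<le> u * (1 - exp (- u))"
    proof -
      have "1 + u \<le> exp u" by (rule exp_ge_add_one_self)
      then have "(1 + u) * exp (- u) \<le> exp u * exp (- u)" by (intro mult_right_mono) auto
      also have "\<dots> = 1" by (simp add: exp_minus)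
      finally show ?thesis by (simp add: algebra_simps)
    qed
    also have "\<dots> \<le> u * u" using u exp_ge_add_one_self[of "- u"] by (intro mult_left_mono) auto
    finally have "g1 n x \<le> u * u" using True by (simp add: g1_def u_def)
    also have "u * u = (real n)\<^sup>2 * x\<^sup>2" by (simp add: u_def power2_eq_square)
    also have "x\<^sup>2 = min 1 (x\<^sup>2)"
      using True by (simp add: abs_square_le_1)
    finally show ?thesis .
  qed (auto simp: g1_def indicator_def)
  have i1: "integrable \<nu> (g1 n)" for n
    by (rule Bochner_Integration.integrable_bound[OF integrable_mult_right[OF mint, of "(real n)\<^sup>2"]])
       (use g1_nonneg g1_le in \<open>auto simp: abs_of_nonneg\<close>)
  have ind_le: "indicator {..-1} x \<le> min 1 (x\<^sup>2)" for x :: real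
  proof (cases "x \<le> -1")
    case True
    then have "1 \<le> x\<^sup>2" using abs_le_square_iff[of 1 x] by simp
    then show ?thesis using True by simp
  qed simp
  have ii: "integrable \<nu> (indicator {..-1} :: real \<Rightarrow> real)"
    by (rule Bochner_Integration.integrable_bound[OF mint]) (use ind_le in auto)
  have g2_nonneg: "0 \<le> g2 n x" and g2_le: "g2 n x \<le> indicator {..-1} x" for n x
    by (auto simp: g2_def indicator_def mult_nonneg_nonpos)
  have i2: "integrable \<nu> (g2 n)" for n
    by (rule Bochner_Integration.integrable_bound[OF ii]) (use g2_nonneg g2_le in \<open>auto simp: abs_of_nonneg\<close>)
  define K where "K = (LINT x|\<nu>. indicator {..-1} x :: real)"
  have main: "(LINT x|\<nu>. g1 (Suc n) x) / real (Suc n) \<le> \<delta> - \<gamma> + K / real (Suc n)" for n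
  proof -
    let ?n = "real (Suc n)"
    have "(LINT x|\<nu>. g (Suc n) x) = (LINT x|\<nu>. g1 (Suc n) x) - (LINT x|\<nu>. g2 (Suc n) x)"
      unfolding split by (rule Bochner_Integration.integral_diff[OF i1 i2])
    moreover have "(LINT x|\<nu>. g2 (Suc n) x) \<le> K" unfolding K_def by (intro integral_mono i2 ii g2_le)
    moreover have "\<gamma> * ?n + \<sigma>\<^sup>2 / 2 * ?n\<^sup>2 + (LINT x|\<nu>. g (Suc n) x) \<le> \<delta> * ?n"
      using slope[of ?n] \<psi>[of ?n] by (simp add: g_def set_lebesgue_integral_def)
    moreover have "0 \<le> \<sigma>\<^sup>2 / 2 * ?n\<^sup>2" by simp
    moreover have "(\<delta> - \<gamma>) * ?n = \<delta> * ?n - \<gamma> * ?n" by (rule left_diff_distrib)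
    ultimately have "(LINT x|\<nu>. g1 (Suc n) x) \<le> (\<delta> - \<gamma>) * ?n + K" by linarith
    then have "(LINT x|\<nu>. g1 (Suc n) x) / ?n \<le> ((\<delta> - \<gamma>) * ?n + K) / ?n" by (intro divide_right_mono) auto
    also have "\<dots> = \<delta> - \<gamma> + K / ?n" by (simp add: add_divide_distrib del: of_nat_Suc)
    finally show ?thesis .
  qed
  define h where "h n x = ennreal (g1 (Suc n) x / real (Suc n))" for n x
  have lim: "(\<lambda>n. h n x) \<longlonglongrightarrow> ennreal (indicator {-1<..<0} x * - x)" for x
  proof (cases "-1 < x \<and> x < 0")
    case True
    have "(\<lambda>n. (exp (real (Suc n) * x) - 1 - real (Suc n) * x) / real (Suc n)) \<longlonglongrightarrow> - x"
    proof -
      have e: "(exp (real (Suc n) * x) - 1 - real (Suc n) * x) / real (Suc n) = (exp (real (Suc n) * x) - 1) / real (Suc n) - x" for n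
        by (simp add: field_simps del: of_nat_Suc)
      have "(\<lambda>n. (exp (real (Suc n) * x) - 1) / real (Suc n)) \<longlonglongrightarrow> 0"
      proof (rule tendsto_sandwich)
        show "(\<lambda>n. - 1 / real (Suc n)) \<longlonglongrightarrow> 0" by real_asymp
        show "\<forall>\<^sub>F n in sequentially. - 1 / real (Suc n) \<le> (exp (real (Suc n) * x) - 1) / real (Suc n)"
          by (intro always_eventually allI divide_right_mono) auto
        show "\<forall>\<^sub>F n in sequentially. (exp (real (Suc n) * x) - 1) / real (Suc n) \<le> 0"
          using True by (intro always_eventually allI divide_nonpos_nonneg) (auto simp: mult_nonneg_nonpos simp del: of_nat_Suc)
      qed simp
      then have "(\<lambda>n. (exp (real (Suc n) * x) - 1) / real (Suc n) - x) \<longlonglongrightarrow> 0 - x" by (intro tendsto_intros)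
      then show ?thesis unfolding e by simp
    qed
    then show ?thesis using True by (auto simp: h_def g1_def intro!: tendsto_ennrealI)
  qed (auto simp: h_def g1_def indicator_def)
  have hI: "(\<integral>\<^sup>+x. h n x \<partial>\<nu>) \<le> ennreal (\<delta> - \<gamma> + K / real (Suc n))" for n
  proof -
    have "(\<integral>\<^sup>+x. h n x \<partial>\<nu>) = ennreal (LINT x|\<nu>. g1 (Suc n) x / real (Suc n))"
      unfolding h_def by (rule nn_integral_eq_integral) (use i1 g1_nonneg in auto)
    then show ?thesis using main[of n] by (simp add: ennreal_leI del: of_nat_Suc)
  qed
  have "(\<integral>\<^sup>+x. ennreal (indicator {-1<..<0} x * - x) \<partial>\<nu>) = (\<integral>\<^sup>+x. liminf (\<lambda>n. h n x) \<partial>\<nu>)"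
    by (rule nn_integral_cong) (rule lim_imp_Liminf[OF _ lim, symmetric], simp)
  also have "\<dots> \<le> liminf (\<lambda>n. \<integral>\<^sup>+x. h n x \<partial>\<nu>)"
    by (rule nn_integral_liminf) (simp add: h_def)
  also have "\<dots> \<le> liminf (\<lambda>n. ennreal (\<delta> - \<gamma> + K / real (Suc n)))"
    by (rule Liminf_mono) (simp add: hI del: of_nat_Suc)
  also have "\<dots> = ennreal (\<delta> - \<gamma>)"
  proof (rule lim_imp_Liminf)
    have "(\<lambda>n. \<delta> - \<gamma> + K / real (Suc n)) \<longlonglongrightarrow> \<delta> - \<gamma>" by real_asymp
    then show "(\<lambda>n. ennreal (\<delta> - \<gamma> + K / real (Suc n))) \<longlonglongrightarrow> ennreal (\<delta> - \<gamma>)" by (rule tendsto_ennrealI)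
  qed simp
  finally have F: "(\<integral>\<^sup>+x. ennreal (indicator {-1<..<0} x * - x) \<partial>\<nu>) \<le> ennreal (\<delta> - \<gamma>)" .
  have nonneg: "0 \<le> \<delta> - \<gamma>"
  proof (rule LIMSEQ_le_const)
    show "(\<lambda>n. \<delta> - \<gamma> + K / real (Suc n)) \<longlonglongrightarrow> \<delta> - \<gamma>" by real_asymp
    have "0 \<le> \<delta> - \<gamma> + K / real (Suc n)" for n
      by (rule order_trans[OF _ main]) (auto intro!: divide_nonneg_nonneg integral_nonneg_AE g1_nonneg)
    then show "\<exists>N. \<forall>n\<ge>N. 0 \<le> \<delta> - \<gamma> + K / real (Suc n)" by blast
  qed
  have "(LINT x|\<nu>. indicator {-1<..<0} x * - x) \<le> \<delta> - \<gamma>"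
  proof -
    have "(LINT x|\<nu>. indicator {-1<..<0} x * - x) = enn2real (\<integral>\<^sup>+x. ennreal (indicator {-1<..<0} x * - x) \<partial>\<nu>)"
      by (rule integral_eq_nn_integral) (auto simp: indicator_def)
    also have "\<dots> \<le> \<delta> - \<gamma>" using F nonneg by (intro enn2real_leI) auto
    finally show ?thesis .
  qed
  then show ?thesis by (simp add: drift_def set_lebesgue_integral_def)
qed

text \<open>An increment over a time step h is at most \<delta> h, hence its modulus is at most 2
  \<delta> h minus the increment, and the sum telescopes. The constant contains 4 \<delta> T in
  total: two for the drift, and one at each end for replacing \<open>u 0\<close> by 0 and
  \<open>u n\<close> by \<open>T\<close>.\<close>

lemma nonincreasing_after_drift_bounded_variation:
  assumes f: "\<And>s t. 0 \<le> s \<Longrightarrow> s \<le> t \<Longrightarrow> f t - f s \<le> \<delta> * (t - s)" and T: "0 \<le> T" and \<delta>: "0 \<le> \<delta>"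
  shows "bounded_variation_on T f"
  unfolding bounded_variation_on_def
proof (intro exI[of _ "3 * \<delta> * T + f 0 - (f T - \<delta> * T)"] allI impI)
  fix n :: nat and u :: "nat \<Rightarrow> real" assume u: "0 \<le> u 0 \<and> mono u \<and> u n \<le> T"
  have u0: "0 \<le> u i" for i using u monoD[of u 0 i] by simp
  have "(\<Sum>i<n. \<bar>f (u (Suc i)) - f (u i)\<bar>) \<le> (\<Sum>i<n. 2 * \<delta> * (u (Suc i) - u i) - (f (u (Suc i)) - f (u i)))"
  proof (rule sum_mono)
    fix i
    have le: "u i \<le> u (Suc i)" using u by (simp add: mono_def)
    have "f (u (Suc i)) - f (u i) \<le> \<delta> * (u (Suc i) - u i)" by (rule f[OF u0 le])
    moreover have "0 \<le> \<delta> * (u (Suc i) - u i)" using \<delta> le by simp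
    ultimately show "\<bar>f (u (Suc i)) - f (u i)\<bar> \<le> 2 * \<delta> * (u (Suc i) - u i) - (f (u (Suc i)) - f (u i))"
      by (simp add: abs_le_iff)
  qed
  also have "\<dots> = 2 * \<delta> * (u n - u 0) - (f (u n) - f (u 0))"
    by (simp only: sum_subtractf[of "\<lambda>i. 2 * \<delta> * (u (Suc i) - u i)"] sum_distrib_left[symmetric] sum_lessThan_telescope[of u] sum_lessThan_telescope[of "\<lambda>i. f (u i)"])
  also have "\<dots> \<le> 3 * \<delta> * T + f 0 - (f T - \<delta> * T)"
  proof -
    have un: "u 0 \<le> u n" "0 \<le> u n" using u by (auto simp: mono_def intro: u0)
    have "\<delta> * (u n - u 0) \<le> \<delta> * T" "\<delta> * (u 0 - 0) \<le> \<delta> * T" "\<delta> * (T - u n) \<le> \<delta> * T"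
      using u un u0[of 0] \<delta> by (intro mult_left_mono; simp)+
    moreover have "f (u 0) - f 0 \<le> \<delta> * (u 0 - 0)" "f T - f (u n) \<le> \<delta> * (T - u n)"
      using u u0[of 0] un by (intro f; simp)+
    ultimately show ?thesis by (simp add: algebra_simps)
  qed
  finally show "(\<Sum>i<n. \<bar>f (u (Suc i)) - f (u i)\<bar>) \<le> 3 * \<delta> * T + f 0 - (f T - \<delta> * T)" .
qed

context exponentially_integrable_process begin

text \<open>Chernoff's bound: P(X t \<ge> \<delta> t + \<epsilon>) \<le> exp(-\<theta> \<epsilon>)
  for every \<theta> \<ge> 0, so the probability is 0. Stationarity carries this over to increments,
  countably many dyadic pairs share one null set, and right-continuity fills in the remaining
  times.\<close>

lemma increments_le_of_exponent_le:
  assumes \<delta>: "0 \<le> \<delta>" and le: "\<And>\<theta>. 0 \<le> \<theta> \<Longrightarrow> \<psi> \<theta> \<le> \<delta> * \<theta>"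
  shows "AE w in M. \<forall>s t. 0 \<le> s \<longrightarrow> s \<le> t \<longrightarrow> X t w - X s w \<le> \<delta> * (t - s)"
proof -
  have one: "AE w in M. X (real k / 2 ^ n) w \<le> \<delta> * (real k / 2 ^ n)" for k n
  proof -
    define t where "t = real k / 2 ^ n"
    have t: "0 \<le> t" by (simp add: t_def)
    have [measurable]: "X t \<in> borel_measurable M" by (rule random_variable_X[OF t])
    have "prob {w \<in> space M. \<delta> * t + 1 / real (Suc m) \<le> X t w} = 0" for m
    proof -
      define P where "P = prob {w \<in> space M. \<delta> * t + 1 / real (Suc m) \<le> X t w}"
      have bound: "P \<le> exp (- \<theta> / real (Suc m))" if \<theta>: "0 \<le> \<theta>" for \<theta>
      proof -
        define A where "A = exp (\<theta> * (\<delta> * t + 1 / real (Suc m)))"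
        have "ennreal A * emeasure M {w \<in> space M. \<delta> * t + 1 / real (Suc m) \<le> X t w}
          = (\<integral>\<^sup>+w. ennreal A * indicator {w \<in> space M. \<delta> * t + 1 / real (Suc m) \<le> X t w} w \<partial>M)"
          by (simp add: nn_integral_cmult)
        also have "\<dots> \<le> (\<integral>\<^sup>+w. ennreal (exp (\<theta> * X t w)) \<partial>M)"
          by (intro nn_integral_mono) (use \<theta> in \<open>auto simp: A_def indicator_def intro!: ennreal_leI mult_left_mono\<close>)
        also have "\<dots> = ennreal (exp (\<psi> \<theta> * t))" unfolding t_def by (rule exponential_moment(3)[OF \<theta>])
        also have "\<dots> \<le> ennreal (exp (\<theta> * (\<delta> * t)))"
          using mult_right_mono[OF le[OF \<theta>] t] by (intro ennreal_leI) (simp add: mult_ac)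
        finally have "ennreal (A * P) \<le> ennreal (exp (\<theta> * (\<delta> * t)))"
          by (simp add: P_def emeasure_eq_measure ennreal_mult A_def)
        then have "A * P \<le> exp (\<theta> * (\<delta> * t))" by (subst (asm) ennreal_le_iff) auto
        then have "P \<le> exp (\<theta> * (\<delta> * t)) / A" by (simp add: A_def pos_le_divide_eq mult.commute)
        also have "\<dots> = exp (- \<theta> / real (Suc m))" by (simp add: A_def exp_diff[symmetric] distrib_left)
        finally show ?thesis .
      qed
      have "P \<le> 0"
      proof (rule LIMSEQ_le_const)
        show "(\<lambda>j. exp (- real j / real (Suc m))) \<longlonglongrightarrow> 0" by real_asymp
        show "\<exists>N. \<forall>j\<ge>N. P \<le> exp (- real j / real (Suc m))" using bound by auto
      qed
      then show ?thesis using measure_nonneg[of M] by (simp add: P_def antisym)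
    qed
    then have "AE w in M. \<forall>m. \<not> (\<delta> * t + 1 / real (Suc m) \<le> X t w)"
      by (subst AE_all_countable, intro allI, subst AE_iff_measurable[OF _ refl]) (auto simp: emeasure_eq_measure)
    then show ?thesis
    proof eventually_elim
      case (elim w)
      show ?case
      proof (rule ccontr)
        assume "\<not> X (real k / 2 ^ n) w \<le> \<delta> * (real k / 2 ^ n)"
        then have "0 < X t w - \<delta> * t" by (simp add: t_def)
        then obtain m where "1 / real (Suc m) < X t w - \<delta> * t" using nat_approx_posE by blast
        moreover have "X t w < \<delta> * t + 1 / real (Suc m)" using elim by (simp add: not_le del: of_nat_Suc)
        ultimately show False by linarith
      qed
    qed
  qed
  have two: "AE w in M. X (real l / 2 ^ n) w - X (real k / 2 ^ n) w \<le> \<delta> * (real l / 2 ^ n - real k / 2 ^ n)" if "k \<le> l" for k l n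
  proof -
    define s where "s = real k / 2 ^ n"
    define u where "u = real (l - k) / 2 ^ n"
    have su: "0 \<le> s" "0 \<le> u" "s + u = real l / 2 ^ n" using that by (auto simp: s_def u_def add_divide_distrib[symmetric] of_nat_diff)
    have [measurable]: "X s \<in> borel_measurable M" "X (s + u) \<in> borel_measurable M" "X u \<in> borel_measurable M" using su by (auto intro: random_variable_X)
    have "AE w in M. X u w \<le> \<delta> * u" unfolding u_def by (rule one)
    then have "AE y in distr M borel (X u). y \<le> \<delta> * u" by (subst AE_distr_iff) auto
    then have "AE y in distr M borel (\<lambda>w. X (s + u) w - X s w). y \<le> \<delta> * u"
      unfolding stationary_increments[OF su(1,2)] .
    then have "AE w in M. X (s + u) w - X s w \<le> \<delta> * u"
      by (subst (asm) AE_distr_iff) auto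
    then have "AE w in M. X (real l / 2 ^ n) w - X (real k / 2 ^ n) w \<le> \<delta> * u"
      unfolding su(3) unfolding s_def .
    moreover have "u = real l / 2 ^ n - real k / 2 ^ n" using su(3) by (simp add: s_def)
    ultimately show ?thesis by (simp only:)
  qed
  have "AE w in M. \<forall>n k l. k \<le> l \<longrightarrow> X (real l / 2 ^ n) w - X (real k / 2 ^ n) w \<le> \<delta> * (real l / 2 ^ n - real k / 2 ^ n)"
    unfolding AE_all_countable using two by auto
  with AE_spectrally_negative_path show ?thesis
  proof eventually_elim
    case (elim w)
    then interpret spectrally_negative_path "\<lambda>t. X t w" by simp
    show ?case
    proof (intro allI impI)
      fix s t :: real assume st: "0 \<le> s" "s \<le> t"
      let ?d = dyadic_above
      have lim: "(\<lambda>n. ?d n u) \<longlonglongrightarrow> u" for u using dyadic_above_tendsto[of u] by (simp add: filterlim_at)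
      have Xlim: "(\<lambda>n. X (?d n u) w) \<longlonglongrightarrow> X u w" if "0 \<le> u" for u
        by (rule tendsto_dyadic_above[OF right_cont[OF that]])
      have nat: "?d n u = real (nat (\<lfloor>2 ^ n * u\<rfloor> + 1)) / 2 ^ n" if "0 \<le> u" for n u
        using that by (simp add: dyadic_above_def)
      show "X t w - X s w \<le> \<delta> * (t - s)"
      proof (rule LIMSEQ_le)
        show "(\<lambda>n. X (?d n t) w - X (?d n s) w) \<longlonglongrightarrow> X t w - X s w" using st by (intro tendsto_diff Xlim) auto
        show "(\<lambda>n. \<delta> * (?d n t - ?d n s)) \<longlonglongrightarrow> \<delta> * (t - s)" by (intro tendsto_intros lim)
        have "X (?d n t) w - X (?d n s) w \<le> \<delta> * (?d n t - ?d n s)" for n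
        proof -
          have "nat (\<lfloor>2 ^ n * s\<rfloor> + 1) \<le> nat (\<lfloor>2 ^ n * t\<rfloor> + 1)" using st by (intro nat_mono add_right_mono floor_mono mult_left_mono) auto
          moreover have "0 \<le> t" using st by simp
          ultimately show ?thesis using elim(2) unfolding nat[OF st(1)] nat[OF \<open>0 \<le> t\<close>] by blast
        qed
        then show "\<exists>N. \<forall>n\<ge>N. X (?d n t) w - X (?d n s) w \<le> \<delta> * (?d n t - ?d n s)" by blast
      qed
    qed
  qed
qed

text \<open>If \<psi> \<theta> \<le> \<delta> * \<theta> held for all \<theta>, then X t - \<delta>
  t would be nonincreasing, so the paths would have bounded variation and a drift of at most
  \<delta>, contrary to the assumption. So the difference is positive at some \<open>s\<close>, and
  convexity with \<psi>(0) = 0 makes it grow at least with the slope \<open>c\<close> of the chord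
  from 0 to \<open>s\<close>.\<close>

lemma laplace_exponent_growth:
  assumes LK: "levy_khintchine_triplet \<gamma> \<sigma> \<nu> \<psi>" and \<delta>: "0 \<le> \<delta>"
    and bv: "bounded_variation_paths M X \<longrightarrow> \<delta> < drift \<gamma> \<nu>"
  shows "\<forall>\<^sub>F \<theta> in at_top. q < \<psi> \<theta> - \<delta> * \<theta>"
proof -
  have "\<exists>\<theta>\<ge>0. \<delta> * \<theta> < \<psi> \<theta>"
  proof (rule ccontr)
    assume "\<not> (\<exists>\<theta>\<ge>0. \<delta> * \<theta> < \<psi> \<theta>)"
    then have le: "\<And>\<theta>. 0 \<le> \<theta> \<Longrightarrow> \<psi> \<theta> \<le> \<delta> * \<theta>" by (auto simp: not_less)
    have "bounded_variation_paths M X"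
      unfolding bounded_variation_paths_def
    proof -
      have "AE w in M. \<forall>s t. 0 \<le> s \<longrightarrow> s \<le> t \<longrightarrow> X t w - X s w \<le> \<delta> * (t - s)"
        by (rule increments_le_of_exponent_le[OF \<delta>]) (rule le)
      then show "AE w in M. \<forall>T\<ge>0. bounded_variation_on T (\<lambda>t. X t w)"
      proof eventually_elim
        case (elim w)
        then show ?case by (intro allI impI nonincreasing_after_drift_bounded_variation[OF _ _ \<delta>]) auto
      qed
    qed
    then show False using bv levy_khintchine_drift_le[OF LK, of \<delta>] le by simp
  qed
  then obtain s where s: "0 \<le> s" "\<delta> * s < \<psi> s" by blast
  have s0: "0 < s" using s laplace_exponent_zero by (cases "s = 0") auto
  define c where "c = (\<psi> s - \<delta> * s) / s"
  have c: "0 < c" using s s0 by (simp add: c_def)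
  have lower: "c * \<theta> \<le> \<psi> \<theta> - \<delta> * \<theta>" if "s \<le> \<theta>" for \<theta>
  proof -
    have \<theta>: "0 < \<theta>" using that s0 by simp
    have "\<psi> ((1 - s / \<theta>) *\<^sub>R 0 + (s / \<theta>) *\<^sub>R \<theta>) \<le> (1 - s / \<theta>) * \<psi> 0 + (s / \<theta>) * \<psi> \<theta>"
      using that s0 \<theta> by (intro convex_onD[OF convex_on_laplace_exponent]) auto
    then have "\<psi> s \<le> (s / \<theta>) * \<psi> \<theta>" using \<theta> by (simp add: laplace_exponent_zero)
    then have "\<psi> s * \<theta> \<le> s * \<psi> \<theta>" using \<theta> by (simp add: field_simps)
    then show ?thesis using s0 by (simp add: c_def field_simps)
  qed
  have "\<forall>\<^sub>F \<theta> in at_top. q < c * \<theta>"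
    using c filterlim_at_top_dense[THEN iffD1, OF filterlim_tendsto_pos_mult_at_top[OF tendsto_const c filterlim_ident]] by blast
  then show ?thesis using eventually_ge_at_top[of s]
    by eventually_elim (use lower in fastforce)
qed

end

section \<open>Inversion by scale functions\<close>

text \<open>A bilateral transform with values in \<open>ennreal\<close>: the functions to be
  inverted start at - a, and no question of convergence arises.\<close>

definition laplace :: "(real \<Rightarrow> ennreal) \<Rightarrow> real \<Rightarrow> ennreal" where
  "laplace K \<theta> = (\<integral>\<^sup>+c. ennreal (exp (- \<theta> * c)) * K c \<partial>lborel)"

definition exp_moment :: "real measure \<Rightarrow> real \<Rightarrow> ennreal" where
  "exp_moment \<mu> \<theta> = (\<integral>\<^sup>+y. ennreal (exp (\<theta> * y)) \<partial>\<mu>)"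

lemma laplace_shift:
  assumes [measurable]: "K \<in> borel_measurable borel"
  shows "laplace (\<lambda>c. K (c + y)) \<theta> = ennreal (exp (\<theta> * y)) * laplace K \<theta>"
proof -
  have "laplace K \<theta> = (\<integral>\<^sup>+c. ennreal (exp (- \<theta> * (y + c))) * K (y + c) \<partial>lborel)"
    unfolding laplace_def by (subst nn_integral_real_affine[where c = 1 and t = y]) auto
  then have "ennreal (exp (\<theta> * y)) * laplace K \<theta> = ennreal (exp (\<theta> * y)) * (\<integral>\<^sup>+c. ennreal (exp (- \<theta> * (y + c))) * K (y + c) \<partial>lborel)"
    by (rule arg_cong)
  also have "\<dots> = (\<integral>\<^sup>+c. ennreal (exp (\<theta> * y)) * (ennreal (exp (- \<theta> * (y + c))) * K (y + c)) \<partial>lborel)"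
    by (rule nn_integral_cmult[symmetric]) measurable
  also have "\<dots> = laplace (\<lambda>c. K (c + y)) \<theta>"
    unfolding laplace_def
  proof (rule nn_integral_cong)
    fix c
    have "ennreal (exp (\<theta> * y)) * ennreal (exp (- \<theta> * (y + c))) = ennreal (exp (- \<theta> * c))"
      by (subst ennreal_mult[symmetric]) (simp_all add: exp_add[symmetric] algebra_simps)
    then show "ennreal (exp (\<theta> * y)) * (ennreal (exp (- \<theta> * (y + c))) * K (y + c)) = ennreal (exp (- \<theta> * c)) * K (c + y)"
      by (simp only: mult.assoc[symmetric] add.commute[of y c])
  qed
  finally show ?thesis ..
qed

text \<open>The mixture is the convolution of \<open>K\<close> with the reflection of \<mu> at 0;
  therefore \<mu> enters with the increasing exponential, as in the identity to be inverted.\<close>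

lemma laplace_mixture:
  assumes [measurable]: "K \<in> borel_measurable borel" and \<mu>: "finite_measure \<mu>" "sets \<mu> = sets borel"
  shows "laplace (\<lambda>c. \<integral>\<^sup>+y. K (c + y) \<partial>\<mu>) \<theta> = exp_moment \<mu> \<theta> * laplace K \<theta>"
    and "(\<lambda>c. \<integral>\<^sup>+y. K (c + y) \<partial>\<mu>) \<in> borel_measurable borel"
proof -
  interpret \<mu>: finite_measure \<mu> by fact
  interpret P: pair_sigma_finite \<mu> lborel ..
  note \<mu>(2)[measurable_cong]
  show "(\<lambda>c. \<integral>\<^sup>+y. K (c + y) \<partial>\<mu>) \<in> borel_measurable borel"
    by (rule \<mu>.borel_measurable_nn_integral) measurable
  have "laplace (\<lambda>c. \<integral>\<^sup>+y. K (c + y) \<partial>\<mu>) \<theta> = (\<integral>\<^sup>+c. \<integral>\<^sup>+y. ennreal (exp (- \<theta> * c)) * K (c + y) \<partial>\<mu> \<partial>lborel)"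
    unfolding laplace_def by (intro nn_integral_cong, subst nn_integral_cmult) auto
  also have "\<dots> = (\<integral>\<^sup>+y. \<integral>\<^sup>+c. ennreal (exp (- \<theta> * c)) * K (c + y) \<partial>lborel \<partial>\<mu>)"
    by (rule P.Fubini') measurable
  also have "\<dots> = (\<integral>\<^sup>+y. ennreal (exp (\<theta> * y)) * laplace K \<theta> \<partial>\<mu>)"
    using laplace_shift[of K] by (intro nn_integral_cong) (simp add: laplace_def)
  also have "\<dots> = exp_moment \<mu> \<theta> * laplace K \<theta>"
    unfolding exp_moment_def by (rule nn_integral_multc) measurable
  finally show "laplace (\<lambda>c. \<integral>\<^sup>+y. K (c + y) \<partial>\<mu>) \<theta> = exp_moment \<mu> \<theta> * laplace K \<theta>" .
qed

lemma laplace_add: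
  assumes [measurable]: "f \<in> borel_measurable borel" "g \<in> borel_measurable borel"
  shows "laplace (\<lambda>c. f c + g c) \<theta> = laplace f \<theta> + laplace g \<theta>"
  unfolding laplace_def by (subst nn_integral_add[symmetric]) (auto simp: distrib_left)

lemma laplace_cmult:
  assumes [measurable]: "f \<in> borel_measurable borel"
  shows "laplace (\<lambda>c. k * f c) \<theta> = k * laplace f \<theta>"
  unfolding laplace_def by (subst nn_integral_cmult[symmetric]) (auto simp: mult_ac)

lemma laplace_heaviside:
  assumes "0 < \<theta>"
  shows "(\<integral>\<^sup>+c. ennreal (exp (- \<theta> * c)) * indicator {u..} c \<partial>lborel) = ennreal (exp (- \<theta> * u) / \<theta>)"
proof -
  have "(\<integral>\<^sup>+c. ennreal (exp (- \<theta> * c)) * indicator {u..} c \<partial>lborel) = ennreal (0 - (- exp (- \<theta> * u) / \<theta>))"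
  proof (rule nn_integral_FTC_atLeast)
    show "((\<lambda>c. - exp (- \<theta> * c) / \<theta>) \<longlongrightarrow> 0) at_top"
      using assms by real_asymp
  qed (use assms in \<open>auto intro!: derivative_eq_intros\<close>)
  then show ?thesis by simp
qed

definition primitive :: "(real \<Rightarrow> ennreal) \<Rightarrow> real \<Rightarrow> ennreal" where
  "primitive K c = (\<integral>\<^sup>+u. K u * indicator {..c} u \<partial>lborel)"

lemma heaviside_measurable[measurable]:
  "(\<lambda>z::real \<times> real. indicator {snd z..} (fst z) :: ennreal) \<in> borel_measurable (borel \<Otimes>\<^sub>M borel)"
proof -
  have "closed {z :: real \<times> real. snd z \<le> fst z}"
    by (intro closed_Collect_le continuous_intros)
  then have [measurable]: "{z :: real \<times> real. snd z \<le> fst z} \<in> sets (borel \<Otimes>\<^sub>M borel)"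
    by (metis borel_closed borel_prod)
  have "(\<lambda>z::real \<times> real. indicator {snd z..} (fst z) :: ennreal) = indicator {z. snd z \<le> fst z}"
    by (auto simp: indicator_def)
  then show ?thesis by simp
qed

lemma primitive_measurable[measurable]:
  assumes [measurable]: "K \<in> borel_measurable borel"
  shows "primitive K \<in> borel_measurable borel"
proof -
  have "(\<lambda>c. \<integral>\<^sup>+u. K u * indicator {u..} c \<partial>lborel) \<in> borel_measurable borel"
    by (rule lborel.borel_measurable_nn_integral) (simp add: split_beta', measurable)
  also have "(\<lambda>c. \<integral>\<^sup>+u. K u * indicator {u..} c \<partial>lborel) = primitive K"
    by (auto simp: primitive_def fun_eq_iff indicator_def intro!: nn_integral_cong)
  finally show ?thesis .
qed

lemma laplace_primitive:
  assumes [measurable]: "K \<in> borel_measurable borel" and \<theta>: "0 < \<theta>"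
  shows "laplace (primitive K) \<theta> = laplace K \<theta> * ennreal (1 / \<theta>)"
proof -
  have ind: "indicator {..c} u = (indicator {u..} c :: ennreal)" for c u :: real by (simp add: indicator_def)
  have "laplace (primitive K) \<theta> = (\<integral>\<^sup>+c. \<integral>\<^sup>+u. ennreal (exp (- \<theta> * c)) * (K u * indicator {u..} c) \<partial>lborel \<partial>lborel)"
    unfolding laplace_def primitive_def ind
    by (intro nn_integral_cong, subst nn_integral_cmult) (auto simp: ind[symmetric])
  also have "\<dots> = (\<integral>\<^sup>+u. \<integral>\<^sup>+c. ennreal (exp (- \<theta> * c)) * (K u * indicator {u..} c) \<partial>lborel \<partial>lborel)"
  proof (rule lborel_pair.Fubini')
    have "(\<lambda>z. indicator {fst z..} (snd z) :: ennreal) \<in> borel_measurable (borel \<Otimes>\<^sub>M (borel :: real measure))"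
      using measurable_compose[OF _ heaviside_measurable, of "\<lambda>z. (snd z, fst z)" "borel \<Otimes>\<^sub>M borel"] by simp
    then show "(\<lambda>(u, c). ennreal (exp (- \<theta> * c)) * (K u * indicator {u..} c)) \<in> borel_measurable (lborel \<Otimes>\<^sub>M lborel)"
      by (simp add: split_beta' measurable_lborel1 cong: measurable_cong_sets)
  qed
  also have "\<dots> = (\<integral>\<^sup>+u. (ennreal (exp (- \<theta> * u)) * K u) * ennreal (1 / \<theta>) \<partial>lborel)"
  proof (intro nn_integral_cong)
    fix u
    have "(\<integral>\<^sup>+c. ennreal (exp (- \<theta> * c)) * (K u * indicator {u..} c) \<partial>lborel) = K u * (\<integral>\<^sup>+c. ennreal (exp (- \<theta> * c)) * indicator {u..} c \<partial>lborel)"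
      by (subst nn_integral_cmult[symmetric]) (auto simp: mult_ac)
    also have "\<dots> = K u * (ennreal (exp (- \<theta> * u)) * ennreal (1 / \<theta>))"
      using \<theta> by (subst laplace_heaviside) (simp_all add: ennreal_mult[symmetric])
    finally show "(\<integral>\<^sup>+c. ennreal (exp (- \<theta> * c)) * (K u * indicator {u..} c) \<partial>lborel) = (ennreal (exp (- \<theta> * u)) * K u) * ennreal (1 / \<theta>)"
      by (simp add: mult_ac)
  qed
  also have "\<dots> = laplace K \<theta> * ennreal (1 / \<theta>)"
    unfolding laplace_def by (rule nn_integral_multc) measurable
  finally show ?thesis .
qed

text \<open>By monotonicity only the sign of W 0 is at stake. It is read off from the transform at
  infinity: \<theta> times the transform tends to W 0, and the transform is 1 / (\<psi> \<theta> -
  q) > 0 for large \<theta>.\<close>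

lemma scale_function_nonneg:
  assumes sc: "scale_function \<psi> q W" and pos: "\<forall>\<^sub>F \<theta> in at_top. q < \<psi> \<theta>"
  shows "0 \<le> W y"
proof (cases "y < 0")
  case True
  then show ?thesis using sc by (simp add: scale_function_def)
next
  case False
  have cont: "continuous_on {0..} W" and mono: "mono_on {0..} W"
    and int: "\<And>\<theta>. right_inverse \<psi> q < \<theta> \<Longrightarrow> ((\<lambda>x. exp (- \<theta> * x) * W x) has_integral 1 / (\<psi> \<theta> - q)) {0..}"
    using sc by (auto simp: scale_function_def)
  have "0 \<le> W 0"
  proof (rule ccontr)
    assume "\<not> 0 \<le> W 0"
    define c where "c = - W 0"
    have c: "0 < c" using \<open>\<not> 0 \<le> W 0\<close> by (simp add: c_def)
    \<comment> \<open>Lifting by c = - W 0 gives a nonnegative function that vanishes at 0. Its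
      transform, rescaled by \<theta>, tends to 0 by dominated convergence although it is at least c
      for all large \<theta>.\<close>
    define h where "h u = (if 0 \<le> u then W u + c else 0)" for u
    have h0: "0 \<le> h u" for u using mono by (auto simp: h_def c_def mono_on_def)
    have hmono: "h u \<le> h w" if "u \<le> w" for u w
      using mono that h0[of w] by (auto simp: h_def mono_on_def)
    then have hm[measurable]: "h \<in> borel_measurable borel" by (intro borel_measurable_mono monoI)
    obtain \<theta>0 where \<theta>0: "\<And>\<theta>. \<theta>0 \<le> \<theta> \<Longrightarrow> q < \<psi> \<theta>" using pos by (auto simp: eventually_at_top_linorder)
    define \<theta>1 where "\<theta>1 = max 1 (max \<theta>0 (right_inverse \<psi> q + 1))"
    have hint: "(\<integral>\<^sup>+u. ennreal (exp (- \<theta> * u) * h u) \<partial>lborel) = ennreal (1 / (\<psi> \<theta> - q) + c / \<theta>)" if "\<theta>1 \<le> \<theta>" for \<theta>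
    proof -
      have \<theta>: "right_inverse \<psi> q < \<theta>" "0 < \<theta>" using that by (auto simp: \<theta>1_def)
      have "((\<lambda>u. exp (- \<theta> * u)) has_integral exp (- \<theta> * 0) / \<theta>) {0..}"
        using has_integral_exp_minus_to_infinity[OF \<theta>(2), of 0] by simp
      from has_integral_add[OF int[OF \<theta>(1)] has_integral_mult_left[OF this, of c]]
      have "((\<lambda>u. exp (- \<theta> * u) * W u + exp (- \<theta> * u) * c) has_integral 1 / (\<psi> \<theta> - q) + c / \<theta>) {0..}" by simp
      then have "((\<lambda>u. exp (- \<theta> * u) * h u) has_integral 1 / (\<psi> \<theta> - q) + c / \<theta>) {0..}"
        by (rule has_integral_eq[rotated]) (auto simp: h_def distrib_left)
      then have "(\<integral>\<^sup>+u. indicator {0..} u * (exp (- \<theta> * u) * h u) \<partial>lborel) = ennreal (1 / (\<psi> \<theta> - q) + c / \<theta>)"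
        by (intro nn_integral_has_integral_lebesgue) (use h0 in auto)
      moreover have "(\<integral>\<^sup>+u. indicator {0..} u * (exp (- \<theta> * u) * h u) \<partial>lborel) = (\<integral>\<^sup>+u. ennreal (exp (- \<theta> * u) * h u) \<partial>lborel)"
        by (intro nn_integral_cong) (auto simp: h_def indicator_def)
      ultimately show ?thesis by simp
    qed
    have scaled: "(\<integral>\<^sup>+u. ennreal (exp (- u) * h (u / \<theta>)) \<partial>lborel) = ennreal (\<theta> * (1 / (\<psi> \<theta> - q)) + c)" if "\<theta>1 \<le> \<theta>" for \<theta>
    proof -
      have \<theta>: "0 < \<theta>" "q < \<psi> \<theta>" using that \<theta>0[of \<theta>] by (auto simp: \<theta>1_def)
      have "(\<integral>\<^sup>+u. ennreal (exp (- u) * h (u / \<theta>)) \<partial>lborel) = ennreal \<theta> * (\<integral>\<^sup>+u. ennreal (exp (- \<theta> * u) * h u) \<partial>lborel)"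
        using \<theta> by (subst nn_integral_real_affine[where c = \<theta> and t = 0]) auto
      also have "\<dots> = ennreal (\<theta> * (1 / (\<psi> \<theta> - q) + c / \<theta>))"
        unfolding hint[OF that] using \<theta> c by (intro ennreal_mult[symmetric]) auto
      also have "\<theta> * (1 / (\<psi> \<theta> - q) + c / \<theta>) = \<theta> * (1 / (\<psi> \<theta> - q)) + c" using \<theta> by (simp add: distrib_left)
      finally show ?thesis .
    qed
    have lim: "(\<lambda>n. \<integral>\<^sup>+u. ennreal (exp (- u) * h (u / (\<theta>1 + real n))) \<partial>lborel) \<longlonglongrightarrow> (\<integral>\<^sup>+u. 0 \<partial>(lborel :: real measure))"
    proof (rule nn_integral_dominated_convergence[where w = "\<lambda>u. ennreal (exp (- u) * h (u / \<theta>1))"])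
      have \<theta>1p: "0 < \<theta>1" by (simp add: \<theta>1_def)
      show "AE u in lborel. ennreal (exp (- u) * h (u / (\<theta>1 + real n))) \<le> ennreal (exp (- u) * h (u / \<theta>1))" for n
      proof (intro AE_I2 ennreal_leI mult_left_mono)
        fix u show "h (u / (\<theta>1 + real n)) \<le> h (u / \<theta>1)"
        proof (cases "0 \<le> u")
          case True
          then show ?thesis using \<theta>1p by (intro hmono divide_left_mono) auto
        next
          case False
          then have "u / (\<theta>1 + real n) < 0" using \<theta>1p by (simp add: divide_less_0_iff)
          then show ?thesis using h0[of "u / \<theta>1"] by (simp add: h_def)
        qed
      qed simp
      show "(\<integral>\<^sup>+u. ennreal (exp (- u) * h (u / \<theta>1)) \<partial>lborel) < \<infinity>" using scaled[of \<theta>1] by simp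
      show "AE u in lborel. (\<lambda>n. ennreal (exp (- u) * h (u / (\<theta>1 + real n)))) \<longlonglongrightarrow> 0"
      proof (rule AE_I2)
        fix u :: real
        have "(\<lambda>n. exp (- u) * h (u / (\<theta>1 + real n))) \<longlonglongrightarrow> 0"
        proof (cases "0 \<le> u")
          case True
          have l: "(\<lambda>n. u / (\<theta>1 + real n)) \<longlonglongrightarrow> 0" by real_asymp
          have "(\<lambda>n. W (u / (\<theta>1 + real n))) \<longlonglongrightarrow> W 0"
            by (rule continuous_on_tendsto_compose[OF cont l]) (use True \<theta>1p in auto)
          then have "(\<lambda>n. exp (- u) * (W (u / (\<theta>1 + real n)) + c)) \<longlonglongrightarrow> exp (- u) * (W 0 + c)"
            by (intro tendsto_intros)
          then show ?thesis using True \<theta>1p by (simp add: h_def c_def)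
        next
          case False
          then have "\<not> 0 \<le> u / (\<theta>1 + real n)" for n using \<theta>1p by (simp add: not_le divide_less_0_iff)
          then show ?thesis by (simp add: h_def)
        qed
        then show "(\<lambda>n. ennreal (exp (- u) * h (u / (\<theta>1 + real n)))) \<longlonglongrightarrow> 0"
          using tendsto_ennrealI by fastforce
      qed
    qed auto
    have "ennreal c \<le> (\<integral>\<^sup>+u. ennreal (exp (- u) * h (u / (\<theta>1 + real n))) \<partial>lborel)" for n
    proof -
      have "\<theta>1 \<le> \<theta>1 + real n" by simp
      moreover have "0 \<le> (\<theta>1 + real n) * (1 / (\<psi> (\<theta>1 + real n) - q))"
      proof (rule mult_nonneg_nonneg)
        have "0 < \<theta>1" "\<theta>0 \<le> \<theta>1" by (auto simp: \<theta>1_def)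
        then show "0 \<le> \<theta>1 + real n" "0 \<le> 1 / (\<psi> (\<theta>1 + real n) - q)" using \<theta>0[of "\<theta>1 + real n"] by auto
      qed
      ultimately show ?thesis by (subst scaled) (auto intro: ennreal_leI)
    qed
    then have "ennreal c \<le> 0" using lim by (intro LIMSEQ_le_const) auto
    then show False using c by simp
  qed
  then show ?thesis using mono False by (auto simp: mono_on_def intro: order.trans[of 0 "W 0"])
qed

section \<open>Total masses from the identity at 0 and near 0\<close>

locale potential_identity =
  fixes U \<kappa> :: "real measure" and p a b x \<delta> q d :: real and \<psi> :: "real \<Rightarrow> real"
  assumes sets_U[measurable_cong]: "sets U = sets borel" and sets_\<kappa>[measurable_cong]: "sets \<kappa> = sets borel"
    and a: "0 < a" "x \<le> a" and b: "0 < b" and \<delta>: "0 \<le> \<delta>" and q: "0 < q" and p: "0 \<le> p"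
    and U_supp: "AE y in U. 0 \<le> y \<and> y \<le> a" and \<kappa>_supp: "AE z in \<kappa>. z \<le> 0"
    and \<psi>_zero: "\<psi> 0 = 0" and \<psi>_slope: "((\<lambda>\<theta>. \<psi> \<theta> / \<theta>) \<longlongrightarrow> d) (at_right 0)"
    and id: "\<And>\<theta> c1 c2. 0 \<le> \<theta> \<Longrightarrow> 0 \<le> c1 \<Longrightarrow> 0 \<le> c2 \<Longrightarrow> c1 - c2 = \<psi> \<theta> - q \<Longrightarrow>
      ennreal (exp (\<theta> * a)) * ennreal p + (\<integral>\<^sup>+y. ennreal (exp (\<theta> * y) * (c2 + \<theta> * \<delta> * indicator {b<..} y)) \<partial>U)
      = ennreal (exp (\<theta> * x)) + (\<integral>\<^sup>+y. ennreal (exp (\<theta> * y) * c1) \<partial>U) + ennreal \<theta> * (\<integral>\<^sup>+y. ennreal (exp (\<theta> * y)) \<partial>\<kappa>)"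
begin

lemma space_U: "space U = UNIV" using sets_eq_imp_space_eq[OF sets_U] by simp

text \<open>The case \<theta> = 0 with the rates 0 and \<open>q\<close>. It bounds the mass of
  \<open>U\<close> by 1 / q, the first finiteness result.\<close>

lemma mass_ennreal: "ennreal p + ennreal q * emeasure U UNIV = 1"
  using id[of 0 0 q] q by (simp add: \<psi>_zero space_U)

lemma U_finite: "finite_measure U"
proof
  show "emeasure U (space U) \<noteq> \<infinity>"
    using mass_ennreal q by (auto simp: space_U ennreal_mult_top)
qed

interpretation U: finite_measure U by (rule U_finite)

lemma mass: "p + q * measure U UNIV = 1"
proof -
  have "ennreal (p + q * measure U UNIV) = ennreal 1"
    using mass_ennreal p q by (simp add: U.emeasure_eq_measure ennreal_mult ennreal_plus)
  then show ?thesis using p q by (subst (asm) ennreal_inj) auto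
qed

lemma U_integrable:
  fixes g :: "real \<Rightarrow> real"
  assumes [measurable]: "g \<in> borel_measurable borel" and "\<And>y. 0 \<le> y \<Longrightarrow> y \<le> a \<Longrightarrow> \<bar>g y\<bar> \<le> C"
  shows "integrable U g"
proof (rule U.integrable_const_bound)
  show "AE y in U. norm (g y) \<le> C" using U_supp by eventually_elim (use assms(2) in auto)
qed measurable

definition EU where "EU \<theta> = (LINT y|U. exp (\<theta> * y))"
definition EG where "EG \<theta> = (LINT y|U. exp (\<theta> * y) * indicator {b<..} y)"

lemma int_exp: "0 \<le> \<theta> \<Longrightarrow> integrable U (\<lambda>y. exp (\<theta> * y))"
  by (rule U_integrable[where C = "exp (\<theta> * a)"]) (auto simp: mult_left_mono)

lemma int_exp_ind: "0 \<le> \<theta> \<Longrightarrow> integrable U (\<lambda>y. exp (\<theta> * y) * indicator {b<..} y)"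
  by (rule U_integrable[where C = "exp (\<theta> * a)"]) (auto simp: mult_left_mono indicator_def)

lemma EU_nonneg: "0 \<le> EU \<theta>" and EG_nonneg: "0 \<le> EG \<theta>"
  unfolding EU_def EG_def by (auto intro!: integral_nonneg_AE)

text \<open>\<open>U\<close> is finite and lives on [0, a], so the left side is finite and forces
  the moment of \<kappa> to be finite as well; only then can the identity be written in real numbers
  with the single rate \<psi> \<theta> - q.\<close>

lemma real_identity:
  assumes \<theta>: "0 < \<theta>"
  obtains k where "0 \<le> k" "(\<integral>\<^sup>+y. ennreal (exp (\<theta> * y)) \<partial>\<kappa>) = ennreal k"
    "p * exp (\<theta> * a) + \<theta> * \<delta> * EG \<theta> = exp (\<theta> * x) + (\<psi> \<theta> - q) * EU \<theta> + \<theta> * k"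
proof -
  \<comment> \<open>Positive and negative part of \<psi>, with the killing rate \<open>q\<close>
    added to the latter.\<close>
  define c1 c2 where "c1 = max (\<psi> \<theta>) 0" and "c2 = max (- \<psi> \<theta>) 0 + q"
  have c: "0 \<le> c1" "0 \<le> c2" "c1 - c2 = \<psi> \<theta> - q" using q by (auto simp: c1_def c2_def)
  have \<theta>0: "0 \<le> \<theta>" using \<theta> by simp
  have i1: "(\<integral>\<^sup>+y. ennreal (exp (\<theta> * y) * (c2 + \<theta> * \<delta> * indicator {b<..} y)) \<partial>U) = ennreal (c2 * EU \<theta> + \<theta> * \<delta> * EG \<theta>)"
  proof (subst nn_integral_eq_integral)
    have eq: "(\<lambda>y. exp (\<theta> * y) * (c2 + \<theta> * \<delta> * indicator {b<..} y)) = (\<lambda>y. c2 * exp (\<theta> * y) + \<theta> * \<delta> * (exp (\<theta> * y) * indicator {b<..} y))"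
      by (auto simp: algebra_simps)
    show "integrable U (\<lambda>y. exp (\<theta> * y) * (c2 + \<theta> * \<delta> * indicator {b<..} y))"
      unfolding eq using int_exp[OF \<theta>0] int_exp_ind[OF \<theta>0] by (intro Bochner_Integration.integrable_add integrable_mult_right)
    show "ennreal (LINT y|U. exp (\<theta> * y) * (c2 + \<theta> * \<delta> * indicator {b<..} y)) = ennreal (c2 * EU \<theta> + \<theta> * \<delta> * EG \<theta>)"
      unfolding eq EU_def EG_def using int_exp[OF \<theta>0] int_exp_ind[OF \<theta>0] by (simp add: Bochner_Integration.integral_add)
  qed (use c \<theta> \<delta> in auto)
  have i2: "(\<integral>\<^sup>+y. ennreal (exp (\<theta> * y) * c1) \<partial>U) = ennreal (c1 * EU \<theta>)"
    using c int_exp[OF \<theta>0] by (subst nn_integral_eq_integral) (auto simp: EU_def mult.commute)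
  let ?K = "\<integral>\<^sup>+y. ennreal (exp (\<theta> * y)) \<partial>\<kappa>"
  have main: "ennreal (exp (\<theta> * a) * p + (c2 * EU \<theta> + \<theta> * \<delta> * EG \<theta>)) = ennreal (exp (\<theta> * x) + c1 * EU \<theta>) + ennreal \<theta> * ?K"
    using id[OF \<theta>0 c] p c \<theta> \<delta> EU_nonneg[of \<theta>] EG_nonneg[of \<theta>] unfolding i1 i2 by (simp add: ennreal_mult ennreal_plus)
  have "?K \<noteq> \<top>"
  proof
    assume "?K = \<top>"
    then have "ennreal (exp (\<theta> * a) * p + (c2 * EU \<theta> + \<theta> * \<delta> * EG \<theta>)) = \<top>" using main \<theta> by (simp add: ennreal_mult_top)
    then show False by simp
  qed
  then obtain k where k: "0 \<le> k" "?K = ennreal k" by (cases ?K) auto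
  have "ennreal (exp (\<theta> * a) * p + (c2 * EU \<theta> + \<theta> * \<delta> * EG \<theta>)) = ennreal (exp (\<theta> * x) + c1 * EU \<theta> + \<theta> * k)"
    using main k \<theta> c EU_nonneg[of \<theta>] by (simp add: ennreal_mult ennreal_plus)
  then have "exp (\<theta> * a) * p + (c2 * EU \<theta> + \<theta> * \<delta> * EG \<theta>) = exp (\<theta> * x) + c1 * EU \<theta> + \<theta> * k"
    using k \<theta> \<delta> p c EU_nonneg[of \<theta>] EG_nonneg[of \<theta>] by (subst (asm) ennreal_inj) auto
  moreover have "(\<psi> \<theta> - q) * EU \<theta> = c1 * EU \<theta> - c2 * EU \<theta>" using c(3)[symmetric] by (simp add: left_diff_distrib)
  ultimately have "p * exp (\<theta> * a) + \<theta> * \<delta> * EG \<theta> = exp (\<theta> * x) + (\<psi> \<theta> - q) * EU \<theta> + \<theta> * k" by (simp add: mult_ac)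
  then show thesis using that k by blast
qed

lemma exp_quotient_bound:
  assumes "0 < \<theta>" "\<theta> \<le> 1" "0 \<le> y" "y \<le> a"
  shows "\<bar>(exp (\<theta> * y) - 1) / \<theta>\<bar> \<le> a * exp a"
proof -
  have "\<bar>(exp (\<theta> * y) - 1) / \<theta>\<bar> \<le> y * exp (\<theta> * y)"
    using abs_exp_minus_one_le[of "\<theta> * y"] assms by (simp add: abs_mult divide_le_eq mult_ac)
  also have "\<dots> \<le> a * exp a"
  proof (intro mult_mono)
    have "\<theta> * y \<le> 1 * a" using assms a by (intro mult_mono) auto
    then show "exp (\<theta> * y) \<le> exp a" by simp
  qed (use assms in auto)
  finally show ?thesis .
qed

text \<open>Solve for the moment of \<kappa>, cancel the constant terms by \<open>mass\<close>, and
  let \<theta> tend to 0 along 1 / (n + 1). The exponentials become difference quotients with limits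
  a, x and the mean of \<open>U\<close>, and \<psi>(\<theta>) / \<theta> tends to \<open>d\<close>.
  On the other hand the moments tend to the total mass, because \<kappa> lives on the negative
  half-line.\<close>

theorem \<kappa>_mass:
  "emeasure \<kappa> UNIV = ennreal (p * a + q * (LINT y|U. y) - x + \<delta> * measure U {b<..} - d * measure U UNIV)" (is "_ = ennreal ?L")
  and \<kappa>_mass_nonneg: "0 \<le> p * a + q * (LINT y|U. y) - x + \<delta> * measure U {b<..} - d * measure U UNIV"
proof -
  define t where "t n = 1 / (real n + 1)" for n :: nat
  have t: "0 < t n" "t n \<le> 1" for n by (auto simp: t_def field_simps)
  have t0: "filterlim t (at_right 0) sequentially" unfolding t_def by real_asymp
  have "\<forall>n. \<exists>k. 0 \<le> k \<and> (\<integral>\<^sup>+y. ennreal (exp (t n * y)) \<partial>\<kappa>) = ennreal k \<and> p * exp (t n * a) + t n * \<delta> * EG (t n) = exp (t n * x) + (\<psi> (t n) - q) * EU (t n) + t n * k"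
    using real_identity[OF t(1)] by metis
  then obtain k where k: "\<And>n. 0 \<le> k n" "\<And>n. (\<integral>\<^sup>+y. ennreal (exp (t n * y)) \<partial>\<kappa>) = ennreal (k n)"
    "\<And>n. p * exp (t n * a) + t n * \<delta> * EG (t n) = exp (t n * x) + (\<psi> (t n) - q) * EU (t n) + t n * k n"
    by metis
  define Q where "Q n y = (exp (t n * y) - 1) / t n" for n and y :: real
  have Ql: "(\<lambda>n. Q n y) \<longlonglongrightarrow> y" for y unfolding Q_def t_def by real_asymp
  have Qm[measurable]: "Q n \<in> borel_measurable borel" for n unfolding Q_def[abs_def] by measurable
  have Qi: "integrable U (Q n)" for n
    by (rule U_integrable[where C = "a * exp a"]) (use exp_quotient_bound[OF t] in \<open>auto simp: Q_def\<close>)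
  have QEU: "(LINT y|U. Q n y) = (EU (t n) - measure U UNIV) / t n" for n
    unfolding Q_def EU_def using int_exp[of "t n"] t[of n] by (simp add: Bochner_Integration.integral_diff space_U)
  have k_eq: "k n = p * Q n a + q * (LINT y|U. Q n y) - Q n x + \<delta> * EG (t n) - \<psi> (t n) / t n * EU (t n)" for n
  proof -
    have tn: "t n \<noteq> 0" using t[of n] by simp
    have "t n * k n = p * (exp (t n * a) - 1) + q * (EU (t n) - measure U UNIV) - (exp (t n * x) - 1) + t n * \<delta> * EG (t n) - \<psi> (t n) * EU (t n)"
      using k(3)[of n] mass by (simp add: algebra_simps)
    then have "k n = (p * (exp (t n * a) - 1) + q * (EU (t n) - measure U UNIV) - (exp (t n * x) - 1) + t n * \<delta> * EG (t n) - \<psi> (t n) * EU (t n)) / t n"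
      using tn by (simp add: field_simps)
    also have "\<dots> = p * Q n a + q * (LINT y|U. Q n y) - Q n x + \<delta> * EG (t n) - \<psi> (t n) / t n * EU (t n)"
      unfolding QEU unfolding Q_def using tn by (simp add: add_divide_distrib diff_divide_distrib algebra_simps)
    finally show ?thesis .
  qed
  have tl: "t \<longlonglongrightarrow> 0" using t0 by (simp add: filterlim_at)
  have l1: "(\<lambda>n. LINT y|U. Q n y) \<longlonglongrightarrow> (LINT y|U. y)"
  proof (rule integral_dominated_convergence[where w = "\<lambda>_. a * exp a"])
    show "AE y in U. norm (Q n y) \<le> a * exp a" for n
      using U_supp by eventually_elim (use exp_quotient_bound[OF t[of n]] in \<open>auto simp: Q_def\<close>)
  qed (use Ql in \<open>auto simp: Q_def\<close>)
  have l2: "(\<lambda>n. EU (t n)) \<longlonglongrightarrow> (LINT y|U. 1)"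
    unfolding EU_def
  proof (rule integral_dominated_convergence[where w = "\<lambda>_. exp a"])
    show "AE y in U. norm (exp (t n * y)) \<le> exp a" for n
      using U_supp by eventually_elim (use t[of n] a in \<open>auto intro!: order.trans[OF mult_mono[of "t n" 1 _ a]]\<close>)
    show "AE y in U. (\<lambda>n. exp (t n * y)) \<longlonglongrightarrow> 1"
      using tendsto_exp[OF tendsto_mult_right[OF tl]] by (intro AE_I2) (auto simp: mult.commute)
  qed auto
  have l3: "(\<lambda>n. EG (t n)) \<longlonglongrightarrow> (LINT y|U. indicator {b<..} y)"
    unfolding EG_def
  proof (rule integral_dominated_convergence[where w = "\<lambda>_. exp a"])
    show "AE y in U. norm (exp (t n * y) * indicator {b<..} y) \<le> exp a" for n
      using U_supp by eventually_elim (use t[of n] a in \<open>auto simp: indicator_def intro!: order.trans[OF mult_mono[of "t n" 1 _ a]]\<close>)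
    show "AE y in U. (\<lambda>n. exp (t n * y) * indicator {b<..} y) \<longlonglongrightarrow> indicator {b<..} y"
    proof (rule AE_I2)
      fix y
      have "(\<lambda>n. exp (t n * y) * indicator {b<..} y) \<longlonglongrightarrow> exp (0 * y) * indicator {b<..} y"
        by (intro tendsto_intros tl)
      then show "(\<lambda>n. exp (t n * y) * indicator {b<..} y) \<longlonglongrightarrow> (indicator {b<..} y :: real)" by simp
    qed
  qed auto
  have l4: "(\<lambda>n. \<psi> (t n) / t n) \<longlonglongrightarrow> d" by (rule filterlim_compose[OF \<psi>_slope t0])
  have lk: "k \<longlonglongrightarrow> ?L"
  proof -
    have "(\<lambda>n. p * Q n a + q * (LINT y|U. Q n y) - Q n x + \<delta> * EG (t n) - \<psi> (t n) / t n * EU (t n)) \<longlonglongrightarrow>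
       p * a + q * (LINT y|U. y) - x + \<delta> * (LINT y|U. indicator {b<..} y) - d * (LINT y|U. 1)"
      by (intro tendsto_intros Ql l1 l2 l3 l4)
    then show ?thesis unfolding k_eq[symmetric] by (simp add: space_U)
  qed
  show L0: "0 \<le> ?L" by (rule LIMSEQ_le_const[OF lk]) (use k in auto)
  \<comment> \<open>The minimum with 0 changes the integrand only on a \<kappa>-null set and makes
    it increase with n everywhere, so monotone convergence applies before the mass is known to be
    finite.\<close>
  have "(\<lambda>n. \<integral>\<^sup>+y. ennreal (exp (t n * min y 0)) \<partial>\<kappa>) \<longlonglongrightarrow> (\<integral>\<^sup>+y. 1 \<partial>\<kappa>)"
  proof (rule nn_integral_LIMSEQ)
    show "incseq (\<lambda>n y. ennreal (exp (t n * min y 0)))"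
      unfolding incseq_def le_fun_def
    proof (intro allI impI ennreal_leI)
      fix m n :: nat and y :: real assume "m \<le> n"
      then have "t n \<le> t m" by (simp add: t_def frac_le)
      then have "t m * min y 0 \<le> t n * min y 0" by (intro mult_right_mono_neg) auto
      then show "exp (t m * min y 0) \<le> exp (t n * min y 0)" by simp
    qed
    fix y :: real
    have "(\<lambda>n. exp (t n * min y 0)) \<longlonglongrightarrow> exp (0 * min y 0)" by (intro tendsto_intros tl)
    then show "(\<lambda>n. ennreal (exp (t n * min y 0))) \<longlonglongrightarrow> 1"
      using tendsto_ennrealI by fastforce
  qed measurable
  moreover have "(\<integral>\<^sup>+y. ennreal (exp (t n * min y 0)) \<partial>\<kappa>) = ennreal (k n)" for n
    unfolding k(2)[symmetric] by (rule nn_integral_cong_AE) (use \<kappa>_supp in eventually_elim, simp)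
  ultimately have "(\<lambda>n. ennreal (k n)) \<longlonglongrightarrow> emeasure \<kappa> UNIV"
    using sets_eq_imp_space_eq[OF sets_\<kappa>] by simp
  moreover have "(\<lambda>n. ennreal (k n)) \<longlonglongrightarrow> ennreal ?L" by (intro tendsto_ennrealI lk)
  ultimately show "emeasure \<kappa> UNIV = ennreal ?L" by (rule LIMSEQ_unique)
qed

lemma \<kappa>_finite: "finite_measure \<kappa>"
  by standard (use \<kappa>_mass sets_eq_imp_space_eq[OF sets_\<kappa>] in simp)

end

lemma AE_dense:
  assumes P: "AE s in lborel. P s" and uv: "u < (v::real)"
  obtains s where "u < s" "s < v" "P s"
proof -
  have "\<exists>s. u < s \<and> s < v \<and> P s"
  proof (rule ccontr)
    assume neg: "\<not> (\<exists>s. u < s \<and> s < v \<and> P s)"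
    have "AE s in lborel. s \<notin> {u<..<v}"
      using P by eventually_elim (use neg in auto)
    then have "{u<..<v} \<in> null_sets lborel" by (subst AE_iff_null_sets) auto
    then show False using uv by (simp add: null_sets_def)
  qed
  then show thesis using that by blast
qed

text \<open>Laplace inversion gives identities only almost everywhere; a value at a particular point
  is obtained as a limit along such a sequence.\<close>

lemma AE_dense_sequence:
  assumes P: "AE s in lborel. P s"
  obtains \<sigma> :: "nat \<Rightarrow> real" where "\<sigma> \<longlonglongrightarrow> s" "\<And>n. s < \<sigma> n" "\<And>n. \<sigma> n < s + 1" "\<And>n. P (\<sigma> n)"
proof -
  have "\<exists>u. s < u \<and> u < s + 1 / (real n + 1) \<and> P u" for n
    using AE_dense[OF P, of s "s + 1 / (real n + 1)"] by (metis less_add_same_cancel1 of_nat_0_le_iff add_nonneg_pos zero_less_divide_1_iff zero_less_one)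
  then obtain \<sigma> where \<sigma>: "\<And>n. s < \<sigma> n" "\<And>n. \<sigma> n < s + 1 / (real n + 1)" "\<And>n. P (\<sigma> n)" by metis
  have "\<sigma> \<longlonglongrightarrow> s"
  proof (rule tendsto_sandwich[OF _ _ tendsto_const])
    show "(\<lambda>n. s + 1 / (real n + 1)) \<longlonglongrightarrow> s" by real_asymp
  qed (use \<sigma>(1,2)[THEN less_imp_le] in \<open>auto intro!: always_eventually\<close>)
  moreover have "\<sigma> n < s + 1" for n
  proof -
    have "1 / (real n + 1) \<le> 1" by simp
    then show ?thesis using \<sigma>(2)[of n] by linarith
  qed
  ultimately show thesis using that \<sigma>(1,3) by blast
qed

lemma emeasure_atLeast_tendsto:
  fixes M :: "real measure"
  assumes "finite_measure M" and sets: "sets M = sets borel" and \<sigma>: "\<sigma> \<longlonglongrightarrow> s" "\<And>n. s < \<sigma> n"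
  shows "(\<lambda>n. emeasure M {\<sigma> n..}) \<longlonglongrightarrow> emeasure M {s<..}"
proof -
  interpret finite_measure M by fact
  note sets[measurable_cong]
  have "(\<lambda>n. \<integral>\<^sup>+y. indicator {\<sigma> n..} y \<partial>M) \<longlonglongrightarrow> (\<integral>\<^sup>+y. indicator {s<..} y \<partial>M)"
  proof (rule nn_integral_dominated_convergence[where w = "\<lambda>_. 1"])
    show "AE y in M. (\<lambda>n. indicator {\<sigma> n..} y) \<longlonglongrightarrow> (indicator {s<..} y :: ennreal)"
    proof (rule AE_I2, rule tendsto_eventually)
      fix y
      show "\<forall>\<^sub>F n in sequentially. indicator {\<sigma> n..} y = (indicator {s<..} y :: ennreal)"
      proof (cases "s < y")
        case True
        then show ?thesis using order_tendstoD(2)[OF \<sigma>(1) True] by (auto elim!: eventually_mono simp: indicator_def)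
      next
        case False
        then have "\<sigma> n > y" for n using \<sigma>(2)[of n] by simp
        then show ?thesis using False by (auto simp: indicator_def not_le)
      qed
    qed
  qed (auto simp: indicator_def emeasure_finite less_top[symmetric])
  then show ?thesis by simp
qed

text \<open>The sum of the two measures is a measure determined by its values on open rays. The
  relation is kept additive, as \<open>A\<close> would otherwise have to be a difference of
  measures.\<close>

lemma nn_integral_add_measures:
  fixes A B C :: "real measure"
  assumes sets[measurable_cong]: "sets A = sets borel" "sets B = sets borel" "sets C = sets borel"
    and fin: "\<And>s. emeasure C {s<..} < \<infinity>"
    and eq: "\<And>s. emeasure A {s<..} + emeasure B {s<..} = emeasure C {s<..}"
    and h: "h \<in> borel_measurable borel"
  shows "(\<integral>\<^sup>+y. h y \<partial>A) + (\<integral>\<^sup>+y. h y \<partial>B) = (\<integral>\<^sup>+y. h y \<partial>C)"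
proof -
  define S where "S = measure_of UNIV (sets borel) (\<lambda>X :: real set. emeasure A X + emeasure B X)"
  have sS: "sets S = sets borel" unfolding S_def using sigma_algebra.sigma_sets_eq[of UNIV "sets (borel :: real measure)"] sets.sigma_algebra_axioms[of "borel :: real measure"] by simp
  have eS: "emeasure S X = emeasure A X + emeasure B X" if "X \<in> sets borel" for X
  proof (rule emeasure_measure_of[OF S_def])
    show "countably_additive (sets S) (\<lambda>X. emeasure A X + emeasure B X)"
      unfolding countably_additive_def sS
    proof (intro allI impI)
      fix F :: "nat \<Rightarrow> real set" assume F: "range F \<subseteq> sets borel" "disjoint_family F" "\<Union> (range F) \<in> sets borel"
      have "(\<Sum>i. emeasure A (F i) + emeasure B (F i)) = (\<Sum>i. emeasure A (F i)) + (\<Sum>i. emeasure B (F i))"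
        by (rule suminf_add[symmetric]) auto
      then show "(\<Sum>i. emeasure A (F i) + emeasure B (F i)) = emeasure A (\<Union> (range F)) + emeasure B (\<Union> (range F))"
        using F sets by (simp add: suminf_emeasure)
    qed
  qed (use that sS in \<open>auto simp: positive_def\<close>)
  have "S = C"
  proof (rule measure_eqI_lessThan)
    show "emeasure S {s<..} = emeasure C {s<..}" for s by (simp add: eS eq)
    show "emeasure S {s<..} < \<infinity>" for s using fin[of s] by (simp add: eS eq)
  qed (use sS sets in auto)
  have "(\<integral>\<^sup>+y. h y \<partial>S) = (\<integral>\<^sup>+y. h y \<partial>A) + (\<integral>\<^sup>+y. h y \<partial>B)"
    using h
  proof (induction rule: borel_measurable_induct)
    case (cong f g)
    then show ?case by (simp cong: nn_integral_cong)
  next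
    case (set X)
    then show ?case using sS sets eS by simp
  next
    case (mult u c)
    note sS[measurable_cong] and mult(2)[measurable]
    show ?case using mult by (simp add: nn_integral_cmult distrib_left)
  next
    case (add u v)
    note sS[measurable_cong] and add(1,3)[measurable]
    show ?case using add by (simp add: nn_integral_add ac_simps)
  next
    case (seq U)
    note sS[measurable_cong] and seq(1)[measurable]
    have inc: "incseq (\<lambda>i. \<integral>\<^sup>+y. U i y \<partial>N)" for N :: "real measure"
      using seq(3) by (auto simp: incseq_def le_fun_def intro!: nn_integral_mono)
    have "(\<integral>\<^sup>+y. (SUP i. U i y) \<partial>S) = (SUP i. (\<integral>\<^sup>+y. U i y \<partial>A) + (\<integral>\<^sup>+y. U i y \<partial>B))"
      using seq by (subst nn_integral_monotone_convergence_SUP) auto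
    also have "\<dots> = (SUP i. \<integral>\<^sup>+y. U i y \<partial>A) + (SUP i. \<integral>\<^sup>+y. U i y \<partial>B)"
      by (rule ennreal_SUP_add[OF inc inc])
    also have "\<dots> = (\<integral>\<^sup>+y. (SUP i. U i y) \<partial>A) + (\<integral>\<^sup>+y. (SUP i. U i y) \<partial>B)"
      using seq by (simp add: nn_integral_monotone_convergence_SUP)
    finally show ?case by (simp add: SUP_apply image_comp)
  qed
  then show ?thesis using \<open>S = C\<close> by simp
qed

lemma scale_function_mono:
  assumes "scale_function \<psi> q W" and "\<forall>\<^sub>F \<theta> in at_top. q < \<psi> \<theta>"
  shows "mono W"
proof (rule monoI)
  fix u w :: real assume "u \<le> w"
  have "0 \<le> W w" by (rule scale_function_nonneg[OF assms])
  then show "W u \<le> W w"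
    using assms(1) \<open>u \<le> w\<close> by (cases "u < 0") (auto simp: scale_function_def mono_on_def)
qed

lemma laplace_scale_function:
  assumes sc: "scale_function \<psi> q W" and pos: "\<forall>\<^sub>F \<theta> in at_top. q < \<psi> \<theta>" and \<theta>: "right_inverse \<psi> q < \<theta>"
  shows "laplace (\<lambda>u. ennreal (W u)) \<theta> = ennreal (1 / (\<psi> \<theta> - q))"
proof -
  have [measurable]: "W \<in> borel_measurable borel" by (rule borel_measurable_mono[OF scale_function_mono[OF sc pos]])
  have neg: "W u = 0" if "u < 0" for u using sc that by (simp add: scale_function_def)
  have nn: "0 \<le> W u" for u by (rule scale_function_nonneg[OF sc pos])
  have "(\<integral>\<^sup>+u. ennreal (exp (- \<theta> * u) * W u) * indicator {0..} u \<partial>lborel) = ennreal (1 / (\<psi> \<theta> - q))"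
    by (intro nn_integral_has_integral_lebesgue') (use sc \<theta> nn in \<open>auto simp: scale_function_def\<close>)
  moreover have "ennreal (exp (- \<theta> * u) * W u) * indicator {0..} u = ennreal (exp (- \<theta> * u)) * ennreal (W u)" for u
    using neg[of u] nn[of u] by (cases "u < 0") (auto simp: ennreal_mult)
  ultimately show ?thesis by (simp add: laplace_def)
qed

text \<open>Links the oriented interval integrals, in which the scale functions are expressed, with
  integrals over a half-line. For negative \<open>x\<close> both vanish because \<open>f\<close>
  does.\<close>

lemma interval_primitive:
  fixes f :: "real \<Rightarrow> real"
  assumes f: "mono f" "\<And>y. y < 0 \<Longrightarrow> f y = 0"
  shows "ennreal (LBINT y=0..ereal x. f y) = primitive (\<lambda>u. ennreal (f u)) x"
    and "mono (\<lambda>x. LBINT y=0..ereal x. f y)" and "x \<le> 0 \<Longrightarrow> (LBINT y=0..ereal x. f y) = 0"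
    and "interval_lebesgue_integrable lborel 0 (ereal x) f"
proof -
  have [measurable]: "f \<in> borel_measurable borel" by (rule borel_measurable_mono[OF f(1)])
  have nn: "0 \<le> f y" for y using monoD[OF f(1), of "min y (- 1)" y] f(2)[of "min y (- 1)"] by simp
  have si: "set_integrable lborel {..x} f" for x
    unfolding set_integrable_def
  proof (rule integrableI_bounded_set[where B = "f x" and A = "{0..max x 0}"])
    show "AE u in lborel. u \<in> {0..max x 0} \<longrightarrow> norm (indicator {..x} u *\<^sub>R f u) \<le> f x"
      using nn monoD[OF f(1)] by (auto simp: indicator_def)
  qed (use f(2) in \<open>auto simp: indicator_def\<close>)
  have eq: "(LBINT y=0..ereal x. f y) = (LINT y:{..x}|lborel. f y)" for x
  proof (cases "0 \<le> x")
    case True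
    then have "(LBINT y=0..ereal x. f y) = (LINT y:{0..x}|lborel. f y)"
      using interval_integral_Icc[of 0 x f] by (simp add: zero_ereal_def)
    also have "\<dots> = (LINT y:{..x}|lborel. f y)"
      unfolding set_lebesgue_integral_def by (intro Bochner_Integration.integral_cong) (auto simp: indicator_def f(2))
    finally show ?thesis .
  next
    case False
    then have "(LBINT y=0..ereal x. f y) = - (LINT y:{x<..<0}|lborel. f y)"
      by (simp add: interval_lebesgue_integral_def einterval_eq_Icc zero_ereal_def)
    moreover have "(LINT y:{x<..<0}|lborel. f y) = 0"
      unfolding set_lebesgue_integral_def by (rule integral_eq_zero_AE) (auto simp: indicator_def f(2))
    moreover have "(LINT y:{..x}|lborel. f y) = 0"
      unfolding set_lebesgue_integral_def by (rule integral_eq_zero_AE) (use False in \<open>auto simp: indicator_def f(2)\<close>)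
    ultimately show ?thesis by simp
  qed
  show "ennreal (LBINT y=0..ereal x. f y) = primitive (\<lambda>u. ennreal (f u)) x"
    unfolding eq primitive_def set_lebesgue_integral_def
    by (subst nn_integral_eq_integral[OF si[of x, unfolded set_integrable_def], symmetric])
       (use nn in \<open>auto simp: indicator_def intro!: nn_integral_cong\<close>)
  show "mono (\<lambda>x. LBINT y=0..ereal x. f y)"
  proof (rule monoI)
    fix u w :: real assume "u \<le> w"
    then show "(LBINT y=0..ereal u. f y) \<le> (LBINT y=0..ereal w. f y)"
      unfolding eq set_lebesgue_integral_def
      using si[of u] si[of w] nn by (intro integral_mono) (auto simp: set_integrable_def indicator_def)
  qed
  show "interval_lebesgue_integrable lborel 0 (ereal x) f"
  proof -
    have "set_integrable lborel {0<..<x} f" "set_integrable lborel {x<..<0} f"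
      by (rule set_integrable_subset[OF si[of "max x 0"]]; auto)+
    then show ?thesis
      by (auto simp: interval_lebesgue_integrable_def zero_ereal_def)
  qed
  show "(LBINT y=0..ereal x. f y) = 0" if "x \<le> 0"
    unfolding eq set_lebesgue_integral_def
  proof (rule integral_eq_zero_AE)
    show "AE y in lborel. indicator {..x} y *\<^sub>R f y = 0"
      using AE_lborel_singleton[of 0] by eventually_elim (use that in \<open>auto simp: indicator_def f(2)\<close>)
  qed
qed

lemma interval_convolution:
  fixes f h :: "real \<Rightarrow> real"
  assumes f: "mono f" "\<And>y. y < 0 \<Longrightarrow> f y = 0" and h: "mono h" "\<And>y. 0 \<le> h y"
  shows "(\<integral>\<^sup>+y. ennreal (h y) * (ennreal (f (x - y)) * indicator {b<..} y) \<partial>lborel) = ennreal (LBINT y=ereal b..ereal x. f (x - y) * h y)"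
    and "0 \<le> (LBINT y=ereal b..ereal x. f (x - y) * h y)"
    and "interval_lebesgue_integrable lborel (ereal b) (ereal x) (\<lambda>y. f (x - y) * h y)"
proof -
  have [measurable]: "f \<in> borel_measurable borel" "h \<in> borel_measurable borel"
    using borel_measurable_mono f(1) h(1) by auto
  have nn: "0 \<le> f y" for y using monoD[OF f(1), of "min y (- 1)" y] f(2)[of "min y (- 1)"] by simp
  have si: "integrable lborel (\<lambda>y. indicator {b<..} y *\<^sub>R (f (x - y) * h y))"
  proof (rule integrableI_bounded_set[where B = "f (x - b) * h x" and A = "{b..x}"])
    have "f (x - y) * h y \<le> f (x - b) * h x" if "b \<le> y" "y \<le> x" for y
      using that nn h(2) by (intro mult_mono monoD[OF f(1)] monoD[OF h(1)]) auto
    then show "AE u in lborel. u \<in> {b..x} \<longrightarrow> norm (indicator {b<..} u *\<^sub>R (f (x - u) * h u)) \<le> f (x - b) * h x"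
      using nn h(2) by (auto simp: indicator_def)
  qed (use f(2) in \<open>auto simp: indicator_def emeasure_lborel_Icc_eq\<close>)
  have eq: "(LBINT y=ereal b..ereal x. f (x - y) * h y) = (LINT y:{b<..}|lborel. f (x - y) * h y)"
  proof (cases "b \<le> x")
    case True
    then have "(LBINT y=ereal b..ereal x. f (x - y) * h y) = (LINT y:{b<..x}|lborel. f (x - y) * h y)"
      by (simp add: interval_integral_Ioc)
    also have "\<dots> = (LINT y:{b<..}|lborel. f (x - y) * h y)"
      unfolding set_lebesgue_integral_def by (intro Bochner_Integration.integral_cong) (auto simp: indicator_def f(2))
    finally show ?thesis .
  next
    case False
    then have "(LBINT y=ereal b..ereal x. f (x - y) * h y) = - (LINT y:{x<..<b}|lborel. f (x - y) * h y)"
      by (simp add: interval_lebesgue_integral_def einterval_eq_Icc)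
    moreover have "(LINT y:{x<..<b}|lborel. f (x - y) * h y) = 0"
      unfolding set_lebesgue_integral_def by (rule integral_eq_zero_AE) (auto simp: indicator_def f(2))
    moreover have "(LINT y:{b<..}|lborel. f (x - y) * h y) = 0"
      unfolding set_lebesgue_integral_def by (rule integral_eq_zero_AE) (use False in \<open>auto simp: indicator_def f(2)\<close>)
    ultimately show ?thesis by simp
  qed
  have z: "set_integrable lborel {x<..<b} (\<lambda>y. f (x - y) * h y)"
  proof -
    have "(\<lambda>y. indicator {x<..<b} y *\<^sub>R (f (x - y) * h y)) = (\<lambda>_. 0)" by (auto simp: fun_eq_iff indicator_def f(2))
    then show ?thesis unfolding set_integrable_def by simp
  qed
  have "set_integrable lborel {b<..<x} (\<lambda>y. f (x - y) * h y)"
    by (rule set_integrable_subset[of _ "{b<..}"]) (use si in \<open>auto simp: set_integrable_def\<close>)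
  then show "interval_lebesgue_integrable lborel (ereal b) (ereal x) (\<lambda>y. f (x - y) * h y)"
    using z by (simp add: interval_lebesgue_integrable_def)
  show "(\<integral>\<^sup>+y. ennreal (h y) * (ennreal (f (x - y)) * indicator {b<..} y) \<partial>lborel) = ennreal (LBINT y=ereal b..ereal x. f (x - y) * h y)"
    unfolding eq set_lebesgue_integral_def
    by (subst nn_integral_eq_integral[OF si, symmetric])
       (use nn h(2) in \<open>auto simp: indicator_def ennreal_mult mult.commute intro!: nn_integral_cong\<close>)
  show "0 \<le> (LBINT y=ereal b..ereal x. f (x - y) * h y)"
    unfolding eq set_lebesgue_integral_def using nn h(2) by (intro integral_nonneg_AE) auto
qed

section \<open>Two convolution equations from the exponential identity\<close>

locale scale_identity = potential_identity +
  fixes W WY :: "real \<Rightarrow> real"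
  assumes W: "scale_function \<psi> q W" and WY: "scale_function (\<lambda>\<theta>. \<psi> \<theta> - \<delta> * \<theta>) q WY"
    and growth: "\<forall>\<^sub>F \<theta> in at_top. q < \<psi> \<theta> - \<delta> * \<theta>"
begin

interpretation U: finite_measure U by (rule U_finite)
interpretation \<kappa>: finite_measure \<kappa> by (rule \<kappa>_finite)

lemma growth': "\<forall>\<^sub>F \<theta> in at_top. q < \<psi> \<theta>"
  using growth eventually_ge_at_top[of 0]
proof eventually_elim
  case (elim \<theta>)
  then show ?case using mult_nonneg_nonneg[OF \<delta>, of \<theta>] by linarith
qed

lemma W_mono: "mono W" and WY_mono: "mono WY"
  and W_neg: "y < 0 \<Longrightarrow> W y = 0" and WY_neg: "y < 0 \<Longrightarrow> WY y = 0"
  and W_nonneg: "0 \<le> W y" and WY_nonneg: "0 \<le> WY y"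
  using scale_function_mono[OF W growth'] scale_function_mono[OF WY growth]
    scale_function_nonneg[OF W growth'] scale_function_nonneg[OF WY growth] W WY
  by (auto simp: scale_function_def)

lemma W_measurable[measurable]: "W \<in> borel_measurable borel" and WY_measurable[measurable]: "WY \<in> borel_measurable borel"
  using borel_measurable_mono W_mono WY_mono by auto

definition "U_above = density U (indicator {b<..})"
definition "U_below = density U (indicator {..b})"

lemma sets_above[measurable_cong]: "sets U_above = sets borel" and sets_below[measurable_cong]: "sets U_below = sets borel"
  using sets_U by (auto simp: U_above_def U_below_def)

lemma nn_integral_above: "h \<in> borel_measurable borel \<Longrightarrow> (\<integral>\<^sup>+y. h y \<partial>U_above) = (\<integral>\<^sup>+y. h y * indicator {b<..} y \<partial>U)"
  and nn_integral_below: "h \<in> borel_measurable borel \<Longrightarrow> (\<integral>\<^sup>+y. h y \<partial>U_below) = (\<integral>\<^sup>+y. h y * indicator {..b} y \<partial>U)"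
  unfolding U_above_def U_below_def by (subst nn_integral_density; simp add: mult.commute)+

lemma finite_above: "finite_measure U_above" and finite_below: "finite_measure U_below"
  unfolding U_above_def U_below_def by (rule U.finite_measure_restricted; simp add: sets_U)+

abbreviation "w \<equiv> (\<lambda>u. ennreal (W u))"
abbreviation "wY \<equiv> (\<lambda>u. ennreal (WY u))"

lemma transforms:
  assumes \<theta>: "0 < \<theta>"
  obtains k l where "0 \<le> k" "0 \<le> l" "exp_moment \<kappa> \<theta> = ennreal k" "exp_moment U \<theta> = ennreal (EU \<theta>)"
    "exp_moment U_above \<theta> = ennreal (EG \<theta>)" "exp_moment U_below \<theta> = ennreal l" "EU \<theta> = EG \<theta> + l"
    "p * exp (\<theta> * a) + \<theta> * \<delta> * EG \<theta> = exp (\<theta> * x) + (\<psi> \<theta> - q) * EU \<theta> + \<theta> * k"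
proof -
  have \<theta>0: "0 \<le> \<theta>" using \<theta> by simp
  obtain k where k: "0 \<le> k" "exp_moment \<kappa> \<theta> = ennreal k"
    "p * exp (\<theta> * a) + \<theta> * \<delta> * EG \<theta> = exp (\<theta> * x) + (\<psi> \<theta> - q) * EU \<theta> + \<theta> * k"
    using real_identity[OF \<theta>] unfolding exp_moment_def by blast
  have u: "exp_moment U \<theta> = ennreal (EU \<theta>)"
    unfolding exp_moment_def EU_def by (rule nn_integral_eq_integral[OF int_exp[OF \<theta>0]]) auto
  have g: "exp_moment U_above \<theta> = ennreal (EG \<theta>)"
    unfolding exp_moment_def EG_def
    by (subst nn_integral_above, simp, subst nn_integral_eq_integral[OF int_exp_ind[OF \<theta>0], symmetric])
       (auto intro!: nn_integral_cong simp: indicator_def)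
  have "integrable U (\<lambda>y. exp (\<theta> * y) * indicator {..b} y)"
    by (rule U_integrable[where C = "exp (\<theta> * a)"]) (use \<theta>0 in \<open>auto simp: mult_left_mono indicator_def\<close>)
  note il = this
  define l where "l = (LINT y|U. exp (\<theta> * y) * indicator {..b} y)"
  have l: "exp_moment U_below \<theta> = ennreal l"
    unfolding exp_moment_def l_def
    by (subst nn_integral_below, simp, subst nn_integral_eq_integral[OF il, symmetric])
       (auto intro!: nn_integral_cong simp: indicator_def)
  have "EU \<theta> = EG \<theta> + l"
    unfolding EU_def EG_def l_def
    by (subst Bochner_Integration.integral_add[OF int_exp_ind[OF \<theta>0] il, symmetric])
       (auto intro!: Bochner_Integration.integral_cong simp: indicator_def)
  moreover have "0 \<le> l" unfolding l_def by (intro integral_nonneg_AE) auto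
  ultimately show thesis using that k u g l by blast
qed

lemma AE_U_zero: "c < - a \<Longrightarrow> (\<integral>\<^sup>+y. h (c + y) \<partial>U) = 0" if "\<And>u. u < 0 \<Longrightarrow> h u = 0" for h :: "real \<Rightarrow> ennreal"
  using nn_integral_cong_AE[of "\<lambda>y. h (c + y)" "\<lambda>_. 0" U] U_supp that
  by (simp add: eventually_mono[OF U_supp])

lemma AE_\<kappa>_zero: "c < 0 \<Longrightarrow> (\<integral>\<^sup>+z. h (c + z) \<partial>\<kappa>) = 0" if "\<And>u. u < 0 \<Longrightarrow> h u = 0" for h :: "real \<Rightarrow> ennreal"
  using nn_integral_cong_AE[of "\<lambda>y. h (c + y)" "\<lambda>_. 0" \<kappa>] that
  by (simp add: eventually_mono[OF \<kappa>_supp])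

lemma primitive_neg: "c < 0 \<Longrightarrow> primitive h c = 0" if "\<And>u. u < 0 \<Longrightarrow> h u = 0" for h :: "real \<Rightarrow> ennreal"
  unfolding primitive_def by (intro nn_integral_zero' AE_I2) (use that in \<open>auto simp: indicator_def\<close>)

text \<open>The Heaviside function, inverse transform of 1 / \<theta>. It turns a mixture over
  \<open>U\<close> into a tail of \<open>U\<close>.\<close>

definition "H = (indicator {0..} :: real \<Rightarrow> ennreal)"

lemma H_measurable[measurable]: "H \<in> borel_measurable borel" unfolding H_def by simp

lemma laplace_H: "0 < \<theta> \<Longrightarrow> laplace H \<theta> = ennreal (1 / \<theta>)"
  using laplace_heaviside[of \<theta> 0] by (simp add: laplace_def H_def)

text \<open>\<beta> = 0 yields the equation for \<open>W\<close> and \<beta> = \<delta> the one for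
  \<open>WY\<close>. As \<open>U\<close> splits at \<open>b\<close>, \<theta> \<beta> times the part
  above is traded for \<theta> \<beta> times all of \<open>U\<close> minus the part below, which
  changes the factor of \<open>U\<close> from \<psi> - q to \<psi> - \<beta> \<theta> - q. Division
  by \<theta> (\<psi> - \<beta> \<theta> - q) then leaves products of transforms, with 1 / \<theta>
  accounting for \<open>primitive\<close> and \<open>H\<close>.\<close>

lemma resolvent:
  assumes \<beta>: "0 \<le> \<beta>" "\<beta> \<le> \<delta>" and K: "scale_function (\<lambda>\<theta>. \<psi> \<theta> - \<beta> * \<theta>) q K"
  defines "k \<equiv> \<lambda>u. ennreal (K u)"
  shows "AE c in lborel. ennreal p * primitive k (c + a) + ennreal (\<delta> - \<beta>) * (\<integral>\<^sup>+y. k (c + y) \<partial>U_above)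
     = primitive k (c + x) + (\<integral>\<^sup>+y. H (c + y) \<partial>U) + ennreal \<beta> * (\<integral>\<^sup>+y. k (c + y) \<partial>U_below) + (\<integral>\<^sup>+z. k (c + z) \<partial>\<kappa>)"
proof -
  have gr: "\<forall>\<^sub>F \<theta> in at_top. q < \<psi> \<theta> - \<beta> * \<theta>"
    using growth eventually_ge_at_top[of 0]
  proof eventually_elim
    case (elim \<theta>)
    then show ?case using mult_right_mono[OF \<beta>(2), of \<theta>] by linarith
  qed
  have km[measurable]: "k \<in> borel_measurable borel"
    unfolding k_def using borel_measurable_mono[OF scale_function_mono[OF K gr]] by measurable
  have k_neg: "k u = 0" if "u < 0" for u using K that by (simp add: k_def scale_function_def)
  obtain t0 where t0: "\<And>\<theta>. t0 \<le> \<theta> \<Longrightarrow> q < \<psi> \<theta> - \<beta> * \<theta>" using gr by (auto simp: eventually_at_top_linorder)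
  define t where "t = Max {1, t0, right_inverse (\<lambda>\<theta>. \<psi> \<theta> - \<beta> * \<theta>) q + 1}"
  have t: "1 \<le> t" "t0 \<le> t" "right_inverse (\<lambda>\<theta>. \<psi> \<theta> - \<beta> * \<theta>) q + 1 \<le> t" unfolding t_def by (rule Max_ge; simp)+
  define g1 where "g1 c = ennreal p * primitive k (c + a) + ennreal (\<delta> - \<beta>) * (\<integral>\<^sup>+y. k (c + y) \<partial>U_above)" for c
  define g2 where "g2 c = primitive k (c + x) + (\<integral>\<^sup>+y. H (c + y) \<partial>U) + ennreal \<beta> * (\<integral>\<^sup>+y. k (c + y) \<partial>U_below) + (\<integral>\<^sup>+z. k (c + z) \<partial>\<kappa>)" for c
  note mix = laplace_mixture[OF km finite_above sets_above] laplace_mixture[OF km finite_below sets_below]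
    laplace_mixture[OF km \<kappa>_finite sets_\<kappa>] laplace_mixture[OF H_measurable U_finite sets_U]
  note mix(2,4,6,8)[measurable]
  have gm[measurable]: "g1 \<in> borel_measurable borel" "g2 \<in> borel_measurable borel"
    unfolding g1_def[abs_def] g2_def[abs_def] by measurable
  have vals: "laplace g1 \<theta> < \<infinity> \<and> laplace g2 \<theta> = laplace g1 \<theta>" if "t \<le> \<theta>" for \<theta>
  proof -
    have \<theta>: "0 < \<theta>" "right_inverse (\<lambda>\<theta>. \<psi> \<theta> - \<beta> * \<theta>) q < \<theta>" "q < \<psi> \<theta> - \<beta> * \<theta>" using t that t0[of \<theta>] by auto
    obtain \<kappa>' m where k: "0 \<le> \<kappa>'" "0 \<le> m" "exp_moment \<kappa> \<theta> = ennreal \<kappa>'" "exp_moment U \<theta> = ennreal (EU \<theta>)"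
      "exp_moment U_above \<theta> = ennreal (EG \<theta>)" "exp_moment U_below \<theta> = ennreal m" "EU \<theta> = EG \<theta> + m"
      "p * exp (\<theta> * a) + \<theta> * \<delta> * EG \<theta> = exp (\<theta> * x) + (\<psi> \<theta> - q) * EU \<theta> + \<theta> * \<kappa>'"
      using transforms[OF \<theta>(1)] by metis
    define l where "l = 1 / (\<psi> \<theta> - \<beta> * \<theta> - q)"
    have l: "0 < l" "(\<psi> \<theta> - \<beta> * \<theta> - q) * l = 1" using \<theta> by (auto simp: l_def)
    have Lk: "laplace k \<theta> = ennreal l" unfolding k_def l_def by (rule laplace_scale_function[OF K gr \<theta>(2)])
    note nn = EU_nonneg[of \<theta>] EG_nonneg[of \<theta>] p \<beta> k(1,2) l(1) \<theta>(1)
    have "laplace g1 \<theta> = ennreal p * (ennreal (exp (\<theta> * a)) * (ennreal l * ennreal (1 / \<theta>))) + ennreal (\<delta> - \<beta>) * (ennreal (EG \<theta>) * ennreal l)"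
      unfolding g1_def[abs_def] using \<theta>(1)
      by (simp add: laplace_add laplace_cmult laplace_shift laplace_primitive mix(1) Lk k)
    also have "\<dots> = ennreal (p * exp (\<theta> * a) * (l / \<theta>) + (\<delta> - \<beta>) * (EG \<theta> * l))"
      using nn by (simp add: ennreal_mult[symmetric] ennreal_plus[symmetric] mult.assoc del: ennreal_plus)
    finally have 1: "laplace g1 \<theta> = ennreal (p * exp (\<theta> * a) * (l / \<theta>) + (\<delta> - \<beta>) * (EG \<theta> * l))" .
    have "laplace g2 \<theta> = ennreal (exp (\<theta> * x)) * (ennreal l * ennreal (1 / \<theta>)) + ennreal (EU \<theta>) * ennreal (1 / \<theta>)
        + ennreal \<beta> * (ennreal m * ennreal l) + ennreal \<kappa>' * ennreal l"
      unfolding g2_def[abs_def] using \<theta>(1)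
      by (simp add: laplace_add laplace_cmult laplace_shift laplace_primitive laplace_H mix(3,5,7) Lk k(3,4,6))
    also have "\<dots> = ennreal (exp (\<theta> * x) * (l / \<theta>) + EU \<theta> * (1 / \<theta>) + \<beta> * (m * l) + \<kappa>' * l)"
      using nn by (simp add: ennreal_mult[symmetric] ennreal_plus[symmetric] del: ennreal_plus)
    also have "exp (\<theta> * x) * (l / \<theta>) + EU \<theta> * (1 / \<theta>) + \<beta> * (m * l) + \<kappa>' * l = p * exp (\<theta> * a) * (l / \<theta>) + (\<delta> - \<beta>) * (EG \<theta> * l)"
    proof -
      have "EU \<theta> * (1 / \<theta>) = ((\<psi> \<theta> - \<beta> * \<theta> - q) * EU \<theta>) * (l / \<theta>)" using l(2) by (simp add: mult_ac)
      then have "exp (\<theta> * x) * (l / \<theta>) + EU \<theta> * (1 / \<theta>) + \<beta> * (m * l) + \<kappa>' * l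
        = (exp (\<theta> * x) + ((\<psi> \<theta> - q) * EU \<theta> - \<theta> * \<beta> * EU \<theta>) + \<theta> * \<beta> * m + \<theta> * \<kappa>') * (l / \<theta>)"
        using \<theta>(1) by (simp add: algebra_simps)
      also have "exp (\<theta> * x) + ((\<psi> \<theta> - q) * EU \<theta> - \<theta> * \<beta> * EU \<theta>) + \<theta> * \<beta> * m + \<theta> * \<kappa>' = p * exp (\<theta> * a) + \<theta> * (\<delta> - \<beta>) * EG \<theta>"
        using k(8) by (simp add: k(7) algebra_simps)
      finally show ?thesis using \<theta>(1) by (simp add: distrib_left add_divide_distrib mult_ac)
    qed
    finally show ?thesis using 1 by simp
  qed
  have "AE c in lborel. g1 c = g2 c"
  \<comment> \<open>Below - a both sides vanish: \<open>U\<close> lives on [0, a], \<kappa> on the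
    negative half-line, and x \<le> a.\<close>
  proof (rule laplace_unique_AE[where \<theta> = t and K = "- a", OF gm])
    fix c assume c: "c < - a"
    have c': "c < 0" "c + a < 0" "c + x < 0" using c a by auto
    have "(\<integral>\<^sup>+y. k (c + y) \<partial>U_above) \<le> (\<integral>\<^sup>+y. k (c + y) \<partial>U)" "(\<integral>\<^sup>+y. k (c + y) \<partial>U_below) \<le> (\<integral>\<^sup>+y. k (c + y) \<partial>U)"
      by (subst nn_integral_above nn_integral_below; auto intro!: nn_integral_mono simp: indicator_def)+
    moreover have "(\<integral>\<^sup>+y. k (c + y) \<partial>U) = 0" by (rule AE_U_zero[OF k_neg c])
    ultimately show "g1 c = 0" "g2 c = 0"
      using c' AE_U_zero[of H, OF _ c] AE_\<kappa>_zero[OF k_neg c'(1)] by (simp_all add: g1_def g2_def primitive_neg k_neg H_def)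
  next
    show "(\<integral>\<^sup>+c. exp (- (t + n) * c) * g1 c \<partial>lborel) = (\<integral>\<^sup>+c. exp (- (t + n) * c) * g2 c \<partial>lborel)" for n :: nat
      using vals[of "t + n"] by (simp add: laplace_def)
    show "(\<integral>\<^sup>+c. exp (- t * c) * g1 c \<partial>lborel) < \<infinity>"
      using vals[of t] by (simp add: laplace_def)
  qed
  then show ?thesis by (simp add: g1_def g2_def)
qed

lemma resolvent_W:
  "AE c in lborel. ennreal p * primitive w (c + a) + ennreal \<delta> * (\<integral>\<^sup>+y. w (c + y) \<partial>U_above)
     = primitive w (c + x) + (\<integral>\<^sup>+y. H (c + y) \<partial>U) + (\<integral>\<^sup>+z. w (c + z) \<partial>\<kappa>)"
  using resolvent[of 0 W] W \<delta> by simp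

lemma resolvent_WY:
  "AE c in lborel. ennreal p * primitive wY (c + a)
     = primitive wY (c + x) + (\<integral>\<^sup>+y. H (c + y) \<partial>U) + ennreal \<delta> * (\<integral>\<^sup>+y. wY (c + y) \<partial>U_below) + (\<integral>\<^sup>+z. wY (c + z) \<partial>\<kappa>)"
  using resolvent[of \<delta> WY] WY \<delta> by simp

end

lemma AE_lborel_minus:
  assumes "AE c in lborel. P c"
  shows "AE c in lborel. P (- c :: real)"
proof -
  have "AE c in distr lborel borel (\<lambda>c. - c :: real). P c"
    by (subst lborel_distr_uminus) (rule assms)
  from AE_distrD[OF _ this] show ?thesis by simp
qed

section \<open>Evaluation of the two equations\<close>

context scale_identity begin

interpretation U: finite_measure U by (rule U_finite)
interpretation \<kappa>: finite_measure \<kappa> by (rule \<kappa>_finite)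

lemma nn_integral_H: "(\<integral>\<^sup>+y. H (c + y) \<partial>U) = emeasure U {- c..}"
proof -
  have "(\<integral>\<^sup>+y. H (c + y) \<partial>U) = (\<integral>\<^sup>+y. indicator {- c..} y \<partial>U)"
    by (intro nn_integral_cong) (auto simp: H_def indicator_def)
  then show ?thesis by simp
qed

lemma W_cont: "0 < y \<Longrightarrow> isCont W y"
  using W unfolding scale_function_def by (intro continuous_on_interior[of "{0..}"]) auto

lemma primitive_finite: "primitive w s < \<infinity>"
  using interval_primitive(1)[OF W_mono W_neg, of s] by (metis ennreal_less_top infinity_ennreal_def)

lemma tendsto_primitive:
  assumes \<sigma>: "\<sigma> \<longlonglongrightarrow> 0" "\<And>n. \<sigma> n < 1"
  shows "(\<lambda>n. primitive w (\<sigma> n + s)) \<longlonglongrightarrow> primitive w s"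
  unfolding primitive_def
proof (rule nn_integral_dominated_convergence[where w = "\<lambda>u. w u * indicator {..1 + s} u"])
  show "AE u in lborel. w u * indicator {..\<sigma> n + s} u \<le> w u * indicator {..1 + s} u" for n
    using \<sigma>(2)[of n] by (auto simp: indicator_def)
  show "(\<integral>\<^sup>+u. w u * indicator {..1 + s} u \<partial>lborel) < \<infinity>"
    using primitive_finite[of "1 + s"] by (simp add: primitive_def)
  show "AE u in lborel. (\<lambda>n. w u * indicator {..\<sigma> n + s} u) \<longlonglongrightarrow> w u * indicator {..s} u"
    using AE_lborel_singleton[of s]
  proof eventually_elim
    case (elim u)
    have lim: "(\<lambda>n. \<sigma> n + s) \<longlonglongrightarrow> 0 + s" by (intro tendsto_intros \<sigma>)
    from elim consider "u < s" | "s < u" by linarith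
    then have "\<forall>\<^sub>F n in sequentially. (u \<le> \<sigma> n + s \<longleftrightarrow> u \<le> s)"
    proof cases
      case 1
      then show ?thesis using order_tendstoD(1)[OF lim, of u] by (auto elim!: eventually_mono)
    next
      case 2
      then show ?thesis using order_tendstoD(2)[OF lim, of u] by (auto elim!: eventually_mono)
    qed
    then have "\<forall>\<^sub>F n in sequentially. w u * indicator {..\<sigma> n + s} u = w u * indicator {..s} u"
      by eventually_elim (simp add: indicator_def)
    then show ?case by (rule tendsto_eventually)
  qed
qed auto

text \<open>\<open>U_above\<close> lives above b > 0, so \<open>W\<close> is used only near interior
  points of the half-line, where it is continuous; its possible jump at 0 is not seen.\<close>

lemma tendsto_above:
  assumes \<sigma>: "\<sigma> \<longlonglongrightarrow> 0" "\<And>n. \<sigma> n < 1"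
  shows "(\<lambda>n. \<integral>\<^sup>+y. w (\<sigma> n + y) \<partial>U_above) \<longlonglongrightarrow> (\<integral>\<^sup>+y. w y \<partial>U_above)"
proof (rule nn_integral_dominated_convergence[where w = "\<lambda>_. w (1 + a)"])
  have supp: "AE y in U_above. b < y \<and> y \<le> a"
  proof -
    have "AE y in U. 0 < (indicator {b<..} y :: ennreal) \<longrightarrow> b < y \<and> y \<le> a"
      using U_supp by eventually_elim (auto simp: indicator_def)
    then show ?thesis unfolding U_above_def by (subst AE_density) simp_all
  qed
  show "AE y in U_above. w (\<sigma> n + y) \<le> w (1 + a)" for n
    using supp by eventually_elim (use \<sigma>(2)[of n] in \<open>auto intro!: ennreal_leI monoD[OF W_mono]\<close>)
  show "AE y in U_above. (\<lambda>n. w (\<sigma> n + y)) \<longlonglongrightarrow> w y"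
    using supp
  proof eventually_elim
    case (elim y)
    have "(\<lambda>n. \<sigma> n + y) \<longlonglongrightarrow> 0 + y" by (intro tendsto_intros \<sigma>)
    then have lim: "(\<lambda>n. \<sigma> n + y) \<longlonglongrightarrow> y" by simp
    have "isCont W y" using W_cont elim b by simp
    from isCont_tendsto_compose[OF this lim] have "(\<lambda>n. W (\<sigma> n + y)) \<longlonglongrightarrow> W y" .
    then show ?case by (rule tendsto_ennrealI)
  qed
  show "(\<integral>\<^sup>+y. w (1 + a) \<partial>U_above) < \<infinity>"
    using finite_measure.emeasure_finite[OF finite_above, of "space U_above"] by (simp add: ennreal_mult_less_top less_top)
qed auto

text \<open>At \<open>c = 0\<close> the left limit excludes a possible atom of the occupation measure at
  \<open>0\<close>, the right limit includes it, so that there is none.\<close>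

lemma resolvent_W_at_zero:
  "ennreal p * primitive w a + ennreal \<delta> * (\<integral>\<^sup>+y. w y \<partial>U_above) = primitive w x + emeasure U UNIV"
proof -
  define L where "L c = ennreal p * primitive w (c + a) + ennreal \<delta> * (\<integral>\<^sup>+y. w (c + y) \<partial>U_above)" for c
  define R where "R c = primitive w (c + x) + emeasure U {- c..} + (\<integral>\<^sup>+z. w (c + z) \<partial>\<kappa>)" for c
  have ae: "AE c in lborel. L c = R c" using resolvent_W by (simp add: L_def R_def nn_integral_H)
  have Ll: "(\<lambda>n. L (\<sigma> n)) \<longlonglongrightarrow> ennreal p * primitive w a + ennreal \<delta> * (\<integral>\<^sup>+y. w y \<partial>U_above)"
    if "\<sigma> \<longlonglongrightarrow> 0" "\<And>n. \<sigma> n < 1" for \<sigma>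
    unfolding L_def by (intro tendsto_add ennreal_tendsto_cmult tendsto_primitive tendsto_above that) auto
  obtain \<sigma> where \<sigma>: "\<sigma> \<longlonglongrightarrow> 0" "\<And>n. 0 < \<sigma> n" "\<And>n. \<sigma> n < 1" "\<And>n. L (\<sigma> n) = R (\<sigma> n)"
    using AE_dense_sequence[OF ae, of 0] by auto
  have aem: "AE c in lborel. L (- c) = R (- c)" by (rule AE_lborel_minus[OF ae])
  obtain \<tau> where \<tau>': "\<tau> \<longlonglongrightarrow> 0" "\<And>n. 0 < \<tau> n" "\<And>n. \<tau> n < 1" and \<tau>3: "\<And>n. L (- \<tau> n) = R (- \<tau> n)"
    using AE_dense_sequence[OF aem, of 0] by auto
  note \<tau> = \<tau>'(1,2) \<tau>3
  have "(\<lambda>n. R (- \<tau> n)) \<longlonglongrightarrow> primitive w x + emeasure U {0<..}"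
  proof -
    \<comment> \<open>From the left of 0 the \<kappa>-term has only negative arguments and
      disappears, so that the limit is an equality.\<close>
    have "(\<integral>\<^sup>+z. w (- \<tau> n + z) \<partial>\<kappa>) = 0" for n by (rule AE_\<kappa>_zero) (use \<tau>(2)[of n] W_neg in auto)
    then have R: "R (- \<tau> n) = primitive w (- \<tau> n + x) + emeasure U {\<tau> n..}" for n by (simp add: R_def)
    have "(\<lambda>n. primitive w (- \<tau> n + x)) \<longlonglongrightarrow> primitive w x"
    proof (rule tendsto_primitive)
      show "(\<lambda>n. - \<tau> n) \<longlonglongrightarrow> 0" using tendsto_minus[OF \<tau>(1)] by simp
      show "- \<tau> n < 1" for n using \<tau>(2)[of n] by simp
    qed
    then show ?thesis
      unfolding R by (rule tendsto_add[OF _ emeasure_atLeast_tendsto[OF U_finite sets_U \<tau>(1,2)]])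
  qed
  moreover have "(\<lambda>n. L (- \<tau> n)) \<longlonglongrightarrow> ennreal p * primitive w a + ennreal \<delta> * (\<integral>\<^sup>+y. w y \<partial>U_above)"
  proof (rule Ll)
    show "(\<lambda>n. - \<tau> n) \<longlonglongrightarrow> 0" using tendsto_minus[OF \<tau>(1)] by simp
    show "- \<tau> n < 1" for n using \<tau>(2)[of n] by simp
  qed
  ultimately have left: "ennreal p * primitive w a + ennreal \<delta> * (\<integral>\<^sup>+y. w y \<partial>U_above) = primitive w x + emeasure U {0<..}"
    unfolding \<tau>(3) by (rule LIMSEQ_unique[symmetric])
  \<comment> \<open>From the right the \<kappa>-term is merely known to be nonnegative, which gives
    an inequality; together with the equality from the left this suffices.\<close>
  have "primitive w x + emeasure U UNIV \<le> ennreal p * primitive w a + ennreal \<delta> * (\<integral>\<^sup>+y. w y \<partial>U_above)"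
  proof (rule LIMSEQ_le[OF _ Ll[OF \<sigma>(1,3)]])
    show "(\<lambda>n. primitive w (\<sigma> n + x) + emeasure U UNIV) \<longlonglongrightarrow> primitive w x + emeasure U UNIV"
      by (intro tendsto_add tendsto_const tendsto_primitive \<sigma>)
    have "emeasure U {- \<sigma> n..} = emeasure U UNIV" for n
      by (rule emeasure_eq_AE) (use U_supp \<sigma>(2)[of n] in \<open>auto elim!: eventually_mono\<close>)
    then show "\<exists>N. \<forall>n\<ge>N. primitive w (\<sigma> n + x) + emeasure U UNIV \<le> L (\<sigma> n)"
      unfolding \<sigma>(4) R_def by simp
  qed
  moreover have "emeasure U {0<..} \<le> emeasure U UNIV" by (rule emeasure_mono) auto
  ultimately show ?thesis using left by (metis add_left_mono antisym)
qed

text \<open>Integration over c < 0, where the \<kappa>-term vanishes. Each mixture with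
  \<open>w\<close> becomes one with its primitive, and the tails of \<open>U\<close> integrate to
  its mean.\<close>

lemma resolvent_W_integrated:
  "ennreal p * primitive (primitive w) a + ennreal \<delta> * (\<integral>\<^sup>+y. primitive w y \<partial>U_above)
     = primitive (primitive w) x + ennreal (LINT y|U. y)"
proof -
  have shift: "(\<integral>\<^sup>+c. h (c + s) * indicator {..0} c \<partial>lborel) = primitive h s" if [measurable]: "h \<in> borel_measurable borel"
    for h and s :: real
    unfolding primitive_def
    by (subst nn_integral_real_affine[where c = 1 and t = s, of "\<lambda>u. h u * indicator {..s} u"])
       (auto simp: add.commute indicator_def intro!: nn_integral_cong)
  have mix: "(\<integral>\<^sup>+c. (\<integral>\<^sup>+y. h (c + y) \<partial>\<mu>) * indicator {..0} c \<partial>lborel) = (\<integral>\<^sup>+y. primitive h y \<partial>\<mu>)"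
    if [measurable]: "h \<in> borel_measurable borel" and \<mu>: "finite_measure \<mu>" "sets \<mu> = sets borel" for h and \<mu> :: "real measure"
  proof -
    interpret \<mu>: finite_measure \<mu> by fact
    interpret P: pair_sigma_finite \<mu> lborel ..
    note \<mu>(2)[measurable_cong]
    have "(\<integral>\<^sup>+c. (\<integral>\<^sup>+y. h (c + y) \<partial>\<mu>) * indicator {..0} c \<partial>lborel) = (\<integral>\<^sup>+c. \<integral>\<^sup>+y. h (c + y) * indicator {..0} c \<partial>\<mu> \<partial>lborel)"
      by (intro nn_integral_cong nn_integral_multc[symmetric]) measurable
    also have "\<dots> = (\<integral>\<^sup>+y. \<integral>\<^sup>+c. h (c + y) * indicator {..0} c \<partial>lborel \<partial>\<mu>)"
      by (rule P.Fubini') measurable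
    finally show ?thesis using shift[of h] by simp
  qed
  note m = laplace_mixture(2)
  have [measurable]: "(\<lambda>c. \<integral>\<^sup>+y. w (c + y) \<partial>U_above) \<in> borel_measurable borel" "(\<lambda>c. \<integral>\<^sup>+y. H (c + y) \<partial>U) \<in> borel_measurable borel"
    by (intro m finite_above U_finite sets_above sets_U; measurable)+
  have mixW: "(\<integral>\<^sup>+c. (\<integral>\<^sup>+y. w (c + y) \<partial>U_above) * indicator {..0} c \<partial>lborel) = (\<integral>\<^sup>+y. primitive w y \<partial>U_above)"
    by (rule mix[OF _ finite_above sets_above]) measurable
  have "ennreal p * primitive (primitive w) a + ennreal \<delta> * (\<integral>\<^sup>+y. primitive w y \<partial>U_above)
     = (\<integral>\<^sup>+c. (ennreal p * primitive w (c + a) + ennreal \<delta> * (\<integral>\<^sup>+y. w (c + y) \<partial>U_above)) * indicator {..0} c \<partial>lborel)"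
    by (simp add: distrib_right mult.assoc nn_integral_add nn_integral_cmult shift mixW)
  also have "\<dots> = (\<integral>\<^sup>+c. (primitive w (c + x) + (\<integral>\<^sup>+y. H (c + y) \<partial>U)) * indicator {..0} c \<partial>lborel)"
  proof (rule nn_integral_cong_AE)
    show "AE c in lborel. (ennreal p * primitive w (c + a) + ennreal \<delta> * (\<integral>\<^sup>+y. w (c + y) \<partial>U_above)) * indicator {..0} c
      = (primitive w (c + x) + (\<integral>\<^sup>+y. H (c + y) \<partial>U)) * indicator {..0} c"
      using resolvent_W AE_lborel_singleton[of 0]
    proof eventually_elim
      case (elim c)
      then show ?case using AE_\<kappa>_zero[of w c] by (cases "c < 0") (auto simp: W_neg)
    qed
  qed
  also have "\<dots> = primitive (primitive w) x + (\<integral>\<^sup>+y. primitive H y \<partial>U)"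
    by (simp add: distrib_right nn_integral_add shift mix[OF _ U_finite sets_U])
  also have "(\<integral>\<^sup>+y. primitive H y \<partial>U) = (\<integral>\<^sup>+y. ennreal y \<partial>U)"
  proof (rule nn_integral_cong_AE)
    have "primitive H y = ennreal y" if "0 \<le> y" for y
    proof -
      have "primitive H y = (\<integral>\<^sup>+u. indicator {0..y} u \<partial>lborel)"
        unfolding primitive_def H_def by (intro nn_integral_cong) (auto simp: indicator_def)
      then show ?thesis using that by simp
    qed
    then show "AE y in U. primitive H y = ennreal y" using U_supp by (auto elim!: eventually_mono)
  qed
  also have "\<dots> = ennreal (LINT y|U. y)"
    by (rule nn_integral_eq_integral) (use U_integrable[of "\<lambda>y. y" a] U_supp in \<open>auto elim!: eventually_mono\<close>)
  finally show ?thesis .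
qed

text \<open>At c = - t with t > b the terms with \<open>U_below\<close> and \<kappa> vanish, as
  their arguments are negative. What remains of the equation for \<open>WY\<close> expresses the
  tail of \<open>U\<close> at t by primitives of \<open>WY\<close>; in other words \<open>U\<close>
  has the density p * WY (a - y) - WY (x - y) above \<open>b\<close>. The subtracted part is kept on
  the left.\<close>

lemma occupation_above:
  assumes h[measurable]: "h \<in> borel_measurable borel"
  shows "(\<integral>\<^sup>+y. h y \<partial>U_above) + (\<integral>\<^sup>+y. h y * (wY (x - y) * indicator {b<..} y) \<partial>lborel)
     = ennreal p * (\<integral>\<^sup>+y. h y * (wY (a - y) * indicator {b<..} y) \<partial>lborel)"
proof -
  define B where "B = density lborel (\<lambda>y. wY (x - y) * indicator {b<..} y)"
  define C where "C = density lborel (\<lambda>y. ennreal p * (wY (a - y) * indicator {b<..} y))"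
  have sB[measurable_cong]: "sets B = sets borel" and sC[measurable_cong]: "sets C = sets borel" by (auto simp: B_def C_def)
  have fin: "(\<integral>\<^sup>+y. wY (s - y) * indicator {b<..} y \<partial>lborel) < \<infinity>" if "s \<le> a" for s
  proof -
    have "(\<integral>\<^sup>+y. wY (s - y) * indicator {b<..} y \<partial>lborel) \<le> (\<integral>\<^sup>+y. wY a * indicator {b..a} y \<partial>lborel)"
    proof (rule nn_integral_mono)
      fix y
      show "wY (s - y) * indicator {b<..} y \<le> wY a * indicator {b..a} y"
      proof (cases "b < y \<and> y \<le> s")
        case True
        then show ?thesis using that b by (auto intro!: ennreal_leI monoD[OF WY_mono])
      next
        case False
        then have "WY (s - y) = 0 \<or> \<not> b < y" using WY_neg[of "s - y"] by auto
        then show ?thesis by auto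
      qed
    qed
    also have "\<dots> < \<infinity>" by (simp add: nn_integral_cmult ennreal_mult_less_top emeasure_lborel_Icc_eq)
    finally show ?thesis .
  qed
  have spB: "space B = UNIV" and spC: "space C = UNIV" by (auto simp: B_def C_def)
  have fB: "finite_measure B"
    by standard (use fin[OF a(2)] in \<open>auto simp: B_def emeasure_density\<close>)
  have fC: "finite_measure C"
    by standard (use fin[of a] in \<open>auto simp: C_def emeasure_density nn_integral_cmult ennreal_mult_eq_top_iff\<close>)
  have tail: "(\<integral>\<^sup>+y. wY (s - y) * indicator {b<..} y * indicator {t..} y \<partial>lborel) = primitive wY (s - t)" if "b < t" for s t
    unfolding primitive_def
    by (subst nn_integral_real_affine[where c = "- 1" and t = s, of "\<lambda>u. wY u * indicator {..s - t} u"])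
       (use that in \<open>auto simp: indicator_def intro!: nn_integral_cong\<close>)
  have ae: "AE t in lborel. b < t \<longrightarrow> emeasure U_above {t..} + emeasure B {t..} = emeasure C {t..}"
  proof -
    have "AE t in lborel. ennreal p * primitive wY (- t + a)
     = primitive wY (- t + x) + (\<integral>\<^sup>+y. H (- t + y) \<partial>U) + ennreal \<delta> * (\<integral>\<^sup>+y. wY (- t + y) \<partial>U_below) + (\<integral>\<^sup>+z. wY (- t + z) \<partial>\<kappa>)"
      by (rule AE_lborel_minus[OF resolvent_WY])
    then show ?thesis
    proof eventually_elim
      case (elim t)
      show ?case
      proof
        assume t: "b < t"
        have 1: "(\<integral>\<^sup>+y. wY (- t + y) \<partial>U_below) = 0"
          by (subst nn_integral_below) (use t WY_neg in \<open>auto simp: indicator_def intro!: nn_integral_zero' AE_I2\<close>)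
        have 2: "(\<integral>\<^sup>+z. wY (- t + z) \<partial>\<kappa>) = 0"
          by (rule AE_\<kappa>_zero) (use t b WY_neg in auto)
        have 3: "emeasure U_above {t..} = emeasure U {t..}"
        proof -
          have "emeasure U_above {t..} = (\<integral>\<^sup>+y. indicator {t..} y * indicator {b<..} y \<partial>U)"
            using nn_integral_above[of "indicator {t..}"] by simp
          also have "\<dots> = (\<integral>\<^sup>+y. indicator {t..} y \<partial>U)" using t by (intro nn_integral_cong) (auto simp: indicator_def)
          finally show ?thesis by simp
        qed
        have "emeasure B {t..} = primitive wY (x - t)" using tail[OF t, of x] by (simp add: B_def emeasure_density)
        moreover have "emeasure C {t..} = ennreal p * primitive wY (a - t)"
          using tail[OF t, of a] by (simp add: C_def emeasure_density nn_integral_cmult mult.assoc)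
        ultimately show "emeasure U_above {t..} + emeasure B {t..} = emeasure C {t..}"
          using elim 1 2 3 nn_integral_H[of "- t"] by (simp add: add.commute)
      qed
    qed
  qed
  \<comment> \<open>The closed tails agree at almost every point above \<open>b\<close>; approaching
    \<open>s\<close> from the right gives the open ray at every \<open>s\<close>, the boundary point
    \<open>b\<close> included.\<close>
  have right: "emeasure U_above {s<..} + emeasure B {s<..} = emeasure C {s<..}" if "b \<le> s" for s
  proof -
    obtain \<sigma> where \<sigma>: "\<sigma> \<longlonglongrightarrow> s" "\<And>n. s < \<sigma> n" "\<And>n. b < \<sigma> n \<longrightarrow> emeasure U_above {\<sigma> n..} + emeasure B {\<sigma> n..} = emeasure C {\<sigma> n..}"
      using AE_dense_sequence[OF ae, of s] by metis
    have eq: "emeasure U_above {\<sigma> n..} + emeasure B {\<sigma> n..} = emeasure C {\<sigma> n..}" for n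
      using \<sigma>(2,3)[of n] that by simp
    have "(\<lambda>n. emeasure U_above {\<sigma> n..} + emeasure B {\<sigma> n..}) \<longlonglongrightarrow> emeasure U_above {s<..} + emeasure B {s<..}"
      by (intro tendsto_add emeasure_atLeast_tendsto[OF _ _ \<sigma>(1,2)] finite_above fB sets_above sB)
    moreover have "(\<lambda>n. emeasure C {\<sigma> n..}) \<longlonglongrightarrow> emeasure C {s<..}"
      by (intro emeasure_atLeast_tendsto[OF _ _ \<sigma>(1,2)] fC sC)
    ultimately show ?thesis unfolding eq by (rule LIMSEQ_unique)
  qed
  have "emeasure U_above {s<..} + emeasure B {s<..} = emeasure C {s<..}" for s
  proof (cases "b \<le> s")
    case False
    have "emeasure U_above {s<..} = emeasure U_above {b<..}"
      using nn_integral_above[of "indicator {s<..}"] nn_integral_above[of "indicator {b<..}"] False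
      by (simp add: indicator_inter_arith[symmetric]) (intro arg_cong[where f = "emeasure U"]; auto)
    moreover have "emeasure B {s<..} = emeasure B {b<..}" "emeasure C {s<..} = emeasure C {b<..}"
      using False by (auto simp: B_def C_def emeasure_density indicator_def intro!: nn_integral_cong)
    ultimately show ?thesis using right[of b] by simp
  qed (rule right)
  from nn_integral_add_measures[OF sets_above sB sC _ this h]
  have "(\<integral>\<^sup>+y. h y \<partial>U_above) + (\<integral>\<^sup>+y. h y \<partial>B) = (\<integral>\<^sup>+y. h y \<partial>C)"
    using finite_measure.emeasure_finite[OF fC] by (simp add: less_top)
  then show ?thesis
    by (simp add: B_def C_def nn_integral_density nn_integral_cmult mult_ac)
qed

interpretation U: finite_measure U by (rule U_finite)

abbreviation "Wbar \<equiv> scale_Wbar W"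

lemma Wbar: "mono Wbar" "y \<le> 0 \<Longrightarrow> Wbar y = 0" "0 \<le> Wbar y" "ennreal (Wbar y) = primitive w y"
proof -
  show m: "mono Wbar" and z: "y \<le> 0 \<Longrightarrow> Wbar y = 0" and "ennreal (Wbar y) = primitive w y" for y
    unfolding scale_Wbar_def[abs_def] by (rule interval_primitive[OF W_mono W_neg]; simp)+
  show "0 \<le> Wbar y" using monoD[OF m, of "min y 0" y] z[of "min y 0"] by simp
qed

lemma Wbar_measurable[measurable]: "Wbar \<in> borel_measurable borel" by (rule borel_measurable_mono[OF Wbar(1)])

definition "Wbarbar y = (LBINT z=0..ereal y. Wbar z)"

lemma Wbarbar_nonneg: "0 \<le> Wbarbar y" and Wbarbar_primitive: "ennreal (Wbarbar y) = primitive (primitive w) y"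
proof -
  have neg: "\<And>y. y < 0 \<Longrightarrow> Wbar y = 0" using Wbar(2) by simp
  note ip = interval_primitive[OF Wbar(1) neg]
  show "ennreal (Wbarbar y) = primitive (primitive w) y"
    unfolding Wbarbar_def Wbar(4)[symmetric] by (rule ip(1)) simp
  have "Wbarbar (min y 0) \<le> Wbarbar y" unfolding Wbarbar_def by (rule monoD[OF ip(2)]) simp_all
  moreover have "Wbarbar (min y 0) = 0" unfolding Wbarbar_def by (rule ip(3)) simp_all
  ultimately show "0 \<le> Wbarbar y" by simp
qed

lemma scale_Zbar_eq: "scale_Zbar q W y = y + q * Wbarbar y"
proof -
  have i: "interval_lebesgue_integrable lborel 0 (ereal y) Wbar"
    by (rule interval_primitive(4)[OF Wbar(1)]) (simp add: Wbar(2))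
  have "(LBINT z=0..ereal y. 1 + q * Wbar z) = (LBINT z=0..ereal y. 1) + (LBINT z=0..ereal y. q * Wbar z)"
    using i by (intro interval_lebesgue_integral_add) (auto simp: zero_ereal_def)
  then show ?thesis by (simp add: scale_Zbar_def scale_Z_def Wbarbar_def zero_ereal_def)
qed

definition "conv s h = (LBINT y=ereal b..ereal s. WY (s - y) * h y)"

lemma occupation_above_real:
  assumes h: "mono h" "\<And>y. 0 \<le> h y"
  obtains g where "0 \<le> g" "(\<integral>\<^sup>+y. ennreal (h y) \<partial>U_above) = ennreal g" "g = p * conv a h - conv x h"
    "0 \<le> conv a h"
proof -
  have [measurable]: "h \<in> borel_measurable borel" by (rule borel_measurable_mono[OF h(1)])
  have c: "(\<integral>\<^sup>+y. ennreal (h y) * (wY (s - y) * indicator {b<..} y) \<partial>lborel) = ennreal (conv s h)" "0 \<le> conv s h" for s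
    unfolding conv_def by (rule interval_convolution[OF WY_mono _ h]; simp add: WY_neg)+
  have eq: "(\<integral>\<^sup>+y. ennreal (h y) \<partial>U_above) + ennreal (conv x h) = ennreal (p * conv a h)"
    using occupation_above[of "\<lambda>y. ennreal (h y)"] p c(2)[of a] unfolding c(1) by (simp add: ennreal_mult)
  then obtain g where g: "0 \<le> g" "(\<integral>\<^sup>+y. ennreal (h y) \<partial>U_above) = ennreal g"
    by (cases "\<integral>\<^sup>+y. ennreal (h y) \<partial>U_above") auto
  have "ennreal (g + conv x h) = ennreal (p * conv a h)" using eq g c(2)[of x] by (simp add: ennreal_plus)
  then have "g + conv x h = p * conv a h" using g c(2) p by (subst (asm) ennreal_inj) auto
  then show thesis using that[of g] g c(2)[of a] by simp
qed

text \<open>The integrals of \<open>W\<close>, \<open>Wbar\<close> and 1 against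
  \<open>U_above\<close> are combinations of the refraction integrals at a and x. With them the
  equation at 0 and p + q * m = 1 combine to p * r a = r x, and the integrated equation eliminates
  the mean of \<open>U\<close> from \<open>\<kappa>_mass\<close>. The bound r a \<ge> 1 licenses the
  later division.\<close>

theorem undershoot_mass:
  "1 \<le> r_fun b \<delta> q W WY a"
  "p * r_fun b \<delta> q W WY a = r_fun b \<delta> q W WY x"
  "emeasure \<kappa> UNIV = ennreal (p * r_tilde d b \<delta> q W WY a - r_tilde d b \<delta> q W WY x)"
  "0 \<le> p * r_tilde d b \<delta> q W WY a - r_tilde d b \<delta> q W WY x"
proof -
  define m where "m = measure U UNIV"
  obtain gW where gW: "0 \<le> gW" "(\<integral>\<^sup>+y. w y \<partial>U_above) = ennreal gW" "gW = p * conv a W - conv x W" "0 \<le> conv a W"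
    using occupation_above_real[OF W_mono W_nonneg] by metis
  obtain gB where gB: "0 \<le> gB" "(\<integral>\<^sup>+y. ennreal (Wbar y) \<partial>U_above) = ennreal gB" "gB = p * conv a Wbar - conv x Wbar"
    using occupation_above_real[OF Wbar(1,3)] by metis
  obtain g1 where g1: "0 \<le> g1" "(\<integral>\<^sup>+y. ennreal 1 \<partial>U_above) = ennreal g1" "g1 = p * conv a (\<lambda>_. 1) - conv x (\<lambda>_. 1)"
    using occupation_above_real[of "\<lambda>_. 1"] by (auto simp: mono_def)
  have rf: "r_fun b \<delta> q W WY s = 1 + q * Wbar s + q * \<delta> * conv s W" for s
    by (simp add: r_fun_def scale_Z_def conv_def)
  show "1 \<le> r_fun b \<delta> q W WY a" using gW(4) Wbar(3)[of a] q \<delta> by (simp add: rf)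
  have "ennreal (p * Wbar a + \<delta> * gW) = ennreal (Wbar x + m)"
    using resolvent_W_at_zero p \<delta> gW(1) Wbar(3)[of a] Wbar(3)[of x]
    by (simp add: gW(2) Wbar(4)[symmetric] U.emeasure_eq_measure m_def ennreal_mult ennreal_plus)
  then have 1: "p * Wbar a + \<delta> * gW = Wbar x + m"
    using p \<delta> gW(1) Wbar(3)[of a] Wbar(3)[of x] by (subst (asm) ennreal_inj) (auto simp: m_def)
  have mass': "p + q * m = 1" using mass by (simp add: m_def)
  have "p * r_fun b \<delta> q W WY a = p + q * (p * Wbar a + \<delta> * gW) + q * \<delta> * conv x W"
    by (simp add: rf gW(3) algebra_simps)
  also have "\<dots> = r_fun b \<delta> q W WY x" unfolding 1 rf using mass' by (simp add: algebra_simps)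
  finally show "p * r_fun b \<delta> q W WY a = r_fun b \<delta> q W WY x" .
  define e where "e = (LINT y|U. y)"
  have e0: "0 \<le> e" unfolding e_def by (rule integral_nonneg_AE) (use U_supp in \<open>auto elim!: eventually_mono\<close>)
  have "ennreal (p * Wbarbar a + \<delta> * gB) = ennreal (Wbarbar x + e)"
    using resolvent_W_integrated p \<delta> gB(1) Wbarbar_nonneg[of a] Wbarbar_nonneg[of x] e0 gB(2)
    by (simp add: Wbar(4) Wbarbar_primitive[symmetric] e_def[symmetric] ennreal_mult ennreal_plus)
  then have 2: "p * Wbarbar a + \<delta> * gB = Wbarbar x + e"
    using p \<delta> gB(1) Wbarbar_nonneg[of a] Wbarbar_nonneg[of x] e0 by (subst (asm) ennreal_inj) auto
  have "measure U {b<..} = g1"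
  proof -
    have "(\<integral>\<^sup>+y. ennreal 1 \<partial>U_above) = emeasure U {b<..}" using nn_integral_above[of "\<lambda>_. 1"] by simp
    then show ?thesis using g1(1,2) by (simp add: measure_def)
  qed
  note 3 = this
  have conv_Z: "conv s (scale_Z q W) = conv s (\<lambda>_. 1) + q * conv s Wbar" for s
  proof -
    have i: "interval_lebesgue_integrable lborel (ereal b) (ereal s) (\<lambda>y. WY (s - y) * h y)" if "mono h" "\<And>y. 0 \<le> h y" for h
      by (rule interval_convolution(3)[OF WY_mono _ that]) (simp_all add: WY_neg)
    have "conv s (scale_Z q W) = (LBINT y=ereal b..ereal s. WY (s - y) * 1 + q * (WY (s - y) * Wbar y))"
      by (simp add: conv_def scale_Z_def distrib_left mult_ac)
    also have "\<dots> = conv s (\<lambda>_. 1) + q * conv s Wbar"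
      using i[of "\<lambda>_. 1"] i[OF Wbar(1,3)] unfolding conv_def
      by (subst interval_lebesgue_integral_add) (auto simp: mono_def)
    finally show ?thesis .
  qed
  have rt: "r_tilde d b \<delta> q W WY s = s + q * Wbarbar s + d / q + \<delta> * (conv s (\<lambda>_. 1) + q * conv s Wbar)" for s
    unfolding r_tilde_def scale_Zbar_eq conv_Z[unfolded conv_def[of _ "scale_Z q W"]] ..
  have "p * a + q * e - x + \<delta> * g1 - d * m = p * r_tilde d b \<delta> q W WY a - r_tilde d b \<delta> q W WY x"
  proof -
    have qe: "q * e = q * (p * Wbarbar a + \<delta> * gB - Wbarbar x)" using 2 by simp
    \<comment> \<open>This is where the constant d / q of \<open>r_tilde\<close> comes from: - d * m
      equals p * (d / q) - d / q.\<close>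
    have "m = (1 - p) / q" using mass' q by (simp add: field_simps)
    then have "d * m = d * ((1 - p) / q)" by (rule arg_cong)
    then have dm: "d * m = d / q - p * (d / q)" by (simp add: right_diff_distrib diff_divide_distrib mult.commute)
    show ?thesis unfolding qe dm rt g1(3) gB(3) by (simp add: algebra_simps)
  qed
  then show "emeasure \<kappa> UNIV = ennreal (p * r_tilde d b \<delta> q W WY a - r_tilde d b \<delta> q W WY x)"
    "0 \<le> p * r_tilde d b \<delta> q W WY a - r_tilde d b \<delta> q W WY x"
    using \<kappa>_mass \<kappa>_mass_nonneg unfolding e_def[symmetric] m_def[symmetric] 3 by simp_all
qed

end

section \<open>The expected discounted injection\<close>

context injected_process begin

lemma V_bounds:
  assumes w: "w \<in> space M" and t: "0 \<le> t" "alive t w"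
  shows "0 \<le> V t w" "V t w \<le> a"
proof -
  interpret P: injected_path "\<lambda>t. x + X t w" "\<lambda>t. V t w" b \<delta> a by (rule paths[OF w])
  show "0 \<le> V t w" by (rule P.v_nonneg)
  have "\<not> P.exits \<or> t \<le> P.exit_time" using t(2) by (auto simp: alive_def exit_def etime_def)
  then consider "\<not> P.exits \<or> t < P.exit_time" | "P.exits" "t = P.exit_time" by fastforce
  then show "V t w \<le> a"
  proof cases
    case 1
    then show ?thesis by (rule P.v_le_before_exit[OF t(1)])
  next
    case 2
    then show ?thesis using P.v_at_exit by simp
  qed
qed

lemma sets_occupation: "sets occupation = sets borel" and sets_undershoot: "sets undershoot = sets borel"
  by (simp_all add: occupation_def undershoot_def)

lemma occupation_support: "AE y in occupation. 0 \<le> y \<and> y \<le> a"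
proof -
  have "(\<integral>\<^sup>+y. indicator (- {0..a}) y \<partial>occupation) = 0"
  proof (subst nn_integral_occupation, simp, rule nn_integral_zero', rule AE_I2)
    fix z :: "'a \<times> real" assume "z \<in> space MT"
    then have "fst z \<in> space M" by (auto simp: space_pair_measure)
    then show "indicator (- {0..a}) (V (snd z) (fst z)) * (disc (snd z) * of_bool (0 \<le> snd z \<and> alive (snd z) (fst z))) = 0"
      using V_bounds[of "fst z" "snd z"] by (auto simp: indicator_def)
  qed
  then have "- {0..a} \<in> null_sets occupation" using sets_occupation by (auto simp: null_sets_def)
  then show ?thesis by (rule AE_I'[rotated 0]) auto
qed

lemma undershoot_support: "AE z in undershoot. z \<le> 0"
proof -
  have "(\<integral>\<^sup>+y. indicator {0<..} y \<partial>undershoot) = 0"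
  proof (subst nn_integral_undershoot, simp, rule nn_integral_zero', rule AE_I2)
    fix z :: "'a \<times> real" assume "z \<in> space MT"
    then have w: "fst z \<in> space M" by (auto simp: space_pair_measure)
    interpret P: injected_path "\<lambda>t. x + X t (fst z)" "\<lambda>t. V t (fst z)" b \<delta> a by (rule paths[OF w])
    have "snd z - Rp (it z) (fst z) \<le> 0" if "reach (snd z) (fst z)"
      using that P.R_at_inj_time[of "snd z"] by (simp add: it_def reach_def itime_def Rp_def)
    then show "indicator {0<..} (snd z - Rp (it z) (fst z)) * (disc (it z) * of_bool (0 \<le> snd z \<and> reach (snd z) (fst z) \<and> alive (it z) (fst z))) = 0"
      by (auto simp: indicator_def)
  qed
  then have "{0<..} \<in> null_sets undershoot" using sets_undershoot by (auto simp: null_sets_def)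
  then show ?thesis by (rule AE_I'[rotated 0]) auto
qed

lemma exit_transform_le_one: "exit_transform \<le> 1"
proof -
  have "exit_transform \<le> (\<integral>\<^sup>+w. 1 \<partial>M)"
    unfolding exit_transform_def
  proof (rule nn_integral_mono)
    fix w assume w: "w \<in> space M"
    interpret P: injected_path "\<lambda>t. x + X t w" "\<lambda>t. V t w" b \<delta> a by (rule paths[OF w])
    have "0 \<le> etime w" if "exit w" using that P.exit_time_nonneg by (simp add: exit_def etime_def)
    then show "disc (etime w) * of_bool (exit w) \<le> 1"
      using q by (cases "exit w") (auto simp: ennreal_le_1)
  qed
  then show ?thesis by (simp add: emeasure_space_1)
qed

text \<open>Exchanging the expectation with the integral over levels turns the level form of the
  injection into a total mass.\<close>

lemma expected_discounted_injection:
  "(\<integral>\<^sup>+w. discounted_injection b \<delta> q a (\<lambda>t. x + X t w) (\<lambda>t. V t w) \<partial>M) = emeasure undershoot UNIV"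
proof -
  define h where "h z = disc (it z) * of_bool (0 \<le> snd z \<and> reach (snd z) (fst z) \<and> alive (it z) (fst z))" for z
  have hm: "h \<in> borel_measurable MT" unfolding h_def[abs_def] by measurable
  have "emeasure undershoot UNIV = (\<integral>\<^sup>+z. h z \<partial>MT)"
    using nn_integral_undershoot[of "\<lambda>_. 1"] sets_eq_imp_space_eq[OF sets_undershoot] by (simp add: h_def)
  also have "\<dots> = (\<integral>\<^sup>+w. \<integral>\<^sup>+r. h (w, r) \<partial>lborel \<partial>M)"
    by (rule lborel.nn_integral_fst[OF hm, symmetric])
  also have "\<dots> = (\<integral>\<^sup>+w. discounted_injection b \<delta> q a (\<lambda>t. x + X t w) (\<lambda>t. V t w) \<partial>M)"
  proof (rule nn_integral_cong)
    fix w assume w: "w \<in> space M"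
    interpret P: injected_path "\<lambda>t. x + X t w" "\<lambda>t. V t w" b \<delta> a by (rule paths[OF w])
    show "(\<integral>\<^sup>+r. h (w, r) \<partial>lborel) = discounted_injection b \<delta> q a (\<lambda>t. x + X t w) (\<lambda>t. V t w)"
      unfolding P.discounted_injection_eq h_def it_def alive_def reach_def itime_def exit_def etime_def P.clamped_inj_time_def fst_conv snd_conv
      by simp
  qed
  finally show ?thesis ..
qed

end

section \<open>Passage to the given process outside a null set\<close>

context exponentially_integrable_process begin

context
  fixes V :: "real \<Rightarrow> 'a \<Rightarrow> real" and b \<delta> q a x :: real and N :: "'a set"
  assumes b: "0 < b" and \<delta>: "0 \<le> \<delta>" and q: "0 < q" and a: "0 < a" "x \<le> a"
    and V: "\<And>t. 0 \<le> t \<Longrightarrow> V t \<in> borel_measurable (Fil t)"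
    and N: "N \<in> null_sets M"
    and good: "\<And>w. w \<in> space M - N \<Longrightarrow> spectrally_negative_path (\<lambda>t. X t w) \<and> X 0 w = 0 \<and>
      refracted_reflected_path b \<delta> x (\<lambda>t. x + X t w) (\<lambda>t. V t w)"
begin

text \<open>On the exceptional null set the paths are replaced by a deterministic trajectory on which nothing is
  injected, so that the required path properties hold everywhere.\<close>

definition "reg_X t w = (if w \<in> N then if b < x then \<delta> * max 0 t else 0 else X (max 0 t) w)"
definition "reg_V t w = (if w \<in> N then max x 0 else V (max 0 t) w)"
definition "reg_F t = Fil (max 0 t)"

lemma AE_not_N: "AE w in M. w \<in> space M - N"
  using AE_not_in[OF N] AE_space by eventually_elim simp

lemma reg_injected_path:
  assumes w: "w \<in> space M"
  shows "injected_path (\<lambda>t. x + reg_X t w) (\<lambda>t. reg_V t w) b \<delta> a"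
proof (cases "w \<in> N")
  case False
  then have g: "spectrally_negative_path (\<lambda>t. X t w)" "X 0 w = 0"
    "refracted_reflected_path b \<delta> x (\<lambda>t. x + X t w) (\<lambda>t. V t w)" using good w by auto
  interpret P: spectrally_negative_path "\<lambda>t. X t w" by (rule g(1))
  have "spectrally_negative_path (\<lambda>t. x + X t w)"
  proof
    show "continuous (at_right t) (\<lambda>t. x + X t w)" if "0 \<le> t" for t
      by (intro continuous_add continuous_const P.right_cont that)
    show "\<exists>l. ((\<lambda>t. x + X t w) \<longlongrightarrow> l) (at_left t)" if t: "0 < t" for t
    proof -
      obtain l where "((\<lambda>t. X t w) \<longlongrightarrow> l) (at_left t)" using P.left_lim[OF t] by blast
      then have "((\<lambda>t. x + X t w) \<longlongrightarrow> x + l) (at_left t)" by (intro tendsto_add tendsto_const)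
      then show ?thesis by blast
    qed
    show "x + X t w \<le> l" if "0 < t" "((\<lambda>t. x + X t w) \<longlongrightarrow> l) (at_left t)" for t l
    proof -
      have "((\<lambda>t. (x + X t w) - x) \<longlongrightarrow> l - x) (at_left t)" by (intro tendsto_diff tendsto_const that)
      then have "X t w \<le> l - x" by (intro P.no_up_jump that) simp
      then show ?thesis by simp
    qed
  qed
  then interpret R: refracted_reflected "\<lambda>t. x + X t w" "\<lambda>t. V t w" b \<delta> x
    using b \<delta> g(2,3) by (intro refracted_reflected.intro refracted_reflected_axioms.intro) auto
  show ?thesis using R.injected_path[OF a] False by (simp add: reg_X_def reg_V_def)
next
  case True
  define v0 where "v0 = max x 0"
  \<comment> \<open>A constant trajectory above \<open>b\<close> is refracted all the time at rate
    \<delta>; the drift \<delta> given to \<open>reg_X\<close> in that case compensates this, so the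
    injection keeps its initial value \<open>v0 - x\<close>.\<close>
  have ref: "refraction_part b \<delta> (\<lambda>t. v0) t = (if b < x then \<delta> * t else 0)" if "0 \<le> t" for t
    using b that by (auto simp: refraction_part_def v0_def set_lebesgue_integral_def max_def)
  have c: "isCont (\<lambda>t. x + reg_X t w) t" for t
    using True by (cases "b < x") (auto simp: reg_X_def intro!: continuous_intros)
  have inj: "v0 - (x + reg_X t w) + refraction_part b \<delta> (\<lambda>t. v0) t = v0 - x" if "0 \<le> t" for t
    using True that by (simp add: ref reg_X_def)
  have V0: "(\<lambda>t. reg_V t w) = (\<lambda>t. v0)" using True by (simp add: reg_V_def v0_def)
  show ?thesis
    unfolding V0
  proof
    show "continuous (at_right t) (\<lambda>t. x + reg_X t w)" for t
      by (rule continuous_at_imp_continuous_at_within[OF c])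
    show "\<exists>\<eta>>0. \<forall>u. t - \<eta> < u \<and> u < t \<longrightarrow> x + reg_X t w \<le> x + reg_X u w + e" if te: "0 < t" "0 < e" for t e
    proof -
      define \<eta> where "\<eta> = e / (\<delta> + 1)"
      have \<eta>: "0 < \<eta>" "\<delta> * \<eta> \<le> e" using te(2) \<delta> by (auto simp: \<eta>_def field_simps)
      show ?thesis
      proof (rule exI[of _ \<eta>], intro conjI allI impI)
        fix u assume u: "t - \<eta> < u \<and> u < t"
        have "\<delta> * max 0 t - \<delta> * max 0 u = \<delta> * (max 0 t - max 0 u)" by (rule right_diff_distrib[symmetric])
        also have "\<dots> \<le> \<delta> * \<eta>" using u te(1) \<delta> by (intro mult_left_mono) auto
        finally have "\<delta> * max 0 t \<le> \<delta> * max 0 u + e" using \<eta>(2) by linarith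
        moreover have "reg_X t w = (if b < x then \<delta> * max 0 t else 0)" "reg_X u w = (if b < x then \<delta> * max 0 u else 0)"
          using True by (simp_all add: reg_X_def)
        ultimately show "x + reg_X t w \<le> x + reg_X u w + e" using te(2) by (cases "b < x") simp_all
      qed (rule \<eta>(1))
    qed
    show "x + reg_X t w = x + reg_X 0 w" if "t \<le> 0" for t using True that by (simp add: reg_X_def)
    show "v0 = max (x + reg_X 0 w) 0" "x + reg_X 0 w \<le> a" using True a by (simp_all add: reg_X_def v0_def)
    show "v0 - (x + reg_X s w) + refraction_part b \<delta> (\<lambda>t. v0) s \<le> v0 - (x + reg_X t w) + refraction_part b \<delta> (\<lambda>t. v0) t"
      if "0 \<le> s" "s \<le> t" for s t using inj[of s] inj[of t] that by simp
    show "\<exists>\<eta>>0. \<forall>u. 0 \<le> u \<and> \<bar>u - t\<bar> < \<eta> \<longrightarrow>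
      v0 - (x + reg_X u w) + refraction_part b \<delta> (\<lambda>t. v0) u = v0 - (x + reg_X t w) + refraction_part b \<delta> (\<lambda>t. v0) t"
      if "0 \<le> t" for t
    proof (rule exI[of _ 1], intro conjI allI impI)
      fix u assume "0 \<le> u \<and> \<bar>u - t\<bar> < 1"
      then show "v0 - (x + reg_X u w) + refraction_part b \<delta> (\<lambda>t. v0) u = v0 - (x + reg_X t w) + refraction_part b \<delta> (\<lambda>t. v0) t"
        using inj[of u] inj[OF that] by linarith
    qed simp
  qed (use \<delta> a in \<open>auto simp: v0_def\<close>)
qed

lemma N_Fil: "N \<in> sets (Fil t)" by (rule null_sets_augmented[OF N])

text \<open>The modification on \<open>N\<close> preserves adaptedness because the augmented
  filtration contains the null sets at every time, and it leaves all expectations unchanged.\<close>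

lemma reg_injected_process: "injected_process M reg_F reg_X \<psi> reg_V x b \<delta> a q"
proof (intro injected_process.intro injected_process_axioms.intro exponential_martingales.intro exponential_martingales_axioms.intro)
  show "prob_space M" by (rule prob_space_axioms)
  have pred: "Measurable.pred (Fil t) (\<lambda>w. w \<in> N)" for t using N_Fil by simp
  show "space (reg_F t) = space M" for t by (simp add: reg_F_def space_augmented_filtration)
  show "sets (reg_F t) \<subseteq> events" for t unfolding reg_F_def by (rule sets_augmented_filtration_le)
  show "sets (reg_F s) \<subseteq> sets (reg_F t)" if "s \<le> t" for s t
    unfolding reg_F_def using that by (intro augmented_filtration_mono) simp
  show "reg_X t \<in> borel_measurable (reg_F t)" if "0 \<le> t" for t
    unfolding reg_X_def[abs_def] reg_F_def using X_adapted[OF that] pred that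
    by (intro measurable_If borel_measurable_const) (simp_all add: pred_def)
  show "reg_V t \<in> borel_measurable (reg_F t)" if "0 \<le> t" for t
    unfolding reg_V_def[abs_def] reg_F_def using V[OF that] pred that
    by (intro measurable_If borel_measurable_const) (simp_all add: pred_def)
  show "reg_X 0 w = 0" if "w \<in> space M" for w using good[of w] that by (auto simp: reg_X_def)
  show "continuous (at_right t) (\<lambda>s. reg_X s w)" if "w \<in> space M" for w t
  proof -
    have "continuous (at_right t) (\<lambda>s. (x + reg_X s w) - x)"
      by (intro continuous_diff continuous_const injected_path.f_right_continuous[OF reg_injected_path[OF that]])
    then show ?thesis by simp
  qed
  show "injected_path (\<lambda>t. x + reg_X t w) (\<lambda>t. reg_V t w) b \<delta> a" if "w \<in> space M" for w
    by (rule reg_injected_path[OF that])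
  show "0 < q" by (rule q)
  fix \<theta> :: real and n k l :: nat and H :: "'a \<Rightarrow> ennreal"
  assume \<theta>: "0 \<le> \<theta>" and kl: "k \<le> l" and H: "H \<in> borel_measurable (reg_F (real k / 2 ^ n))"
  define s where "s = real k / 2 ^ n"
  define t where "t = real l / 2 ^ n"
  have st: "0 \<le> s" "s \<le> t" using kl by (auto simp: s_def t_def divide_right_mono)
  have H': "H \<in> borel_measurable (Fil s)" using H st by (simp add: reg_F_def s_def)
  have "(\<integral>\<^sup>+w. ennreal (exp (\<theta> * (reg_X t w - reg_X s w))) * H w \<partial>M)
    = (\<integral>\<^sup>+w. ennreal (exp (\<theta> * (X t w - X s w))) * H w \<partial>M)"
    by (rule nn_integral_cong_AE) (use AE_not_N in eventually_elim, use st in \<open>simp add: reg_X_def\<close>)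
  also have "\<dots> = (\<integral>\<^sup>+w. ennreal (exp (\<theta> * X (t - s) w)) \<partial>M) * (\<integral>\<^sup>+w. H w \<partial>M)"
    by (rule nn_integral_past_increment[OF st H', where g = "\<lambda>y. ennreal (exp (\<theta> * y))"]) measurable
  also have "t - s = real (l - k) / 2 ^ n" using kl by (simp add: t_def s_def of_nat_diff diff_divide_distrib)
  finally show "(\<integral>\<^sup>+w. ennreal (exp (\<theta> * (reg_X (real l / 2 ^ n) w - reg_X (real k / 2 ^ n) w))) * H w \<partial>M)
        = ennreal (exp (\<psi> \<theta> * (real (l - k) / 2 ^ n))) * (\<integral>\<^sup>+w. H w \<partial>M)"
    unfolding exponential_moment(3)[OF \<theta>] s_def t_def .
qed

lemma expected_discounted_injection_formula:
  assumes W: "scale_function \<psi> q W" and WY: "scale_function (\<lambda>\<theta>. \<psi> \<theta> - \<delta> * \<theta>) q WY"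
    and growth: "\<forall>\<^sub>F \<theta> in at_top. q < \<psi> \<theta> - \<delta> * \<theta>" and slope: "((\<lambda>\<theta>. \<psi> \<theta> / \<theta>) \<longlongrightarrow> d) (at_right 0)"
  shows "enn2ereal (\<integral>\<^sup>+w. discounted_injection b \<delta> q a (\<lambda>t. x + X t w) (\<lambda>t. V t w) \<partial>M)
    = ereal (r_tilde d b \<delta> q W WY a * (r_fun b \<delta> q W WY x / r_fun b \<delta> q W WY a) - r_tilde d b \<delta> q W WY x)"
proof -
  interpret I: injected_process M reg_F reg_X \<psi> reg_V x b \<delta> a q by (rule reg_injected_process)
  define p where "p = enn2real I.exit_transform"
  have "I.exit_transform < \<top>" by (rule le_less_trans[OF I.exit_transform_le_one]) simp
  then have p: "I.exit_transform = ennreal p" "0 \<le> p" by (simp_all add: p_def)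
  interpret S: scale_identity I.occupation I.undershoot p a b x \<delta> q d \<psi> W WY
  proof
    show "ennreal (exp (\<theta> * a)) * ennreal p + (\<integral>\<^sup>+y. ennreal (exp (\<theta> * y) * (c2 + \<theta> * \<delta> * indicator {b<..} y)) \<partial>I.occupation)
      = ennreal (exp (\<theta> * x)) + (\<integral>\<^sup>+y. ennreal (exp (\<theta> * y) * c1) \<partial>I.occupation) + ennreal \<theta> * (\<integral>\<^sup>+y. ennreal (exp (\<theta> * y)) \<partial>I.undershoot)"
      if "0 \<le> \<theta>" "0 \<le> c1" "0 \<le> c2" "c1 - c2 = \<psi> \<theta> - q" for \<theta> c1 c2
      using I.exponential_identity[OF that] by (simp only: p(1))
  qed (use assms a b \<delta> q p(2) I.sets_occupation I.sets_undershoot I.occupation_support I.undershoot_support laplace_exponent_zero in auto)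
  have "(\<integral>\<^sup>+w. discounted_injection b \<delta> q a (\<lambda>t. x + X t w) (\<lambda>t. V t w) \<partial>M)
    = (\<integral>\<^sup>+w. discounted_injection b \<delta> q a (\<lambda>t. x + reg_X t w) (\<lambda>t. reg_V t w) \<partial>M)"
  proof (rule nn_integral_cong_AE)
    show "AE w in M. discounted_injection b \<delta> q a (\<lambda>t. x + X t w) (\<lambda>t. V t w) = discounted_injection b \<delta> q a (\<lambda>t. x + reg_X t w) (\<lambda>t. reg_V t w)"
      using AE_not_N by eventually_elim (rule discounted_injection_cong; simp add: reg_X_def reg_V_def)
  qed
  also have "\<dots> = ennreal (p * r_tilde d b \<delta> q W WY a - r_tilde d b \<delta> q W WY x)"
    unfolding I.expected_discounted_injection by (rule S.undershoot_mass(3))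
  finally have "enn2ereal (\<integral>\<^sup>+w. discounted_injection b \<delta> q a (\<lambda>t. x + X t w) (\<lambda>t. V t w) \<partial>M)
    = ereal (p * r_tilde d b \<delta> q W WY a - r_tilde d b \<delta> q W WY x)"
    using S.undershoot_mass(4) by (simp add: enn2ereal_ennreal)
  also have "p = r_fun b \<delta> q W WY x / r_fun b \<delta> q W WY a"
    using S.undershoot_mass(1,2) by (simp add: field_simps)
  finally show ?thesis by (simp add: mult.commute)
qed

end

end

theorem proposition5p1:
  fixes M :: "'a measure" and X V :: "real \<Rightarrow> 'a \<Rightarrow> real"
    and \<gamma> \<sigma> b \<delta> q a x :: real and \<nu> :: "real measure" and W WY :: "real \<Rightarrow> real"
  assumes "spectrally_negative_levy_process M X"
    and "levy_khintchine_triplet \<gamma> \<sigma> \<nu> (laplace_exponent M X)"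
    and "0 < b" and "0 \<le> \<delta>"
    and "bounded_variation_paths M X \<longrightarrow> \<delta> < drift \<gamma> \<nu>"
    and "refracted_reflected_process M X b \<delta> x V"
    and "deriv_zero_plus (laplace_exponent M X) > - \<infinity>"
    and "0 < q"
    and "scale_function (laplace_exponent M X) q W"
    and "scale_function (\<lambda>\<theta>. laplace_exponent M X \<theta> - \<delta> * \<theta>) q WY"
    and "0 < a" and "x \<le> a"
  shows "enn2ereal (\<integral>\<^sup>+\<omega>. discounted_injection b \<delta> q a (\<lambda>t. x + X t \<omega>) (\<lambda>t. V t \<omega>) \<partial>M) =
    ereal (let r = r_fun b \<delta> q W WY;
               r' = r_tilde (real_of_ereal (deriv_zero_plus (laplace_exponent M X))) b \<delta> q W WY
           in r' a * (r x / r a) - r' x)"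
proof -
  interpret X: spectrally_negative_levy_process M X by fact
  interpret exponentially_integrable_process M X
    by standard (rule X.exponential_moment_integrable[OF assms(9,8)])
  have "AE \<omega> in M. spectrally_negative_path (\<lambda>t. X t \<omega>) \<and> X 0 \<omega> = 0 \<and>
      refracted_reflected_path b \<delta> x (\<lambda>t. x + X t \<omega>) (\<lambda>t. V t \<omega>)"
    using X.AE_spectrally_negative_path assms(6) unfolding refracted_reflected_process_def
    by (auto elim!: eventually_elim2)
  then obtain N where N: "N \<in> null_sets M" "\<And>\<omega>. \<omega> \<in> space M - N \<Longrightarrow> spectrally_negative_path (\<lambda>t. X t \<omega>) \<and> X 0 \<omega> = 0 \<and>
      refracted_reflected_path b \<delta> x (\<lambda>t. x + X t \<omega>) (\<lambda>t. V t \<omega>)"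
    by (elim AE_E) (auto simp: null_sets_def)
  have V: "\<And>t. 0 \<le> t \<Longrightarrow> V t \<in> borel_measurable (augmented_filtration M X t)"
    using assms(6) by (simp add: refracted_reflected_process_def)
  show ?thesis
    unfolding Let_def
    by (rule expected_discounted_injection_formula[OF assms(3,4,8,11,12) V N assms(9,10)
          laplace_exponent_growth[OF assms(2,4,5)] laplace_exponent_slope_at_zero[OF assms(7)]])
qed

end
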